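(* Let $(R,\mathfrak{m},k)$ be a Gorenstein local domain of Krull dimension one with maximal ideal $\mathfrak{m}$ and residue field $k$. Assume that the embedding dimension of $R$ is at most $3$ and that there exists an element $u\in\mathfrak{m}\setminus\mathfrak{m}^2$ such that the artinian ring $R/Ru$ contains $k$. Then every rigid ideal in $R$ is principal; equivalently, every rigid ideal in $R$ is free as an $R$-module.
   Context: Rings are commutative and noetherian. The embedding dimension of a local ring $(R,\mathfrak{m},k)$ is $\dim_k(\mathfrak{m}/\mathfrak{m}^2)$. An ideal $I$ of $R$ is rigid if $\operatorname{Ext}^1_R(I,I)=0$. That $R/Ru$ contains $k$ means that $R/Ru$ contains a coefficient field, i.e. a subfield mapping isomorphically onto the residue field $k$ under the canonical surjection $R/Ru\to k$. *)

theory Defs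
  imports
    "HOL-Library.Extended_Nat"
    "Jordan_Normal_Form.Missing_VectorSpace"
    "HOL-Algebra.Algebra"
begin

section \<open>Local rings, Krull dimension, embedding dimension\<close>

definition local_ring :: "('a, 'm) ring_scheme \<Rightarrow> 'a set \<Rightarrow> bool" where
  "local_ring R \<mm> \<longleftrightarrow> cring R \<and> {J. maximalideal J R} = {\<mm>}"

definition krull_dim :: "('a, 'm) ring_scheme \<Rightarrow> enat" where
  "krull_dim R = Sup {enat n | n. \<exists>P :: nat \<Rightarrow> 'a set.
     (\<forall>i\<le>n. primeideal (P i) R) \<and> (\<forall>i<n. P i \<subset> P (Suc i))}"

text \<open>
  The space \<open>\<mm>/\<mm>\<^sup>2\<close> over the residue field \<open>R/\<mm>\<close>. The scalar multiplication sends the cosets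
  \<open>\<mm> + a\<close> and \<open>\<mm>\<^sup>2 + x\<close> to \<open>\<mm>\<^sup>2 + a x\<close>. The fields
  \<^const>\<open>monoid.mult\<close> and \<^const>\<open>monoid.one\<close> of a module record carry no meaning.
\<close>

definition cotangent_space :: "('a, 'm) ring_scheme \<Rightarrow> 'a set \<Rightarrow> ('a set, 'a set) module" where
  "cotangent_space R \<mm> =
    \<lparr>carrier = {ideal_prod R \<mm> \<mm> +>\<^bsub>R\<^esub> x | x. x \<in> \<mm>},
     monoid.mult = undefined, monoid.one = undefined,
     ring.zero = ideal_prod R \<mm> \<mm>, ring.add = set_add R,
     smult = rcoset_mult R (ideal_prod R \<mm> \<mm>)\<rparr>"

text \<open>
  \<^const>\<open>vectorspace.dim\<close> is the least size of a finite generating set; it is meaningful here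
  whenever \<open>\<mm>\<close> is finitely generated, in particular over a noetherian ring.
\<close>

definition embdim :: "('a, 'm) ring_scheme \<Rightarrow> 'a set \<Rightarrow> nat" where
  "embdim R \<mm> = vectorspace.dim (R Quot \<mm>) (cotangent_space R \<mm>)"

text \<open>
  For an ideal \<open>J \<subseteq> \<mm>\<close> the canonical surjection \<open>R/J \<rightarrow> R/\<mm>\<close> sends a coset \<open>X\<close> of \<open>J\<close> to the
  coset \<open>\<mm> + X\<close> of \<open>\<mm>\<close>.
\<close>

definition coefficient_field :: "('a, 'm) ring_scheme \<Rightarrow> 'a set \<Rightarrow> 'a set \<Rightarrow> 'a set set \<Rightarrow> bool" where
  "coefficient_field R \<mm> J K \<longleftrightarrow>
     subfield K (R Quot J) \<and>
     set_add R \<mm> \<in> ring_iso ((R Quot J)\<lparr>carrier := K\<rparr>) (R Quot \<mm>)"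


section \<open>Modules\<close>

definition ideal_module :: "('a, 'm) ring_scheme \<Rightarrow> 'a set \<Rightarrow> ('a, 'a) module" where
  "ideal_module R I =
    \<lparr>carrier = I, monoid.mult = undefined, monoid.one = undefined,
     ring.zero = \<zero>\<^bsub>R\<^esub>, ring.add = ring.add R, smult = monoid.mult R\<rparr>"

definition free_module :: "('a, 'm) ring_scheme \<Rightarrow> ('a, 'b, 'n) module_scheme \<Rightarrow> bool" where
  "free_module R M \<longleftrightarrow> Module.module R M \<and>
     (\<exists>B \<subseteq> carrier M. \<not> LinearCombinations.module.lin_dep R M B \<and>
                       LinearCombinations.module.span R M B = carrier M)"

definition module_ker ::
  "('a, 'b, 'n) module_scheme \<Rightarrow> ('a, 'c, 'p) module_scheme \<Rightarrow> ('b \<Rightarrow> 'c) \<Rightarrow> 'b set" where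
  "module_ker M N f = {x \<in> carrier M. f x = \<zero>\<^bsub>N\<^esub>}"


section \<open>Ext\<close>

definition free_resolution ::
  "('a, 'm) ring_scheme \<Rightarrow> ('a, 'b, 'n) module_scheme \<Rightarrow>
   (nat \<Rightarrow> ('a, 'f, 'p) module_scheme) \<Rightarrow> (nat \<Rightarrow> 'f \<Rightarrow> 'f) \<Rightarrow> ('f \<Rightarrow> 'b) \<Rightarrow> bool" where
  "free_resolution R M F d \<epsilon> \<longleftrightarrow>
     Module.module R M \<and>
     (\<forall>n. free_module R (F n)) \<and>
     (\<forall>n. d n \<in> module_hom R (F (Suc n)) (F n)) \<and>
     \<epsilon> \<in> module_hom R (F 0) M \<and>
     \<epsilon> ` carrier (F 0) = carrier M \<and>
     d 0 ` carrier (F (Suc 0)) = module_ker (F 0) M \<epsilon> \<and>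
     (\<forall>n. d (Suc n) ` carrier (F (Suc (Suc n))) = module_ker (F (Suc n)) (F n) (d n))"

text \<open>The abelian group \<open>Hom\<^sub>R(M, N)\<close>, written multiplicatively so that quotients can be taken
  with \<^const>\<open>FactGroup\<close>.\<close>

definition Hom_group ::
  "('a, 'm) ring_scheme \<Rightarrow> ('a, 'b, 'n) module_scheme \<Rightarrow> ('a, 'c, 'p) module_scheme \<Rightarrow>
   ('b \<Rightarrow> 'c) monoid" where
  "Hom_group R M N =
    \<lparr>carrier = module_hom R M N \<inter> extensional (carrier M),
     monoid.mult = (\<lambda>f g. \<lambda>x\<in>carrier M. f x \<oplus>\<^bsub>N\<^esub> g x),
     monoid.one = (\<lambda>x\<in>carrier M. \<zero>\<^bsub>N\<^esub>)\<rparr>"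

text \<open>The map \<open>Hom\<^sub>R(F\<^sub>n, N) \<rightarrow> Hom\<^sub>R(F\<^sub>n\<^sub>+\<^sub>1, N)\<close> induced by \<open>d\<^sub>n : F\<^sub>n\<^sub>+\<^sub>1 \<rightarrow> F\<^sub>n\<close>.\<close>

definition codiff ::
  "(nat \<Rightarrow> ('a, 'f, 'p) module_scheme) \<Rightarrow> (nat \<Rightarrow> 'f \<Rightarrow> 'f) \<Rightarrow> nat \<Rightarrow> ('f \<Rightarrow> 'c) \<Rightarrow> ('f \<Rightarrow> 'c)" where
  "codiff F d n f = (\<lambda>x\<in>carrier (F (Suc n)). f (d n x))"

definition cocycles where
  "cocycles R F d N n =
     kernel (Hom_group R (F n) N) (Hom_group R (F (Suc n)) N) (codiff F d n)"

fun coboundaries where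
  "coboundaries R F d N 0 = {\<one>\<^bsub>Hom_group R (F 0) N\<^esub>}"
| "coboundaries R F d N (Suc n) = codiff F d n ` carrier (Hom_group R (F n) N)"

text \<open>\<open>Ext\<^sup>n\<^sub>R(M, N) = H\<^sup>n(Hom\<^sub>R(F, N))\<close>, computed from a free resolution \<open>F\<close> of \<open>M\<close>.\<close>

definition Ext_group ::
  "('a, 'm) ring_scheme \<Rightarrow> (nat \<Rightarrow> ('a, 'f, 'p) module_scheme) \<Rightarrow> (nat \<Rightarrow> 'f \<Rightarrow> 'f) \<Rightarrow>
   ('a, 'c, 'q) module_scheme \<Rightarrow> nat \<Rightarrow> ('f \<Rightarrow> 'c) set monoid" where
  "Ext_group R F d N n =
     (Hom_group R (F n) N)\<lparr>carrier := cocycles R F d N n\<rparr> Mod coboundaries R F d N n"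

text \<open>
  \<open>Ext\<^sup>n\<^sub>R(M, N) = 0\<close>. Up to isomorphism the group does not depend on the resolution, so it is
  computed from any one. Only resolutions on the type \<^typ>\<open>nat \<Rightarrow> 'a\<close> are considered;
  this suffices for finitely generated modules over a noetherian ring, which have resolutions by
  modules \<open>R\<^sup>k\<close>, whose elements are sequences of ring elements.
\<close>

definition Ext_vanishes ::
  "('a, 'm) ring_scheme \<Rightarrow> nat \<Rightarrow> ('a, 'b, 'n) module_scheme \<Rightarrow> ('a, 'c, 'q) module_scheme \<Rightarrow> bool" where
  "Ext_vanishes R n M N \<longleftrightarrow>
     (\<exists>(F :: nat \<Rightarrow> ('a, nat \<Rightarrow> 'a) module) d \<epsilon>.
        free_resolution R M F d \<epsilon> \<and> trivial_group (Ext_group R F d N n))"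

definition rigid_ideal :: "('a, 'm) ring_scheme \<Rightarrow> 'a set \<Rightarrow> bool" where
  "rigid_ideal R I \<longleftrightarrow> ideal I R \<and> Ext_vanishes R 1 (ideal_module R I) (ideal_module R I)"


section \<open>Injective dimension and Gorenstein local rings\<close>

text \<open>
  The lifting property is required for monomorphisms between modules on the type
  \<^typ>\<open>nat \<Rightarrow> 'a\<close>. These include isomorphic copies of all inclusions \<open>I \<subseteq> R\<close> of ideals, so by
  Baer's criterion the restriction on the type is harmless.
\<close>

definition injective_module :: "('a, 'm) ring_scheme \<Rightarrow> ('a, 'e, 'n) module_scheme \<Rightarrow> bool" where
  "injective_module R E \<longleftrightarrow> Module.module R E \<and>
     (\<forall>(A :: ('a, nat \<Rightarrow> 'a) module) (B :: ('a, nat \<Rightarrow> 'a) module) f g.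
        Module.module R A \<longrightarrow> Module.module R B \<longrightarrow>
        f \<in> module_hom R A B \<longrightarrow> inj_on f (carrier A) \<longrightarrow> g \<in> module_hom R A E \<longrightarrow>
        (\<exists>h \<in> module_hom R B E. \<forall>x \<in> carrier A. h (f x) = g x))"

definition injective_resolution ::
  "('a, 'm) ring_scheme \<Rightarrow> ('a, 'b, 'n) module_scheme \<Rightarrow>
   (nat \<Rightarrow> ('a, 'e, 'p) module_scheme) \<Rightarrow> (nat \<Rightarrow> 'e \<Rightarrow> 'e) \<Rightarrow> ('b \<Rightarrow> 'e) \<Rightarrow> bool" where
  "injective_resolution R M E \<delta> \<iota> \<longleftrightarrow>
     Module.module R M \<and>
     (\<forall>n. injective_module R (E n)) \<and>
     (\<forall>n. \<delta> n \<in> module_hom R (E n) (E (Suc n))) \<and>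
     \<iota> \<in> module_hom R M (E 0) \<and>
     inj_on \<iota> (carrier M) \<and>
     \<iota> ` carrier M = module_ker (E 0) (E (Suc 0)) (\<delta> 0) \<and>
     (\<forall>n. \<delta> n ` carrier (E n) = module_ker (E (Suc n)) (E (Suc (Suc n))) (\<delta> (Suc n)))"

text \<open>
  Again the resolving modules live on \<^typ>\<open>nat \<Rightarrow> 'a\<close>. Over a noetherian ring \<open>R\<close> the injective
  hull of a finitely generated module has at most \<open>max |R| \<aleph>\<^sub>0\<close> elements, and so do the terms of
  the minimal injective resolution, which therefore exists on this type.
\<close>

definition finite_injdim :: "('a, 'm) ring_scheme \<Rightarrow> ('a, 'b, 'n) module_scheme \<Rightarrow> bool" where
  "finite_injdim R M \<longleftrightarrow>
     (\<exists>(E :: nat \<Rightarrow> ('a, nat \<Rightarrow> 'a) module) \<delta> \<iota> n.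
        injective_resolution R M E \<delta> \<iota> \<and> (\<forall>i>n. carrier (E i) = {\<zero>\<^bsub>E i\<^esub>}))"

definition gorenstein_local_ring :: "('a, 'm) ring_scheme \<Rightarrow> 'a set \<Rightarrow> bool" where
  "gorenstein_local_ring R \<mm> \<longleftrightarrow>
     noetherian_ring R \<and> local_ring R \<mm> \<and> finite_injdim R (ideal_module R (carrier R))"

end

theory Submission imports Defs begin

text \<open>Let \<open>I\<close> be a nonzero rigid ideal, \<open>S = R/uR\<close>, and let \<open>K\<close> be the coefficient field of \<open>S\<close>. The whole
argument takes place on the closed fibre \<open>V = I/uI\<close>, a finite-dimensional \<open>K\<close>-space on which \<open>S\<close> acts.

Three facts prepare the ground. First, every nonzero ideal \<open>J\<close> has \<open>dim J/uJ = dim S =: n\<close>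
(\<open>fiber_dimension\<close>). Second, multiplication by the nonzerodivisor \<open>u\<close> on \<open>I\<close> and \<open>Ext\<^sup>1(I, I) = 0\<close> show that every
\<open>R\<close>-linear endomorphism of \<open>V\<close> is induced by an endomorphism of \<open>I\<close> (\<open>rigid_lifts\<close>). Evaluation at a fixed
nonzero \<open>a \<in> I\<close> embeds \<open>End(I)\<close> as a nonzero ideal, so \<open>End\<^sub>S(V)\<close> has at most \<open>n = dim V\<close> independent
elements (\<open>comm_end_dependent\<close>). Third, since the embedding dimension is at most three and \<open>u\<close> is part of a
minimal generating set, \<open>\<mm> = (u, x, y)\<close> (\<open>three_generators\<close>); hence \<open>S\<close> acts on \<open>V\<close> through the
algebra generated by \<open>K\<close> and two commuting nilpotent operators, and \<open>End\<^sub>S(V)\<close> is their centralizer.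

The key is a statement of linear algebra (\<open>alg_indep\<close>): if the centralizer of two commuting nilpotent operators
on an \<open>n\<close>-dimensional space has at most \<open>n\<close> independent elements, then the algebra that they generate has
at least \<open>n\<close>. Since \<open>dim S = n\<close>, the action of \<open>S\<close> on \<open>V\<close> is therefore faithful (\<open>fiber_faithful\<close>).

The Gorenstein hypothesis enters through the socle: any two elements of the socle of \<open>S\<close> are proportional
(\<open>simple_socle\<close>). Let \<open>s\<close> generate it. By faithfulness some \<open>a \<in> I\<close> has \<open>s a \<notin> uI\<close>. Every nonzero ideal of
\<open>S\<close> contains the socle, so \<open>r \<mapsto> r a\<close> is injective from \<open>S\<close> to \<open>V\<close>; the dimensions agree, so it is
bijective, \<open>I = Ra + uI\<close>, and \<open>I = Ra\<close> by Nakayama (\<open>rigid_principal\<close>).\<close>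

section \<open>Linear combinations of families\<close>

definition linear_on ::
 "('k, 'e) ring_scheme \<Rightarrow> ('k, 'v, 'n) module_scheme \<Rightarrow> ('k, 'w, 'p) module_scheme \<Rightarrow> 'v set \<Rightarrow> ('v \<Rightarrow> 'w) \<Rightarrow> bool" where
 "linear_on K V N W f \<longleftrightarrow>
   (\<forall>w\<in>W. f w \<in> carrier N) \<and>
   (\<forall>w\<in>W. \<forall>w'\<in>W. f (w \<oplus>\<^bsub>V\<^esub> w') = f w \<oplus>\<^bsub>N\<^esub> f w') \<and>
   (\<forall>c\<in>carrier K. \<forall>w\<in>W. f (c \<odot>\<^bsub>V\<^esub> w) = c \<odot>\<^bsub>N\<^esub> f w)"

lemma linear_onI:
 assumes "\<And>w. w \<in> W ==> f w \<in> carrier N"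
  and "\<And>w w'. w \<in> W ==> w' \<in> W ==> f (w \<oplus>\<^bsub>V\<^esub> w') = f w \<oplus>\<^bsub>N\<^esub> f w'"
  and "\<And>c w. c \<in> carrier K ==> w \<in> W ==> f (c \<odot>\<^bsub>V\<^esub> w) = c \<odot>\<^bsub>N\<^esub> f w"
 shows "linear_on K V N W f"
 using assms by (auto simp: linear_on_def)

lemma linear_onD:
 assumes "linear_on K V N W f"
 shows "w \<in> W ==> f w \<in> carrier N"
  and "w \<in> W ==> w' \<in> W ==> f (w \<oplus>\<^bsub>V\<^esub> w') = f w \<oplus>\<^bsub>N\<^esub> f w'"
  and "c \<in> carrier K ==> w \<in> W ==> f (c \<odot>\<^bsub>V\<^esub> w) = c \<odot>\<^bsub>N\<^esub> f w"
 using assms by (auto simp: linear_on_def)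

lemma linear_on_subset: "linear_on K V N W f ==> W' \<subseteq> W ==> linear_on K V N W' f"
 unfolding linear_on_def by blast

text \<open>Linear combinations are indexed by \<open>i < n\<close> and allow repetitions. Counting families instead of
sets makes concatenation and replacement of vectors a matter of index arithmetic, and applies verbatim to modules over a ring.\<close>

primrec lc :: "('k, 'v, 'n) module_scheme \<Rightarrow> nat \<Rightarrow> (nat \<Rightarrow> 'k) \<Rightarrow> (nat \<Rightarrow> 'v) \<Rightarrow> 'v" where
 "lc V 0 a v = \<zero>\<^bsub>V\<^esub>"
| "lc V (Suc n) a v = lc V n a v \<oplus>\<^bsub>V\<^esub> (a n \<odot>\<^bsub>V\<^esub> v n)"

lemma lc_cong:
 "(\<And>i. i < n ==> a i = b i) ==> (\<And>i. i < n ==> v i = w i) ==> lc V n a v = lc V n b w"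
 by (induction n) auto

definition skip :: "nat \<Rightarrow> nat \<Rightarrow> nat" where
 "skip p j = (if j < p then j else Suc j)"

lemma skip_lt: "j < m ==> skip p j < Suc m" by (auto simp: skip_def)

context vectorspace
begin

text \<open>Proofs that involve a second vector space keep the indexed notation.\<close>

abbreviation (input) zero_V ("\<zero>\<^sub>V") where "\<zero>\<^sub>V \<equiv> \<zero>\<^bsub>V\<^esub>"
abbreviation (input) add_V (infixl "\<oplus>\<^sub>V" 65) where "v \<oplus>\<^sub>V w \<equiv> v \<oplus>\<^bsub>V\<^esub> w"
abbreviation (input) minus_V (infixl "\<ominus>\<^sub>V" 65) where "v \<ominus>\<^sub>V w \<equiv> v \<ominus>\<^bsub>V\<^esub> w"
abbreviation (input) uminus_V ("\<ominus>\<^sub>V _" [81] 80) where "\<ominus>\<^sub>V v \<equiv> \<ominus>\<^bsub>V\<^esub> v"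
abbreviation (input) smult_V (infixl "\<odot>\<^sub>V" 70) where "c \<odot>\<^sub>V v \<equiv> c \<odot>\<^bsub>V\<^esub> v"
abbreviation (input) zero_K ("\<zero>\<^sub>K") where "\<zero>\<^sub>K \<equiv> \<zero>\<^bsub>K\<^esub>"
abbreviation (input) one_K ("\<one>\<^sub>K") where "\<one>\<^sub>K \<equiv> \<one>\<^bsub>K\<^esub>"
abbreviation (input) add_K (infixl "\<oplus>\<^sub>K" 65) where "a \<oplus>\<^sub>K b \<equiv> a \<oplus>\<^bsub>K\<^esub> b"
abbreviation (input) minus_K (infixl "\<ominus>\<^sub>K" 65) where "a \<ominus>\<^sub>K b \<equiv> a \<ominus>\<^bsub>K\<^esub> b"
abbreviation (input) uminus_K ("\<ominus>\<^sub>K _" [81] 80) where "\<ominus>\<^sub>K a \<equiv> \<ominus>\<^bsub>K\<^esub> a"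
abbreviation (input) mult_K (infixl "\<otimes>\<^sub>K" 70) where "a \<otimes>\<^sub>K b \<equiv> a \<otimes>\<^bsub>K\<^esub> b"

abbreviation scalars :: "('a, 'a) module" where
 "scalars \<equiv> ideal_module K (carrier K)"

lemma scalars_simps [simp]:
 "carrier scalars = carrier K" "\<zero>\<^bsub>scalars\<^esub> = \<zero>\<^sub>K" "x \<oplus>\<^bsub>scalars\<^esub> y = x \<oplus>\<^sub>K y"
 "x \<odot>\<^bsub>scalars\<^esub> y = x \<otimes>\<^sub>K y"
 by (simp_all add: ideal_module_def)

lemma scalars_vectorspace: "vectorspace K scalars"
proof (rule vs_criteria)
 show "field K" by (rule field.field_axioms)
 show "\<forall>v\<in>carrier scalars. \<exists>neg_v\<in>carrier scalars. v \<oplus>\<^bsub>scalars\<^esub> neg_v = \<zero>\<^bsub>scalars\<^esub>"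
  using R.r_neg by auto
qed (auto simp: R.m_assoc R.a_assoc R.l_distr R.r_distr intro: R.a_comm)

lemma submodule_carrier: "submodule K (carrier V) V"
 by (unfold_locales) (auto)

lemma submodule_zero: "submodule K {\<zero>\<^sub>V} V"
 by (unfold_locales) auto

lemma sub_carrier: "submodule K W V ==> x \<in> W ==> x \<in> carrier V"
 by (auto dest: submodule.subset)

lemma sub_uminus: "submodule K W V ==> x \<in> W ==> \<ominus>\<^sub>V x \<in> W"
 using submodule.smult_closed[of K W V "\<ominus>\<^sub>K \<one>\<^sub>K" x]
 by (metis R.one_closed R.a_inv_closed smult_minus_1 sub_carrier)

lemma sub_minus: "submodule K W V ==> x \<in> W ==> y \<in> W ==> x \<ominus>\<^sub>V y \<in> W"
 unfolding a_minus_def by (rule submodule.m_closed) (auto intro: sub_uminus)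

lemma lc_in:
 assumes "submodule K W V" "\<forall>i<n. a i \<in> carrier K" "\<forall>i<n. v i \<in> W"
 shows "lc V n a v \<in> W"
 using assms(2,3) by (induction n) (auto simp: submodule.zero_closed[OF assms(1)] intro!: submodule.m_closed[OF assms(1)] submodule.smult_closed[OF assms(1)])

lemma lc_closed:
 "\<forall>i<n. a i \<in> carrier K ==> \<forall>i<n. v i \<in> carrier V ==> lc V n a v \<in> carrier V"
 using lc_in[OF submodule_carrier] .

lemma lc_coeff_add:
 assumes "\<forall>i<n. a i \<in> carrier K" "\<forall>i<n. b i \<in> carrier K" "\<forall>i<n. v i \<in> carrier V"
 shows "lc V n (\<lambda>i. a i \<oplus>\<^sub>K b i) v = lc V n a v \<oplus>\<^sub>V lc V n b v"
 using assms
proof (induction n)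
 case (Suc n)
 have c: "lc V n a v \<in> carrier V" "lc V n b v \<in> carrier V"
  using Suc.prems by (auto intro!: lc_closed)
 have "lc V (Suc n) (\<lambda>i. a i \<oplus>\<^sub>K b i) v
   = (lc V n a v \<oplus>\<^sub>V lc V n b v) \<oplus>\<^sub>V (a n \<odot>\<^sub>V v n \<oplus>\<^sub>V b n \<odot>\<^sub>V v n)"
  using Suc by (simp add: smult_l_distr)
 also have "\<dots> = lc V (Suc n) a v \<oplus>\<^sub>V lc V (Suc n) b v"
  using Suc.prems c by (simp add: M.a_ac)
 finally show ?case .
qed simp

lemma lc_vec_add:
 assumes "\<forall>i<n. a i \<in> carrier K" "\<forall>i<n. v i \<in> carrier V" "\<forall>i<n. w i \<in> carrier V"
 shows "lc V n a (\<lambda>i. v i \<oplus>\<^sub>V w i) = lc V n a v \<oplus>\<^sub>V lc V n a w"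
 using assms
proof (induction n)
 case (Suc n)
 have c: "lc V n a v \<in> carrier V" "lc V n a w \<in> carrier V"
  using Suc.prems by (auto intro!: lc_closed)
 have "lc V (Suc n) a (\<lambda>i. v i \<oplus>\<^sub>V w i)
   = (lc V n a v \<oplus>\<^sub>V lc V n a w) \<oplus>\<^sub>V (a n \<odot>\<^sub>V v n \<oplus>\<^sub>V a n \<odot>\<^sub>V w n)"
  using Suc by (simp add: smult_r_distr)
 also have "\<dots> = lc V (Suc n) a v \<oplus>\<^sub>V lc V (Suc n) a w"
  using Suc.prems c by (simp add: M.a_ac)
 finally show ?case .
qed simp

lemma lc_coeff_smult:
 assumes "\<forall>i<n. a i \<in> carrier K" "c \<in> carrier K" "\<forall>i<n. v i \<in> carrier V"
 shows "lc V n (\<lambda>i. c \<otimes>\<^sub>K a i) v = c \<odot>\<^sub>V lc V n a v"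
 using assms
proof (induction n)
 case (Suc n)
 have c: "lc V n a v \<in> carrier V" using Suc.prems by (auto intro!: lc_closed)
 then show ?case using Suc by (simp add: smult_r_distr smult_assoc1)
qed simp

lemma lc_coeff_zero:
 assumes "\<forall>i<n. a i = \<zero>\<^sub>K" "\<forall>i<n. v i \<in> carrier V"
 shows "lc V n a v = \<zero>\<^sub>V"
 using assms by (induction n) auto

lemma lc_vec_zero:
 assumes "\<forall>i<n. a i \<in> carrier K" "\<forall>i<n. v i = \<zero>\<^sub>V"
 shows "lc V n a v = \<zero>\<^sub>V"
 using assms by (induction n) auto

lemma lc_linear:
 assumes W: "submodule K W V" and N: "vectorspace K N" and f: "linear_on K V N W f"
  and "\<forall>i<n. a i \<in> carrier K" "\<forall>i<n. v i \<in> W"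
 shows "f (lc V n a v) = lc N n a (\<lambda>i. f (v i))"
 using assms(4,5)
proof (induction n)
 case 0
 have z: "\<zero>\<^bsub>V\<^esub> \<in> W" using W by (rule submodule.zero_closed)
 interpret N: vectorspace K N by (rule N)
 have "f (\<zero>\<^bsub>K\<^esub> \<odot>\<^bsub>V\<^esub> \<zero>\<^bsub>V\<^esub>) = \<zero>\<^bsub>K\<^esub> \<odot>\<^bsub>N\<^esub> f \<zero>\<^bsub>V\<^esub>" by (rule linear_onD(3)[OF f _ z]) simp
 then show ?case using linear_onD(1)[OF f z] by simp
next
 case (Suc n)
 have "lc V n a v \<in> W" using Suc.prems by (auto intro!: lc_in[OF W])
 then show ?case using Suc linear_onD[OF f] submodule.smult_closed[OF W] by auto
qed

lemma linear_on_zero: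
 assumes "submodule K W V" "vectorspace K N" "linear_on K V N W f"
 shows "f \<zero>\<^sub>V = \<zero>\<^bsub>N\<^esub>"
 using lc_linear[OF assms, of 0] by simp

lemma lc_split:
 assumes "\<forall>i<l+q. a i \<in> carrier K" "\<forall>i<l+q. v i \<in> carrier V"
 shows "lc V (l + q) a v = lc V l a v \<oplus>\<^sub>V lc V q (\<lambda>i. a (l + i)) (\<lambda>i. v (l + i))"
 using assms
proof (induction q)
 case 0
 then show ?case by (simp add: lc_closed)
next
 case (Suc q)
 have "lc V l a v \<in> carrier V" "lc V q (\<lambda>i. a (l + i)) (\<lambda>i. v (l + i)) \<in> carrier V"
  using Suc.prems by (auto intro!: lc_closed)
 then show ?case using Suc by (simp add: M.a_assoc)
qed

lemma lc_skip:
 assumes "p \<le> m" "\<forall>i\<le>m. a i \<in> carrier K" "\<forall>i\<le>m. v i \<in> carrier V"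
 shows "lc V (Suc m) a v = lc V m (\<lambda>j. a (skip p j)) (\<lambda>j. v (skip p j)) \<oplus>\<^sub>V a p \<odot>\<^sub>V v p"
 using assms
proof (induction m)
 case 0
 then show ?case by simp
next
 case (Suc m)
 show ?case
 proof (cases "p = Suc m")
  case True
  have "lc V (Suc m) a v = lc V (Suc m) (\<lambda>j. a (skip p j)) (\<lambda>j. v (skip p j))"
   by (rule lc_cong) (auto simp: True skip_def)
  then show ?thesis by (simp only: lc.simps(2)[of V "Suc m"] True)
 next
  case False
  then have p: "p \<le> m" using Suc.prems by simp
  have c: "lc V m (\<lambda>j. a (skip p j)) (\<lambda>j. v (skip p j)) \<in> carrier V"
   using Suc.prems by (intro lc_closed) (auto simp: skip_def)
  have s: "skip p m = Suc m" using p by (simp add: skip_def)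
  have "lc V (Suc (Suc m)) a v = lc V (Suc m) a v \<oplus>\<^sub>V a (Suc m) \<odot>\<^sub>V v (Suc m)" by simp
  also have "\<dots> = (lc V m (\<lambda>j. a (skip p j)) (\<lambda>j. v (skip p j)) \<oplus>\<^sub>V a p \<odot>\<^sub>V v p) \<oplus>\<^sub>V a (Suc m) \<odot>\<^sub>V v (Suc m)"
   using Suc.IH[OF p] Suc.prems by simp
  also have "\<dots> = (lc V m (\<lambda>j. a (skip p j)) (\<lambda>j. v (skip p j)) \<oplus>\<^sub>V a (Suc m) \<odot>\<^sub>V v (Suc m)) \<oplus>\<^sub>V a p \<odot>\<^sub>V v p"
   using c Suc.prems p by (simp add: M.a_ac)
  finally show ?thesis by (simp add: s)
 qed
qed

lemma lc_delta:
 assumes "j < n" "c \<in> carrier K" "\<forall>i<n. v i \<in> carrier V"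
 shows "lc V n (\<lambda>i. if i = j then c else \<zero>\<^sub>K) v = c \<odot>\<^sub>V v j"
 using assms
proof (induction n)
 case (Suc n)
 show ?case
 proof (cases "j = n")
  case True
  have "lc V n (\<lambda>i. if i = j then c else \<zero>\<^sub>K) v = \<zero>\<^sub>V"
   by (rule lc_coeff_zero) (use True Suc.prems in auto)
  then show ?thesis using Suc.prems True by simp
 next
  case False
  then have "lc V n (\<lambda>i. if i = j then c else \<zero>\<^sub>K) v = c \<odot>\<^sub>V v j" using Suc by simp
  then show ?thesis using Suc.prems False by simp
 qed
qed simp

lemma lc_lc:
 assumes "\<forall>j<m. b j \<in> carrier K" "\<forall>j<m. \<forall>i<n. A j i \<in> carrier K" "\<forall>i<n. v i \<in> carrier V"
 shows "lc V m b (\<lambda>j. lc V n (A j) v) = lc V n (\<lambda>i. lc scalars m b (\<lambda>j. A j i)) v"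
 using assms
proof (induction m)
 case 0
 then show ?case by (simp add: lc_coeff_zero)
next
 case (Suc m)
 have c: "\<forall>i<n. lc scalars m b (\<lambda>j. A j i) \<in> carrier K"
  using vectorspace.lc_closed[OF scalars_vectorspace] Suc.prems by simp
 have "lc V (Suc m) b (\<lambda>j. lc V n (A j) v)
   = lc V n (\<lambda>i. lc scalars m b (\<lambda>j. A j i)) v \<oplus>\<^sub>V lc V n (\<lambda>i. b m \<otimes>\<^sub>K A m i) v"
  using Suc by (simp add: lc_coeff_smult)
 also have "\<dots> = lc V n (\<lambda>i. lc scalars m b (\<lambda>j. A j i) \<oplus>\<^sub>K b m \<otimes>\<^sub>K A m i) v"
  using Suc.prems c by (subst lc_coeff_add) auto
 finally show ?case by simp
qed

end

section \<open>Dimension counts relative to a subspace\<close>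

text \<open>Linear independence of the maps \<open>\<phi>\<^sub>0, ..., \<phi>\<^sub>n\<^sub>-\<^sub>1\<close> restricted to \<open>W\<close>. It takes the place of a dimension
of a space of homomorphisms: bounds are stated as the absence of \<open>n + 1\<close> independent maps.\<close>

definition mindep ::
 "('k, 'e) ring_scheme \<Rightarrow> ('k, 'v, 'n) module_scheme \<Rightarrow> 'w set \<Rightarrow> nat \<Rightarrow> (nat \<Rightarrow> 'w \<Rightarrow> 'v) \<Rightarrow> bool" where
 "mindep K V W n \<phi> \<longleftrightarrow>
   (\<forall>a. (\<forall>i<n. a i \<in> carrier K) \<longrightarrow> (\<forall>w\<in>W. lc V n a (\<lambda>i. \<phi> i w) = \<zero>\<^bsub>V\<^esub>) \<longrightarrow> (\<forall>i<n. a i = \<zero>\<^bsub>K\<^esub>))"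

text \<open>Independence and bases modulo a subspace \<open>W'\<close>, so that quotient spaces need not be formed.\<close>

definition rel_indep ::
 "('k, 'e) ring_scheme \<Rightarrow> ('k, 'v, 'n) module_scheme \<Rightarrow> 'v set \<Rightarrow> nat \<Rightarrow> (nat \<Rightarrow> 'v) \<Rightarrow> bool" where
 "rel_indep K V W' n v \<longleftrightarrow>
   (\<forall>a. (\<forall>i<n. a i \<in> carrier K) \<longrightarrow> lc V n a v \<in> W' \<longrightarrow> (\<forall>i<n. a i = \<zero>\<^bsub>K\<^esub>))"

definition rel_basis ::
 "('k, 'e) ring_scheme \<Rightarrow> ('k, 'v, 'n) module_scheme \<Rightarrow> 'v set \<Rightarrow> 'v set \<Rightarrow> nat \<Rightarrow> (nat \<Rightarrow> 'v) \<Rightarrow> bool" where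
 "rel_basis K V W W' n v \<longleftrightarrow>
   (\<forall>i<n. v i \<in> W) \<and> rel_indep K V W' n v \<and>
   (\<forall>w\<in>W. \<exists>a. (\<forall>i<n. a i \<in> carrier K) \<and> w \<ominus>\<^bsub>V\<^esub> lc V n a v \<in> W')"

lemma mindepD:
 "mindep K V W n \<phi> ==> (\<And>i. i < n ==> a i \<in> carrier K) ==> (\<And>w. w \<in> W ==> lc V n a (\<lambda>i. \<phi> i w) = \<zero>\<^bsub>V\<^esub>)
  ==> i < n ==> a i = \<zero>\<^bsub>K\<^esub>"
 unfolding mindep_def by blast

lemma mindepI:
 "(\<And>a i. (\<And>i. i < n ==> a i \<in> carrier K) ==> (\<And>w. w \<in> W ==> lc V n a (\<lambda>i. \<phi> i w) = \<zero>\<^bsub>V\<^esub>)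
  ==> i < n ==> a i = \<zero>\<^bsub>K\<^esub>) ==> mindep K V W n \<phi>"
 unfolding mindep_def by blast

lemma rel_indepD:
 "rel_indep K V W' n v ==> (\<And>i. i < n ==> a i \<in> carrier K) ==> lc V n a v \<in> W' ==> i < n ==> a i = \<zero>\<^bsub>K\<^esub>"
 unfolding rel_indep_def by blast

lemma rel_indepI:
 "(\<And>a i. (\<And>i. i < n ==> a i \<in> carrier K) ==> lc V n a v \<in> W' ==> i < n ==> a i = \<zero>\<^bsub>K\<^esub>)
  ==> rel_indep K V W' n v"
 unfolding rel_indep_def by blast

context vectorspace
begin

lemma uminus_zero [simp]: "\<ominus>\<^sub>V \<zero>\<^sub>V = \<zero>\<^sub>V"
 by (metis M.r_neg M.l_zero M.zero_closed M.a_inv_closed)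

text \<open>Gaussian elimination: more unknowns than equations leave a nonzero solution. All comparisons of dimensions rest on this.\<close>

lemma homogeneous_system_nontrivial:
 assumes "\<forall>k<n. \<forall>j\<le>n. A k j \<in> carrier K"
 shows "\<exists>a. (\<forall>j\<le>n. a j \<in> carrier K) \<and> (\<exists>j\<le>n. a j \<noteq> \<zero>\<^bsub>K\<^esub>) \<and> (\<forall>k<n. lc scalars (Suc n) a (A k) = \<zero>\<^bsub>K\<^esub>)"
 using assms
proof (induction n arbitrary: A)
 case 0
 show ?case by (intro exI[of _ "\<lambda>_. \<one>\<^bsub>K\<^esub>"] conjI) simp_all
next
 case (Suc n)
 interpret S: vectorspace K scalars by (rule scalars_vectorspace)
 show ?case
 proof (cases "\<forall>j\<le>Suc n. A n j = \<zero>\<^bsub>K\<^esub>")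
  case True
  have "\<forall>k<n. \<forall>j\<le>n. A k j \<in> carrier K" using Suc.prems by simp
  from Suc.IH[OF this]
  obtain a where a: "\<forall>j\<le>n. a j \<in> carrier K" "\<exists>j\<le>n. a j \<noteq> \<zero>\<^bsub>K\<^esub>" "\<forall>k<n. lc scalars (Suc n) a (A k) = \<zero>\<^bsub>K\<^esub>"
   by blast
  let ?a = "\<lambda>j. if j \<le> n then a j else \<zero>\<^bsub>K\<^esub>"
  have "lc scalars (Suc (Suc n)) ?a (A k) = \<zero>\<^bsub>K\<^esub>" if k: "k < Suc n" for k
  proof (cases "k = n")
   case True
   with \<open>\<forall>j\<le>Suc n. A n j = \<zero>\<^bsub>K\<^esub>\<close> a(1) show ?thesis
    by (subst S.lc_vec_zero) auto
  next
   case False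
   with k have "k < n" by simp
   have "lc scalars (Suc n) ?a (A k) = lc scalars (Suc n) a (A k)" by (rule lc_cong) auto
   then have "lc scalars (Suc n) ?a (A k) = \<zero>\<^bsub>K\<^esub>" using a(3) \<open>k < n\<close> by simp
   then show ?thesis using Suc.prems k by (subst lc.simps(2)) auto
  qed
  then show ?thesis using a(1,2) by (intro exI[of _ ?a]) auto
 next
  case False
  then obtain p where p: "p \<le> Suc n" "A n p \<noteq> \<zero>\<^bsub>K\<^esub>" by blast
  have Ap: "A n p \<in> carrier K" using Suc.prems p by simp
  define c where "c = inv\<^bsub>K\<^esub> (A n p)"
  have c: "c \<in> carrier K" "c \<otimes>\<^bsub>K\<^esub> A n p = \<one>\<^bsub>K\<^esub>"
   using Ap p(2) by (auto simp: c_def field.field_Units)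
  define d where "d k = \<ominus>\<^bsub>K\<^esub> (c \<otimes>\<^bsub>K\<^esub> A k p)" for k
  have d: "d k \<in> carrier K" if "k < Suc n" for k
   using Suc.prems p c that by (auto simp: d_def)
  have As: "A k (skip p j) \<in> carrier K" if "k < Suc n" "j \<le> n" for k j
   using Suc.prems that by (auto simp: skip_def)
  define A' where "A' k j = A k (skip p j) \<oplus>\<^bsub>K\<^esub> A n (skip p j) \<otimes>\<^bsub>K\<^esub> d k" for k j
  have "\<forall>k<n. \<forall>j\<le>n. A' k j \<in> carrier K" using As d by (auto simp: A'_def)
  from Suc.IH[OF this] obtain b where b: "\<forall>j\<le>n. b j \<in> carrier K" "\<exists>j\<le>n. b j \<noteq> \<zero>\<^bsub>K\<^esub>"
    "\<forall>k<n. lc scalars (Suc n) b (A' k) = \<zero>\<^bsub>K\<^esub>" by blast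
  define \<sigma> where "\<sigma> = lc scalars (Suc n) b (\<lambda>j. A n (skip p j))"
  have \<sigma>: "\<sigma> \<in> carrier K" unfolding \<sigma>_def
   using S.lc_closed[of "Suc n" b "\<lambda>j. A n (skip p j)"] b(1) As by (simp add: less_Suc_eq_le)
  define a where "a i = (if i = p then \<ominus>\<^bsub>K\<^esub> (\<sigma> \<otimes>\<^bsub>K\<^esub> c) else b (if i < p then i else i - 1))" for i
  have as: "a (skip p j) = b j" for j by (auto simp: a_def skip_def)
  have aK: "\<forall>j\<le>Suc n. a j \<in> carrier K"
   using b(1) \<sigma> c p by (auto simp: a_def)
  have row: "lc scalars (Suc (Suc n)) a (A k) = lc scalars (Suc n) b (\<lambda>j. A k (skip p j)) \<oplus>\<^bsub>K\<^esub> a p \<otimes>\<^bsub>K\<^esub> A k p"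
   if "k < Suc n" for k
   using S.lc_skip[of p "Suc n" a "A k"] p aK Suc.prems that by (simp add: as del: lc.simps)
  have rm: "lc scalars (Suc n) b (\<lambda>j. x j \<otimes>\<^bsub>K\<^esub> e) = lc scalars (Suc n) b x \<otimes>\<^bsub>K\<^esub> e"
   if "\<forall>j\<le>n. x j \<in> carrier K" "e \<in> carrier K" for x e
  proof -
   have "linear_on K scalars scalars (carrier K) (\<lambda>y. y \<otimes>\<^bsub>K\<^esub> e)"
    using that by (auto intro!: linear_onI simp: R.l_distr R.m_assoc)
   from S.lc_linear[OF S.submodule_carrier[simplified] scalars_vectorspace this, of "Suc n" b x]
   show ?thesis using that b by (simp add: less_Suc_eq_le)
  qed
  have "lc scalars (Suc (Suc n)) a (A k) = \<zero>\<^bsub>K\<^esub>" if k: "k < Suc n" for k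
  proof (cases "k = n")
   case True
   have "\<sigma> \<oplus>\<^bsub>K\<^esub> (\<ominus>\<^bsub>K\<^esub> (\<sigma> \<otimes>\<^bsub>K\<^esub> c)) \<otimes>\<^bsub>K\<^esub> A n p = \<zero>\<^bsub>K\<^esub>"
    using \<sigma> c Ap by (simp add: R.l_minus R.m_assoc R.r_neg)
   then show ?thesis using row[of n] True by (simp add: \<sigma>_def a_def del: lc.simps)
  next
   case False
   then have kn: "k < n" using k by simp
   have Akp: "A k p \<in> carrier K" using Suc.prems k p by simp
   have cl: "lc scalars (Suc n) b (\<lambda>j. A k (skip p j)) \<in> carrier K"
    using S.lc_closed[of "Suc n" b "\<lambda>j. A k (skip p j)"] b(1) As k by (simp add: less_Suc_eq_le)
   have "\<zero>\<^bsub>K\<^esub> = lc scalars (Suc n) b (A' k)" using b(3) kn by simp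
   also have "\<dots> = lc scalars (Suc n) b (\<lambda>j. A k (skip p j)) \<oplus>\<^bsub>K\<^esub> lc scalars (Suc n) b (\<lambda>j. A n (skip p j) \<otimes>\<^bsub>K\<^esub> d k)"
    unfolding A'_def
    using S.lc_vec_add[of "Suc n" b "\<lambda>j. A k (skip p j)" "\<lambda>j. A n (skip p j) \<otimes>\<^bsub>K\<^esub> d k"] b(1) As d k
    by (simp add: less_Suc_eq_le del: lc.simps)
   also have "\<dots> = lc scalars (Suc n) b (\<lambda>j. A k (skip p j)) \<oplus>\<^bsub>K\<^esub> \<sigma> \<otimes>\<^bsub>K\<^esub> d k"
    using rm[of "\<lambda>j. A n (skip p j)" "d k"] As d k by (simp add: \<sigma>_def del: lc.simps)
   also have "\<sigma> \<otimes>\<^bsub>K\<^esub> d k = a p \<otimes>\<^bsub>K\<^esub> A k p"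
    using \<sigma> c Akp by (simp add: d_def a_def R.l_minus R.r_minus R.m_assoc)
   finally show ?thesis using row[OF k] by simp
  qed
  moreover have "\<exists>j\<le>Suc n. a j \<noteq> \<zero>\<^bsub>K\<^esub>"
   using b(2) as skip_lt by (metis less_Suc_eq_le)
  ultimately show ?thesis using aK by blast
 qed
qed

lemma rel_indep_mono: "rel_indep K V W' m v ==> k \<le> m ==> (\<forall>i<m. v i \<in> carrier V) ==> rel_indep K V W' k v"
proof (rule rel_indepI)
 fix a i assume h: "rel_indep K V W' m v" "k \<le> m" "\<forall>i<m. v i \<in> carrier V"
  and a: "\<And>i. i < k ==> a i \<in> carrier K" "lc V k a v \<in> W'" and i: "i < k"
 let ?a = "\<lambda>i. if i < k then a i else \<zero>\<^sub>K"
 have "lc V (k + (m - k)) ?a v = lc V k ?a v \<oplus>\<^sub>V lc V (m - k) (\<lambda>i. ?a (k + i)) (\<lambda>i. v (k + i))"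
  using h a by (intro lc_split) auto
 also have "lc V (m - k) (\<lambda>i. ?a (k + i)) (\<lambda>i. v (k + i)) = \<zero>\<^sub>V"
  using h by (intro lc_coeff_zero) auto
 also have "lc V k ?a v = lc V k a v" by (rule lc_cong) auto
 finally have "lc V m ?a v = lc V k a v"
  using h a by (simp add: lc_closed)
 then have "?a i = \<zero>\<^sub>K"
  using rel_indepD[OF h(1), of ?a i] a h(2) i by auto
 then show "a i = \<zero>\<^sub>K" using i by simp
qed

lemma indep_le_spanning:
 assumes W: "submodule K W' V"
  and v: "\<forall>i<n. v i \<in> carrier V"
  and sp: "\<forall>j<m. \<exists>a. (\<forall>i<n. a i \<in> carrier K) \<and> w j \<ominus>\<^sub>V lc V n a v \<in> W'"
  and w: "\<forall>j<m. w j \<in> carrier V" "rel_indep K V W' m w"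
 shows "m \<le> n"
proof (rule ccontr)
 assume "\<not> m \<le> n"
 then have nm: "Suc n \<le> m" by simp
 from sp obtain B where B: "\<And>j. j < m ==> (\<forall>i<n. B j i \<in> carrier K) \<and> w j \<ominus>\<^sub>V lc V n (B j) v \<in> W'" by metis
 have "\<forall>k<n. \<forall>j\<le>n. B j k \<in> carrier K" using B nm by auto
 from homogeneous_system_nontrivial[of n "\<lambda>k j. B j k", OF this]
 obtain a where a: "\<forall>j\<le>n. a j \<in> carrier K" "\<exists>j\<le>n. a j \<noteq> \<zero>\<^sub>K" "\<forall>k<n. lc scalars (Suc n) a (\<lambda>j. B j k) = \<zero>\<^sub>K"
  by blast
 have cl: "\<forall>j<Suc n. lc V n (B j) v \<in> carrier V" using B v nm by (auto intro!: lc_closed)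
 have "lc V (Suc n) a w = lc V (Suc n) a (\<lambda>j. (w j \<ominus>\<^sub>V lc V n (B j) v) \<oplus>\<^sub>V lc V n (B j) v)"
  using cl w nm by (intro lc_cong) (auto simp: a_minus_def M.a_assoc M.l_neg)
 also have "\<dots> = lc V (Suc n) a (\<lambda>j. w j \<ominus>\<^sub>V lc V n (B j) v) \<oplus>\<^sub>V lc V (Suc n) a (\<lambda>j. lc V n (B j) v)"
  using cl w nm a by (intro lc_vec_add) auto
 also have "lc V (Suc n) a (\<lambda>j. lc V n (B j) v) = lc V n (\<lambda>i. lc scalars (Suc n) a (\<lambda>j. B j i)) v"
  using a B nm v by (intro lc_lc) auto
 also have "\<dots> = \<zero>\<^sub>V" using a v by (intro lc_coeff_zero) auto
 finally have "lc V (Suc n) a w = lc V (Suc n) a (\<lambda>j. w j \<ominus>\<^sub>V lc V n (B j) v)"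
  using cl w nm a by (simp add: lc_closed del: lc.simps)
 also have "\<dots> \<in> W'" using a B nm by (intro lc_in[OF W]) auto
 finally have "lc V (Suc n) a w \<in> W'" .
 then have "\<forall>j\<le>n. a j = \<zero>\<^sub>K"
  using rel_indepD[OF rel_indep_mono[OF w(2) nm w(1)], of a] a(1) by (simp add: less_Suc_eq_le del: lc.simps)
 then show False using a(2) by blast
qed

lemma rel_indep_extend:
 assumes W: "submodule K W' V" and w: "\<forall>i<m. w i \<in> carrier V" "rel_indep K V W' m w"
  and v: "v \<in> carrier V" "\<And>a. (\<forall>i<m. a i \<in> carrier K) ==> v \<ominus>\<^sub>V lc V m a w \<notin> W'"
 shows "rel_indep K V W' (Suc m) (w(m := v))"
proof (rule rel_indepI)
 fix a i assume a: "\<And>i. i < Suc m ==> a i \<in> carrier K" "lc V (Suc m) a (w(m := v)) \<in> W'" and i: "i < Suc m"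
 have e: "lc V m a (w(m := v)) = lc V m a w" by (rule lc_cong) auto
 have am: "a m \<in> carrier K" using a by simp
 have cl: "lc V m a w \<in> carrier V" using a w by (intro lc_closed) auto
 have am0: "a m = \<zero>\<^sub>K"
 proof (rule ccontr)
  assume n: "a m \<noteq> \<zero>\<^sub>K"
  let ?c = "inv\<^bsub>K\<^esub> (a m)"
  have c: "?c \<in> carrier K" "?c \<otimes>\<^sub>K a m = \<one>\<^sub>K"
   using am n by (auto simp: field.field_Units)
  let ?b = "\<lambda>i. (\<ominus>\<^sub>K ?c) \<otimes>\<^sub>K a i"
  have b: "\<forall>i<m. ?b i \<in> carrier K" using c a by auto
  have "lc V m ?b w = (\<ominus>\<^sub>K ?c) \<odot>\<^sub>V lc V m a w" using c a w by (intro lc_coeff_smult) auto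
  then have "v \<ominus>\<^sub>V lc V m ?b w = v \<oplus>\<^sub>V ?c \<odot>\<^sub>V lc V m a w"
   using c cl v by (simp add: a_minus_def smult_l_minus)
  also have "\<dots> = ?c \<odot>\<^sub>V (lc V m a w \<oplus>\<^sub>V a m \<odot>\<^sub>V v)"
   using c cl v am by (simp add: smult_r_distr smult_assoc1[symmetric] M.a_comm)
  also have "\<dots> \<in> W'" using a(2) c by (auto simp: e intro: submodule.smult_closed[OF W])
  finally show False using v(2)[OF b] by simp
 qed
 have "lc V m a w \<in> W'" using a(2) cl v by (simp add: e am0)
 then show "a i = \<zero>\<^sub>K"
  using rel_indepD[OF w(2), of a i] a(1) i am0 by (cases "i = m") auto
qed

lemma rel_basis_exists:
 assumes W': "submodule K W' V" and W: "submodule K W V"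
  and bd: "\<And>m w. (\<forall>i<m. w i \<in> W) ==> rel_indep K V W' m w ==> m \<le> N"
 shows "\<exists>n v. rel_basis K V W W' n v"
proof -
 let ?P = "\<lambda>m. \<exists>w. (\<forall>i<m. w i \<in> W) \<and> rel_indep K V W' m w"
 have P0: "?P 0" by (auto simp: rel_indep_def)
 have bd': "\<And>m. ?P m ==> m \<le> N" using bd by blast
 define m where "m = (GREATEST m. ?P m)"
 have "?P m" unfolding m_def using P0 bd' by (rule GreatestI_nat)
 then obtain w where w: "\<forall>i<m. w i \<in> W" "rel_indep K V W' m w" by blast
 have max: "k \<le> m" if "?P k" for k unfolding m_def using that bd' by (rule Greatest_le_nat)
 have "\<exists>a. (\<forall>i<m. a i \<in> carrier K) \<and> v \<ominus>\<^sub>V lc V m a w \<in> W'" if v: "v \<in> W" for v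
 proof (rule ccontr)
  assume "\<not> ?thesis"
  then have nv: "v \<ominus>\<^sub>V lc V m a w \<notin> W'" if "\<forall>i<m. a i \<in> carrier K" for a using that by blast
  have "\<forall>i<m. w i \<in> carrier V" using w(1) sub_carrier[OF W] by blast
  from rel_indep_extend[OF W' this w(2) sub_carrier[OF W v] nv]
  have "rel_indep K V W' (Suc m) (w(m := v))" .
  moreover have "\<forall>i<Suc m. (w(m := v)) i \<in> W" using w v by auto
  ultimately have "?P (Suc m)" by blast
  then have "Suc m \<le> m" by (rule max)
  then show False by simp
 qed
 then show ?thesis using w unfolding rel_basis_def by blast
qed

lemma rel_basisD:
 assumes "rel_basis K V W W' n v"
 shows "i < n ==> v i \<in> W" "rel_indep K V W' n v"
  "w \<in> W ==> \<exists>a. (\<forall>i<n. a i \<in> carrier K) \<and> w \<ominus>\<^sub>V lc V n a v \<in> W'"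
 using assms unfolding rel_basis_def by auto

lemma rel_basis_unique:
 assumes "submodule K W' V" "submodule K W V" "rel_basis K V W W' n v" "rel_basis K V W W' m w"
 shows "n = m"
proof -
 have "n \<le> m"
  using assms rel_basisD[OF assms(3)] rel_basisD[OF assms(4)] sub_carrier[OF assms(2)] by (intro indep_le_spanning[OF assms(1), of m w n v]) auto
 moreover have "m \<le> n"
  using assms rel_basisD[OF assms(3)] rel_basisD[OF assms(4)] sub_carrier[OF assms(2)] by (intro indep_le_spanning[OF assms(1), of n v m w]) auto
 ultimately show ?thesis by simp
qed

lemma rel_basis_bound:
 assumes W': "submodule K W' V" and W: "submodule K W V" and b: "rel_basis K V W W' n v"
  and w: "\<forall>i<m. w i \<in> W" "rel_indep K V W' m w"
 shows "m \<le> n"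
 using indep_le_spanning[OF W', of n v m w] w rel_basisD[OF b] sub_carrier[OF W] by auto

lemma minus_minus_add:
 "x \<in> carrier V ==> y \<in> carrier V ==> z \<in> carrier V ==> (x \<ominus>\<^sub>V y) \<ominus>\<^sub>V z = x \<ominus>\<^sub>V (y \<oplus>\<^sub>V z)"
 by (simp add: a_minus_def M.minus_add M.a_assoc)

lemma rel_basis_append:
 assumes W'': "submodule K W'' V" and W': "submodule K W' V" and W: "submodule K W V"
  and s: "W'' \<subseteq> W'" "W' \<subseteq> W"
  and v: "rel_basis K V W W' n v" and w: "rel_basis K V W' W'' m w"
 shows "rel_basis K V W W'' (n + m) (\<lambda>i. if i < n then v i else w (i - n))" (is "rel_basis _ _ _ _ _ ?u")
proof -
 have uW: "\<forall>i<n+m. ?u i \<in> W"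
  using rel_basisD(1)[OF v] rel_basisD(1)[OF w] s by auto
 then have uV: "\<forall>i<n+m. ?u i \<in> carrier V" using sub_carrier[OF W] by blast
 have split: "lc V (n + m) a ?u = lc V n a v \<oplus>\<^sub>V lc V m (\<lambda>i. a (n + i)) w" if "\<forall>i<n+m. a i \<in> carrier K" for a
 proof -
  have "lc V n a ?u = lc V n a v" by (rule lc_cong) auto
  moreover have "lc V m (\<lambda>i. a (n + i)) (\<lambda>i. ?u (n + i)) = lc V m (\<lambda>i. a (n + i)) w" by (rule lc_cong) auto
  ultimately show ?thesis using lc_split[OF that uV] by simp
 qed
 have "rel_indep K V W'' (n + m) ?u"
 proof (rule rel_indepI)
  fix a i assume a: "\<And>i. i < n + m ==> a i \<in> carrier K" "lc V (n + m) a ?u \<in> W''" and i: "i < n + m"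
  have 1: "lc V m (\<lambda>i. a (n + i)) w \<in> W'" using a rel_basisD(1)[OF w] by (intro lc_in[OF W']) auto
  have 2: "lc V n a v \<in> carrier V" using a rel_basisD(1)[OF v] sub_carrier[OF W] by (intro lc_closed) auto
  have eq: "lc V (n + m) a ?u = lc V n a v \<oplus>\<^sub>V lc V m (\<lambda>i. a (n + i)) w" using split a by simp
  have "lc V n a v = lc V (n + m) a ?u \<ominus>\<^sub>V lc V m (\<lambda>i. a (n + i)) w"
   unfolding eq using 1 2 sub_carrier[OF W' 1] by (simp add: a_minus_def M.a_assoc M.r_neg)
  also have "\<dots> \<in> W'" using a(2) s 1 by (intro sub_minus[OF W']) auto
  finally have a0: "\<And>i. i < n ==> a i = \<zero>\<^sub>K" using rel_indepD[OF rel_basisD(2)[OF v], of a] a(1) by auto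
  have "lc V n a v = \<zero>\<^sub>V" using a0 rel_basisD(1)[OF v] sub_carrier[OF W] by (intro lc_coeff_zero) auto
  then have "lc V (n + m) a ?u = lc V m (\<lambda>i. a (n + i)) w"
   unfolding eq by (simp only: M.l_zero[OF sub_carrier[OF W' 1]])
  with a(2) have "lc V m (\<lambda>i. a (n + i)) w \<in> W''" by (simp only:)
  from rel_indepD[OF rel_basisD(2)[OF w] _ this] a(1)
  have "a (n + i) = \<zero>\<^sub>K" if "i < m" for i using that by simp
  from this[of "i - n"] show "a i = \<zero>\<^sub>K" using a0 i by (cases "i < n") auto
 qed
 moreover have "\<exists>a. (\<forall>i<n+m. a i \<in> carrier K) \<and> x \<ominus>\<^sub>V lc V (n + m) a ?u \<in> W''" if x: "x \<in> W" for x
 proof -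
  obtain a where a: "\<forall>i<n. a i \<in> carrier K" "x \<ominus>\<^sub>V lc V n a v \<in> W'" using rel_basisD(3)[OF v x] by blast
  obtain b where b: "\<forall>i<m. b i \<in> carrier K" "x \<ominus>\<^sub>V lc V n a v \<ominus>\<^sub>V lc V m b w \<in> W''"
   using rel_basisD(3)[OF w a(2)] by blast
  let ?c = "\<lambda>i. if i < n then a i else b (i - n)"
  have c: "\<forall>i<n+m. ?c i \<in> carrier K" using a b by auto
  have "lc V (n + m) ?c ?u = lc V n a v \<oplus>\<^sub>V lc V m b w"
   unfolding split[OF c] by (rule arg_cong2[of _ _ _ _ "\<lambda>x y. x \<oplus>\<^sub>V y"]; rule lc_cong) auto
  moreover have "x \<in> carrier V" by (rule sub_carrier[OF W x])
  moreover have "\<forall>i<n. v i \<in> carrier V" using rel_basisD(1)[OF v] sub_carrier[OF W] by blast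
  then have "lc V n a v \<in> carrier V" by (rule lc_closed[OF a(1)])
  moreover have "\<forall>i<m. w i \<in> carrier V" using rel_basisD(1)[OF w] sub_carrier[OF W'] by blast
  then have "lc V m b w \<in> carrier V" by (rule lc_closed[OF b(1)])
  ultimately have "x \<ominus>\<^sub>V lc V (n + m) ?c ?u = x \<ominus>\<^sub>V lc V n a v \<ominus>\<^sub>V lc V m b w"
   by (simp only: minus_minus_add)
  then have "x \<ominus>\<^sub>V lc V (n + m) ?c ?u \<in> W''" using b(2) by (simp only:)
  with c show ?thesis by (intro exI[of _ ?c] conjI)
 qed
 ultimately show ?thesis using uW unfolding rel_basis_def by (intro conjI ballI) simp_all
qed

lemma subspace_basis:
 assumes W'': "submodule K W'' V" and W': "submodule K W' V" and W: "submodule K W V"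
  and s: "W'' \<subseteq> W'" "W' \<subseteq> W" and b: "rel_basis K V W W'' n v"
 obtains l v' m w' where "rel_basis K V W W' l v'" "rel_basis K V W' W'' m w'" "n = l + m"
proof -
 have b': "\<forall>w\<in>W. \<exists>a. (\<forall>i<n. a i \<in> carrier K) \<and> w \<ominus>\<^sub>V lc V n a v \<in> W'"
  using rel_basisD(3)[OF b] s by blast
 have "\<exists>l v'. rel_basis K V W W' l v'"
 proof (rule rel_basis_exists[OF W' W, of n])
  fix m w assume "\<forall>i<m. w i \<in> W" "rel_indep K V W' m w"
  then show "m \<le> n" using indep_le_spanning[OF W', of n v m w] b' rel_basisD(1)[OF b] sub_carrier[OF W] by auto
 qed
 moreover have "\<exists>m w'. rel_basis K V W' W'' m w'"
  by (rule rel_basis_exists[OF W'' W', of n]) (use rel_basis_bound[OF W'' W b] s in blast)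
 ultimately obtain l v' m w' where *: "rel_basis K V W W' l v'" "rel_basis K V W' W'' m w'" by blast
 have "n = l + m" using rel_basis_unique[OF W'' W b rel_basis_append[OF W'' W' W s *]] .
 with * show ?thesis using that by blast
qed

lemma coordinate_functional:
 assumes W': "submodule K W' V" and W: "submodule K W V" and s: "W' \<subseteq> W"
  and b: "rel_basis K V W W' n v" and j: "j < n"
 obtains f where "linear_on K V scalars W f" "\<And>w. w \<in> W' ==> f w = \<zero>\<^sub>K"
  "\<And>i. i < n ==> f (v i) = (if i = j then \<one>\<^sub>K else \<zero>\<^sub>K)"
proof -
 define P where "P w a \<longleftrightarrow> (\<forall>i<n. a i \<in> carrier K) \<and> w \<ominus>\<^sub>V lc V n a v \<in> W'" for w a
 have vV: "\<forall>i<n. v i \<in> carrier V" using rel_basisD(1)[OF b] sub_carrier[OF W] by auto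
 have uniq: "a i = a' i" if "P w a" "P w a'" "w \<in> W" "i < n" for w a a' i
 proof -
  have c: "w \<in> carrier V" "lc V n a v \<in> carrier V" "lc V n a' v \<in> carrier V"
   using that vV sub_carrier[OF W] by (auto simp: P_def intro!: lc_closed)
  have "lc V n (\<lambda>i. a i \<oplus>\<^sub>K (\<ominus>\<^sub>K \<one>\<^sub>K) \<otimes>\<^sub>K a' i) v = lc V n a v \<oplus>\<^sub>V (\<ominus>\<^sub>K \<one>\<^sub>K) \<odot>\<^sub>V lc V n a' v"
   using that vV by (subst lc_coeff_add) (auto simp: P_def lc_coeff_smult)
  also have "\<dots> = lc V n a v \<ominus>\<^sub>V lc V n a' v" using c by (simp add: a_minus_def smult_l_minus)
  also have "\<dots> = (w \<ominus>\<^sub>V lc V n a' v) \<ominus>\<^sub>V (w \<ominus>\<^sub>V lc V n a v)"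
   using c by (simp add: a_minus_def M.minus_add M.a_ac M.r_neg M.r_neg2 M.r_neg1)
  also have "\<dots> \<in> W'" using that by (auto simp: P_def intro: sub_minus[OF W'])
  finally have "a i \<oplus>\<^sub>K (\<ominus>\<^sub>K \<one>\<^sub>K) \<otimes>\<^sub>K a' i = \<zero>\<^sub>K"
   using rel_indepD[OF rel_basisD(2)[OF b], of "\<lambda>i. a i \<oplus>\<^sub>K (\<ominus>\<^sub>K \<one>\<^sub>K) \<otimes>\<^sub>K a' i" i] that by (auto simp: P_def)
  then have "a i \<ominus>\<^sub>K a' i = \<zero>\<^sub>K" using that by (auto simp: P_def a_minus_def R.l_minus)
  then show ?thesis using that by (auto simp: P_def)
 qed
 define f where "f w = (SOME a. P w a) j" for w
 have P: "P w (SOME a. P w a)" if "w \<in> W" for w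
  using rel_basisD(3)[OF b that] unfolding P_def by (rule someI_ex)
 have feq: "f w = a j" if "w \<in> W" "P w a" for w a
  unfolding f_def using uniq[OF P[OF that(1)] that(2,1) j] .
 have "linear_on K V scalars W f"
 proof (rule linear_onI)
  fix w assume w: "w \<in> W"
  show "f w \<in> carrier scalars" using P[OF w] j by (simp add: f_def P_def)
 next
  fix w w' assume w: "w \<in> W" "w' \<in> W"
  obtain a where a: "P w a" using P[OF w(1)] ..
  obtain a' where a': "P w' a'" using P[OF w(2)] ..
  have c: "w \<in> carrier V" "w' \<in> carrier V" "lc V n a v \<in> carrier V" "lc V n a' v \<in> carrier V"
   using w a a' vV sub_carrier[OF W] by (auto simp: P_def intro!: lc_closed)
  have "(w \<oplus>\<^sub>V w') \<ominus>\<^sub>V (lc V n a v \<oplus>\<^sub>V lc V n a' v) = (w \<ominus>\<^sub>V lc V n a v) \<oplus>\<^sub>V (w' \<ominus>\<^sub>V lc V n a' v)"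
   using c by (simp add: a_minus_def M.minus_add M.a_ac)
  then have "P (w \<oplus>\<^sub>V w') (\<lambda>i. a i \<oplus>\<^sub>K a' i)"
   using a a' vV submodule.m_closed[OF W'] by (auto simp: P_def lc_coeff_add)
  then show "f (w \<oplus>\<^sub>V w') = f w \<oplus>\<^bsub>scalars\<^esub> f w'"
   using feq[OF w(1) a] feq[OF w(2) a'] feq[of "w \<oplus>\<^sub>V w'"] submodule.m_closed[OF W] w by auto
 next
  fix c w assume c: "c \<in> carrier K" and w: "w \<in> W"
  obtain a where a: "P w a" using P[OF w] ..
  have cc: "w \<in> carrier V" "lc V n a v \<in> carrier V"
   using w a vV sub_carrier[OF W] by (auto simp: P_def intro!: lc_closed)
  have "c \<odot>\<^sub>V w \<ominus>\<^sub>V c \<odot>\<^sub>V lc V n a v = c \<odot>\<^sub>V (w \<ominus>\<^sub>V lc V n a v)"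
   using c cc by (simp add: a_minus_def smult_r_distr smult_r_minus)
  then have "P (c \<odot>\<^sub>V w) (\<lambda>i. c \<otimes>\<^sub>K a i)"
   using a c vV submodule.smult_closed[OF W'] by (auto simp: P_def lc_coeff_smult)
  then show "f (c \<odot>\<^sub>V w) = c \<odot>\<^bsub>scalars\<^esub> f w"
   using feq[OF w a] feq[of "c \<odot>\<^sub>V w"] submodule.smult_closed[OF W] w c by auto
 qed
 moreover have "f w = \<zero>\<^sub>K" if w: "w \<in> W'" for w
 proof -
  have "P w (\<lambda>_. \<zero>\<^sub>K)" using w vV sub_carrier[OF W'] by (auto simp: P_def lc_coeff_zero a_minus_def uminus_zero)
  then show ?thesis using feq[of w] w s by auto
 qed
 moreover have "f (v i) = (if i = j then \<one>\<^sub>K else \<zero>\<^sub>K)" if i: "i < n" for i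
 proof -
  have "P (v i) (\<lambda>k. if k = i then \<one>\<^sub>K else \<zero>\<^sub>K)"
   using i vV submodule.zero_closed[OF W'] by (auto simp: P_def lc_delta a_minus_def M.r_neg)
  then show ?thesis using feq[OF rel_basisD(1)[OF b i]] by auto
 qed
 ultimately show ?thesis using that by blast
qed

text \<open>Functionals without a common zero span the dual space: as long as fewer than \<open>n\<close> have been chosen, they have a common zero \<open>w \<noteq> 0\<close>, and a functional that is nonzero at \<open>w\<close> is independent of them.\<close>

lemma separating_functionals:
 assumes W: "submodule K W V" and b: "rel_basis K V W {\<zero>\<^bsub>V\<^esub>} n v"
  and F: "\<And>f. f \<in> F ==> linear_on K V scalars W f"
  and sep: "\<And>w. w \<in> W ==> (\<forall>f\<in>F. f w = \<zero>\<^bsub>K\<^esub>) ==> w = \<zero>\<^bsub>V\<^esub>"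
  and p: "p \<le> n"
 shows "\<exists>f. (\<forall>i<p. f i \<in> F) \<and> mindep K scalars W p f"
 using p
proof (induction p)
 case 0
 show ?case by (auto simp: mindep_def)
next
 case (Suc p)
 interpret S: vectorspace K scalars by (rule scalars_vectorspace)
 from Suc obtain f where f: "\<forall>i<p. f i \<in> F" "mindep K scalars W p f" by auto
 have pn: "p < n" using Suc.prems by simp
 have vV: "\<forall>i<n. v i \<in> W" using rel_basisD(1)[OF b] by auto
 have "\<forall>k<p. \<forall>j\<le>p. f k (v j) \<in> carrier K"
  using f(1) linear_onD(1)[OF F] vV pn by fastforce
 from homogeneous_system_nontrivial[of p "\<lambda>k j. f k (v j)", OF this]
 obtain a where a: "\<forall>j\<le>p. a j \<in> carrier K" "\<exists>j\<le>p. a j \<noteq> \<zero>\<^bsub>K\<^esub>"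
  "\<forall>k<p. lc scalars (Suc p) a (\<lambda>j. f k (v j)) = \<zero>\<^bsub>K\<^esub>" by blast
 define w where "w = lc V (Suc p) a v"
 have wW: "w \<in> W" unfolding w_def using a(1) vV pn by (intro lc_in[OF W]) auto
 have "rel_indep K V {\<zero>\<^bsub>V\<^esub>} (Suc p) v"
  using rel_indep_mono[OF rel_basisD(2)[OF b], of "Suc p"] pn vV sub_carrier[OF W] by auto
 then have "w \<noteq> \<zero>\<^bsub>V\<^esub>"
  using rel_indepD[of K V "{\<zero>\<^bsub>V\<^esub>}" "Suc p" v a] a(1,2) by (auto simp: w_def less_Suc_eq_le simp del: lc.simps)
 then have "\<not> (\<forall>f\<in>F. f w = \<zero>\<^bsub>K\<^esub>)" using sep[OF wW] by (rule contrapos_nn)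
 then obtain g where g: "g \<in> F" "g w \<noteq> \<zero>\<^bsub>K\<^esub>" by (auto simp only: bex_simps not_all Ball_def simp_thms)
 have fw: "f k w = \<zero>\<^bsub>K\<^esub>" if "k < p" for k
  unfolding w_def using lc_linear[OF W scalars_vectorspace F, of "f k" "Suc p" a v] f(1) that a vV pn by (auto simp del: lc.simps)
 have gw: "g w \<in> carrier K" using linear_onD(1)[OF F[OF g(1)] wW] by simp
 let ?f = "f(p := g)"
 have "mindep K scalars W (Suc p) ?f"
 proof (rule mindepI)
  fix c i assume c: "\<And>i. i < Suc p ==> c i \<in> carrier K"
   "\<And>w. w \<in> W ==> lc scalars (Suc p) c (\<lambda>i. ?f i w) = \<zero>\<^bsub>scalars\<^esub>" and i: "i < Suc p"
  have e: "lc scalars p c (\<lambda>i. ?f i w) = lc scalars p c (\<lambda>i. f i w)" for w by (rule lc_cong) auto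
  have "lc scalars p c (\<lambda>i. f i w) = \<zero>\<^bsub>K\<^esub>" using S.lc_vec_zero[of p c "\<lambda>i. f i w"] c(1) fw by auto
  then have "c p \<otimes>\<^bsub>K\<^esub> g w = \<zero>\<^bsub>K\<^esub>" using c(2)[OF wW] e c(1) gw by simp
  then have cp: "c p = \<zero>\<^bsub>K\<^esub>" using g(2) gw c(1)[of p] field.integral_iff by auto
  have "lc scalars p c (\<lambda>i. f i x) = \<zero>\<^bsub>scalars\<^esub>" if x: "x \<in> W" for x
  proof -
   have "lc scalars p c (\<lambda>i. f i x) \<in> carrier scalars"
    by (rule S.lc_closed) (use c(1) f(1) linear_onD(1)[OF F _] x in \<open>auto\<close>)
   then show ?thesis using c(2)[OF x] e[of x] cp linear_onD(1)[OF F[OF g(1)] x] by simp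
  qed
  then have "\<And>i. i < p ==> c i = \<zero>\<^bsub>K\<^esub>" using mindepD[OF f(2), of c] c(1) by auto
  then show "c i = \<zero>\<^bsub>K\<^esub>" using cp i by (cases "i = p") auto
 qed
 moreover have "\<forall>i<Suc p. ?f i \<in> F" using f g by auto
 ultimately show ?case by blast
qed

end

section \<open>Polynomials as finitely supported sequences\<close>

text \<open>The space \<open>K[t]\<close>: a polynomial is its sequence of coefficients.\<close>

definition finseq_space :: "('k, 'e) ring_scheme \<Rightarrow> ('k, nat \<Rightarrow> 'k) module" where
 "finseq_space K =
  \<lparr>carrier = {f. (\<forall>n. f n \<in> carrier K) \<and> (\<exists>N. \<forall>n\<ge>N. f n = \<zero>\<^bsub>K\<^esub>)},
   monoid.mult = undefined, monoid.one = undefined,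
   ring.zero = (\<lambda>_. \<zero>\<^bsub>K\<^esub>), ring.add = (\<lambda>f g n. f n \<oplus>\<^bsub>K\<^esub> g n), smult = (\<lambda>c f n. c \<otimes>\<^bsub>K\<^esub> f n)\<rparr>"

lemma finseq_space_simps:
 "carrier (finseq_space K) = {f. (\<forall>n. f n \<in> carrier K) \<and> (\<exists>N. \<forall>n\<ge>N. f n = \<zero>\<^bsub>K\<^esub>)}"
 "\<zero>\<^bsub>finseq_space K\<^esub> = (\<lambda>_. \<zero>\<^bsub>K\<^esub>)"
 "f \<oplus>\<^bsub>finseq_space K\<^esub> g = (\<lambda>n. f n \<oplus>\<^bsub>K\<^esub> g n)"
 "c \<odot>\<^bsub>finseq_space K\<^esub> f = (\<lambda>n. c \<otimes>\<^bsub>K\<^esub> f n)"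
 by (simp_all add: finseq_space_def)

text \<open>Multiplication by \<open>t\<^sup>l\<close>.\<close>

definition shift :: "('k, 'e) ring_scheme \<Rightarrow> nat \<Rightarrow> (nat \<Rightarrow> 'k) \<Rightarrow> nat \<Rightarrow> 'k" where
 "shift K l f = (\<lambda>n. if n < l then \<zero>\<^bsub>K\<^esub> else f (n - l))"

text \<open>The linear map from \<open>K[t]\<close> that sends \<open>t\<^sup>n\<close> to the vector \<open>v n\<close>.\<close>

definition eval_seq ::
 "('k, 'e) ring_scheme \<Rightarrow> ('k, 'v, 'n) module_scheme \<Rightarrow> (nat \<Rightarrow> 'v) \<Rightarrow> (nat \<Rightarrow> 'k) \<Rightarrow> 'v" where
 "eval_seq K V v f = lc V (LEAST N. \<forall>n\<ge>N. f n = \<zero>\<^bsub>K\<^esub>) f v"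

text \<open>The polynomial is nonzero of degree \<open>d\<close>.\<close>

definition leads :: "('k, 'e) ring_scheme \<Rightarrow> (nat \<Rightarrow> 'k) \<Rightarrow> nat \<Rightarrow> bool" where
 "leads K f d \<longleftrightarrow> f d \<noteq> \<zero>\<^bsub>K\<^esub> \<and> (\<forall>k>d. f k = \<zero>\<^bsub>K\<^esub>)"

context vectorspace
begin

abbreviation polys :: "('a, nat \<Rightarrow> 'a) module" where
 "polys \<equiv> finseq_space K"

lemma polysI: "(\<And>n. f n \<in> carrier K) ==> (\<And>n. N \<le> n ==> f n = \<zero>\<^sub>K) ==> f \<in> carrier polys"
 unfolding finseq_space_simps by blast

lemma polys_nth: "f \<in> carrier polys ==> f n \<in> carrier K"
 by (simp add: finseq_space_simps)

lemma polys_bound: "f \<in> carrier polys ==> \<exists>N. \<forall>n\<ge>N. f n = \<zero>\<^sub>K"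
 by (simp add: finseq_space_simps)

lemma polys_vectorspace: "vectorspace K polys"
proof (rule vs_criteria)
 show "field K" by (rule field.field_axioms)
 show "\<zero>\<^bsub>polys\<^esub> \<in> carrier polys" by (simp add: finseq_space_simps)
 show "\<forall>v w. v \<in> carrier polys \<and> w \<in> carrier polys \<longrightarrow> v \<oplus>\<^bsub>polys\<^esub> w \<in> carrier polys"
 proof (intro allI impI, elim conjE)
  fix v w assume v: "v \<in> carrier polys" and w: "w \<in> carrier polys"
  obtain N M where "\<forall>n\<ge>N. v n = \<zero>\<^sub>K" "\<forall>n\<ge>M. w n = \<zero>\<^sub>K"
   using polys_bound[OF v] polys_bound[OF w] by blast
  then show "v \<oplus>\<^bsub>polys\<^esub> w \<in> carrier polys"
   using polys_nth[OF v] polys_nth[OF w]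
   by (intro polysI[of _ "max N M"]) (simp_all add: finseq_space_simps(3))
 qed
 show "\<forall>v\<in>carrier polys. \<exists>neg_v\<in>carrier polys. v \<oplus>\<^bsub>polys\<^esub> neg_v = \<zero>\<^bsub>polys\<^esub>"
 proof
  fix v assume v: "v \<in> carrier polys"
  obtain N where "\<forall>n\<ge>N. v n = \<zero>\<^sub>K" using polys_bound[OF v] by blast
  then have "(\<lambda>n. \<ominus>\<^sub>K v n) \<in> carrier polys"
   using polys_nth[OF v] by (intro polysI[of _ N]) simp_all
  moreover have "v \<oplus>\<^bsub>polys\<^esub> (\<lambda>n. \<ominus>\<^sub>K v n) = \<zero>\<^bsub>polys\<^esub>"
   using polys_nth[OF v] by (simp add: finseq_space_simps(2,3) R.r_neg)
  ultimately show "\<exists>neg_v\<in>carrier polys. v \<oplus>\<^bsub>polys\<^esub> neg_v = \<zero>\<^bsub>polys\<^esub>" by blast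
 qed
 show "\<forall>c v. c \<in> carrier K \<and> v \<in> carrier polys \<longrightarrow> c \<odot>\<^bsub>polys\<^esub> v \<in> carrier polys"
 proof (intro allI impI, elim conjE)
  fix c v assume c: "c \<in> carrier K" and v: "v \<in> carrier polys"
  obtain N where "\<forall>n\<ge>N. v n = \<zero>\<^sub>K" using polys_bound[OF v] by blast
  then show "c \<odot>\<^bsub>polys\<^esub> v \<in> carrier polys"
   using polys_nth[OF v] c by (intro polysI[of _ N]) (simp_all add: finseq_space_simps(4))
 qed
qed (simp_all add: finseq_space_simps R.m_assoc R.a_ac R.l_distr R.r_distr)

lemma lc_extend:
 assumes "N \<le> M" "\<forall>n\<ge>N. a n = \<zero>\<^sub>K" "\<forall>n<N. a n \<in> carrier K" "\<forall>n. v n \<in> carrier V"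
 shows "lc V M a v = lc V N a v"
proof -
 have "lc V (N + (M - N)) a v = lc V N a v \<oplus>\<^sub>V lc V (M - N) (\<lambda>i. a (N + i)) (\<lambda>i. v (N + i))"
  using assms by (intro lc_split) (metis not_less R.zero_closed, simp)
 also have "lc V (M - N) (\<lambda>i. a (N + i)) (\<lambda>i. v (N + i)) = \<zero>\<^sub>V"
  using assms by (intro lc_coeff_zero) simp_all
 finally show ?thesis using assms(1) lc_closed[of N a v] assms(3,4) by simp
qed

lemma eval_seq_eq:
 assumes f: "f \<in> carrier polys" and N: "\<forall>n\<ge>N. f n = \<zero>\<^sub>K" and v: "\<forall>n. v n \<in> carrier V"
 shows "eval_seq K V v f = lc V N f v"
proof -
 define M where "M = (LEAST N. \<forall>n\<ge>N. f n = \<zero>\<^sub>K)"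
 have M: "\<forall>n\<ge>M. f n = \<zero>\<^sub>K" "M \<le> N"
  unfolding M_def using N by (rule LeastI, rule Least_le)
 have "lc V N f v = lc V M f v"
  using M v polys_nth[OF f] by (intro lc_extend) simp_all
 then show ?thesis by (simp only: eval_seq_def M_def)
qed

lemma eval_seq_in:
 assumes W: "submodule K W V" and f: "f \<in> carrier polys" and v: "\<forall>n. v n \<in> W"
 shows "eval_seq K V v f \<in> W"
proof -
 obtain N where N: "\<forall>n\<ge>N. f n = \<zero>\<^sub>K" using polys_bound[OF f] by blast
 have "\<forall>n. v n \<in> carrier V" using v sub_carrier[OF W] by blast
 then show ?thesis
  unfolding eval_seq_eq[OF f N \<open>\<forall>n. v n \<in> carrier V\<close>] using v polys_nth[OF f] by (intro lc_in[OF W]) simp_all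
qed

lemma eval_seq_linear:
 assumes v: "\<forall>n. v n \<in> carrier V"
 shows "linear_on K polys V (carrier polys) (eval_seq K V v)"
proof (rule linear_onI)
 fix f assume "f \<in> carrier polys"
 then show "eval_seq K V v f \<in> carrier V" using v by (intro eval_seq_in[OF submodule_carrier])
next
 fix f g assume f: "f \<in> carrier polys" and g: "g \<in> carrier polys"
 interpret P: vectorspace K polys by (rule polys_vectorspace)
 obtain N M where NM: "\<forall>n\<ge>N. f n = \<zero>\<^bsub>K\<^esub>" "\<forall>n\<ge>M. g n = \<zero>\<^bsub>K\<^esub>"
  using polys_bound[OF f] polys_bound[OF g] by blast
 let ?N = "max N M"
 have b: "\<forall>n\<ge>?N. f n = \<zero>\<^bsub>K\<^esub>" "\<forall>n\<ge>?N. g n = \<zero>\<^bsub>K\<^esub>" using NM by simp_all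
 then have "\<forall>n\<ge>?N. (f \<oplus>\<^bsub>polys\<^esub> g) n = \<zero>\<^bsub>K\<^esub>" by (simp add: finseq_space_simps(3))
 from eval_seq_eq[OF P.M.a_closed[OF f g] this v]
 have "eval_seq K V v (f \<oplus>\<^bsub>polys\<^esub> g) = lc V ?N (\<lambda>n. f n \<oplus>\<^bsub>K\<^esub> g n) v" by (simp only: finseq_space_simps(3))
 also have "\<dots> = lc V ?N f v \<oplus>\<^bsub>V\<^esub> lc V ?N g v"
  using v polys_nth[OF f] polys_nth[OF g] by (intro lc_coeff_add) simp_all
 finally show "eval_seq K V v (f \<oplus>\<^bsub>polys\<^esub> g) = eval_seq K V v f \<oplus>\<^bsub>V\<^esub> eval_seq K V v g"
  by (simp only: eval_seq_eq[OF f b(1) v] eval_seq_eq[OF g b(2) v])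
next
 fix c f assume c: "c \<in> carrier K" and f: "f \<in> carrier polys"
 interpret P: vectorspace K polys by (rule polys_vectorspace)
 obtain N where N: "\<forall>n\<ge>N. f n = \<zero>\<^bsub>K\<^esub>" using polys_bound[OF f] by blast
 then have "\<forall>n\<ge>N. (c \<odot>\<^bsub>polys\<^esub> f) n = \<zero>\<^bsub>K\<^esub>" using c by (simp add: finseq_space_simps(4))
 from eval_seq_eq[OF P.smult_closed[OF c f] this v]
 have "eval_seq K V v (c \<odot>\<^bsub>polys\<^esub> f) = lc V N (\<lambda>n. c \<otimes>\<^bsub>K\<^esub> f n) v" by (simp only: finseq_space_simps(4))
 also have "\<dots> = c \<odot>\<^bsub>V\<^esub> lc V N f v"
  using v polys_nth[OF f] c by (intro lc_coeff_smult) simp_all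
 finally show "eval_seq K V v (c \<odot>\<^bsub>polys\<^esub> f) = c \<odot>\<^bsub>V\<^esub> eval_seq K V v f"
  by (simp only: eval_seq_eq[OF f N v])
qed

lemma shift_closed: "f \<in> carrier polys ==> shift K l f \<in> carrier polys"
proof -
 assume f: "f \<in> carrier polys"
 obtain N where "\<forall>n\<ge>N. f n = \<zero>\<^sub>K" using polys_bound[OF f] by blast
 then show ?thesis using polys_nth[OF f] by (intro polysI[of _ "N + l"]) (simp_all add: shift_def)
qed

lemma unshift_closed: "f \<in> carrier polys ==> (\<lambda>n. f (n + l)) \<in> carrier polys"
proof -
 assume f: "f \<in> carrier polys"
 obtain N where "\<forall>n\<ge>N. f n = \<zero>\<^sub>K" using polys_bound[OF f] by blast
 then show ?thesis using polys_nth[OF f] by (intro polysI[of _ N]) simp_all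
qed

lemma shift_linear: "linear_on K polys polys (carrier polys) (shift K l)"
 by (rule linear_onI, erule shift_closed) (auto simp: shift_def finseq_space_simps(3,4))

lemma shift_unshift: "(\<And>n. n < l ==> f n = \<zero>\<^sub>K) ==> shift K l (\<lambda>n. f (n + l)) = f"
 by (auto simp: shift_def)

lemma unshift_shift: "(\<lambda>n. shift K l f (n + l)) = f"
 by (auto simp: shift_def)

lemma eval_seq_split:
 assumes f: "f \<in> carrier polys" and v: "\<forall>n. v n \<in> carrier V"
 shows "eval_seq K V v f = lc V l f v \<oplus>\<^sub>V eval_seq K V (\<lambda>i. v (l + i)) (\<lambda>n. f (n + l))"
proof -
 obtain N where N: "\<forall>n\<ge>N. f n = \<zero>\<^sub>K" using polys_bound[OF f] by blast
 have "eval_seq K V v f = lc V (l + N) f v"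
  using N by (intro eval_seq_eq[OF f _ v]) simp
 also have "\<dots> = lc V l f v \<oplus>\<^sub>V lc V N (\<lambda>i. f (l + i)) (\<lambda>i. v (l + i))"
  using v polys_nth[OF f] by (intro lc_split) simp_all
 also have "lc V N (\<lambda>i. f (l + i)) (\<lambda>i. v (l + i)) = eval_seq K V (\<lambda>i. v (l + i)) (\<lambda>n. f (n + l))"
  by (subst eval_seq_eq[OF unshift_closed[OF f], of N]) (use N v in \<open>simp_all add: add.commute\<close>)
 finally show ?thesis .
qed

lemma eval_seq_image:
 assumes W: "submodule K W V" and S: "linear_on K V V W S" and f: "f \<in> carrier polys" and v: "\<forall>n. v n \<in> W"
 shows "S (eval_seq K V v f) = eval_seq K V (\<lambda>i. S (v i)) f"
proof -
 obtain N where N: "\<forall>n\<ge>N. f n = \<zero>\<^sub>K" using polys_bound[OF f] by blast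
 have v': "\<forall>n. v n \<in> carrier V" using v sub_carrier[OF W] by blast
 have S': "\<forall>n. S (v n) \<in> carrier V" using v linear_onD(1)[OF S] by blast
 show ?thesis
  unfolding eval_seq_eq[OF f N v'] eval_seq_eq[OF f N S']
  by (rule lc_linear[OF W vectorspace_axioms S]) (use polys_nth[OF f] v in simp_all)
qed

lemma eval_seq_shift:
 assumes W: "submodule K W V" and S: "linear_on K V V W S" and f: "f \<in> carrier polys"
  and v: "\<forall>n. v n \<in> W" "\<forall>n. v (l + n) = S (v n)"
 shows "eval_seq K V v (shift K l f) = S (eval_seq K V v f)"
proof -
 have v': "\<forall>n. v n \<in> carrier V" using v sub_carrier[OF W] by blast
 have 0: "lc V l (shift K l f) v = \<zero>\<^sub>V"
  using v' by (intro lc_coeff_zero) (simp_all add: shift_def)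
 have "eval_seq K V v (shift K l f) = \<zero>\<^sub>V \<oplus>\<^sub>V eval_seq K V (\<lambda>i. v (l + i)) f"
  using eval_seq_split[OF shift_closed[OF f] v', of l l] by (simp only: 0 unshift_shift)
 also have "eval_seq K V (\<lambda>i. v (l + i)) f = S (eval_seq K V v f)"
  unfolding eval_seq_image[OF W S f v(1)] using v(2) by simp
 also have "S (eval_seq K V v f) \<in> carrier V"
  using linear_onD(1)[OF S eval_seq_in[OF W f v(1)]] .
 then have "\<zero>\<^sub>V \<oplus>\<^sub>V S (eval_seq K V v f) = S (eval_seq K V v f)" by simp
 finally show ?thesis .
qed

lemma lc_polys_nth: "lc polys n a u k = lc scalars n a (\<lambda>i. u i k)"
 by (induction n) (simp_all add: finseq_space_simps)

lemma lc_single: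
 assumes "j < n" "\<forall>i<n. i \<noteq> j \<longrightarrow> a i \<odot>\<^sub>V v i = \<zero>\<^sub>V" "a j \<odot>\<^sub>V v j \<in> carrier V"
 shows "lc V n a v = a j \<odot>\<^sub>V v j"
 using assms
proof (induction n)
 case (Suc n)
 show ?case
 proof (cases "j = n")
  case True
  have "lc V m a v = \<zero>\<^sub>V" if "m \<le> n" for m using that Suc.prems(2) True by (induction m) simp_all
  from this[of n] show ?thesis using True Suc.prems(3) by simp
 next
  case False
  then show ?thesis using Suc by simp
 qed
qed simp

end

text \<open>Endomorphisms of \<open>W\<close> in the centralizer of \<open>S\<close> and \<open>T\<close>.\<close>

definition comm_end ::
 "('k, 'e) ring_scheme \<Rightarrow> ('k, 'v, 'n) module_scheme \<Rightarrow> ('v \<Rightarrow> 'v) \<Rightarrow> ('v \<Rightarrow> 'v) \<Rightarrow> 'v set \<Rightarrow> ('v \<Rightarrow> 'v) \<Rightarrow> bool" where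
 "comm_end K V S T W \<phi> \<longleftrightarrow> linear_on K V V W \<phi> \<and>
   (\<forall>w\<in>W. \<phi> w \<in> W \<and> \<phi> (S w) = S (\<phi> w) \<and> \<phi> (T w) = T (\<phi> w))"

locale commuting_pair = vectorspace K V for K and V +
 fixes S T
 assumes S_linear: "linear_on K V V (carrier V) S"
  and T_linear: "linear_on K V V (carrier V) T"
  and ST_commute: "v \<in> carrier V ==> S (T v) = T (S v)"
begin

definition stable where
 "stable W \<longleftrightarrow> submodule K W V \<and> (\<forall>w\<in>W. S w \<in> W) \<and> (\<forall>w\<in>W. T w \<in> W)"

lemma stableD:
 assumes "stable W"
 shows "submodule K W V" "w \<in> W ==> S w \<in> W" "w \<in> W ==> T w \<in> W"
 using assms by (auto simp: stable_def)

lemma image_submodule: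
 assumes W: "submodule K W V" and f: "linear_on K V V W f"
 shows "submodule K (f ` W) V"
proof (unfold_locales)
 show "f ` W \<subseteq> carrier V" using linear_onD(1)[OF f] by blast
 show "v \<oplus>\<^sub>V w \<in> f ` W" if "v \<in> f ` W" "w \<in> f ` W" for v w
  using that linear_onD(2)[OF f] submodule.m_closed[OF W] by (auto simp: image_iff) (metis)
 show "\<zero>\<^sub>V \<in> f ` W"
  using linear_on_zero[OF W vectorspace_axioms f] submodule.zero_closed[OF W] by (metis imageI)
 show "c \<odot>\<^sub>V v \<in> f ` W" if "c \<in> carrier K" "v \<in> f ` W" for c v
  using that linear_onD(3)[OF f] submodule.smult_closed[OF W] by (auto simp: image_iff) (metis)
qed

lemma stable_image_S:
 assumes "stable W"
 shows "stable (S ` W)" "S ` W \<subseteq> W"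
proof -
 note W = stableD[OF assms]
 have f: "linear_on K V V W S" using linear_on_subset[OF S_linear] submodule.subset[OF W(1)] .
 show "S ` W \<subseteq> W" using W(2) by blast
 then show "stable (S ` W)"
  unfolding stable_def using image_submodule[OF W(1) f] W ST_commute[symmetric] sub_carrier[OF W(1)] by auto
qed

end

section \<open>New centralizer elements from a polynomial model\<close>

text \<open>Let \<open>v\<^sub>0, ..., v\<^sub>l\<^sub>-\<^sub>1\<close> be a basis of \<open>W\<close> modulo \<open>S W\<close>. Then \<open>W\<close> is a quotient of \<open>K[t]\<close> on which \<open>S\<close> is
multiplication by \<open>t\<^sup>l\<close>: send \<open>t\<^sup>n\<close> to \<open>S\<^sup>q v\<^sub>r\<close>, where \<open>n = q l + r\<close>. The operator \<open>T\<close> lifts to \<open>K[t]\<close>, and the lift can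
be changed by a high power of \<open>t\<close>, which is zero on \<open>W\<close>. With the degrees under control, endomorphisms of \<open>K[t]\<close> that
commute with both lifts provide \<open>l\<close> centralizer elements that are new compared with those coming from \<open>S W\<close>.\<close>

locale shift_model = commuting_pair K V S T for K and V and S and T +
 fixes W v l p
 assumes stable: "stable W" and l_pos: "l > 0"
  and basis: "rel_basis K V W (S ` W) l v"
  and nil: "w \<in> W ==> (S ^^ p) w = \<zero>\<^sub>V"
begin

lemmas W_sub = stableD(1)[OF stable] and S_in = stableD(2)[OF stable] and T_in = stableD(3)[OF stable]

lemma W_carrier: "w \<in> W ==> w \<in> carrier V"
 using sub_carrier[OF W_sub] .

lemma S_W: "linear_on K V V W S"
 using linear_on_subset[OF S_linear] submodule.subset[OF W_sub] .

lemma T_W: "linear_on K V V W T"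
 using linear_on_subset[OF T_linear] submodule.subset[OF W_sub] .

lemma SW_sub: "submodule K (S ` W) V"
 using stableD(1)[OF stable_image_S(1)[OF stable]] .

lemma S_pow_in: "w \<in> W ==> (S ^^ k) w \<in> W"
 by (induction k) (auto intro: S_in)

lemma S_zero: "S \<zero>\<^sub>V = \<zero>\<^sub>V"
 using linear_on_zero[OF W_sub vectorspace_axioms S_W] .

lemma S_pow_zero: "(S ^^ k) \<zero>\<^sub>V = \<zero>\<^sub>V"
 by (induction k) (auto simp: S_zero)

lemma S_pow_nil: "w \<in> W ==> p \<le> k ==> (S ^^ k) w = \<zero>\<^sub>V"
 using nil[of w] S_pow_zero[of "k - p"] funpow_add[of "k - p" p S] by (simp add: o_def)

text \<open>The image of \<open>t\<^sup>n\<close> in \<open>W\<close>.\<close>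

definition vv where "vv n = (S ^^ (n div l)) (v (n mod l))"

abbreviation ev where "ev \<equiv> eval_seq K V vv"
abbreviation F where "F \<equiv> carrier polys"
abbreviation sh where "sh \<equiv> shift K l"

lemma vv_in: "vv n \<in> W"
 unfolding vv_def using rel_basisD(1)[OF basis] l_pos by (intro S_pow_in) simp

lemma vv_shift: "vv (l + n) = S (vv n)"
 using l_pos by (simp add: vv_def)

lemma vv_low: "n < l ==> vv n = v n"
 by (simp add: vv_def)

lemma vv_high: "p * l \<le> n ==> vv n = \<zero>\<^sub>V"
 unfolding vv_def using rel_basisD(1)[OF basis] l_pos
 by (intro S_pow_nil) (simp_all add: less_eq_div_iff_mult_less_eq)

lemma vv_carrier: "\<forall>n. vv n \<in> carrier V"
 using vv_in W_carrier by blast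

lemma ev_in: "f \<in> F ==> ev f \<in> W"
 using eval_seq_in[OF W_sub] vv_in by blast

lemma ev_linear: "linear_on K polys V F ev"
 by (rule eval_seq_linear[OF vv_carrier])

lemma ev_shift: "f \<in> F ==> ev (sh f) = S (ev f)"
 using eval_seq_shift[OF W_sub S_W] vv_in vv_shift by blast

lemma ev_split: "f \<in> F ==> ev f = lc V l f v \<oplus>\<^sub>V S (ev (\<lambda>n. f (n + l)))"
proof -
 assume f: "f \<in> F"
 have "eval_seq K V (\<lambda>i. vv (l + i)) (\<lambda>n. f (n + l)) = S (ev (\<lambda>n. f (n + l)))"
  using eval_seq_image[OF W_sub S_W unshift_closed[OF f]] vv_in by (simp add: vv_shift)
 moreover have "lc V l f vv = lc V l f v" by (rule lc_cong) (simp_all add: vv_low)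
 ultimately show ?thesis using eval_seq_split[OF f vv_carrier, of l] by simp
qed

lemma ev_low_zero:
 assumes f: "f \<in> F" and e: "ev f \<in> S ` W" and i: "i < l"
 shows "f i = \<zero>\<^sub>K"
proof -
 have c: "lc V l f v \<in> W" using polys_nth[OF f] rel_basisD(1)[OF basis] by (intro lc_in[OF W_sub]) simp_all
 have d: "S (ev (\<lambda>n. f (n + l))) \<in> S ` W" using ev_in[OF unshift_closed[OF f]] by blast
 have "lc V l f v = ev f \<ominus>\<^sub>V S (ev (\<lambda>n. f (n + l)))"
  using ev_split[OF f] W_carrier[OF c] sub_carrier[OF SW_sub d] by (simp add: a_minus_def M.a_assoc M.r_neg)
 also have "\<dots> \<in> S ` W" using sub_minus[OF SW_sub e d] .
 finally show ?thesis using rel_indepD[OF rel_basisD(2)[OF basis], of f i] polys_nth[OF f] i by blast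
qed

lemma ev_unshift:
 assumes f: "f \<in> F" and e: "ev f \<in> S ` W"
 shows "sh (\<lambda>n. f (n + l)) = f"
 using ev_low_zero[OF f e] by (rule shift_unshift)

lemma ev_surj: "w \<in> W ==> \<exists>f\<in>F. ev f = w"
proof -
 have step: "\<exists>f\<in>F. \<exists>w'\<in>W. w = ev f \<oplus>\<^bsub>V\<^esub> (S ^^ q) w'" if "w \<in> W" for w q
  using that
 proof (induction q arbitrary: w)
  case 0
  interpret P: vectorspace K polys by (rule polys_vectorspace)
  have "ev \<zero>\<^bsub>polys\<^esub> = \<zero>\<^bsub>V\<^esub>" by (rule P.linear_on_zero[OF P.submodule_carrier vectorspace_axioms ev_linear])
  then show ?case using 0 W_carrier by (intro bexI[of _ "\<zero>\<^bsub>polys\<^esub>"] bexI[of _ w]) simp_all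
 next
  case (Suc q)
  obtain a where a: "\<forall>i<l. a i \<in> carrier K" "w \<ominus>\<^bsub>V\<^esub> lc V l a v \<in> S ` W"
   using rel_basisD(3)[OF basis Suc.prems] by blast
  obtain w1 where w1: "w1 \<in> W" "w \<ominus>\<^bsub>V\<^esub> lc V l a v = S w1" using a(2) by blast
  obtain f1 w2 where f1: "f1 \<in> F" and w2: "w2 \<in> W" and e1: "w1 = ev f1 \<oplus>\<^bsub>V\<^esub> (S ^^ q) w2"
   using Suc.IH[OF w1(1)] by blast
  define f where "f n = (if n < l then a n else f1 (n - l))" for n
  obtain N where N: "\<forall>n\<ge>N. f1 n = \<zero>\<^bsub>K\<^esub>" using polys_bound[OF f1] by blast
  have f: "f \<in> F" by (rule polysI[of _ "N + l"]) (use a(1) N polys_nth[OF f1] in \<open>simp_all add: f_def\<close>)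
  have "lc V l f v = lc V l a v" by (rule lc_cong) (simp_all add: f_def)
  moreover have "(\<lambda>n. f (n + l)) = f1" by (simp add: f_def)
  ultimately have ef: "ev f = lc V l a v \<oplus>\<^bsub>V\<^esub> S (ev f1)" using ev_split[OF f] by simp
  have c: "lc V l a v \<in> carrier V" using a(1) rel_basisD(1)[OF basis] by (intro W_carrier lc_in[OF W_sub]) simp_all
  have cw: "w \<in> carrier V" using W_carrier[OF Suc.prems] .
  have c1: "S (ev f1) \<in> carrier V" using W_carrier S_in ev_in[OF f1] by blast
  have c2: "(S ^^ Suc q) w2 \<in> carrier V" using W_carrier S_pow_in[OF w2] by blast
  have "S w1 = S (ev f1) \<oplus>\<^bsub>V\<^esub> (S ^^ Suc q) w2"
   using e1 linear_onD(2)[OF S_W ev_in[OF f1] S_pow_in[OF w2, of q]] by simp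
  then have "w \<ominus>\<^bsub>V\<^esub> lc V l a v = S (ev f1) \<oplus>\<^bsub>V\<^esub> (S ^^ Suc q) w2" using w1(2) by simp
  moreover have "w = (w \<ominus>\<^bsub>V\<^esub> lc V l a v) \<oplus>\<^bsub>V\<^esub> lc V l a v"
   using c cw by (simp add: a_minus_def M.a_assoc M.l_neg)
  ultimately have "w = (S (ev f1) \<oplus>\<^bsub>V\<^esub> (S ^^ Suc q) w2) \<oplus>\<^bsub>V\<^esub> lc V l a v" by simp
  also have "\<dots> = ev f \<oplus>\<^bsub>V\<^esub> (S ^^ Suc q) w2" unfolding ef using c c1 c2 by (simp only: M.a_ac M.a_closed)
  finally show ?case using f w2 by blast
 qed
 assume w: "w \<in> W"
 from step[OF w, of p] obtain f w' where "f \<in> F" "w' \<in> W" "w = ev f \<oplus>\<^bsub>V\<^esub> (S ^^ p) w'" by blast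
 then have "ev f = w" using nil[of w'] W_carrier[OF ev_in[of f]] by simp
 with \<open>f \<in> F\<close> show ?thesis by blast
qed

text \<open>A lift to \<open>K[t]\<close> of \<open>T v\<^sub>j\<close>; the degrees of these lifts are bounded by \<open>DD\<close>.\<close>

definition gg where "gg j = (SOME f. f \<in> F \<and> ev f = T (v j))"

lemma gg: "j < l ==> gg j \<in> F" "j < l ==> ev (gg j) = T (v j)"
proof -
 assume "j < l"
 then have "T (v j) \<in> W" using T_in rel_basisD(1)[OF basis] by blast
 then have "\<exists>f. f \<in> F \<and> ev f = T (v j)" using ev_surj by blast
 then have "gg j \<in> F \<and> ev (gg j) = T (v j)" unfolding gg_def by (rule someI_ex)
 then show "gg j \<in> F" "ev (gg j) = T (v j)" by simp_all
qed

definition DD where "DD = (SOME D. \<forall>j<l. \<forall>n\<ge>D. gg j n = \<zero>\<^sub>K)"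

lemma DD: "j < l ==> DD \<le> n ==> gg j n = \<zero>\<^sub>K"
proof -
 have "\<exists>D. \<forall>j<m. \<forall>n\<ge>D. gg j n = \<zero>\<^sub>K" if "m \<le> l" for m
  using that
 proof (induction m)
  case (Suc m)
  then obtain D where D: "\<forall>j<m. \<forall>n\<ge>D. gg j n = \<zero>\<^sub>K" by auto
  obtain N where N: "\<forall>n\<ge>N. gg m n = \<zero>\<^sub>K" using polys_bound[OF gg(1)[of m]] Suc.prems by auto
  have "\<forall>j<Suc m. \<forall>n\<ge>max D N. gg j n = \<zero>\<^sub>K" using D N by (simp add: less_Suc_eq)
  then show ?case by blast
 qed simp
 from this[of l] have "\<exists>D. \<forall>j<l. \<forall>n\<ge>D. gg j n = \<zero>\<^sub>K" by simp
 then have "\<forall>j<l. \<forall>n\<ge>DD. gg j n = \<zero>\<^sub>K" unfolding DD_def by (rule someI_ex)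
 then show "j < l ==> DD \<le> n ==> gg j n = \<zero>\<^sub>K" by blast
qed

text \<open>Large enough for \<open>t\<^sup>M\<close> to kill \<open>W\<close> and to dominate the lifts of \<open>T v\<^sub>j\<close>, and congruent to 1 modulo \<open>l\<close>, so that the
\<open>r\<close>-th power of an operator that raises degrees by \<open>M\<close> reaches the residue class \<open>r\<close>.\<close>

definition MM where "MM = l * (p + DD) + 1"

lemma MM_ge: "p * l \<le> MM" "DD \<le> MM"
proof -
 show "p * l \<le> MM" by (simp add: MM_def algebra_simps)
 have "1 * DD \<le> l * DD" using l_pos by (intro mult_le_mono1) simp
 then show "DD \<le> MM" unfolding MM_def add_mult_distrib2 by linarith
qed

lemma MM_mod: "(r * MM) mod l = r mod l"
proof -
 have "r * MM = r + l * (r * (p + DD))" by (simp add: MM_def algebra_simps)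
 then show ?thesis by simp
qed

definition mono :: "nat \<Rightarrow> nat \<Rightarrow> 'a" where "mono k n = (if n = k then \<one>\<^sub>K else \<zero>\<^sub>K)"

lemma mono_closed: "mono k \<in> F"
 by (rule polysI[of _ "Suc k"]) (auto simp: mono_def)

lemma ev_mono: "ev (mono k) = vv k"
proof -
 have "ev (mono k) = lc V (Suc k) (mono k) vv"
  by (rule eval_seq_eq[OF mono_closed _ vv_carrier]) (simp add: mono_def)
 also have "\<dots> = \<one>\<^sub>K \<odot>\<^sub>V vv k"
  using lc_delta[of k "Suc k" "\<one>\<^sub>K" vv] vv_carrier by (simp add: mono_def[abs_def] del: lc.simps)
 finally show ?thesis using vv_carrier by simp
qed

text \<open>The image of \<open>t\<^sup>n\<close> under the lift of \<open>T\<close>: the obvious lift plus \<open>t\<^sup>n\<^sup>+\<^sup>M\<close>, which makes the leading term visible.\<close>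

definition hh where "hh n = (sh ^^ (n div l)) (gg (n mod l) \<oplus>\<^bsub>polys\<^esub> mono (n mod l + MM))"

lemma sh_pow_closed: "f \<in> F ==> (sh ^^ k) f \<in> F"
 by (induction k) (auto intro: shift_closed)

lemma hh_closed: "hh n \<in> F"
proof -
 interpret P: vectorspace K polys by (rule polys_vectorspace)
 show ?thesis unfolding hh_def using gg(1)[of "n mod l"] l_pos mono_closed by (intro sh_pow_closed P.M.a_closed) simp_all
qed

lemma hh_shift: "hh (l + n) = sh (hh n)"
 using l_pos by (simp add: hh_def)

lemma hh_lead: "hh n (n + MM) = \<one>\<^sub>K" "n + MM < k ==> hh n k = \<zero>\<^sub>K"
proof -
 have "hh n (n + MM) = \<one>\<^sub>K \<and> (\<forall>k>n+MM. hh n k = \<zero>\<^sub>K)"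
 proof (induction n rule: less_induct)
  case (less n)
  show ?case
  proof (cases "n < l")
   case True
   have "gg n k = \<zero>\<^sub>K" if "n + MM \<le> k" for k using DD[OF True, of k] that MM_ge(2) by simp
   then show ?thesis using True by (simp add: hh_def finseq_space_simps(3) mono_def)
  next
   case False
   then have n: "n = l + (n - l)" by simp
   have h: "hh n = sh (hh (n - l))" using hh_shift[of "n - l"] n by simp
   have "n - l < n" using False l_pos by simp
   note IH = less.IH[OF this]
   have "n + MM - l = n - l + MM" using False by simp
   then have "hh n (n + MM) = \<one>\<^sub>K" using IH False by (simp add: h shift_def)
   moreover have "hh n k = \<zero>\<^sub>K" if "k > n + MM" for k
   proof -
    have "k - l > n - l + MM" using that False by simp
    then show ?thesis using IH by (simp add: h shift_def)
   qed
   ultimately show ?thesis by blast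
  qed
 qed
 then show "hh n (n + MM) = \<one>\<^sub>K" "n + MM < k ==> hh n k = \<zero>\<^sub>K" by blast+
qed

lemma ev_hh: "ev (hh n) = T (vv n)"
proof (induction n rule: less_induct)
 case (less n)
 show ?case
 proof (cases "n < l")
  case True
  have "ev (gg n \<oplus>\<^bsub>polys\<^esub> mono (n + MM)) = ev (gg n) \<oplus>\<^sub>V ev (mono (n + MM))"
   using linear_onD(2)[OF ev_linear gg(1)[OF True] mono_closed] .
  also have "ev (mono (n + MM)) = \<zero>\<^sub>V" using MM_ge(1) by (simp add: ev_mono vv_high)
  also have "ev (gg n) \<oplus>\<^sub>V \<zero>\<^sub>V = T (v n)"
   using gg(2)[OF True] W_carrier[OF ev_in[OF gg(1)[OF True]]] by simp
  finally show ?thesis using True by (simp add: hh_def vv_low)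
 next
  case False
  then have n: "n = l + (n - l)" by simp
  have "ev (hh n) = S (ev (hh (n - l)))" using ev_shift[OF hh_closed, of "n - l"] hh_shift[of "n - l"] n by simp
  also have "\<dots> = T (S (vv (n - l)))"
   using less.IH[of "n - l"] False l_pos vv_carrier ST_commute by simp
  also have "S (vv (n - l)) = vv n" using vv_shift[of "n - l"] n by simp
  finally show ?thesis .
 qed
qed

definition TT where "TT = eval_seq K polys hh"

lemma hh_closed': "\<forall>n. hh n \<in> F" using hh_closed by blast

lemma TT_linear: "linear_on K polys polys F TT"
 unfolding TT_def by (rule vectorspace.eval_seq_linear[OF polys_vectorspace hh_closed'])

lemma TT_closed: "f \<in> F ==> TT f \<in> F"
 using linear_onD(1)[OF TT_linear] .

lemma F_sub: "submodule K F polys"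
 by (rule vectorspace.submodule_carrier[OF polys_vectorspace])

lemma TT_shift: "f \<in> F ==> TT (sh f) = sh (TT f)"
 unfolding TT_def
 using vectorspace.eval_seq_shift[OF polys_vectorspace F_sub shift_linear _ hh_closed'] hh_shift by blast

lemma ev_TT:
 assumes f: "f \<in> F"
 shows "ev (TT f) = T (ev f)"
proof -
 obtain N where N: "\<forall>n\<ge>N. f n = \<zero>\<^sub>K" using polys_bound[OF f] by blast
 have "TT f = lc polys N f hh"
  unfolding TT_def by (rule vectorspace.eval_seq_eq[OF polys_vectorspace f N hh_closed'])
 then have "ev (TT f) = lc V N f (\<lambda>i. ev (hh i))"
  using vectorspace.lc_linear[OF polys_vectorspace F_sub vectorspace_axioms ev_linear, of N f hh] polys_nth[OF f] hh_closed
  by simp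
 also have "\<dots> = lc V N f (\<lambda>i. T (vv i))" by (simp only: ev_hh)
 also have "\<dots> = T (lc V N f vv)"
  using lc_linear[OF W_sub vectorspace_axioms T_W, of N f vv] polys_nth[OF f] vv_in by simp
 also have "lc V N f vv = ev f" by (rule eval_seq_eq[OF f N vv_carrier, symmetric])
 finally show ?thesis .
qed

lemma leads_TT:
 assumes f: "f \<in> F" and d: "leads K f d"
 shows "leads K (TT f) (d + MM)"
proof -
 interpret C: vectorspace K scalars by (rule scalars_vectorspace)
 have N: "\<forall>n\<ge>Suc d. f n = \<zero>\<^bsub>K\<^esub>" using d by (simp add: leads_def)
 have e: "TT f = lc polys (Suc d) f hh"
  unfolding TT_def by (rule vectorspace.eval_seq_eq[OF polys_vectorspace f N hh_closed'])
 have val: "TT f k = f d \<otimes>\<^bsub>K\<^esub> hh d k" if k: "d + MM \<le> k" for k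
 proof -
  have "lc scalars d f (\<lambda>i. hh i k) = \<zero>\<^bsub>scalars\<^esub>"
   using hh_lead(2) k polys_nth[OF f] by (intro C.lc_vec_zero) simp_all
  then have "lc scalars (Suc d) f (\<lambda>i. hh i k) = f d \<otimes>\<^bsub>K\<^esub> hh d k"
   using polys_nth[OF f, of d] polys_nth[OF hh_closed, of d k] by simp
  then show ?thesis by (simp only: e lc_polys_nth)
 qed
 show ?thesis
  unfolding leads_def using val hh_lead(1)[of d] hh_lead(2)[of d] d polys_nth[OF f, of d]
  by (simp add: leads_def)
qed

text \<open>Endomorphisms of \<open>K[t]\<close> that commute with the lifts of \<open>S\<close> and \<open>T\<close> and preserve the kernel of \<open>K[t] \<rightarrow> W\<close>, hence
induce centralizer elements of \<open>W\<close>.\<close>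

definition BB where
 "BB = {b. linear_on K polys polys F b \<and> (\<forall>f\<in>F. b (sh f) = sh (b f)) \<and> (\<forall>f\<in>F. b (TT f) = TT (b f)) \<and>
      (\<forall>f\<in>F. ev f = \<zero>\<^sub>V \<longrightarrow> ev (b f) = \<zero>\<^sub>V)}"

lemma BB_D:
 assumes "b \<in> BB"
 shows "linear_on K polys polys F b" "f \<in> F ==> b f \<in> F" "f \<in> F ==> b (sh f) = sh (b f)"
  "f \<in> F ==> b (TT f) = TT (b f)" "f \<in> F ==> ev f = \<zero>\<^sub>V ==> ev (b f) = \<zero>\<^sub>V"
 using assms linear_onD(1)[of K polys polys F b f] by (auto simp: BB_def)

lemma T_zero: "T \<zero>\<^sub>V = \<zero>\<^sub>V"
 using linear_on_zero[OF W_sub vectorspace_axioms T_W] .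

lemma TT_pow_BB: "(TT ^^ r) \<in> BB"
proof (induction r)
 case 0
 show ?case by (simp add: BB_def linear_on_def)
next
 case (Suc r)
 note B = BB_D[OF Suc.IH]
 have "linear_on K polys polys F (TT ^^ Suc r)"
  using linear_onD(2,3)[OF B(1)] B(2) linear_onD[OF TT_linear] by (intro linear_onI) simp_all
 moreover have "ev ((TT ^^ Suc r) f) = \<zero>\<^sub>V" if "f \<in> F" "ev f = \<zero>\<^sub>V" for f
  using B(5)[OF that] ev_TT[OF B(2)[OF that(1)]] T_zero by simp
 ultimately show ?case unfolding BB_def using B(2,3,4) TT_shift by (simp add: o_def)
qed

lemma leads_TT_pow: "leads K ((TT ^^ r) (mono 0)) (r * MM)"
proof (induction r)
 case 0
 then show ?case by (simp add: leads_def mono_def)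
next
 case (Suc r)
 show ?case using leads_TT[OF BB_D(2)[OF TT_pow_BB mono_closed] Suc.IH] by (simp add: add.commute)
qed

text \<open>For each residue class \<open>r\<close> modulo \<open>l\<close>, the least degree of some \<open>b(1)\<close> with \<open>b \<in> BB\<close> in that class, and a \<open>b\<close> attaining it.\<close>

definition dd where "dd r = (LEAST d. d mod l = r \<and> (\<exists>b\<in>BB. leads K (b (mono 0)) d))"
definition bb where "bb r = (SOME b. b \<in> BB \<and> leads K (b (mono 0)) (dd r))"

lemma dd_bb:
 assumes r: "r < l"
 shows "dd r mod l = r" "bb r \<in> BB" "leads K (bb r (mono 0)) (dd r)"
  and dd_le: "b \<in> BB ==> leads K (b (mono 0)) d ==> d mod l = r ==> dd r \<le> d"
proof -
 have "(r * MM) mod l = r \<and> (\<exists>b\<in>BB. leads K (b (mono 0)) (r * MM))"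
  using MM_mod[of r] r TT_pow_BB leads_TT_pow by (intro conjI bexI[of _ "TT ^^ r"]) simp_all
 then have 1: "dd r mod l = r \<and> (\<exists>b\<in>BB. leads K (b (mono 0)) (dd r))" unfolding dd_def by (rule LeastI)
 then show "dd r mod l = r" by simp
 from 1 have "\<exists>b. b \<in> BB \<and> leads K (b (mono 0)) (dd r)" by blast
 then have "bb r \<in> BB \<and> leads K (bb r (mono 0)) (dd r)" unfolding bb_def by (rule someI_ex)
 then show "bb r \<in> BB" "leads K (bb r (mono 0)) (dd r)" by simp_all
 show "dd r \<le> d" if "b \<in> BB" "leads K (b (mono 0)) d" "d mod l = r"
  unfolding dd_def using that by (intro Least_le) blast
qed

text \<open>A section of \<open>K[t] \<rightarrow> W\<close>, and the endomorphism of \<open>W\<close> induced by \<open>b\<close>.\<close>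

definition sec where "sec w = (SOME f. f \<in> F \<and> ev f = w)"
definition ph where "ph b w = ev (b (sec w))"

lemma sec: "w \<in> W ==> sec w \<in> F" "w \<in> W ==> ev (sec w) = w"
proof -
 assume "w \<in> W"
 then have "\<exists>f. f \<in> F \<and> ev f = w" using ev_surj by blast
 then have "sec w \<in> F \<and> ev (sec w) = w" unfolding sec_def by (rule someI_ex)
 then show "sec w \<in> F" "ev (sec w) = w" by simp_all
qed

lemma linear_minus:
 assumes f: "linear_on K polys V F f" and x: "x \<in> F" "y \<in> F"
 shows "f (x \<oplus>\<^bsub>polys\<^esub> (\<ominus>\<^bsub>K\<^esub> \<one>\<^bsub>K\<^esub>) \<odot>\<^bsub>polys\<^esub> y) = f x \<ominus>\<^bsub>V\<^esub> f y"
proof -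
 interpret P: vectorspace K polys by (rule polys_vectorspace)
 have "f (x \<oplus>\<^bsub>polys\<^esub> (\<ominus>\<^bsub>K\<^esub> \<one>\<^bsub>K\<^esub>) \<odot>\<^bsub>polys\<^esub> y) = f x \<oplus>\<^bsub>V\<^esub> (\<ominus>\<^bsub>K\<^esub> \<one>\<^bsub>K\<^esub>) \<odot>\<^bsub>V\<^esub> f y"
  using linear_onD(2)[OF f x(1) P.smult_closed[OF _ x(2), of "\<ominus>\<^bsub>K\<^esub> \<one>\<^bsub>K\<^esub>"]] linear_onD(3)[OF f _ x(2), of "\<ominus>\<^bsub>K\<^esub> \<one>\<^bsub>K\<^esub>"] by simp
 then show ?thesis using linear_onD(1)[OF f x(2)] by (simp add: a_minus_def smult_l_minus)
qed

lemma ev_BB_linear: "b \<in> BB ==> linear_on K polys V F (\<lambda>f. ev (b f))"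
 using linear_onD[OF ev_linear] BB_D(2) linear_onD(2,3)[OF BB_D(1)] by (intro linear_onI) simp_all

lemma ph_ev:
 assumes b: "b \<in> BB" and f: "f \<in> F"
 shows "ph b (ev f) = ev (b f)"
proof -
 interpret P: vectorspace K polys by (rule polys_vectorspace)
 have w: "ev f \<in> W" using ev_in[OF f] .
 let ?g = "sec (ev f) \<oplus>\<^bsub>polys\<^esub> (\<ominus>\<^bsub>K\<^esub> \<one>\<^bsub>K\<^esub>) \<odot>\<^bsub>polys\<^esub> f"
 have g: "?g \<in> F" using sec(1)[OF w] f by simp
 have "ev ?g = \<zero>\<^bsub>V\<^esub>" using linear_minus[OF ev_linear sec(1)[OF w] f] sec(2)[OF w] W_carrier[OF w]
  by (simp add: a_minus_def M.r_neg)
 then have "\<zero>\<^bsub>V\<^esub> = ev (b ?g)" using BB_D(5)[OF b g] by simp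
 also have "\<dots> = ev (b (sec (ev f))) \<ominus>\<^bsub>V\<^esub> ev (b f)"
  using linear_minus[OF ev_BB_linear[OF b] sec(1)[OF w] f] .
 finally show ?thesis
  using W_carrier[OF ev_in[OF BB_D(2)[OF b sec(1)[OF w]]]] W_carrier[OF ev_in[OF BB_D(2)[OF b f]]]
  by (simp add: ph_def a_minus_def) (metis M.minus_equality M.minus_minus M.a_inv_closed M.a_comm)
qed

lemma ph_comm_end:
 assumes b: "b \<in> BB"
 shows "comm_end K V S T W (ph b)"
proof -
 interpret P: vectorspace K polys by (rule polys_vectorspace)
 have ev': "\<exists>f\<in>F. w = ev f" if "w \<in> W" for w using ev_surj[OF that] by blast
 note lin = linear_onD[OF ev_linear] and blin = linear_onD[OF ev_BB_linear[OF b]]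
 have "linear_on K V V W (ph b)"
 proof (rule linear_onI)
  show "ph b w \<in> carrier V" if "w \<in> W" for w
   using ev'[OF that] ph_ev[OF b] blin(1) by auto
  show "ph b (w \<oplus>\<^bsub>V\<^esub> w') = ph b w \<oplus>\<^bsub>V\<^esub> ph b w'" if w: "w \<in> W" "w' \<in> W" for w w'
  proof -
   obtain f f' where f: "f \<in> F" "w = ev f" "f' \<in> F" "w' = ev f'" using ev'[OF w(1)] ev'[OF w(2)] by blast
   have "w \<oplus>\<^bsub>V\<^esub> w' = ev (f \<oplus>\<^bsub>polys\<^esub> f')" using lin(2) f by simp
   then show ?thesis using ph_ev[OF b] blin(2) f by simp
  qed
  show "ph b (c \<odot>\<^bsub>V\<^esub> w) = c \<odot>\<^bsub>V\<^esub> ph b w" if c: "c \<in> carrier K" and w: "w \<in> W" for c w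
  proof -
   obtain f where f: "f \<in> F" "w = ev f" using ev'[OF w] by blast
   have "c \<odot>\<^bsub>V\<^esub> w = ev (c \<odot>\<^bsub>polys\<^esub> f)" using lin(3) f c by simp
   then show ?thesis using ph_ev[OF b] blin(3) f c by simp
  qed
 qed
 moreover have "ph b w \<in> W \<and> ph b (S w) = S (ph b w) \<and> ph b (T w) = T (ph b w)" if w: "w \<in> W" for w
 proof -
  obtain f where f: "f \<in> F" "w = ev f" using ev'[OF w] by blast
  have 1: "ph b w = ev (b f)" "ph b w \<in> W" using f ph_ev[OF b f(1)] ev_in[OF BB_D(2)[OF b f(1)]] by simp_all
  have "ph b (S w) = ev (b (sh f))" using f ev_shift[OF f(1)] ph_ev[OF b shift_closed[OF f(1), of l]] by simp
  then have 2: "ph b (S w) = S (ph b w)" using BB_D(3)[OF b f(1)] ev_shift[OF BB_D(2)[OF b f(1)]] 1 by simp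
  have "ph b (T w) = ev (b (TT f))" using f ev_TT[OF f(1)] ph_ev[OF b TT_closed[OF f(1)]] by simp
  then have "ph b (T w) = T (ph b w)" using BB_D(4)[OF b f(1)] ev_TT[OF BB_D(2)[OF b f(1)]] 1 by simp
  with 1 2 show ?thesis by simp
 qed
 ultimately show ?thesis unfolding comm_end_def by blast
qed

lemma sh_inj:
 assumes "sh f = sh g"
 shows "f = g"
proof -
 have "(\<lambda>n. sh f (n + l)) = (\<lambda>n. sh g (n + l))" by (simp only: assms)
 then show ?thesis by (simp only: unshift_shift)
qed

text \<open>Division by \<open>t\<^sup>l\<close> inside \<open>BB\<close>; the two hypotheses say what \<open>b\<close> has to do on \<open>W\<close> for the quotient to preserve the kernel of \<open>K[t] \<rightarrow> W\<close>.\<close>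

lemma BB_divide:
 assumes b: "b \<in> BB" and 1: "\<And>w. w \<in> W ==> ph b w \<in> S ` W" and 2: "\<And>w. w \<in> W ==> S w = \<zero>\<^sub>V ==> ph b w = \<zero>\<^sub>V"
 shows "(\<lambda>f n. b f (n + l)) \<in> BB" (is "?b \<in> BB") and "f \<in> F ==> sh (\<lambda>n. b f (n + l)) = b f"
proof -
 show sb: "sh (?b f) = b f" if f: "f \<in> F" for f
  using ev_unshift[OF BB_D(2)[OF b f]] 1[OF ev_in[OF f]] ph_ev[OF b f] by simp
 have lin: "linear_on K polys polys F ?b"
 proof (rule linear_onI)
  show "?b f \<in> F" if "f \<in> F" for f using unshift_closed[OF BB_D(2)[OF b that]] .
  show "?b (f \<oplus>\<^bsub>polys\<^esub> g) = ?b f \<oplus>\<^bsub>polys\<^esub> ?b g" if "f \<in> F" "g \<in> F" for f g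
   unfolding linear_onD(2)[OF BB_D(1)[OF b] that] by (simp only: finseq_space_simps(3))
  show "?b (c \<odot>\<^bsub>polys\<^esub> f) = c \<odot>\<^bsub>polys\<^esub> ?b f" if "c \<in> carrier K" "f \<in> F" for c f
   unfolding linear_onD(3)[OF BB_D(1)[OF b] that] by (simp only: finseq_space_simps(4))
 qed
 have cl: "?b f \<in> F" if "f \<in> F" for f using linear_onD(1)[OF lin that] .
 have shb: "?b (sh f) = sh (?b f)" if f: "f \<in> F" for f
  unfolding BB_D(3)[OF b f] unshift_shift sb[OF f] ..
 have TTb: "?b (TT f) = TT (?b f)" if f: "f \<in> F" for f
 proof (rule sh_inj)
  have "sh (?b (TT f)) = TT (b f)" using sb[OF TT_closed[OF f]] BB_D(4)[OF b f] by simp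
  also have "\<dots> = sh (TT (?b f))" using TT_shift[OF cl[OF f]] sb[OF f] by simp
  finally show "sh (?b (TT f)) = sh (TT (?b f))" .
 qed
 have ker: "ev (?b f) = \<zero>\<^sub>V" if f: "f \<in> F" "ev f = \<zero>\<^sub>V" for f
 proof -
  have "ev f \<in> S ` W" unfolding f(2) by (rule submodule.zero_closed[OF SW_sub])
  then have fs: "sh (\<lambda>n. f (n + l)) = f" (is "sh ?g = f") by (rule ev_unshift[OF f(1)])
  have g: "?g \<in> F" by (rule unshift_closed[OF f(1)])
  have "S (ev ?g) = \<zero>\<^sub>V" using ev_shift[OF g] fs f(2) by simp
  from 2[OF ev_in[OF g] this] have "ev (b ?g) = \<zero>\<^sub>V" using ph_ev[OF b g] by simp
  moreover have "?b f = b ?g" using shb[OF g] sb[OF g] by (simp only: fs)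
  ultimately show ?thesis by simp
 qed
 show "?b \<in> BB" unfolding BB_def
  by (intro CollectI conjI ballI impI; (rule lin | rule shb | rule TTb | rule ker); assumption?)
qed

lemma lc_BB:
 assumes c: "\<forall>r<m. c r \<in> carrier K" and b: "\<forall>r<m. b r \<in> BB"
 shows "(\<lambda>f. lc polys m c (\<lambda>r. b r f)) \<in> BB" and "f \<in> F ==> ev (lc polys m c (\<lambda>r. b r f)) = lc V m c (\<lambda>r. ev (b r f))"
proof -
 interpret P: vectorspace K polys by (rule polys_vectorspace)
 let ?b = "\<lambda>f. lc polys m c (\<lambda>r. b r f)"
 have cl: "\<forall>r<m. b r f \<in> F" if "f \<in> F" for f using b BB_D(2)[OF _ that] by blast
 show ev: "ev (?b f) = lc V m c (\<lambda>r. ev (b r f))" if f: "f \<in> F" for f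
  using P.lc_linear[OF F_sub vectorspace_axioms ev_linear c cl[OF f]] .
 have "linear_on K polys polys F ?b"
 proof (rule linear_onI)
  show "?b f \<in> F" if "f \<in> F" for f using P.lc_closed[OF c cl[OF that]] .
  show "?b (f \<oplus>\<^bsub>polys\<^esub> g) = ?b f \<oplus>\<^bsub>polys\<^esub> ?b g" if f: "f \<in> F" "g \<in> F" for f g
  proof -
   have "?b (f \<oplus>\<^bsub>polys\<^esub> g) = lc polys m c (\<lambda>r. b r f \<oplus>\<^bsub>polys\<^esub> b r g)"
    using b linear_onD(2)[OF BB_D(1)] f by (intro lc_cong) simp_all
   then show ?thesis using P.lc_vec_add[OF c cl[OF f(1)] cl[OF f(2)]] by simp
  qed
  show "?b (a \<odot>\<^bsub>polys\<^esub> f) = a \<odot>\<^bsub>polys\<^esub> ?b f" if a: "a \<in> carrier K" and f: "f \<in> F" for a f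
  proof -
   have "?b (a \<odot>\<^bsub>polys\<^esub> f) = lc polys m c (\<lambda>r. a \<odot>\<^bsub>polys\<^esub> b r f)"
    using b linear_onD(3)[OF BB_D(1)] f a by (intro lc_cong) simp_all
   moreover have "linear_on K polys polys F (\<lambda>g. a \<odot>\<^bsub>polys\<^esub> g)"
    using a by (intro linear_onI) (simp_all add: P.smult_r_distr P.smult_assoc1[symmetric] R.m_comm)
   ultimately show ?thesis using P.lc_linear[OF F_sub polys_vectorspace _ c cl[OF f]] by simp
  qed
 qed
 moreover have "?b (sh f) = sh (?b f)" if f: "f \<in> F" for f
 proof -
  have "?b (sh f) = lc polys m c (\<lambda>r. sh (b r f))" using b BB_D(3)[OF _ f] by (intro lc_cong) simp_all
  then show ?thesis using P.lc_linear[OF F_sub polys_vectorspace shift_linear c cl[OF f]] by simp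
 qed
 moreover have "?b (TT f) = TT (?b f)" if f: "f \<in> F" for f
 proof -
  have "?b (TT f) = lc polys m c (\<lambda>r. TT (b r f))" using b BB_D(4)[OF _ f] by (intro lc_cong) simp_all
  then show ?thesis using P.lc_linear[OF F_sub polys_vectorspace TT_linear c cl[OF f]] by simp
 qed
 moreover have "ev (?b f) = \<zero>\<^bsub>V\<^esub>" if f: "f \<in> F" "ev f = \<zero>\<^bsub>V\<^esub>" for f
  unfolding ev[OF f(1)] using c b BB_D(5)[OF _ f] by (intro lc_vec_zero) simp_all
 ultimately show "?b \<in> BB" unfolding BB_def by blast
qed

text \<open>A nontrivial combination \<open>b\<close> of the chosen \<open>bb r\<close> that maps \<open>W\<close> into \<open>S W\<close> and kills the kernel of \<open>S\<close> would be divisible by \<open>t\<^sup>l\<close> within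
\<open>BB\<close>. The degrees of the \<open>bb r (1)\<close> lie in different residue classes, so they do not cancel, and the quotient would have an
image of 1 of smaller degree in the same class, against the choice of \<open>dd\<close>.\<close>

lemma new_endomorphisms:
 assumes c: "\<forall>r<l. c r \<in> carrier K"
  and 1: "\<And>w. w \<in> W ==> lc V l c (\<lambda>r. ph (bb r) w) \<in> S ` W"
  and 2: "\<And>w. w \<in> W ==> S w = \<zero>\<^bsub>V\<^esub> ==> lc V l c (\<lambda>r. ph (bb r) w) = \<zero>\<^bsub>V\<^esub>"
  and r: "r < l"
 shows "c r = \<zero>\<^bsub>K\<^esub>"
proof (rule ccontr)
 assume r0: "c r \<noteq> \<zero>\<^bsub>K\<^esub>"
 interpret C: vectorspace K scalars by (rule scalars_vectorspace)
 have bbB: "\<forall>r<l. bb r \<in> BB" using dd_bb(2) by blast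
 define b where "b = (\<lambda>f. lc polys l c (\<lambda>r. bb r f))"
 have b: "b \<in> BB" unfolding b_def by (rule lc_BB(1)[OF c bbB])
 have phb: "ph b w = lc V l c (\<lambda>r. ph (bb r) w)" if "w \<in> W" for w
  unfolding ph_def b_def by (rule lc_BB(2)[OF c bbB sec(1)[OF that]])
 define A where "A = {i. i < l \<and> c i \<noteq> \<zero>\<^bsub>K\<^esub>}"
 have A: "finite A" "A \<noteq> {}" using r r0 by (auto simp: A_def)
 have "Max (dd ` A) \<in> dd ` A" using A by (intro Max_in) simp_all
 then obtain s where s1: "s \<in> A" "dd s = Max (dd ` A)" by auto
 have s: "s \<in> A" "\<And>i. i \<in> A ==> dd i \<le> dd s"
  using s1 A(1) by simp_all
 have sl: "s < l" "c s \<noteq> \<zero>\<^bsub>K\<^esub>" "c s \<in> carrier K" using s(1) c by (auto simp: A_def)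
 have val: "b (mono 0) k = c s \<otimes>\<^bsub>K\<^esub> bb s (mono 0) k" if k: "dd s \<le> k" for k
 proof -
  have "c i \<odot>\<^bsub>scalars\<^esub> bb i (mono 0) k = \<zero>\<^bsub>scalars\<^esub>" if i: "i < l" "i \<noteq> s" for i
  proof (cases "c i = \<zero>\<^bsub>K\<^esub>")
   case True
   then show ?thesis using polys_nth[OF BB_D(2)[OF dd_bb(2)[OF i(1)] mono_closed]] by simp
  next
   case False
   then have "dd i \<le> dd s" using s(2) i by (simp add: A_def)
   moreover have "dd i \<noteq> dd s" using dd_bb(1)[OF i(1)] dd_bb(1)[OF sl(1)] i(2) by metis
   ultimately have "bb i (mono 0) k = \<zero>\<^bsub>K\<^esub>" using dd_bb(3)[OF i(1)] k by (simp add: leads_def)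
   then show ?thesis using c i by simp
  qed
  then have "lc scalars l c (\<lambda>i. bb i (mono 0) k) = c s \<odot>\<^bsub>scalars\<^esub> bb s (mono 0) k"
   using sl polys_nth[OF BB_D(2)[OF dd_bb(2)[OF sl(1)] mono_closed]] by (intro C.lc_single) simp_all
  then show ?thesis by (simp only: b_def lc_polys_nth scalars_simps)
 qed
 have ld: "leads K (bb s (mono 0)) (dd s)" by (rule dd_bb(3)[OF sl(1)])
 have lead: "leads K (b (mono 0)) (dd s)"
  unfolding leads_def
 proof (intro conjI allI impI)
  have "bb s (mono 0) (dd s) \<in> carrier K" by (rule polys_nth[OF BB_D(2)[OF dd_bb(2)[OF sl(1)] mono_closed]])
  then show "b (mono 0) (dd s) \<noteq> \<zero>\<^bsub>K\<^esub>"
   using val[of "dd s"] ld sl(2,3) field.integral_iff by (simp add: leads_def)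
  show "b (mono 0) k = \<zero>\<^bsub>K\<^esub>" if "dd s < k" for k
   using val[of k] ld sl(3) that by (simp add: leads_def)
 qed
 define b' where "b' = (\<lambda>f n. b f (n + l))"
 have b': "b' \<in> BB" "sh (b' (mono 0)) = b (mono 0)"
  unfolding b'_def using BB_divide[OF b] 1 2 phb mono_closed by simp_all
 have dl: "l \<le> dd s"
 proof (rule ccontr)
  assume "\<not> l \<le> dd s"
  then have "b (mono 0) (dd s) = \<zero>\<^bsub>K\<^esub>" unfolding b'(2)[symmetric] by (simp add: shift_def)
  then show False using lead by (simp add: leads_def)
 qed
 have "leads K (b' (mono 0)) (dd s - l)"
  unfolding leads_def
 proof (intro conjI allI impI)
  show "b' (mono 0) (dd s - l) \<noteq> \<zero>\<^bsub>K\<^esub>" using lead dl by (simp add: b'_def leads_def)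
  show "b' (mono 0) k = \<zero>\<^bsub>K\<^esub>" if "k > dd s - l" for k
   using lead that dl by (simp add: b'_def leads_def)
 qed
 moreover have "(dd s - l) mod l = s" using dd_bb(1)[OF sl(1)] le_mod_geq[OF dl] by simp
 ultimately have "dd s \<le> dd s - l" using dd_le[OF sl(1) b'(1)] by blast
 then show False using dl l_pos by simp
qed

end

section \<open>The algebra generated by two commuting operators\<close>

context vectorspace
begin

lemma functional_nonzero:
 assumes W': "submodule K W' V" and W: "submodule K W V" and s: "W' \<subseteq> W"
  and b: "rel_basis K V W W' n v" and e: "e \<in> W" "e \<notin> W'"
 obtains f where "linear_on K V scalars W f" "\<And>w. w \<in> W' ==> f w = \<zero>\<^bsub>K\<^esub>" "f e = \<one>\<^bsub>K\<^esub>"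
proof -
 interpret C: vectorspace K scalars by (rule scalars_vectorspace)
 obtain a where a: "\<forall>i<n. a i \<in> carrier K" "e \<ominus>\<^bsub>V\<^esub> lc V n a v \<in> W'" using rel_basisD(3)[OF b e(1)] by blast
 have vW: "\<forall>i<n. v i \<in> W" using rel_basisD(1)[OF b] by blast
 have lW: "lc V n a v \<in> W" by (rule lc_in[OF W a(1) vW])
 have eV: "e \<in> carrier V" "lc V n a v \<in> carrier V" using e(1) lW sub_carrier[OF W] by blast+
 have "\<exists>j<n. a j \<noteq> \<zero>\<^bsub>K\<^esub>"
 proof (rule ccontr)
  assume "\<not> ?thesis"
  then have "lc V n a v = \<zero>\<^bsub>V\<^esub>" using vW sub_carrier[OF W] by (intro lc_coeff_zero) blast+
  then have "e \<in> W'" using a(2) eV by (simp add: a_minus_def)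
  then show False using e(2) by simp
 qed
 then obtain j where j: "j < n" "a j \<noteq> \<zero>\<^bsub>K\<^esub>" by blast
 have aj: "a j \<in> carrier K" using a(1) j(1) by blast
 obtain f where f: "linear_on K V scalars W f" "\<And>w. w \<in> W' ==> f w = \<zero>\<^bsub>K\<^esub>"
  "\<And>i. i < n ==> f (v i) = (if i = j then \<one>\<^bsub>K\<^esub> else \<zero>\<^bsub>K\<^esub>)"
  using coordinate_functional[OF W' W s b j(1)] by metis
 have "f (lc V n a v) = lc scalars n a (\<lambda>i. f (v i))"
  by (rule lc_linear[OF W scalars_vectorspace f(1) a(1) vW])
 also have "\<dots> = a j \<odot>\<^bsub>scalars\<^esub> f (v j)"
  using j a(1) f(3) by (intro C.lc_single) simp_all
 finally have fl: "f (lc V n a v) = a j" using f(3)[OF j(1)] aj by simp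
 have "e = (e \<ominus>\<^bsub>V\<^esub> lc V n a v) \<oplus>\<^bsub>V\<^esub> lc V n a v" using eV by (simp add: a_minus_def M.a_assoc M.l_neg)
 then have "f e = f (e \<ominus>\<^bsub>V\<^esub> lc V n a v) \<oplus>\<^bsub>K\<^esub> f (lc V n a v)"
  using linear_onD(2)[OF f(1), of "e \<ominus>\<^bsub>V\<^esub> lc V n a v" "lc V n a v"] a(2) s lW by auto
 then have fe: "f e = a j" using f(2)[OF a(2)] fl aj by simp
 have c: "inv\<^bsub>K\<^esub> (a j) \<in> carrier K" "inv\<^bsub>K\<^esub> (a j) \<otimes>\<^bsub>K\<^esub> a j = \<one>\<^bsub>K\<^esub>"
  using aj j(2) by (auto simp: field.field_Units)
 let ?f = "\<lambda>w. inv\<^bsub>K\<^esub> (a j) \<otimes>\<^bsub>K\<^esub> f w"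
 have "linear_on K V scalars W ?f"
  using c linear_onD[OF f(1)] by (intro linear_onI) (simp_all add: R.r_distr R.m_lcomm)
 moreover have "\<And>w. w \<in> W' ==> ?f w = \<zero>\<^bsub>K\<^esub>" using f(2) c by simp
 moreover have "?f e = \<one>\<^bsub>K\<^esub>" using fe c by simp
 ultimately show ?thesis by (rule that)
qed

text \<open>Nakayama's lemma for a nilpotent operator.\<close>

lemma nilpotent_generation:
 assumes W: "submodule K W V" and f: "linear_on K V V W f" "\<And>w. w \<in> W ==> f w \<in> W"
  and nil: "\<And>w. w \<in> W ==> (f ^^ q) w = \<zero>\<^sub>V"
  and D: "D \<subseteq> W" "\<And>d d'. d \<in> D ==> d' \<in> D ==> d \<oplus>\<^sub>V d' \<in> D" "\<And>d. d \<in> D ==> f d \<in> D"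
  and gen: "\<And>w. w \<in> W ==> \<exists>d\<in>D. \<exists>w'\<in>W. w = d \<oplus>\<^sub>V f w'"
  and w: "w \<in> W"
 shows "w \<in> D"
proof -
 have c: "x \<in> carrier V" if "x \<in> W" for x using sub_carrier[OF W that] .
 have pw: "(f ^^ j) x \<in> W" if "x \<in> W" for j x using that f(2) by (induction j) simp_all
 have "\<exists>d\<in>D. \<exists>w'\<in>W. w = d \<oplus>\<^sub>V (f ^^ Suc j) w'" for j
  using w
 proof (induction j arbitrary: w)
  case 0
  then show ?case using gen by simp
 next
  case (Suc j)
  obtain d w1 where d: "d \<in> D" "w1 \<in> W" "w = d \<oplus>\<^sub>V f w1" using gen[OF Suc.prems] by blast
  obtain d' w2 where d': "d' \<in> D" "w2 \<in> W" "w1 = d' \<oplus>\<^sub>V (f ^^ Suc j) w2" using Suc.IH[OF d(2)] by blast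
  have "f w1 = f d' \<oplus>\<^sub>V f ((f ^^ Suc j) w2)"
   unfolding d'(3) using D(1) d' pw by (intro linear_onD(2)[OF f(1)]) blast+
  then have "w = d \<oplus>\<^sub>V (f d' \<oplus>\<^sub>V f ((f ^^ Suc j) w2))" using d(3) by simp
  also have "\<dots> = (d \<oplus>\<^sub>V f d') \<oplus>\<^sub>V (f ^^ Suc (Suc j)) w2"
   using c[OF pw[OF d'(2), of "Suc (Suc j)"]] c D(1) d d' f(2) by (simp add: M.a_assoc subset_iff)
  finally show ?case using D(2)[OF d(1) D(3)[OF d'(1)]] d'(2) by blast
 qed
 from this[of q] obtain d w' where d: "d \<in> D" "w' \<in> W" "w = d \<oplus>\<^sub>V (f ^^ Suc q) w'" by blast
 have "(f ^^ Suc q) w' = (f ^^ q) (f w')" by (simp only: funpow_Suc_right o_apply)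
 then have "(f ^^ Suc q) w' = \<zero>\<^sub>V" using nil[OF f(2)[OF d(2)]] by simp
 then have "w = d" using d c D(1) by (simp add: subset_iff)
 then show ?thesis using d by simp
qed

lemma sum_submodule:
 assumes A: "submodule K A V" and B: "submodule K B V"
 shows "submodule K {a \<oplus>\<^sub>V b | a b. a \<in> A \<and> b \<in> B} V" (is "submodule K ?P V")
proof (unfold_locales)
 have cA: "a \<in> carrier V" if "a \<in> A" for a using sub_carrier[OF A that] .
 have cB: "b \<in> carrier V" if "b \<in> B" for b using sub_carrier[OF B that] .
 show "?P \<subseteq> carrier V" using cA cB by auto
 show "v \<oplus>\<^sub>V w \<in> ?P" if vw: "v \<in> ?P" "w \<in> ?P" for v w
 proof -
  obtain a b a' b' where h: "v = a \<oplus>\<^sub>V b" "w = a' \<oplus>\<^sub>V b'" "a \<in> A" "b \<in> B" "a' \<in> A" "b' \<in> B" using vw by blast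
  have "v \<oplus>\<^sub>V w = (a \<oplus>\<^sub>V a') \<oplus>\<^sub>V (b \<oplus>\<^sub>V b')" using h cA cB by (simp add: M.a_ac)
  then show ?thesis using submodule.m_closed[OF A] submodule.m_closed[OF B] h by blast
 qed
 show "\<zero>\<^sub>V \<in> ?P"
  using submodule.zero_closed[OF A] submodule.zero_closed[OF B] by (intro CollectI exI[of _ "\<zero>\<^sub>V"]) simp
 show "c \<odot>\<^sub>V v \<in> ?P" if c: "c \<in> carrier K" and v: "v \<in> ?P" for c v
 proof -
  obtain a b where h: "v = a \<oplus>\<^sub>V b" "a \<in> A" "b \<in> B" using v by blast
  have "c \<odot>\<^sub>V v = c \<odot>\<^sub>V a \<oplus>\<^sub>V c \<odot>\<^sub>V b" using h cA cB c by (simp add: smult_r_distr)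
  then show ?thesis using submodule.smult_closed[OF A c] submodule.smult_closed[OF B c] h by blast
 qed
qed

lemma line_submodule:
 assumes u: "u \<in> carrier V"
 shows "submodule K {c \<odot>\<^sub>V u | c. c \<in> carrier K} V" (is "submodule K ?P V")
proof (unfold_locales)
 show "?P \<subseteq> carrier V" using u by auto
 show "v \<oplus>\<^sub>V w \<in> ?P" if vw: "v \<in> ?P" "w \<in> ?P" for v w
 proof -
  obtain c d where h: "v = c \<odot>\<^sub>V u" "w = d \<odot>\<^sub>V u" "c \<in> carrier K" "d \<in> carrier K" using vw by blast
  then have "v \<oplus>\<^sub>V w = (c \<oplus>\<^sub>K d) \<odot>\<^sub>V u" using u by (simp add: smult_l_distr)
  then show ?thesis using h by blast
 qed
 show "\<zero>\<^sub>V \<in> ?P" using u by (intro CollectI exI[of _ "\<zero>\<^sub>K"]) simp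
 show "c \<odot>\<^sub>V v \<in> ?P" if c: "c \<in> carrier K" and v: "v \<in> ?P" for c v
 proof -
  obtain d where h: "v = d \<odot>\<^sub>V u" "d \<in> carrier K" using v by blast
  then have "c \<odot>\<^sub>V v = (c \<otimes>\<^sub>K d) \<odot>\<^sub>V u" using u c by (simp add: smult_assoc1)
  then show ?thesis using h c by blast
 qed
qed

lemma smult_eq_zero:
 assumes "c \<in> carrier K" "x \<in> carrier V" "c \<odot>\<^sub>V x = \<zero>\<^sub>V" "x \<noteq> \<zero>\<^sub>V"
 shows "c = \<zero>\<^sub>K"
proof (rule ccontr)
 assume "c \<noteq> \<zero>\<^sub>K"
 then have i: "inv\<^bsub>K\<^esub> c \<in> carrier K" "inv\<^bsub>K\<^esub> c \<otimes>\<^sub>K c = \<one>\<^sub>K" using assms(1) by (auto simp: field.field_Units)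
 have "x = (inv\<^bsub>K\<^esub> c \<otimes>\<^sub>K c) \<odot>\<^sub>V x" using assms(2) i by simp
 also have "\<dots> = inv\<^bsub>K\<^esub> c \<odot>\<^sub>V \<zero>\<^sub>V" using smult_assoc1[OF i(1) assms(1,2)] assms(3) by simp
 finally show False using assms(4) i by simp
qed

end

context commuting_pair
begin

text \<open>The algebra \<open>K[S, T]\<close> of operators. The rule \<open>alg_comb\<close> covers sums and scalar multiples at once.\<close>

inductive_set alg :: "('c \<Rightarrow> 'c) set" where
 alg_id: "(\<lambda>w. w) \<in> alg"
| alg_S: "a \<in> alg ==> (\<lambda>w. S (a w)) \<in> alg"
| alg_T: "a \<in> alg ==> (\<lambda>w. T (a w)) \<in> alg"
| alg_comb: "a \<in> alg ==> b \<in> alg ==> c \<in> carrier K ==> (\<lambda>w. c \<odot>\<^sub>V a w \<oplus>\<^sub>V b w) \<in> alg"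

lemma alg_comm_end:
 assumes W: "stable W"
 shows "a \<in> alg ==> comm_end K V S T W a"
proof (induction rule: alg.induct)
 note Wd = stableD[OF W]
 have sW: "W \<subseteq> carrier V" by (rule submodule.subset[OF Wd(1)])
 note SW = linear_onD[OF linear_on_subset[OF S_linear sW]] and TW = linear_onD[OF linear_on_subset[OF T_linear sW]]
 have c: "w \<in> carrier V" if "w \<in> W" for w using that sW by blast
 {
  case alg_id
  show ?case using sW by (auto simp: comm_end_def linear_on_def)
 next
  case (alg_S a)
  then show ?case using SW Wd(2) c ST_commute by (auto simp: comm_end_def linear_on_def)
 next
  case (alg_T a)
  then show ?case using TW Wd(3) c ST_commute by (auto simp: comm_end_def linear_on_def)
 next
  case (alg_comb a b k)
  have a: "linear_on K V V W a" and b: "linear_on K V V W b"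
   and aW: "\<And>w. w \<in> W ==> a w \<in> W \<and> a (S w) = S (a w) \<and> a (T w) = T (a w)"
   and bW: "\<And>w. w \<in> W ==> b w \<in> W \<and> b (S w) = S (b w) \<and> b (T w) = T (b w)"
   using alg_comb.IH by (auto simp: comm_end_def)
  have "linear_on K V V W (\<lambda>w. k \<odot>\<^sub>V a w \<oplus>\<^sub>V b w)"
  proof (rule linear_onI)
   show "k \<odot>\<^sub>V a w \<oplus>\<^sub>V b w \<in> carrier V" if "w \<in> W" for w
    using alg_comb.hyps linear_onD(1)[OF a that] linear_onD(1)[OF b that] by simp
   show "k \<odot>\<^sub>V a (w \<oplus>\<^sub>V w') \<oplus>\<^sub>V b (w \<oplus>\<^sub>V w') = (k \<odot>\<^sub>V a w \<oplus>\<^sub>V b w) \<oplus>\<^sub>V (k \<odot>\<^sub>V a w' \<oplus>\<^sub>V b w')"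
    if "w \<in> W" "w' \<in> W" for w w'
    using alg_comb.hyps linear_onD(1)[OF a] linear_onD(1)[OF b] linear_onD(2)[OF a that] linear_onD(2)[OF b that] that
    by (simp add: smult_r_distr M.a_ac)
   show "k \<odot>\<^sub>V a (d \<odot>\<^sub>V w) \<oplus>\<^sub>V b (d \<odot>\<^sub>V w) = d \<odot>\<^sub>V (k \<odot>\<^sub>V a w \<oplus>\<^sub>V b w)"
    if "d \<in> carrier K" "w \<in> W" for d w
    using alg_comb.hyps linear_onD(1)[OF a] linear_onD(1)[OF b] linear_onD(3)[OF a that] linear_onD(3)[OF b that] that
    by (simp add: smult_r_distr smult_assoc1[symmetric] R.m_comm)
  qed
  moreover have "k \<odot>\<^sub>V a w \<in> W" if "w \<in> W" for w
   using aW[OF that] submodule.smult_closed[OF Wd(1) alg_comb.hyps(3)] by blast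
  ultimately show ?case
   unfolding comm_end_def using aW bW SW(2,3) TW(2,3) alg_comb.hyps(3) Wd(2,3) submodule.m_closed[OF Wd(1)] by simp
 }
qed

lemma alg_in: "stable W ==> a \<in> alg ==> w \<in> W ==> a w \<in> W"
 using alg_comm_end by (auto simp: comm_end_def)

lemma alg_S_pow: "a \<in> alg ==> (\<lambda>w. (S ^^ k) (a w)) \<in> alg"
 by (induction k) (auto intro: alg.intros)

lemma alg_T_pow: "a \<in> alg ==> (\<lambda>w. (T ^^ k) (a w)) \<in> alg"
 by (induction k) (auto intro: alg.intros)

lemma T_pow_in: "stable W ==> w \<in> W ==> (T ^^ k) w \<in> W"
 using alg_in[OF _ alg_T_pow[OF alg_id]] by simp

lemma T_pow_linear: "stable W ==> linear_on K V V W (T ^^ k)"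
 using alg_comm_end[OF _ alg_T_pow[OF alg_id, of k]] by (simp add: comm_end_def)

lemma T_pow_S: "stable W ==> w \<in> W ==> (T ^^ k) (S w) = S ((T ^^ k) w)"
 using alg_comm_end[OF _ alg_T_pow[OF alg_id, of k]] by (simp add: comm_end_def)

lemma stable_W_linear:
 assumes "stable W"
 shows "linear_on K V V W S" "linear_on K V V W T"
 using linear_on_subset[OF S_linear] linear_on_subset[OF T_linear] submodule.subset[OF stableD(1)[OF assms]] by blast+

lemma stable_zero_maps:
 assumes "stable W"
 shows "S \<zero>\<^sub>V = \<zero>\<^sub>V" "(T ^^ k) \<zero>\<^sub>V = \<zero>\<^sub>V"
 using linear_on_zero[OF stableD(1)[OF assms] vectorspace_axioms] stable_W_linear[OF assms] T_pow_linear[OF assms] by blast+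

lemma T_pow_vanish: "stable W ==> (T ^^ m) w = \<zero>\<^sub>V ==> m \<le> k ==> (T ^^ k) w = \<zero>\<^sub>V"
 using stable_zero_maps(2)[of W "k - m"] funpow_add[of "k - m" m T] by (simp add: o_def)

lemma lc_Suc_shift:
 assumes "\<forall>i<Suc n. a i \<in> carrier K" "\<forall>i<Suc n. v i \<in> carrier V"
 shows "lc V (Suc n) a v = a 0 \<odot>\<^sub>V v 0 \<oplus>\<^sub>V lc V n (\<lambda>i. a (Suc i)) (\<lambda>i. v (Suc i))"
 using lc_split[of 1 n a v] assms by simp

text \<open>The map \<open>u \<mapsto> \<Sum>\<^sub>i f(T\<^sup>m\<^sup>-\<^sup>1\<^sup>-\<^sup>i u) T\<^sup>i w\<close>. It is the \<open>K[T]\<close>-linear map into \<open>K[T] w\<close> that corresponds to the functional \<open>f\<close>,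
because \<open>K[T]/(T\<^sup>m)\<close> is self-dual.\<close>

definition pairing where
 "pairing m f w u = lc V m (\<lambda>i. f ((T ^^ (m - 1 - i)) u)) (\<lambda>i. (T ^^ i) w)"

text \<open>If \<open>f\<close> kills \<open>S W\<close> and \<open>S w = 0\<close>, then the pairing vanishes on \<open>S W\<close> and has image in the kernel of \<open>S\<close>, so it commutes with \<open>S\<close>;
it commutes with \<open>T\<close> by telescoping.\<close>

lemma pairing_comm_end:
 assumes W: "stable W" and f: "linear_on K V scalars W f" "\<And>w. w \<in> S ` W ==> f w = \<zero>\<^sub>K"
  and m: "\<And>u. u \<in> W ==> f ((T ^^ m) u) = \<zero>\<^sub>K"
  and w: "w \<in> W" "S w = \<zero>\<^sub>V" "(T ^^ m) w = \<zero>\<^sub>V"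
 shows "comm_end K V S T W (pairing m f w)" "u \<in> S ` W ==> pairing m f w u = \<zero>\<^sub>V"
proof -
 note Wd = stableD[OF W]
 have cV: "x \<in> carrier V" if "x \<in> W" for x using sub_carrier[OF Wd(1) that] .
 have fK: "f ((T ^^ k) u) \<in> carrier K" if "u \<in> W" for u k
  using linear_onD(1)[OF f(1) T_pow_in[OF W that]] by simp
 have TwW: "(T ^^ k) w \<in> W" for k by (rule T_pow_in[OF W w(1)])
 have SW: "pairing m f w (S u) = \<zero>\<^sub>V" if u: "u \<in> W" for u
  unfolding pairing_def using T_pow_S[OF W u] f(2) T_pow_in[OF W u] TwW cV by (intro lc_coeff_zero) auto
 then show "u \<in> S ` W ==> pairing m f w u = \<zero>\<^sub>V" by blast
 have pW: "pairing m f w u \<in> W" if u: "u \<in> W" for u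
  unfolding pairing_def using fK[OF u] TwW by (intro lc_in[OF Wd(1)]) blast+
 have "linear_on K V V W (pairing m f w)"
 proof (rule linear_onI)
  show "pairing m f w u \<in> carrier V" if "u \<in> W" for u using cV[OF pW[OF that]] .
  show "pairing m f w (u \<oplus>\<^sub>V u') = pairing m f w u \<oplus>\<^sub>V pairing m f w u'" if u: "u \<in> W" "u' \<in> W" for u u'
  proof -
   have e: "f ((T ^^ k) (u \<oplus>\<^sub>V u')) = f ((T ^^ k) u) \<oplus>\<^sub>K f ((T ^^ k) u')" for k
    using linear_onD(2)[OF T_pow_linear[OF W] u] linear_onD(2)[OF f(1) T_pow_in[OF W u(1)] T_pow_in[OF W u(2)]] by simp
   show ?thesis unfolding pairing_def e
    using fK[OF u(1)] fK[OF u(2)] TwW cV by (intro lc_coeff_add) blast+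
  qed
  show "pairing m f w (c \<odot>\<^sub>V u) = c \<odot>\<^sub>V pairing m f w u" if c: "c \<in> carrier K" and u: "u \<in> W" for c u
  proof -
   have e: "f ((T ^^ k) (c \<odot>\<^sub>V u)) = c \<otimes>\<^sub>K f ((T ^^ k) u)" for k
    using linear_onD(3)[OF T_pow_linear[OF W] c u] linear_onD(3)[OF f(1) c T_pow_in[OF W u(1)]] by simp
   show ?thesis unfolding pairing_def e
    using fK[OF u] TwW cV c by (intro lc_coeff_smult) blast+
  qed
 qed
 moreover have "pairing m f w (S u) = S (pairing m f w u)" if u: "u \<in> W" for u
 proof -
  have "S (pairing m f w u) = lc V m (\<lambda>i. f ((T ^^ (m - 1 - i)) u)) (\<lambda>i. S ((T ^^ i) w))"
   unfolding pairing_def using fK[OF u] TwW by (intro lc_linear[OF Wd(1) vectorspace_axioms stable_W_linear(1)[OF W]]) blast+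
  also have "\<dots> = \<zero>\<^sub>V"
   using fK[OF u] T_pow_S[OF W w(1), symmetric] w(2) stable_zero_maps(2)[OF W] by (intro lc_vec_zero) simp_all
  finally show ?thesis using SW[OF u] by simp
 qed
 moreover have "pairing m f w (T u) = T (pairing m f w u)" if u: "u \<in> W" for u
 proof (cases m)
  case 0
  then show ?thesis using linear_on_zero[OF Wd(1) vectorspace_axioms stable_W_linear(2)[OF W]] by (simp add: pairing_def)
 next
  case (Suc k)
  have T1: "(T ^^ j) (T u) = (T ^^ Suc j) u" for j by (simp only: funpow_Suc_right o_apply)
  have "pairing m f w (T u) = lc V (Suc k) (\<lambda>i. f ((T ^^ Suc (k - i)) u)) (\<lambda>i. (T ^^ i) w)"
   unfolding pairing_def Suc T1 by simp
  also have "\<dots> = f ((T ^^ Suc (k - 0)) u) \<odot>\<^sub>V (T ^^ 0) w \<oplus>\<^sub>V lc V k (\<lambda>i. f ((T ^^ Suc (k - Suc i)) u)) (\<lambda>i. (T ^^ Suc i) w)"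
   using fK[OF u] TwW cV by (intro lc_Suc_shift) blast+
  also have "f ((T ^^ Suc (k - 0)) u) = \<zero>\<^sub>K" using m[OF u] Suc by simp
  also have "lc V k (\<lambda>i. f ((T ^^ Suc (k - Suc i)) u)) (\<lambda>i. (T ^^ Suc i) w)
    = lc V k (\<lambda>i. f ((T ^^ (k - i)) u)) (\<lambda>i. (T ^^ Suc i) w)"
   by (rule lc_cong) (simp_all add: Suc_diff_Suc)
  finally have 1: "pairing m f w (T u) = \<zero>\<^sub>K \<odot>\<^sub>V (T ^^ 0) w \<oplus>\<^sub>V lc V k (\<lambda>i. f ((T ^^ (k - i)) u)) (\<lambda>i. (T ^^ Suc i) w)" .
  have cl: "lc V k (\<lambda>i. f ((T ^^ (k - i)) u)) (\<lambda>i. (T ^^ Suc i) w) \<in> carrier V"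
   using fK[OF u] TwW cV by (intro lc_closed) blast+
  have "T (pairing m f w u) = lc V (Suc k) (\<lambda>i. f ((T ^^ (k - i)) u)) (\<lambda>i. T ((T ^^ i) w))"
   unfolding pairing_def Suc using fK[OF u] TwW
   by (subst lc_linear[OF Wd(1) vectorspace_axioms stable_W_linear(2)[OF W]]) simp_all
  also have "\<dots> = lc V k (\<lambda>i. f ((T ^^ (k - i)) u)) (\<lambda>i. (T ^^ Suc i) w) \<oplus>\<^sub>V f ((T ^^ (k - k)) u) \<odot>\<^sub>V (T ^^ Suc k) w"
   by simp
  also have "(T ^^ Suc k) w = \<zero>\<^sub>V" using w(3) Suc by simp
  finally show ?thesis using 1 cl cV[OF w(1)] fK[OF u, of "k - k"] by simp
 qed
 ultimately show "comm_end K V S T W (pairing m f w)" using pW unfolding comm_end_def by blast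
qed

lemma T_chain_indep:
 assumes W: "stable W" and w: "w \<in> W" "(T ^^ m) w \<noteq> \<zero>\<^sub>V" "(T ^^ Suc m) w = \<zero>\<^sub>V"
 shows "rel_indep K V {\<zero>\<^sub>V} (Suc m) (\<lambda>i. (T ^^ i) w)"
proof (rule rel_indepI)
 fix a i assume a: "\<And>i. i < Suc m ==> a i \<in> carrier K" and z: "lc V (Suc m) a (\<lambda>i. (T ^^ i) w) \<in> {\<zero>\<^sub>V}" and i: "i < Suc m"
 note Wd = stableD[OF W]
 have TW: "(T ^^ k) w \<in> W" for k by (rule T_pow_in[OF W w(1)])
 have cV: "x \<in> carrier V" if "x \<in> W" for x using sub_carrier[OF Wd(1) that] .
 have "j \<le> m \<longrightarrow> a j = \<zero>\<^sub>K" for j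
 proof (induction j rule: less_induct)
  case (less j)
  show ?case
  proof
   assume j: "j \<le> m"
   have "(T ^^ (m - j)) (lc V (Suc m) a (\<lambda>i. (T ^^ i) w)) = lc V (Suc m) a (\<lambda>i. (T ^^ (m - j)) ((T ^^ i) w))"
    using a TW by (intro lc_linear[OF Wd(1) vectorspace_axioms T_pow_linear[OF W]]) simp_all
   also have "\<dots> = lc V (Suc m) a (\<lambda>i. (T ^^ (m - j + i)) w)" by (simp only: funpow_add o_apply)
   also have "\<dots> = a j \<odot>\<^sub>V (T ^^ (m - j + j)) w"
   proof (rule lc_single)
    show "\<forall>i<Suc m. i \<noteq> j \<longrightarrow> a i \<odot>\<^sub>V (T ^^ (m - j + i)) w = \<zero>\<^sub>V"
    proof (intro allI impI)
     fix i assume i: "i < Suc m" "i \<noteq> j"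
     show "a i \<odot>\<^sub>V (T ^^ (m - j + i)) w = \<zero>\<^sub>V"
     proof (cases "i < j")
      case True
      then show ?thesis using less.IH[OF True] j cV[OF TW] by simp
     next
      case False
      then have "(T ^^ (m - j + i)) w = \<zero>\<^sub>V" using i j by (intro T_pow_vanish[OF W w(3)]) simp
      then show ?thesis using a[OF i(1)] by simp
     qed
    qed
   qed (use j a cV[OF TW] in simp_all)
   finally have "a j \<odot>\<^sub>V (T ^^ m) w = \<zero>\<^sub>V" using z j stable_zero_maps(2)[OF W] by simp
   then show "a j = \<zero>\<^sub>K" using smult_eq_zero[OF a cV[OF TW]] j w(2) by simp
  qed
 qed
 then show "a i = \<zero>\<^sub>K" using i by simp
qed

text \<open>Rank and nullity of \<open>S\<close>.\<close>

lemma kernel_basis: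
 assumes W: "stable W" and b: "rel_basis K V W {\<zero>\<^sub>V} (l + n') v" and b': "rel_basis K V (S ` W) {\<zero>\<^sub>V} n' w'"
 obtains z where "rel_basis K V {w \<in> W. S w = \<zero>\<^sub>V} {\<zero>\<^sub>V} l z"
proof -
 note Wd = stableD[OF W]
 define Z where "Z = {w \<in> W. S w = \<zero>\<^sub>V}"
 have cV: "x \<in> carrier V" if "x \<in> W" for x using sub_carrier[OF Wd(1) that] .
 note SW = stable_W_linear(1)[OF W]
 have Z: "submodule K Z V"
 proof (unfold_locales)
  show "Z \<subseteq> carrier V" using cV by (auto simp: Z_def)
  show "v \<oplus>\<^sub>V w \<in> Z" if "v \<in> Z" "w \<in> Z" for v w
   using that submodule.m_closed[OF Wd(1)] linear_onD(2)[OF SW] by (simp add: Z_def)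
  show "\<zero>\<^sub>V \<in> Z" using submodule.zero_closed[OF Wd(1)] stable_zero_maps(1)[OF W] by (simp add: Z_def)
  show "c \<odot>\<^sub>V v \<in> Z" if "c \<in> carrier K" "v \<in> Z" for c v
   using that submodule.smult_closed[OF Wd(1)] linear_onD(3)[OF SW] by (simp add: Z_def)
 qed
 have ZW: "Z \<subseteq> W" by (auto simp: Z_def)
 have z0: "{\<zero>\<^sub>V} \<subseteq> Z" using submodule.zero_closed[OF Z] by simp
 obtain k1 v1 k zz where zz: "rel_basis K V Z {\<zero>\<^sub>V} k zz"
  using subspace_basis[OF submodule_zero Z Wd(1) z0 ZW b] by metis
 have "\<forall>i<n'. \<exists>u. u \<in> W \<and> S u = w' i" using rel_basisD(1)[OF b'] by (metis imageE)
 then obtain u where u: "\<And>i. i < n' ==> u i \<in> W \<and> S (u i) = w' i" by metis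
 have w'V: "\<forall>i<n'. w' i \<in> carrier V" using u linear_onD(1)[OF SW] by metis
 have Slc: "S (lc V n' a u) = lc V n' a w'" if "\<forall>i<n'. a i \<in> carrier K" for a
 proof -
  have "S (lc V n' a u) = lc V n' a (\<lambda>i. S (u i))"
   using that u by (intro lc_linear[OF Wd(1) vectorspace_axioms SW]) blast+
  also have "\<dots> = lc V n' a w'" using u by (intro lc_cong) simp_all
  finally show ?thesis .
 qed
 have "rel_basis K V W Z n' u"
  unfolding rel_basis_def
 proof (intro conjI allI impI ballI)
  show "u i \<in> W" if "i < n'" for i using u[OF that] by simp
  show "rel_indep K V Z n' u"
  proof (rule rel_indepI)
   fix a i assume a: "\<And>i. i < n' ==> a i \<in> carrier K" "lc V n' a u \<in> Z" and i: "i < n'"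
   then have "lc V n' a w' \<in> {\<zero>\<^sub>V}" using Slc[of a] by (simp add: Z_def)
   then show "a i = \<zero>\<^sub>K" using rel_indepD[OF rel_basisD(2)[OF b'], of a i] a i by blast
  qed
  fix w assume w: "w \<in> W"
  obtain a where a: "\<forall>i<n'. a i \<in> carrier K" "S w \<ominus>\<^sub>V lc V n' a w' \<in> {\<zero>\<^sub>V}"
   using rel_basisD(3)[OF b', of "S w"] w by blast
  have lW: "lc V n' a u \<in> W" using a(1) u by (intro lc_in[OF Wd(1)]) blast+
  have "S (w \<oplus>\<^sub>V (\<ominus>\<^sub>K \<one>\<^sub>K) \<odot>\<^sub>V lc V n' a u) = S w \<oplus>\<^sub>V (\<ominus>\<^sub>K \<one>\<^sub>K) \<odot>\<^sub>V S (lc V n' a u)"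
   using linear_onD(2)[OF SW w submodule.smult_closed[OF Wd(1) _ lW, of "\<ominus>\<^sub>K \<one>\<^sub>K"]] linear_onD(3)[OF SW _ lW, of "\<ominus>\<^sub>K \<one>\<^sub>K"]
   by simp
  also have "\<dots> = S w \<ominus>\<^sub>V lc V n' a w'"
   using Slc[OF a(1)] lc_closed[OF a(1) w'V] by (simp add: a_minus_def smult_l_minus)
  also have "w \<oplus>\<^sub>V (\<ominus>\<^sub>K \<one>\<^sub>K) \<odot>\<^sub>V lc V n' a u = w \<ominus>\<^sub>V lc V n' a u"
   using cV[OF lW] by (simp add: a_minus_def smult_l_minus)
  finally have "w \<ominus>\<^sub>V lc V n' a u \<in> Z" using a(2) sub_minus[OF Wd(1) w lW] by (simp add: Z_def)
  then show "\<exists>a. (\<forall>i<n'. a i \<in> carrier K) \<and> w \<ominus>\<^sub>V lc V n' a u \<in> Z" using a(1) by (intro exI[of _ a] conjI)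
 qed
 from rel_basis_unique[OF submodule_zero Wd(1) b rel_basis_append[OF submodule_zero Z Wd(1) z0 ZW this zz]]
 have "k = l" by simp
 with zz show ?thesis using that by (simp add: Z_def)
qed

end

section \<open>Cocyclic spaces\<close>

context commuting_pair
begin

lemma functional_nonzero_ex:
 assumes "submodule K W' V" "submodule K W V" "W' \<subseteq> W" "rel_basis K V W W' n v" "e \<in> W" "e \<notin> W'"
 shows "\<exists>f. linear_on K V scalars W f \<and> (\<forall>w\<in>W'. f w = \<zero>\<^sub>K) \<and> f e = \<one>\<^sub>K"
 by (rule functional_nonzero[OF assms]) blast

lemma mindep_snoc:
 assumes cl: "\<And>i w. i < l ==> w \<in> W ==> \<chi> i w \<in> carrier V" "\<And>w. w \<in> W ==> \<psi> w \<in> carrier V"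
  and last: "\<And>a c. (\<forall>i<l. a i \<in> carrier K) ==> c \<in> carrier K ==>
    (\<And>w. w \<in> W ==> lc V l a (\<lambda>i. \<chi> i w) \<oplus>\<^sub>V c \<odot>\<^sub>V \<psi> w = \<zero>\<^sub>V) ==> c = \<zero>\<^sub>K"
  and indep: "mindep K V W l \<chi>"
 shows "mindep K V W (Suc l) (\<lambda>i. if i < l then \<chi> i else \<psi>)"
proof (rule mindepI)
 fix a i assume a: "\<And>i. i < Suc l ==> a i \<in> carrier K" and i: "i < Suc l"
  and z: "\<And>w. w \<in> W ==> lc V (Suc l) a (\<lambda>i. (if i < l then \<chi> i else \<psi>) w) = \<zero>\<^sub>V"
 have e: "lc V l a (\<lambda>i. (if i < l then \<chi> i else \<psi>) w) = lc V l a (\<lambda>i. \<chi> i w)" for w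
  by (rule lc_cong) simp_all
 have z': "lc V l a (\<lambda>i. \<chi> i w) \<oplus>\<^sub>V a l \<odot>\<^sub>V \<psi> w = \<zero>\<^sub>V" if "w \<in> W" for w
  using z[OF that] by (simp add: e)
 have al: "a l = \<zero>\<^sub>K" using last[of a "a l"] a z' by simp
 have "lc V l a (\<lambda>i. \<chi> i w) = \<zero>\<^sub>V" if "w \<in> W" for w
 proof -
  have "lc V l a (\<lambda>i. \<chi> i w) \<in> carrier V" using a cl(1)[OF _ that] by (intro lc_closed) simp_all
  then show ?thesis using z'[OF that] al cl(2)[OF that] by simp
 qed
 then have "a j = \<zero>\<^sub>K" if "j < l" for j using mindepD[OF indep, of a j] a that by simp
 then show "a i = \<zero>\<^sub>K" using al i by (cases "i = l") simp_all
qed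

text \<open>A functional that kills \<open>S W\<close> and \<open>T W\<close>, times a vector killed by \<open>S\<close> and \<open>T\<close>.\<close>

lemma tensor_comm_end:
 assumes W: "stable W" and g: "linear_on K V scalars W g" "\<And>w. w \<in> W ==> g (S w) = \<zero>\<^sub>K" "\<And>w. w \<in> W ==> g (T w) = \<zero>\<^sub>K"
  and z: "z \<in> W" "S z = \<zero>\<^sub>V" "T z = \<zero>\<^sub>V"
 shows "comm_end K V S T W (\<lambda>u. g u \<odot>\<^sub>V z)"
proof -
 note Wd = stableD[OF W]
 have zV: "z \<in> carrier V" using sub_carrier[OF Wd(1) z(1)] .
 have gK: "g u \<in> carrier K" if "u \<in> W" for u using linear_onD(1)[OF g(1) that] by simp
 have "linear_on K V V W (\<lambda>u. g u \<odot>\<^sub>V z)"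
  using linear_onD(2,3)[OF g(1)] gK zV by (intro linear_onI) (simp_all add: smult_l_distr smult_assoc1)
 moreover have "S (g u \<odot>\<^sub>V z) = \<zero>\<^sub>V \<and> T (g u \<odot>\<^sub>V z) = \<zero>\<^sub>V" if "u \<in> W" for u
  using linear_onD(3)[OF S_linear gK[OF that] zV] linear_onD(3)[OF T_linear gK[OF that] zV] z gK[OF that] by simp
 ultimately show ?thesis
  unfolding comm_end_def using g(2,3) zV gK submodule.smult_closed[OF Wd(1) _ z(1)] by simp
qed

lemma outside_image_T:
 assumes W: "stable W" and nilT: "\<And>w. w \<in> W ==> (T ^^ q) w = \<zero>\<^sub>V"
  and D: "D \<subseteq> W" "\<And>d d'. d \<in> D ==> d' \<in> D ==> d \<oplus>\<^sub>V d' \<in> D" "\<And>d. d \<in> D ==> T d \<in> D" "D \<noteq> W"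
 shows "\<exists>u\<in>W. u \<notin> {d \<oplus>\<^sub>V t | d t. d \<in> D \<and> t \<in> T ` W}"
proof (rule ccontr)
 assume "\<not> ?thesis"
 then have gen: "\<exists>d\<in>D. \<exists>w'\<in>W. w = d \<oplus>\<^sub>V T w'" if "w \<in> W" for w using that by blast
 have "w \<in> D" if "w \<in> W" for w
  by (rule nilpotent_generation[OF stableD(1)[OF W] stable_W_linear(2)[OF W] stableD(3)[OF W] nilT D(1-3) gen that])
 then show False using D(1,4) by blast
qed

lemma functional_mod_both:
 assumes W: "stable W" and b: "rel_basis K V W (S ` W) l v"
  and u: "u \<in> W" "u \<notin> {d \<oplus>\<^sub>V t | d t. d \<in> D \<and> t \<in> T ` W}"
  and D: "submodule K D V" "S ` W \<subseteq> D" "D \<subseteq> W"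
 obtains g where "linear_on K V scalars W g" "\<And>w. w \<in> D ==> g w = \<zero>\<^sub>K" "\<And>w. w \<in> W ==> g (T w) = \<zero>\<^sub>K" "g u = \<one>\<^sub>K"
proof -
 note Wd = stableD[OF W]
 let ?P = "{d \<oplus>\<^sub>V t | d t. d \<in> D \<and> t \<in> T ` W}"
 have TW: "submodule K (T ` W) V" by (rule image_submodule[OF Wd(1) stable_W_linear(2)[OF W]])
 have P: "submodule K ?P V" by (rule sum_submodule[OF D(1) TW])
 have cV: "x \<in> carrier V" if "x \<in> W" for x using sub_carrier[OF Wd(1) that] .
 have DP: "d \<in> ?P" if "d \<in> D" for d
  using that submodule.zero_closed[OF TW] sub_carrier[OF D(1) that] by (intro CollectI exI[of _ d] exI[of _ "\<zero>\<^sub>V"]) simp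
 have TP: "T w \<in> ?P" if "w \<in> W" for w
  using that submodule.zero_closed[OF D(1)] cV[OF Wd(3)[OF that]]
  by (intro CollectI exI[of _ "\<zero>\<^sub>V"] exI[of _ "T w"]) simp
 have PW: "?P \<subseteq> W"
 proof
  fix x assume "x \<in> ?P"
  then obtain d t where "x = d \<oplus>\<^sub>V T t" "d \<in> D" "t \<in> W" by blast
  then show "x \<in> W" using D(3) submodule.m_closed[OF Wd(1)] Wd(3) by (simp add: subset_iff)
 qed
 have SP: "S ` W \<subseteq> ?P" using DP D(2) by blast
 note SW = stable_image_S[OF W]
 obtain k v' where k: "rel_basis K V W ?P k v'"
  by (rule subspace_basis[OF stableD(1)[OF SW(1)] P Wd(1) SP PW b]) (erule that)
 from functional_nonzero_ex[OF P Wd(1) PW k u]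
 obtain g where g: "linear_on K V scalars W g" "\<forall>w\<in>?P. g w = \<zero>\<^sub>K" "g u = \<one>\<^sub>K" by (elim exE conjE)
 show ?thesis
 proof (rule that)
  show "linear_on K V scalars W g" by (rule g(1))
  show "g w = \<zero>\<^sub>K" if "w \<in> D" for w by (rule bspec[OF g(2) DP[OF that]])
  show "g (T w) = \<zero>\<^sub>K" if "w \<in> W" for w by (rule bspec[OF g(2) TP[OF that]])
  show "g u = \<one>\<^sub>K" by (rule g(3))
 qed
qed

text \<open>Apply first the highest power of \<open>S\<close> and then the highest power of \<open>T\<close> that does not give zero.\<close>

lemma nonzero_in_socle:
 assumes W: "stable W" and nilS: "(S ^^ p) w = \<zero>\<^sub>V" and nilT: "\<And>w. w \<in> W ==> (T ^^ q) w = \<zero>\<^sub>V"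
  and w: "w \<in> W" "w \<noteq> \<zero>\<^sub>V"
 obtains a where "a \<in> alg" "a w \<in> W" "a w \<noteq> \<zero>\<^sub>V" "S (a w) = \<zero>\<^sub>V" "T (a w) = \<zero>\<^sub>V"
proof -
 define i where "i = (LEAST i. (S ^^ i) w = \<zero>\<^sub>V)"
 have i: "(S ^^ i) w = \<zero>\<^sub>V" unfolding i_def by (rule LeastI[where P = "\<lambda>i. (S ^^ i) w = \<zero>\<^sub>V", OF nilS])
 then obtain i' where i': "i = Suc i'" using w(2) by (cases i) auto
 have n1: "(S ^^ i') w \<noteq> \<zero>\<^sub>V" using not_less_Least[of i' "\<lambda>i. (S ^^ i) w = \<zero>\<^sub>V"] by (simp add: i_def[symmetric] i')
 let ?b = "\<lambda>w. (S ^^ i') w"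
 have b: "?b \<in> alg" using alg_S_pow[OF alg_id, of i'] by simp
 define w1 where "w1 = ?b w"
 have w1: "w1 \<in> W" "w1 \<noteq> \<zero>\<^sub>V" "S w1 = \<zero>\<^sub>V"
  using alg_in[OF W b w(1)] n1 i by (simp_all add: w1_def i')
 define j where "j = (LEAST j. (T ^^ j) w1 = \<zero>\<^sub>V)"
 have j: "(T ^^ j) w1 = \<zero>\<^sub>V" unfolding j_def by (rule LeastI[where P = "\<lambda>j. (T ^^ j) w1 = \<zero>\<^sub>V", OF nilT[OF w1(1)]])
 then obtain j' where j': "j = Suc j'" using w1(2) by (cases j) auto
 have n2: "(T ^^ j') w1 \<noteq> \<zero>\<^sub>V" using not_less_Least[of j' "\<lambda>j. (T ^^ j) w1 = \<zero>\<^sub>V"] by (simp add: j_def[symmetric] j')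
 have "(\<lambda>w. (T ^^ j') (?b w)) \<in> alg" by (rule alg_T_pow[OF b])
 moreover have "S ((T ^^ j') w1) = \<zero>\<^sub>V"
  using T_pow_S[OF W w1(1), of j'] w1(3) stable_zero_maps(2)[OF W] by simp
 ultimately show ?thesis
  using that[of "\<lambda>w. (T ^^ j') (?b w)"] n2 j T_pow_in[OF W w1(1)] by (simp add: w1_def j')
qed

text \<open>The vector \<open>w\<close> lies in the kernel of \<open>S\<close> and has \<open>T\<close>-nilpotency index exactly \<open>m + 1\<close>, which suffices to kill \<open>W/S W\<close>. Pairing \<open>w\<close> with the
\<open>l\<close> functionals on \<open>W/S W\<close> gives \<open>l\<close> independent centralizer elements that vanish on \<open>S W\<close>. If the common kernel of \<open>S\<close> and
\<open>T\<close> were more than a line, a rank one map into a second line of it would be one more. So the common kernel is a line, and a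
functional that is nonzero on it detects every vector up to the action of \<open>alg\<close>.\<close>

lemma cocyclic_or_extra:
 assumes W: "stable W" and b: "rel_basis K V W (S ` W) l v" and l: "l > 0"
  and b0: "rel_basis K V W {\<zero>\<^bsub>V\<^esub>} n b0"
  and nilS: "\<And>w. w \<in> W ==> (S ^^ p) w = \<zero>\<^bsub>V\<^esub>" and nilT: "\<And>w. w \<in> W ==> (T ^^ q) w = \<zero>\<^bsub>V\<^esub>"
  and w: "w \<in> W" "S w = \<zero>\<^bsub>V\<^esub>" "(T ^^ m) w \<noteq> \<zero>\<^bsub>V\<^esub>" "(T ^^ Suc m) w = \<zero>\<^bsub>V\<^esub>"
  and mW: "\<And>u. u \<in> W ==> (T ^^ Suc m) u \<in> S ` W"
  and noH: "\<And>\<chi>. (\<forall>i<Suc l. comm_end K V S T W (\<chi> i) \<and> (\<forall>w\<in>S ` W. \<chi> i w = \<zero>\<^bsub>V\<^esub>)) ==> mindep K V W (Suc l) \<chi> ==> False"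
 shows "\<exists>f. linear_on K V scalars W f \<and> (\<forall>w\<in>W. (\<forall>a\<in>alg. f (a w) = \<zero>\<^bsub>K\<^esub>) \<longrightarrow> w = \<zero>\<^bsub>V\<^esub>)"
proof -
 interpret C: vectorspace K scalars by (rule scalars_vectorspace)
 note Wd = stableD[OF W]
 have cV: "x \<in> carrier V" if "x \<in> W" for x using sub_carrier[OF Wd(1) that] .
 note SW = stable_image_S[OF W]
 note SWd = stableD[OF SW(1)]
 define e where "e = (T ^^ m) w"
 have e: "e \<in> W" "e \<noteq> \<zero>\<^bsub>V\<^esub>" using T_pow_in[OF W w(1)] w(3) by (simp_all add: e_def)
 have TwW: "(T ^^ k) w \<in> W" for k by (rule T_pow_in[OF W w(1)])
 have chain: "rel_indep K V {\<zero>\<^bsub>V\<^esub>} (Suc m) (\<lambda>i. (T ^^ i) w)" by (rule T_chain_indep[OF W w(1,3,4)])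
 have line: "\<exists>c\<in>carrier K. z = c \<odot>\<^bsub>V\<^esub> e" if z: "z \<in> W" "S z = \<zero>\<^bsub>V\<^esub>" "T z = \<zero>\<^bsub>V\<^esub>" for z
 proof (rule ccontr)
  assume nz: "\<not> ?thesis"
  have zV: "z \<in> carrier V" using cV[OF z(1)] .
  have notspan: "z \<ominus>\<^bsub>V\<^esub> lc V (Suc m) a (\<lambda>i. (T ^^ i) w) \<notin> {\<zero>\<^bsub>V\<^esub>}" if a: "\<forall>i<Suc m. a i \<in> carrier K" for a
  proof
   assume h: "z \<ominus>\<^bsub>V\<^esub> lc V (Suc m) a (\<lambda>i. (T ^^ i) w) \<in> {\<zero>\<^bsub>V\<^esub>}"
   have lV: "lc V (Suc m) a (\<lambda>i. (T ^^ i) w) \<in> carrier V" using a TwW cV by (intro lc_closed) blast+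
   have zl: "z = lc V (Suc m) a (\<lambda>i. (T ^^ i) w)"
   proof -
    have "z = (z \<ominus>\<^bsub>V\<^esub> lc V (Suc m) a (\<lambda>i. (T ^^ i) w)) \<oplus>\<^bsub>V\<^esub> lc V (Suc m) a (\<lambda>i. (T ^^ i) w)"
     using zV lV by (simp add: a_minus_def M.a_assoc M.l_neg del: lc.simps)
    then show ?thesis using h lV by (simp del: lc.simps)
   qed
   have "T z = lc V (Suc m) a (\<lambda>i. T ((T ^^ i) w))"
    unfolding zl using a TwW by (intro lc_linear[OF Wd(1) vectorspace_axioms stable_W_linear(2)[OF W]]) blast+
   also have "\<dots> = lc V m a (\<lambda>i. (T ^^ Suc i) w)"
   proof -
    have "\<forall>i<m. (T ^^ Suc i) w \<in> carrier V" using cV[OF TwW] by blast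
    then have "lc V m a (\<lambda>i. (T ^^ Suc i) w) \<in> carrier V" using a by (intro lc_closed) simp_all
    then show ?thesis using w(4) a by simp
   qed
   finally have T0: "lc V m a (\<lambda>i. (T ^^ Suc i) w) = \<zero>\<^bsub>V\<^esub>" using z(3) by simp
   let ?a = "\<lambda>i. case i of 0 \<Rightarrow> \<zero>\<^bsub>K\<^esub> | Suc k \<Rightarrow> a k"
   have aK: "\<forall>i<Suc m. ?a i \<in> carrier K" using a by (auto split: nat.split)
   have cT: "\<forall>i<Suc m. (T ^^ i) w \<in> carrier V" using TwW cV by blast
   have "lc V (Suc m) ?a (\<lambda>i. (T ^^ i) w) = \<zero>\<^bsub>V\<^esub>"
    unfolding lc_Suc_shift[OF aK cT] using T0 cV[OF w(1)] by simp
   then have "?a i = \<zero>\<^bsub>K\<^esub>" if "i < Suc m" for i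
    using rel_indepD[OF chain, of ?a i] aK that by blast
   then have "a i = \<zero>\<^bsub>K\<^esub>" if "i < m" for i using that by (metis Suc_less_eq nat.simps(5))
   then have "lc V m a (\<lambda>i. (T ^^ i) w) = \<zero>\<^bsub>V\<^esub>" using TwW cV by (intro lc_coeff_zero) blast+
   then have "z = a m \<odot>\<^bsub>V\<^esub> e" using zl a e(1) cV by (simp add: e_def)
   then show False using nz a by blast
  qed
  let ?B = "(\<lambda>i. (T ^^ i) w)(Suc m := z)"
  have cT: "\<forall>i<Suc m. (T ^^ i) w \<in> carrier V" using TwW cV by blast
  have indepB: "rel_indep K V {\<zero>\<^bsub>V\<^esub>} (Suc (Suc m)) ?B"
   by (rule rel_indep_extend[OF submodule_zero cT chain zV notspan])
  have v0: "v 0 \<notin> S ` W"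
  proof
   assume "v 0 \<in> S ` W"
   moreover have "lc V l (\<lambda>i. if i = 0 then \<one>\<^bsub>K\<^esub> else \<zero>\<^bsub>K\<^esub>) v = \<one>\<^bsub>K\<^esub> \<odot>\<^bsub>V\<^esub> v 0"
    using l rel_basisD(1)[OF b] cV by (intro lc_delta) simp_all
   ultimately have "lc V l (\<lambda>i. if i = 0 then \<one>\<^bsub>K\<^esub> else \<zero>\<^bsub>K\<^esub>) v \<in> S ` W"
    using rel_basisD(1)[OF b l] cV by simp
   moreover have "(if i = 0 then \<one>\<^bsub>K\<^esub> else \<zero>\<^bsub>K\<^esub>) \<in> carrier K" for i :: nat by simp
   ultimately have "(if (0::nat) = 0 then \<one>\<^bsub>K\<^esub> else \<zero>\<^bsub>K\<^esub>) = \<zero>\<^bsub>K\<^esub>"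
    using rel_indepD[OF rel_basisD(2)[OF b] _ _ l, of "\<lambda>i. if i = 0 then \<one>\<^bsub>K\<^esub> else \<zero>\<^bsub>K\<^esub>"] by blast
   then show False by simp
  qed
  have SneW: "S ` W \<noteq> W" using v0 rel_basisD(1)[OF b l] by blast
  obtain u0 where u0: "u0 \<in> W" "u0 \<notin> {d \<oplus>\<^bsub>V\<^esub> t | d t. d \<in> S ` W \<and> t \<in> T ` W}"
   using outside_image_T[OF W nilT SW(2) submodule.m_closed[OF SWd(1)] SWd(3) SneW] by blast
  obtain g where g: "linear_on K V scalars W g" "\<And>w. w \<in> S ` W ==> g w = \<zero>\<^bsub>K\<^esub>" "\<And>w. w \<in> W ==> g (T w) = \<zero>\<^bsub>K\<^esub>" "g u0 = \<one>\<^bsub>K\<^esub>"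
   using functional_mod_both[OF W b u0 SWd(1) subset_refl SW(2)] by metis
  have "\<forall>j<l. \<exists>f. linear_on K V scalars W f \<and> (\<forall>w\<in>S ` W. f w = \<zero>\<^bsub>K\<^esub>) \<and> (\<forall>i<l. f (v i) = (if i = j then \<one>\<^bsub>K\<^esub> else \<zero>\<^bsub>K\<^esub>))"
   using coordinate_functional[OF SWd(1) Wd(1) SW(2) b] by metis
  then obtain f where f: "\<And>j. j < l ==> linear_on K V scalars W (f j)" "\<And>j w. j < l ==> w \<in> S ` W ==> f j w = \<zero>\<^bsub>K\<^esub>"
   "\<And>j i. j < l ==> i < l ==> f j (v i) = (if i = j then \<one>\<^bsub>K\<^esub> else \<zero>\<^bsub>K\<^esub>)" by metis
  let ?\<chi> = "\<lambda>i. if i < l then pairing (Suc m) (f i) w else (\<lambda>u. g u \<odot>\<^bsub>V\<^esub> z)"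
  have ce: "comm_end K V S T W (pairing (Suc m) (f i) w)" "\<And>x. x \<in> S ` W ==> pairing (Suc m) (f i) w x = \<zero>\<^bsub>V\<^esub>"
   if "i < l" for i
   using pairing_comm_end[OF W f(1)[OF that] f(2)[OF that] f(2)[OF that mW] w(1,2,4)] by blast+
  have gS: "g (S w) = \<zero>\<^bsub>K\<^esub>" if "w \<in> W" for w using g(2) that by blast
  have ce2: "comm_end K V S T W (\<lambda>u. g u \<odot>\<^bsub>V\<^esub> z)" by (rule tensor_comm_end[OF W g(1) gS g(3) z])
  have fK: "f i x \<in> carrier K" if "i < l" "x \<in> W" for i x using linear_onD(1)[OF f(1)[OF that(1)] that(2)] by simp
  have gK: "g x \<in> carrier K" if "x \<in> W" for x using linear_onD(1)[OF g(1) that] by simp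
  have key: "(\<forall>k<Suc m. lc scalars l a (\<lambda>i. f i ((T ^^ (m - k)) u)) = \<zero>\<^bsub>K\<^esub>) \<and> c \<otimes>\<^bsub>K\<^esub> g u = \<zero>\<^bsub>K\<^esub>"
   if a: "\<forall>i<l. a i \<in> carrier K" and c: "c \<in> carrier K" and u: "u \<in> W"
    and h: "lc V l a (\<lambda>i. pairing (Suc m) (f i) w u) \<oplus>\<^bsub>V\<^esub> c \<odot>\<^bsub>V\<^esub> (g u \<odot>\<^bsub>V\<^esub> z) = \<zero>\<^bsub>V\<^esub>" for a c u
  proof -
   let ?A = "\<lambda>k. lc scalars l a (\<lambda>i. f i ((T ^^ (m - k)) u))"
   have "lc V l a (\<lambda>i. pairing (Suc m) (f i) w u) = lc V (Suc m) ?A (\<lambda>i. (T ^^ i) w)"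
    unfolding pairing_def diff_Suc_1 using a fK T_pow_in[OF W u] cT by (intro lc_lc) blast+
   then have h': "lc V (Suc m) ?A (\<lambda>i. (T ^^ i) w) \<oplus>\<^bsub>V\<^esub> (c \<otimes>\<^bsub>K\<^esub> g u) \<odot>\<^bsub>V\<^esub> z = \<zero>\<^bsub>V\<^esub>"
    using h c gK[OF u] zV by (simp only: smult_assoc1)
   let ?D = "\<lambda>k. if k < Suc m then ?A k else c \<otimes>\<^bsub>K\<^esub> g u"
   have AK: "?A k \<in> carrier K" for k
    using C.lc_closed[of l a "\<lambda>i. f i ((T ^^ (m - k)) u)"] a fK T_pow_in[OF W u] by simp
   have DK: "?D i \<in> carrier K" for i using AK c gK[OF u] by simp
   have "lc V (Suc m) ?D ?B = lc V (Suc m) ?A (\<lambda>i. (T ^^ i) w)" by (rule lc_cong) simp_all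
   then have "lc V (Suc (Suc m)) ?D ?B \<in> {\<zero>\<^bsub>V\<^esub>}" unfolding lc.simps(2)[of V "Suc m"] using h' by simp
   from rel_indepD[OF indepB DK this] have D0: "?D i = \<zero>\<^bsub>K\<^esub>" if "i < Suc (Suc m)" for i using that by blast
   show ?thesis
   proof (intro conjI allI impI)
    show "?A k = \<zero>\<^bsub>K\<^esub>" if "k < Suc m" for k using D0[of k] that by simp
    show "c \<otimes>\<^bsub>K\<^esub> g u = \<zero>\<^bsub>K\<^esub>" using D0[of "Suc m"] by simp
   qed
  qed
  have "mindep K V W (Suc l) ?\<chi>"
  proof (rule mindep_snoc)
   show "pairing (Suc m) (f i) w x \<in> carrier V" if "i < l" "x \<in> W" for i x
    using ce(1)[OF that(1)] that(2) unfolding comm_end_def linear_on_def by blast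
   show "g x \<odot>\<^bsub>V\<^esub> z \<in> carrier V" if "x \<in> W" for x using gK[OF that] zV by simp
   show "c = \<zero>\<^bsub>K\<^esub>" if "\<forall>i<l. a i \<in> carrier K" "c \<in> carrier K"
    "\<And>x. x \<in> W ==> lc V l a (\<lambda>i. pairing (Suc m) (f i) w x) \<oplus>\<^bsub>V\<^esub> c \<odot>\<^bsub>V\<^esub> (g x \<odot>\<^bsub>V\<^esub> z) = \<zero>\<^bsub>V\<^esub>" for a c
    using key[OF that(1,2) u0(1) that(3)[OF u0(1)]] g(4) that(2) by simp
   show "mindep K V W l (\<lambda>i. pairing (Suc m) (f i) w)"
   proof (rule mindepI)
    fix a j assume a: "\<And>i. i < l ==> a i \<in> carrier K" and j: "j < l"
     and h: "\<And>x. x \<in> W ==> lc V l a (\<lambda>i. pairing (Suc m) (f i) w x) = \<zero>\<^bsub>V\<^esub>"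
    have vj: "v j \<in> W" using rel_basisD(1)[OF b j] .
    have a': "\<forall>i<l. a i \<in> carrier K" using a by blast
    have hv: "lc V l a (\<lambda>i. pairing (Suc m) (f i) w (v j)) \<oplus>\<^bsub>V\<^esub> \<zero>\<^bsub>K\<^esub> \<odot>\<^bsub>V\<^esub> (g (v j) \<odot>\<^bsub>V\<^esub> z) = \<zero>\<^bsub>V\<^esub>"
     using h[OF vj] gK[OF vj] zV by simp
    have "\<forall>k<Suc m. lc scalars l a (\<lambda>i. f i ((T ^^ (m - k)) (v j))) = \<zero>\<^bsub>K\<^esub>"
     using key[OF a' R.zero_closed vj hv] by (rule conjunct1)
    from this[rule_format, of m] have "lc scalars l a (\<lambda>i. f i (v j)) = \<zero>\<^bsub>K\<^esub>" by simp
    moreover have "lc scalars l a (\<lambda>i. f i (v j)) = a j \<odot>\<^bsub>scalars\<^esub> f j (v j)"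
     using a j f(3) by (intro C.lc_single) simp_all
    ultimately show "a j = \<zero>\<^bsub>K\<^esub>" using f(3)[OF j j] a[OF j] by simp
   qed
  qed
  moreover have "\<forall>i<Suc l. comm_end K V S T W (?\<chi> i) \<and> (\<forall>w\<in>S ` W. ?\<chi> i w = \<zero>\<^bsub>V\<^esub>)"
   using ce ce2 g(2) zV by simp
  ultimately show False by - (rule noH[of ?\<chi>])
 qed
 have e0: "e \<notin> {\<zero>\<^bsub>V\<^esub>}" using e(2) by simp
 have z0: "{\<zero>\<^bsub>V\<^esub>} \<subseteq> W" using submodule.zero_closed[OF Wd(1)] by simp
 from functional_nonzero_ex[OF submodule_zero Wd(1) z0 b0 e(1) e0]
 obtain f where f: "linear_on K V scalars W f" "\<forall>w\<in>{\<zero>\<^bsub>V\<^esub>}. f w = \<zero>\<^bsub>K\<^esub>" "f e = \<one>\<^bsub>K\<^esub>" by (elim exE conjE)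
 have "x = \<zero>\<^bsub>V\<^esub>" if x: "x \<in> W" "\<forall>a\<in>alg. f (a x) = \<zero>\<^bsub>K\<^esub>" for x
 proof (rule ccontr)
  assume xn: "x \<noteq> \<zero>\<^bsub>V\<^esub>"
  obtain a where a: "a \<in> alg" "a x \<in> W" "a x \<noteq> \<zero>\<^bsub>V\<^esub>" "S (a x) = \<zero>\<^bsub>V\<^esub>" "T (a x) = \<zero>\<^bsub>V\<^esub>"
   using nonzero_in_socle[OF W nilS[OF x(1)] nilT x(1) xn] by metis
  obtain c where c: "c \<in> carrier K" "a x = c \<odot>\<^bsub>V\<^esub> e" using line[OF a(2,4,5)] by blast
  have "f (a x) = c" using linear_onD(3)[OF f(1) c(1) e(1)] f(3) c by simp
  then have "c = \<zero>\<^bsub>K\<^esub>" using x(2) a(1) by simp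
  then show False using a(3) c(2) cV[OF e(1)] by simp
 qed
 then show ?thesis using f(1) by blast
qed

end

section \<open>Cyclic spaces and the dimension inequality\<close>

context commuting_pair
begin

lemma alg_orbit:
 assumes W: "stable W" and u: "u \<in> W"
 shows "stable {a u | a. a \<in> alg}" "{a u | a. a \<in> alg} \<subseteq> W"
proof -
 note Wd = stableD[OF W]
 let ?C = "{a u | a. a \<in> alg}"
 have aW: "a u \<in> W" if "a \<in> alg" for a using alg_in[OF W that u] .
 then show CW: "?C \<subseteq> W" by blast
 have uV: "x \<in> carrier V" if "x \<in> W" for x using sub_carrier[OF Wd(1) that] .
 have id0: "(\<lambda>w. (\<ominus>\<^sub>K \<one>\<^sub>K) \<odot>\<^sub>V w \<oplus>\<^sub>V w) \<in> alg" by (rule alg_comb[OF alg_id alg_id]) simp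
 have z: "(\<ominus>\<^sub>K \<one>\<^sub>K) \<odot>\<^sub>V x \<oplus>\<^sub>V x = \<zero>\<^sub>V" if "x \<in> W" for x
  using uV[OF that] by (simp add: smult_l_minus M.l_neg)
 have sub: "submodule K ?C V"
 proof (unfold_locales)
  show "?C \<subseteq> carrier V" using CW submodule.subset[OF Wd(1)] by (rule subset_trans)
  show "v \<oplus>\<^sub>V w \<in> ?C" if vw: "v \<in> ?C" "w \<in> ?C" for v w
  proof -
   obtain a b where h: "a \<in> alg" "b \<in> alg" "v = a u" "w = b u" using vw by blast
   have "(\<lambda>w. \<one>\<^sub>K \<odot>\<^sub>V a w \<oplus>\<^sub>V b w) \<in> alg" using h by (intro alg_comb) simp_all
   moreover have "v \<oplus>\<^sub>V w = \<one>\<^sub>K \<odot>\<^sub>V a u \<oplus>\<^sub>V b u" using h uV[OF aW[OF h(1)]] by simp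
   ultimately show ?thesis by (intro CollectI exI[of _ "\<lambda>w. \<one>\<^sub>K \<odot>\<^sub>V a w \<oplus>\<^sub>V b w"] conjI)
  qed
  show "\<zero>\<^sub>V \<in> ?C" using id0 z[OF u] by (intro CollectI exI[of _ "\<lambda>w. (\<ominus>\<^sub>K \<one>\<^sub>K) \<odot>\<^sub>V w \<oplus>\<^sub>V w"] conjI) simp_all
  show "c \<odot>\<^sub>V v \<in> ?C" if c: "c \<in> carrier K" and v: "v \<in> ?C" for c v
  proof -
   obtain a where h: "a \<in> alg" "v = a u" using v by blast
   have "(\<lambda>w. c \<odot>\<^sub>V a w \<oplus>\<^sub>V ((\<ominus>\<^sub>K \<one>\<^sub>K) \<odot>\<^sub>V w \<oplus>\<^sub>V w)) \<in> alg" by (rule alg_comb[OF h(1) id0 c])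
   moreover have "c \<odot>\<^sub>V v = c \<odot>\<^sub>V a u \<oplus>\<^sub>V ((\<ominus>\<^sub>K \<one>\<^sub>K) \<odot>\<^sub>V u \<oplus>\<^sub>V u)"
    using h c uV[OF aW[OF h(1)]] z[OF u] by simp
   ultimately show ?thesis
    by (intro CollectI exI[of _ "\<lambda>w. c \<odot>\<^sub>V a w \<oplus>\<^sub>V ((\<ominus>\<^sub>K \<one>\<^sub>K) \<odot>\<^sub>V w \<oplus>\<^sub>V w)"] conjI)
  qed
 qed
 show "stable ?C" unfolding stable_def
 proof (intro conjI ballI sub)
  fix w assume "w \<in> ?C"
  then obtain a where a: "a \<in> alg" "w = a u" by blast
  show "S w \<in> ?C" unfolding a(2) by (intro CollectI exI[of _ "\<lambda>w. S (a w)"] conjI refl alg_S a(1))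
  show "T w \<in> ?C" unfolding a(2) by (intro CollectI exI[of _ "\<lambda>w. T (a w)"] conjI refl alg_T a(1))
 qed
qed

text \<open>The dual situation: \<open>T\<close> has index \<open>m + 1\<close> on \<open>W/S W\<close>, attained at \<open>u0\<close>, and \<open>T\<^sup>m\<^sup>+\<^sup>1\<close> kills the vectors \<open>z\<close> in the kernel of \<open>S\<close>. A functional
that kills \<open>S W\<close> and not \<open>T\<^sup>m u0\<close> is paired with each of them; a second generator of \<open>W\<close> would again give a map of
rank one that is independent of these.\<close>

lemma cyclic_or_extra:
 assumes W: "stable W" and b: "rel_basis K V W (S ` W) l v"
  and nilS: "\<And>w. w \<in> W ==> (S ^^ p) w = \<zero>\<^bsub>V\<^esub>" and nilT: "\<And>w. w \<in> W ==> (T ^^ q) w = \<zero>\<^bsub>V\<^esub>"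
  and z: "\<And>i. i < l ==> z i \<in> W \<and> S (z i) = \<zero>\<^bsub>V\<^esub> \<and> (T ^^ Suc m) (z i) = \<zero>\<^bsub>V\<^esub>"
  and zi: "rel_indep K V {\<zero>\<^bsub>V\<^esub>} l z"
  and z0: "y \<in> W" "y \<noteq> \<zero>\<^bsub>V\<^esub>" "S y = \<zero>\<^bsub>V\<^esub>" "T y = \<zero>\<^bsub>V\<^esub>"
  and u0: "u0 \<in> W" "(T ^^ m) u0 \<notin> S ` W"
  and mW: "\<And>u. u \<in> W ==> (T ^^ Suc m) u \<in> S ` W"
  and noH: "\<And>\<chi>. (\<forall>i<Suc l. comm_end K V S T W (\<chi> i) \<and> (\<forall>w\<in>S ` W. \<chi> i w = \<zero>\<^bsub>V\<^esub>)) ==> mindep K V W (Suc l) \<chi> ==> False"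
 shows "\<forall>w\<in>W. \<exists>a\<in>alg. w = a u0"
proof -
 interpret C: vectorspace K scalars by (rule scalars_vectorspace)
 note Wd = stableD[OF W]
 have cV: "x \<in> carrier V" if "x \<in> W" for x using sub_carrier[OF Wd(1) that] .
 note SW = stable_image_S[OF W]
 note SWd = stableD[OF SW(1)]
 have TW: "(T ^^ k) w \<in> W" if "w \<in> W" for k w by (rule T_pow_in[OF W that])
 define L where "L = {c \<odot>\<^bsub>V\<^esub> u0 | c. c \<in> carrier K}"
 have L: "submodule K L V" unfolding L_def by (rule line_submodule[OF cV[OF u0(1)]])
 define D where "D = {x \<oplus>\<^bsub>V\<^esub> s | x s. x \<in> L \<and> s \<in> S ` W}"
 have D: "submodule K D V" unfolding D_def by (rule sum_submodule[OF L SWd(1)])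
 have LW: "L \<subseteq> W" unfolding L_def using submodule.smult_closed[OF Wd(1) _ u0(1)] by blast
 have DW: "D \<subseteq> W"
 proof
  fix x assume "x \<in> D"
  then obtain y s where "x = y \<oplus>\<^bsub>V\<^esub> s" "y \<in> L" "s \<in> S ` W" unfolding D_def by blast
  then show "x \<in> W" using LW SW(2) submodule.m_closed[OF Wd(1)] by (simp add: subset_iff)
 qed
 have LD: "x \<in> D" if "x \<in> L" for x
  unfolding D_def using that submodule.zero_closed[OF SWd(1)] sub_carrier[OF L that]
  by (intro CollectI exI[of _ x] exI[of _ "\<zero>\<^bsub>V\<^esub>"]) simp
 have SD: "S ` W \<subseteq> D"
 proof
  fix x assume x: "x \<in> S ` W"
  then show "x \<in> D" unfolding D_def using submodule.zero_closed[OF L] sub_carrier[OF SWd(1) x]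
   by (intro CollectI exI[of _ "\<zero>\<^bsub>V\<^esub>"] exI[of _ x]) simp
 qed
 have u0L: "u0 \<in> L" unfolding L_def using cV[OF u0(1)] by (intro CollectI exI[of _ "\<one>\<^bsub>K\<^esub>"]) simp
 have gen: "u \<in> {d \<oplus>\<^bsub>V\<^esub> t | d t. d \<in> D \<and> t \<in> T ` W}" if u: "u \<in> W" for u
 proof (rule ccontr)
  assume nu: "u \<notin> {d \<oplus>\<^bsub>V\<^esub> t | d t. d \<in> D \<and> t \<in> T ` W}"
  obtain g where g: "linear_on K V scalars W g" "\<And>w. w \<in> D ==> g w = \<zero>\<^bsub>K\<^esub>" "\<And>w. w \<in> W ==> g (T w) = \<zero>\<^bsub>K\<^esub>" "g u = \<one>\<^bsub>K\<^esub>"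
   using functional_mod_both[OF W b u nu D SD DW] by metis
  have b1: "S ` W \<subseteq> W" by (rule SW(2))
  from functional_nonzero_ex[OF SWd(1) Wd(1) b1 b TW[OF u0(1)] u0(2)]
  obtain f where f: "linear_on K V scalars W f" "\<forall>w\<in>S ` W. f w = \<zero>\<^bsub>K\<^esub>" "f ((T ^^ m) u0) = \<one>\<^bsub>K\<^esub>" by (elim exE conjE)
  have fK: "f x \<in> carrier K" if "x \<in> W" for x using linear_onD(1)[OF f(1) that] by simp
  have gK: "g x \<in> carrier K" if "x \<in> W" for x using linear_onD(1)[OF g(1) that] by simp
  have f_high: "f ((T ^^ j) x) = \<zero>\<^bsub>K\<^esub>" if "x \<in> W" "Suc m \<le> j" for x j
  proof -
   have "(T ^^ j) x = (T ^^ Suc m) ((T ^^ (j - Suc m)) x)"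
    using that(2) funpow_add[of "Suc m" "j - Suc m" T] by (simp only: o_apply le_add_diff_inverse)
   then show ?thesis using bspec[OF f(2) mW[OF TW[OF that(1), of "j - Suc m"]]] by (simp only:)
  qed
  have gT: "g ((T ^^ k) u0) = \<zero>\<^bsub>K\<^esub>" for k
  proof (cases k)
   case 0
   then show ?thesis using g(2)[OF LD[OF u0L]] by simp
  next
   case (Suc j)
   then show ?thesis using g(3)[OF TW[OF u0(1), of j]] by simp
  qed
  have "\<exists>u1\<in>W. g u1 = \<one>\<^bsub>K\<^esub> \<and> (\<forall>j. Suc m \<le> j + k \<longrightarrow> f ((T ^^ j) u1) = \<zero>\<^bsub>K\<^esub>)" if "k \<le> Suc m" for k
   using that
  proof (induction k)
   case 0
   show ?case using u g(4) f_high[OF u] by (intro bexI[of _ u]) simp_all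
  next
   case (Suc k)
   then obtain u1 where u1: "u1 \<in> W" "g u1 = \<one>\<^bsub>K\<^esub>" "\<And>j. Suc m \<le> j + k ==> f ((T ^^ j) u1) = \<zero>\<^bsub>K\<^esub>" by auto
   define c where "c = \<ominus>\<^bsub>K\<^esub> f ((T ^^ (m - k)) u1)"
   have cK: "c \<in> carrier K" using fK[OF TW[OF u1(1)]] by (simp add: c_def)
   let ?t = "c \<odot>\<^bsub>V\<^esub> (T ^^ k) u0"
   have tW: "?t \<in> W" using submodule.smult_closed[OF Wd(1) cK TW[OF u0(1)]] .
   have ut: "u1 \<oplus>\<^bsub>V\<^esub> ?t \<in> W" using submodule.m_closed[OF Wd(1) u1(1) tW] .
   have gut: "g (u1 \<oplus>\<^bsub>V\<^esub> ?t) = \<one>\<^bsub>K\<^esub>"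
    using linear_onD(2)[OF g(1) u1(1) tW] linear_onD(3)[OF g(1) cK TW[OF u0(1)]] gT u1(2) cK by simp
   have fT: "f ((T ^^ j) (u1 \<oplus>\<^bsub>V\<^esub> ?t)) = f ((T ^^ j) u1) \<oplus>\<^bsub>K\<^esub> c \<otimes>\<^bsub>K\<^esub> f ((T ^^ (j + k)) u0)" for j
   proof -
    have "(T ^^ j) (u1 \<oplus>\<^bsub>V\<^esub> ?t) = (T ^^ j) u1 \<oplus>\<^bsub>V\<^esub> c \<odot>\<^bsub>V\<^esub> (T ^^ (j + k)) u0"
     using linear_onD(2)[OF T_pow_linear[OF W] u1(1) tW] linear_onD(3)[OF T_pow_linear[OF W] cK TW[OF u0(1)]]
     by (simp add: funpow_add)
    then show ?thesis
     using linear_onD(2)[OF f(1) TW[OF u1(1)] submodule.smult_closed[OF Wd(1) cK TW[OF u0(1)]]]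
      linear_onD(3)[OF f(1) cK TW[OF u0(1)]] by simp
   qed
   have "f ((T ^^ j) (u1 \<oplus>\<^bsub>V\<^esub> ?t)) = \<zero>\<^bsub>K\<^esub>" if j: "Suc m \<le> j + Suc k" for j
   proof (cases "Suc m \<le> j + k")
    case True
    then show ?thesis unfolding fT using u1(3) f_high[OF u0(1)] cK by simp
   next
    case False
    then have jm: "j + k = m" "j = m - k" using j by simp_all
    then show ?thesis unfolding fT using f(3) fK[OF TW[OF u1(1), of "m - k"]] by (simp add: c_def R.r_neg)
   qed
   then show ?case using ut gut by blast
  qed
  from this[of "Suc m"] obtain u1 where u1: "u1 \<in> W" "g u1 = \<one>\<^bsub>K\<^esub>" "\<And>j. f ((T ^^ j) u1) = \<zero>\<^bsub>K\<^esub>" by auto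
  let ?\<chi> = "\<lambda>i. if i < l then pairing (Suc m) f (z i) else (\<lambda>u. g u \<odot>\<^bsub>V\<^esub> y)"
  have f2: "f w = \<zero>\<^bsub>K\<^esub>" if "w \<in> S ` W" for w using f(2) that by blast
  have ce: "comm_end K V S T W (pairing (Suc m) f (z i))" "\<And>x. x \<in> S ` W ==> pairing (Suc m) f (z i) x = \<zero>\<^bsub>V\<^esub>"
   if "i < l" for i
   using pairing_comm_end[OF W f(1) f2 f2[OF mW], of "z i"] z[OF that] by blast+
  have gS: "g (S w) = \<zero>\<^bsub>K\<^esub>" if "w \<in> W" for w using g(2) SD that by blast
  have ce2: "comm_end K V S T W (\<lambda>u. g u \<odot>\<^bsub>V\<^esub> y)" by (rule tensor_comm_end[OF W g(1) gS g(3) z0(1,3,4)])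
  have yV: "y \<in> carrier V" by (rule cV[OF z0(1)])
  have pV: "pairing (Suc m) f (z i) x \<in> carrier V" if "i < l" "x \<in> W" for i x
   using ce(1)[OF that(1)] that(2) unfolding comm_end_def linear_on_def by blast
  have "mindep K V W (Suc l) ?\<chi>"
  proof (rule mindep_snoc)
   show "pairing (Suc m) f (z i) x \<in> carrier V" if "i < l" "x \<in> W" for i x by (rule pV[OF that])
   show "g x \<odot>\<^bsub>V\<^esub> y \<in> carrier V" if "x \<in> W" for x using gK[OF that] yV by simp
   show "c = \<zero>\<^bsub>K\<^esub>" if a: "\<forall>i<l. a i \<in> carrier K" and c: "c \<in> carrier K"
    and h: "\<And>x. x \<in> W ==> lc V l a (\<lambda>i. pairing (Suc m) f (z i) x) \<oplus>\<^bsub>V\<^esub> c \<odot>\<^bsub>V\<^esub> (g x \<odot>\<^bsub>V\<^esub> y) = \<zero>\<^bsub>V\<^esub>" for a c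
   proof -
    have "pairing (Suc m) f (z i) u1 = \<zero>\<^bsub>V\<^esub>" if "i < l" for i
     unfolding pairing_def using u1(3) cV[OF TW] z[OF that] by (intro lc_coeff_zero) blast+
    then have "lc V l a (\<lambda>i. pairing (Suc m) f (z i) u1) = \<zero>\<^bsub>V\<^esub>" using a by (intro lc_vec_zero) blast+
    then have "c \<odot>\<^bsub>V\<^esub> y = \<zero>\<^bsub>V\<^esub>" using h[OF u1(1)] u1(2) yV c by simp
    then show ?thesis using smult_eq_zero[OF c yV _ z0(2)] by blast
   qed
   show "mindep K V W l (\<lambda>i. pairing (Suc m) f (z i))"
   proof (rule mindepI)
    fix a j assume a: "\<And>i. i < l ==> a i \<in> carrier K" and j: "j < l"
     and h: "\<And>x. x \<in> W ==> lc V l a (\<lambda>i. pairing (Suc m) f (z i) x) = \<zero>\<^bsub>V\<^esub>"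
    have a': "\<forall>i<l. a i \<in> carrier K" and zW: "\<forall>i<l. z i \<in> W" using a z by blast+
    define x where "x = lc V l a z"
    have xW: "x \<in> W" unfolding x_def by (rule lc_in[OF Wd(1) a' zW])
    let ?d = "\<lambda>i. f ((T ^^ (m - i)) u0)"
    have dK: "?d i \<in> carrier K" for i by (rule fK[OF TW[OF u0(1)]])
    have pl: "linear_on K V V W (\<lambda>w. pairing (Suc m) f w u0)"
    proof (rule linear_onI)
     show "pairing (Suc m) f w u0 \<in> carrier V" if "w \<in> W" for w
      unfolding pairing_def diff_Suc_1 using dK cV[OF TW[OF that]] by (intro lc_closed) blast+
     show "pairing (Suc m) f (w \<oplus>\<^bsub>V\<^esub> w') u0 = pairing (Suc m) f w u0 \<oplus>\<^bsub>V\<^esub> pairing (Suc m) f w' u0"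
      if w: "w \<in> W" "w' \<in> W" for w w'
      unfolding pairing_def diff_Suc_1 linear_onD(2)[OF T_pow_linear[OF W] w]
      using dK cV[OF TW[OF w(1)]] cV[OF TW[OF w(2)]] by (intro lc_vec_add) blast+
     show "pairing (Suc m) f (c \<odot>\<^bsub>V\<^esub> w) u0 = c \<odot>\<^bsub>V\<^esub> pairing (Suc m) f w u0"
      if c: "c \<in> carrier K" and w: "w \<in> W" for c w
     proof -
      have "linear_on K V V (carrier V) (\<lambda>v. c \<odot>\<^bsub>V\<^esub> v)"
       using c by (intro linear_onI) (simp_all add: smult_r_distr smult_assoc1[symmetric] R.m_comm)
      from lc_linear[OF submodule_carrier vectorspace_axioms this, of "Suc m" ?d "\<lambda>i. (T ^^ i) w"]
      show ?thesis
       unfolding pairing_def diff_Suc_1 linear_onD(3)[OF T_pow_linear[OF W] c w]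
       using dK cV[OF TW[OF w]] by simp
     qed
    qed
    have "pairing (Suc m) f x u0 = lc V l a (\<lambda>i. pairing (Suc m) f (z i) u0)"
     unfolding x_def by (rule lc_linear[OF Wd(1) vectorspace_axioms pl a' zW])
    then have p0: "pairing (Suc m) f x u0 = \<zero>\<^bsub>V\<^esub>" using h[OF u0(1)] by simp
    have "x = \<zero>\<^bsub>V\<^esub>"
    proof (rule ccontr)
     assume xn: "x \<noteq> \<zero>\<^bsub>V\<^esub>"
     define k where "k = (LEAST k. (T ^^ k) x = \<zero>\<^bsub>V\<^esub>)"
     have k: "(T ^^ k) x = \<zero>\<^bsub>V\<^esub>" unfolding k_def by (rule LeastI[where P = "\<lambda>k. (T ^^ k) x = \<zero>\<^bsub>V\<^esub>", OF nilT[OF xW]])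
     then obtain k' where k': "k = Suc k'" using xn by (cases k) auto
     have kn: "(T ^^ k') x \<noteq> \<zero>\<^bsub>V\<^esub>" using not_less_Least[of k' "\<lambda>k. (T ^^ k) x = \<zero>\<^bsub>V\<^esub>"] by (simp add: k_def[symmetric] k')
     have "(T ^^ k') (pairing (Suc m) f x u0) = lc V (Suc m) ?d (\<lambda>i. (T ^^ k') ((T ^^ i) x))"
      unfolding pairing_def diff_Suc_1 using dK TW[OF xW]
      by (intro lc_linear[OF Wd(1) vectorspace_axioms T_pow_linear[OF W]]) blast+
     also have "\<dots> = ?d 0 \<odot>\<^bsub>V\<^esub> (T ^^ k') ((T ^^ 0) x)"
     proof (rule lc_single)
      show "\<forall>i<Suc m. i \<noteq> 0 \<longrightarrow> ?d i \<odot>\<^bsub>V\<^esub> (T ^^ k') ((T ^^ i) x) = \<zero>\<^bsub>V\<^esub>"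
      proof (intro allI impI)
       fix i :: nat assume "i \<noteq> 0"
       then have "(T ^^ (k' + i)) x = \<zero>\<^bsub>V\<^esub>" using T_pow_vanish[OF W k, of "k' + i"] k' by simp
       then show "?d i \<odot>\<^bsub>V\<^esub> (T ^^ k') ((T ^^ i) x) = \<zero>\<^bsub>V\<^esub>" using dK by (simp add: funpow_add)
      qed
     qed (use dK[of 0] cV[OF TW[OF xW]] in simp_all)
     also have "\<dots> = (T ^^ k') x" using f(3) cV[OF TW[OF xW]] by simp
     finally show False using kn p0 stable_zero_maps(2)[OF W] by simp
    qed
    then have "lc V l a z \<in> {\<zero>\<^bsub>V\<^esub>}" by (simp add: x_def)
    from rel_indepD[OF zi a this j] show "a j = \<zero>\<^bsub>K\<^esub>" .
   qed
  qed
  moreover have "\<forall>i<Suc l. comm_end K V S T W (?\<chi> i) \<and> (\<forall>w\<in>S ` W. ?\<chi> i w = \<zero>\<^bsub>V\<^esub>)"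
   using ce ce2 g(2) SD yV by (simp add: subset_iff)
  ultimately show False by - (rule noH[of ?\<chi>])
 qed
 define A where "A = {a u0 | a. a \<in> alg}"
 have A: "stable A" "A \<subseteq> W" unfolding A_def using alg_orbit[OF W u0(1)] by blast+
 note Ad = stableD[OF A(1)]
 have u0A: "u0 \<in> A" unfolding A_def by (intro CollectI exI[of _ "\<lambda>w. w"] conjI refl alg_id)
 have LA: "L \<subseteq> A" unfolding L_def using submodule.smult_closed[OF Ad(1) _ u0A] by blast
 define E where "E = {x \<oplus>\<^bsub>V\<^esub> s | x s. x \<in> A \<and> s \<in> S ` W}"
 have Es: "submodule K E V" unfolding E_def by (rule sum_submodule[OF Ad(1) SWd(1)])
 have EW: "E \<subseteq> W"
 proof
  fix x assume "x \<in> E"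
  then obtain y s where "x = y \<oplus>\<^bsub>V\<^esub> s" "y \<in> A" "s \<in> S ` W" unfolding E_def by blast
  then show "x \<in> W" using A(2) SW(2) submodule.m_closed[OF Wd(1)] by (simp add: subset_iff)
 qed
 have ET: "T x \<in> E" if xE: "x \<in> E" for x
 proof -
  obtain y s where h: "x = y \<oplus>\<^bsub>V\<^esub> s" "y \<in> A" "s \<in> S ` W" using xE[unfolded E_def] by blast
  have "T x = T y \<oplus>\<^bsub>V\<^esub> T s" unfolding h(1) using h A(2) SW(2) by (intro linear_onD(2)[OF stable_W_linear(2)[OF W]]) blast+
  then show ?thesis unfolding E_def using Ad(3)[OF h(2)] SWd(3)[OF h(3)] by blast
 qed
 have DE: "D \<subseteq> E" unfolding D_def E_def using LA by blast
 have "w \<in> E" if "w \<in> W" for w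
 proof (rule nilpotent_generation[OF Wd(1) stable_W_linear(2)[OF W] Wd(3) nilT EW submodule.m_closed[OF Es] ET _ that])
  show "\<exists>d\<in>E. \<exists>w'\<in>W. x = d \<oplus>\<^bsub>V\<^esub> T w'" if "x \<in> W" for x
   using gen[OF that] DE by blast
 qed
 then have genA: "\<exists>d\<in>A. \<exists>w'\<in>W. w = d \<oplus>\<^bsub>V\<^esub> S w'" if "w \<in> W" for w using that unfolding E_def by blast
 have "w \<in> A" if "w \<in> W" for w
  by (rule nilpotent_generation[OF Wd(1) stable_W_linear(1)[OF W] Wd(2) nilS A(2) submodule.m_closed[OF Ad(1)] Ad(2) genA that])
 then show ?thesis unfolding A_def by blast
qed

lemma alg_indep_of_cyclic:
 assumes W: "stable W" and b: "rel_basis K V W {\<zero>\<^sub>V} n v" and u: "u \<in> W" and gen: "\<forall>w\<in>W. \<exists>a\<in>alg. w = a u"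
 shows "\<exists>\<rho>. (\<forall>i<n. \<rho> i \<in> alg) \<and> mindep K V W n \<rho>"
proof -
 have "\<forall>i<n. \<exists>a. a \<in> alg \<and> v i = a u" using gen rel_basisD(1)[OF b] by blast
 then obtain \<rho> where \<rho>: "\<And>i. i < n ==> \<rho> i \<in> alg \<and> v i = \<rho> i u" by metis
 have "mindep K V W n \<rho>"
 proof (rule mindepI)
  fix a i assume a: "\<And>i. i < n ==> a i \<in> carrier K" and h: "\<And>w. w \<in> W ==> lc V n a (\<lambda>i. \<rho> i w) = \<zero>\<^sub>V" and i: "i < n"
  have "lc V n a v = lc V n a (\<lambda>i. \<rho> i u)" using \<rho> by (intro lc_cong) simp_all
  then have "lc V n a v \<in> {\<zero>\<^sub>V}" using h[OF u] by simp
  from rel_indepD[OF rel_basisD(2)[OF b] a this i] show "a i = \<zero>\<^sub>K" .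
 qed
 then show ?thesis using \<rho> by blast
qed

text \<open>If \<open>f\<close> separates vectors up to \<open>alg\<close>, the functionals \<open>f \<circ> a\<close> with \<open>a \<in> alg\<close> have no common zero, so \<open>n\<close> of them are independent.\<close>

lemma alg_indep_of_cocyclic:
 assumes W: "stable W" and b: "rel_basis K V W {\<zero>\<^sub>V} n v" and f: "linear_on K V scalars W f"
  and sep: "\<forall>w\<in>W. (\<forall>a\<in>alg. f (a w) = \<zero>\<^sub>K) \<longrightarrow> w = \<zero>\<^sub>V"
 shows "\<exists>\<rho>. (\<forall>i<n. \<rho> i \<in> alg) \<and> mindep K V W n \<rho>"
proof -
 note Wd = stableD[OF W]
 have aW: "a w \<in> W" "linear_on K V V W a" if "a \<in> alg" "w \<in> W" for a w
  using alg_in[OF W that] alg_comm_end[OF W that(1)] by (simp_all add: comm_end_def)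
 let ?F = "{\<lambda>w. f (a w) | a. a \<in> alg}"
 have F: "linear_on K V scalars W g" if gF: "g \<in> ?F" for g
 proof -
  obtain a where a: "a \<in> alg" "g = (\<lambda>w. f (a w))" using gF by blast
  have al: "linear_on K V V W a" using alg_comm_end[OF W a(1)] by (simp add: comm_end_def)
  show ?thesis unfolding a(2)
   using linear_onD[OF f] linear_onD(2,3)[OF al] aW(1)[OF a(1)] by (intro linear_onI) simp_all
 qed
 have sep': "w = \<zero>\<^sub>V" if w: "w \<in> W" "\<forall>g\<in>?F. g w = \<zero>\<^sub>K" for w
 proof -
  have "f (a w) = \<zero>\<^sub>K" if "a \<in> alg" for a
   by (rule bspec[OF w(2), of "\<lambda>w. f (a w)"]) (use that in blast)
  then show ?thesis using sep w(1) by simp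
 qed
 from separating_functionals[OF Wd(1) b F sep' order_refl]
 obtain g where g: "\<forall>i<n. g i \<in> ?F" "mindep K scalars W n g" by blast
 have "\<forall>i<n. \<exists>a. a \<in> alg \<and> g i = (\<lambda>w. f (a w))" using g(1) by blast
 then obtain \<rho> where \<rho>: "\<And>i. i < n ==> \<rho> i \<in> alg \<and> g i = (\<lambda>w. f (\<rho> i w))" by metis
 have "mindep K V W n \<rho>"
 proof (rule mindepI)
  fix a i assume a: "\<And>i. i < n ==> a i \<in> carrier K" and h: "\<And>w. w \<in> W ==> lc V n a (\<lambda>i. \<rho> i w) = \<zero>\<^sub>V" and i: "i < n"
  have "lc scalars n a (\<lambda>i. g i w) = \<zero>\<^bsub>scalars\<^esub>" if w: "w \<in> W" for w
  proof -
   have "f (lc V n a (\<lambda>i. \<rho> i w)) = lc scalars n a (\<lambda>i. f (\<rho> i w))"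
    using a \<rho> aW(1) w by (intro lc_linear[OF Wd(1) scalars_vectorspace f]) blast+
   also have "\<dots> = lc scalars n a (\<lambda>i. g i w)" using \<rho> by (intro lc_cong) simp_all
   finally show ?thesis using h[OF w] linear_on_zero[OF Wd(1) scalars_vectorspace f] by simp
  qed
  from mindepD[OF g(2) a this i] show "a i = \<zero>\<^sub>K" .
 qed
 then show ?thesis using \<rho> by blast
qed

lemma rel_basis_notin:
 assumes W: "submodule K W V" and b: "rel_basis K V W W' l v" and l: "0 < l"
 shows "v 0 \<notin> W'"
proof
 assume h: "v 0 \<in> W'"
 let ?d = "\<lambda>i. if i = 0 then \<one>\<^sub>K else \<zero>\<^sub>K"
 have vV: "\<forall>i<l. v i \<in> carrier V" using rel_basisD(1)[OF b] sub_carrier[OF W] by blast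
 have "lc V l ?d v = \<one>\<^sub>K \<odot>\<^sub>V v 0" using l vV by (intro lc_delta) simp_all
 then have "lc V l ?d v \<in> W'" using h vV l by simp
 moreover have "?d i \<in> carrier K" for i :: nat by simp
 ultimately have "?d (0::nat) = \<zero>\<^sub>K" using rel_indepD[OF rel_basisD(2)[OF b] _ _ l, of ?d] by blast
 then show False by simp
qed

lemma lc_append:
 assumes a: "\<forall>i<n+k. a i \<in> carrier K"
  and A: "\<And>i. i < n ==> A i w \<in> carrier V" and B: "\<And>i. i < k ==> B i w \<in> carrier V"
 shows "lc V (n + k) a (\<lambda>i. (if i < n then A i else B (i - n)) w)
  = lc V n a (\<lambda>i. A i w) \<oplus>\<^sub>V lc V k (\<lambda>i. a (n + i)) (\<lambda>i. B i w)"
proof -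
 have "\<forall>i<n+k. (if i < n then A i else B (i - n)) w \<in> carrier V" using A B by simp
 from lc_split[OF a this]
 have "lc V (n + k) a (\<lambda>i. (if i < n then A i else B (i - n)) w)
  = lc V n a (\<lambda>i. (if i < n then A i else B (i - n)) w) \<oplus>\<^sub>V
   lc V k (\<lambda>i. a (n + i)) (\<lambda>i. (if n + i < n then A (n + i) else B (n + i - n)) w)" .
 moreover have "lc V n a (\<lambda>i. (if i < n then A i else B (i - n)) w) = lc V n a (\<lambda>i. A i w)"
  by (rule lc_cong) simp_all
 moreover have "lc V k (\<lambda>i. a (n + i)) (\<lambda>i. (if n + i < n then A (n + i) else B (n + i - n)) w) = lc V k (\<lambda>i. a (n + i)) (\<lambda>i. B i w)"
  by (rule lc_cong) simp_all
 ultimately show ?thesis by simp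
qed

lemma comm_end_carrier: "submodule K W V ==> comm_end K V S T W \<phi> ==> w \<in> W ==> \<phi> w \<in> carrier V"
 unfolding comm_end_def linear_on_def by blast

text \<open>Composing a centralizer element of \<open>S W\<close> with \<open>S\<close> gives one of \<open>W\<close> that maps into \<open>S W\<close> and kills the kernel of \<open>S\<close>. The \<open>l\<close>
elements of \<open>new_endomorphisms\<close> are independent modulo all of these.\<close>

lemma image_endomorphisms_bound:
 assumes W: "stable W" and b: "rel_basis K V W (S ` W) l v" and l: "0 < l"
  and nilS: "\<And>w. w \<in> W ==> (S ^^ p) w = \<zero>\<^bsub>V\<^esub>"
  and \<psi>: "\<forall>i<k. comm_end K V S T (S ` W) (\<psi> i)" "mindep K V (S ` W) k \<psi>"
 shows "\<exists>\<phi>. (\<forall>i<l+k. comm_end K V S T W (\<phi> i)) \<and> mindep K V W (l + k) \<phi>"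
proof -
 interpret M: shift_model K V S T W v l p
  by unfold_locales (use W b l nilS in auto)
 note Wd = stableD[OF W]
 note SW = stable_image_S[OF W]
 note SWd = stableD[OF SW(1)]
 define \<Phi> where "\<Phi> r = M.ph (M.bb r)" for r
 define B where "B i = (\<lambda>w. \<psi> i (S w))" for i
 have \<Phi>: "comm_end K V S T W (\<Phi> r)" if "r < l" for r
  unfolding \<Phi>_def by (rule M.ph_comm_end[OF M.dd_bb(2)[OF that]])
 have Bc: "comm_end K V S T W (B i)" "\<And>w. w \<in> W ==> B i w \<in> S ` W" "\<And>w. w \<in> W ==> S w = \<zero>\<^bsub>V\<^esub> ==> B i w = \<zero>\<^bsub>V\<^esub>" if i: "i < k" for i
 proof -
  have c: "comm_end K V S T (S ` W) (\<psi> i)" using \<psi>(1) i by blast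
  then have lin: "linear_on K V V (S ` W) (\<psi> i)" and st: "\<And>w. w \<in> S ` W ==> \<psi> i w \<in> S ` W \<and> \<psi> i (S w) = S (\<psi> i w) \<and> \<psi> i (T w) = T (\<psi> i w)"
   by (auto simp: comm_end_def)
  have Sl: "linear_on K V V W S" by (rule stable_W_linear(1)[OF W])
  have "linear_on K V V W (B i)"
   unfolding B_def using linear_onD[OF lin] linear_onD(2,3)[OF Sl] by (intro linear_onI) simp_all
  moreover have "B i w \<in> W \<and> B i (S w) = S (B i w) \<and> B i (T w) = T (B i w)" if "w \<in> W" for w
   unfolding B_def using st[OF imageI[OF that]] SW(2) ST_commute[OF sub_carrier[OF Wd(1) that]] by auto
  ultimately show "comm_end K V S T W (B i)" unfolding comm_end_def by blast
  show "B i w \<in> S ` W" if "w \<in> W" for w unfolding B_def using st[OF imageI[OF that]] by blast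
  show "B i w = \<zero>\<^bsub>V\<^esub>" if "S w = \<zero>\<^bsub>V\<^esub>" for w
   unfolding B_def that using linear_on_zero[OF SWd(1) vectorspace_axioms lin] .
 qed
 let ?\<phi> = "\<lambda>i. if i < l then \<Phi> i else B (i - l)"
 have "mindep K V W (l + k) ?\<phi>"
 proof (rule mindepI)
  fix a j assume a: "\<And>i. i < l + k ==> a i \<in> carrier K" and h: "\<And>w. w \<in> W ==> lc V (l + k) a (\<lambda>i. ?\<phi> i w) = \<zero>\<^bsub>V\<^esub>" and j: "j < l + k"
  have a1: "\<forall>i<l+k. a i \<in> carrier K" "\<forall>i<l. a i \<in> carrier K" "\<forall>i<k. a (l + i) \<in> carrier K" using a by simp_all
  have PV: "\<Phi> i w \<in> carrier V" if "i < l" "w \<in> W" for i w by (rule comm_end_carrier[OF Wd(1) \<Phi>[OF that(1)] that(2)])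
  have BV: "B i w \<in> carrier V" if "i < k" "w \<in> W" for i w by (rule comm_end_carrier[OF Wd(1) Bc(1)[OF that(1)] that(2)])
  have sum: "lc V l a (\<lambda>r. \<Phi> r w) \<oplus>\<^bsub>V\<^esub> lc V k (\<lambda>i. a (l + i)) (\<lambda>i. B i w) = \<zero>\<^bsub>V\<^esub>" if w: "w \<in> W" for w
   using h[OF w] lc_append[OF a1(1), of \<Phi> w B] PV[OF _ w] BV[OF _ w] by simp
  have cl: "lc V l a (\<lambda>r. \<Phi> r w) \<in> carrier V" "lc V k (\<lambda>i. a (l + i)) (\<lambda>i. B i w) \<in> carrier V" if w: "w \<in> W" for w
   using a1 PV[OF _ w] BV[OF _ w] by (auto intro!: lc_closed)
  have al: "a r = \<zero>\<^bsub>K\<^esub>" if r: "r < l" for r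
  proof (rule M.new_endomorphisms[OF a1(2) _ _ r])
   fix w assume w: "w \<in> W"
   have inSW: "lc V k (\<lambda>i. a (l + i)) (\<lambda>i. B i w) \<in> S ` W"
    using a1(3) Bc(2)[OF _ w] by (intro lc_in[OF SWd(1)]) blast+
   have "lc V l a (\<lambda>r. \<Phi> r w) = \<ominus>\<^bsub>V\<^esub> lc V k (\<lambda>i. a (l + i)) (\<lambda>i. B i w)"
    using sum[OF w] cl[OF w] by (simp add: M.minus_equality)
   then show "lc V l a (\<lambda>r. M.ph (M.bb r) w) \<in> S ` W"
    using sub_uminus[OF SWd(1) inSW] by (simp add: \<Phi>_def)
  next
   fix w assume w: "w \<in> W" "S w = \<zero>\<^bsub>V\<^esub>"
   have "lc V k (\<lambda>i. a (l + i)) (\<lambda>i. B i w) = \<zero>\<^bsub>V\<^esub>"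
    using a1(3) Bc(3)[OF _ w] by (intro lc_vec_zero) blast+
   then show "lc V l a (\<lambda>r. M.ph (M.bb r) w) = \<zero>\<^bsub>V\<^esub>" using sum[OF w(1)] cl[OF w(1)] by (simp add: \<Phi>_def)
  qed
  have ak: "a (l + i) = \<zero>\<^bsub>K\<^esub>" if i: "i < k" for i
  proof (rule mindepD[OF \<psi>(2), of "\<lambda>i. a (l + i)", OF _ _ i])
   show "a (l + i) \<in> carrier K" if "i < k" for i using a1(3) that by blast
   fix x assume "x \<in> S ` W"
   then obtain w where w: "w \<in> W" "x = S w" by blast
   have "lc V l a (\<lambda>r. \<Phi> r w) = \<zero>\<^bsub>V\<^esub>" using al PV[OF _ w(1)] by (intro lc_coeff_zero) blast+
   then show "lc V k (\<lambda>i. a (l + i)) (\<lambda>i. \<psi> i x) = \<zero>\<^bsub>V\<^esub>"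
    using sum[OF w(1)] cl[OF w(1)] by (simp add: B_def w(2))
  qed
  show "a j = \<zero>\<^bsub>K\<^esub>" using al[of j] ak[of "j - l"] j by (cases "j < l") simp_all
 qed
 moreover have "\<forall>i<l+k. comm_end K V S T W (?\<phi> i)" using \<Phi> Bc(1) by simp
 ultimately show ?thesis by (intro exI[of _ ?\<phi>] conjI)
qed

text \<open>Induction on the nilpotency index of \<open>S\<close>, passing from \<open>W\<close> to \<open>S W\<close>, of codimension \<open>l\<close>. By \<open>image_endomorphisms_bound\<close> the hypothesis is
inherited by \<open>S W\<close>, so the induction hypothesis gives \<open>n - l\<close> elements of \<open>alg\<close> that are independent on \<open>S W\<close>. Together with
them, centralizer elements that vanish on \<open>S W\<close> stay independent, so at most \<open>l\<close> of the latter are. According to whether \<open>T\<close> has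
the smaller nilpotency index on \<open>W/S W\<close> or on the kernel of \<open>S\<close>, this makes \<open>W\<close> cocyclic or cyclic, and then \<open>alg\<close> is as large as \<open>W\<close>.\<close>

theorem alg_indep:
 assumes "stable W" "rel_basis K V W {\<zero>\<^sub>V} n v"
  and "\<And>w. w \<in> W ==> (S ^^ p) w = \<zero>\<^sub>V" "\<And>w. w \<in> W ==> (T ^^ q) w = \<zero>\<^sub>V"
  and "\<And>\<phi>. (\<forall>i<Suc n. comm_end K V S T W (\<phi> i)) ==> mindep K V W (Suc n) \<phi> ==> False"
 shows "\<exists>\<rho>. (\<forall>i<n. \<rho> i \<in> alg) \<and> mindep K V W n \<rho>"
 using assms
proof (induction p arbitrary: W n v)
 case 0
 have "n = 0"
 proof (rule ccontr)
  assume "n \<noteq> 0"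
  then have "0 < n" by simp
  from rel_basis_notin[OF stableD(1)[OF 0(1)] 0(2) this] rel_basisD(1)[OF 0(2) this] 0(3)[of "v 0"]
  show False by simp
 qed
 then show ?case by (simp add: mindep_def)
next
 case (Suc p)
 note W = Suc.prems(1) and b0 = Suc.prems(2) and nilS = Suc.prems(3) and nilT = Suc.prems(4) and noE = Suc.prems(5)
 note Wd = stableD[OF W]
 note SW = stable_image_S[OF W]
 note SWd = stableD[OF SW(1)]
 have z0: "{\<zero>\<^sub>V} \<subseteq> S ` W" using submodule.zero_closed[OF SWd(1)] by simp
 obtain l v' n' w' where b: "rel_basis K V W (S ` W) l v'" and b': "rel_basis K V (S ` W) {\<zero>\<^sub>V} n' w'" and n: "n = l + n'"
  by (rule subspace_basis[OF submodule_zero SWd(1) Wd(1) z0 SW(2) b0])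
 have nilSW: "(S ^^ p) x = \<zero>\<^sub>V" if xS: "x \<in> S ` W" for x
 proof -
  obtain w where w: "w \<in> W" "x = S w" using xS by blast
  have "(S ^^ p) x = (S ^^ Suc p) w" unfolding w(2) by (simp only: funpow_Suc_right o_apply)
  then show ?thesis using nilS[OF w(1)] by simp
 qed
 show ?case
 proof (cases "l = 0")
  case True
  have "W \<subseteq> S ` W"
  proof
   fix w assume w: "w \<in> W"
   then have "w \<ominus>\<^sub>V \<zero>\<^sub>V \<in> S ` W" using rel_basisD(3)[OF b w] True by simp
   then show "w \<in> S ` W" using sub_carrier[OF Wd(1) w] by (simp add: a_minus_def)
  qed
  then have nil': "(S ^^ p) w = \<zero>\<^sub>V" if "w \<in> W" for w using nilSW that by blast
  show ?thesis by (rule Suc.IH[OF W b0]) (fact nil' nilT noE)+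
 next
  case False
  then have l: "0 < l" by simp
  have nilTW: "(T ^^ q) x = \<zero>\<^sub>V" if "x \<in> S ` W" for x using nilT SW(2) that by blast
  have "\<exists>\<rho>. (\<forall>i<n'. \<rho> i \<in> alg) \<and> mindep K V (S ` W) n' \<rho>"
  proof (rule Suc.IH[OF SW(1) b' nilSW nilTW])
   fix \<psi> assume "\<forall>i<Suc n'. comm_end K V S T (S ` W) (\<psi> i)" "mindep K V (S ` W) (Suc n') \<psi>"
   from image_endomorphisms_bound[OF W b l nilS this]
   show False using noE n by auto
  qed
  then obtain \<rho> where \<rho>: "\<forall>i<n'. \<rho> i \<in> alg" "mindep K V (S ` W) n' \<rho>" by blast
  have noH: False if \<chi>: "\<forall>i<Suc l. comm_end K V S T W (\<chi> i) \<and> (\<forall>w\<in>S ` W. \<chi> i w = \<zero>\<^sub>V)" "mindep K V W (Suc l) \<chi>" for \<chi>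
  proof -
   let ?\<phi> = "\<lambda>i. if i < n' then \<rho> i else \<chi> (i - n')"
   have \<rho>c: "comm_end K V S T W (\<rho> i)" if "i < n'" for i using alg_comm_end[OF W] \<rho>(1) that by blast
   have RV: "\<rho> i w \<in> carrier V" if "i < n'" "w \<in> W" for i w by (rule comm_end_carrier[OF Wd(1) \<rho>c[OF that(1)] that(2)])
   have XV: "\<chi> i w \<in> carrier V" if "i < Suc l" "w \<in> W" for i w using comm_end_carrier[OF Wd(1) _ that(2)] \<chi>(1) that(1) by blast
   have "mindep K V W (n' + Suc l) ?\<phi>"
   proof (rule mindepI)
    fix a j assume a: "\<And>i. i < n' + Suc l ==> a i \<in> carrier K"
     and h: "\<And>w. w \<in> W ==> lc V (n' + Suc l) a (\<lambda>i. ?\<phi> i w) = \<zero>\<^sub>V" and j: "j < n' + Suc l"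
    have a1: "\<forall>i<n'+Suc l. a i \<in> carrier K" "\<forall>i<n'. a i \<in> carrier K" "\<forall>i<Suc l. a (n' + i) \<in> carrier K" using a by simp_all
    have sum: "lc V n' a (\<lambda>i. \<rho> i w) \<oplus>\<^sub>V lc V (Suc l) (\<lambda>i. a (n' + i)) (\<lambda>i. \<chi> i w) = \<zero>\<^sub>V" if w: "w \<in> W" for w
     using h[OF w] lc_append[OF a1(1), of \<rho> w \<chi>] RV[OF _ w] XV[OF _ w] by (simp del: lc.simps)
    have cl: "lc V n' a (\<lambda>i. \<rho> i w) \<in> carrier V" "lc V (Suc l) (\<lambda>i. a (n' + i)) (\<lambda>i. \<chi> i w) \<in> carrier V" if w: "w \<in> W" for w
     using lc_closed[of n' a "\<lambda>i. \<rho> i w"] lc_closed[of "Suc l" "\<lambda>i. a (n' + i)" "\<lambda>i. \<chi> i w"] a1 RV[OF _ w] XV[OF _ w] by blast+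
    have ar: "a i = \<zero>\<^sub>K" if i: "i < n'" for i
    proof (rule mindepD[OF \<rho>(2) _ _ i])
     show "a i \<in> carrier K" if "i < n'" for i using a1(2) that by blast
     fix x assume x: "x \<in> S ` W"
     then have xW: "x \<in> W" using SW(2) by blast
     have "lc V (Suc l) (\<lambda>i. a (n' + i)) (\<lambda>i. \<chi> i x) = \<zero>\<^sub>V" using a1(3) \<chi>(1) x by (intro lc_vec_zero) blast+
     then show "lc V n' a (\<lambda>i. \<rho> i x) = \<zero>\<^sub>V" using sum[OF xW] cl[OF xW] by (simp del: lc.simps)
    qed
    have ac: "a (n' + i) = \<zero>\<^sub>K" if i: "i < Suc l" for i
    proof (rule mindepD[OF \<chi>(2), of "\<lambda>i. a (n' + i)", OF _ _ i])
     show "a (n' + i) \<in> carrier K" if "i < Suc l" for i using a1(3) that by blast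
     fix w assume w: "w \<in> W"
     have "lc V n' a (\<lambda>i. \<rho> i w) = \<zero>\<^sub>V" using ar RV[OF _ w] by (intro lc_coeff_zero) blast+
     then show "lc V (Suc l) (\<lambda>i. a (n' + i)) (\<lambda>i. \<chi> i w) = \<zero>\<^sub>V" using sum[OF w] cl[OF w] by (simp del: lc.simps)
    qed
    show "a j = \<zero>\<^sub>K" using ar[of j] ac[of "j - n'"] j by (cases "j < n'") simp_all
   qed
   moreover have "n' + Suc l = Suc n" using n by simp
   moreover have "\<forall>i<n'+Suc l. comm_end K V S T W (?\<phi> i)" using \<rho>c \<chi>(1) by simp
   ultimately show False using noE[of ?\<phi>] by simp
  qed
  obtain z where zb: "rel_basis K V {w \<in> W. S w = \<zero>\<^sub>V} {\<zero>\<^sub>V} l z"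
   by (rule kernel_basis[OF W b0[unfolded n] b'])
  have zW: "z i \<in> W" "S (z i) = \<zero>\<^sub>V" if "i < l" for i using rel_basisD(1)[OF zb that] by simp_all
  have Zs: "submodule K {\<zero>\<^sub>V} V" by (rule submodule_zero)
  have z0n: "z 0 \<noteq> \<zero>\<^sub>V"
  proof
   assume z00: "z 0 = \<zero>\<^sub>V"
   let ?d = "\<lambda>i. if i = 0 then \<one>\<^sub>K else \<zero>\<^sub>K"
   have "\<forall>i<l. z i \<in> carrier V" using zW(1) sub_carrier[OF Wd(1)] by blast
   then have "lc V l ?d z = \<one>\<^sub>K \<odot>\<^sub>V z 0" using l by (intro lc_delta) simp_all
   then have "lc V l ?d z \<in> {\<zero>\<^sub>V}" using z00 by simp
   moreover have "?d i \<in> carrier K" for i :: nat by simp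
   ultimately have "?d (0::nat) = \<zero>\<^sub>K" using rel_indepD[OF rel_basisD(2)[OF zb] _ _ l, of ?d] by blast
   then show False by simp
  qed
  \<comment> \<open>Nilpotency indices of \<open>T\<close> on \<open>W/S W\<close> and on the kernel of \<open>S\<close>.\<close>
  define m1 where "m1 = (LEAST m. \<forall>u\<in>W. (T ^^ m) u \<in> S ` W)"
  define m2 where "m2 = (LEAST m. \<forall>w\<in>W. S w = \<zero>\<^sub>V \<longrightarrow> (T ^^ m) w = \<zero>\<^sub>V)"
  have "\<forall>u\<in>W. (T ^^ q) u \<in> S ` W" using nilT z0 by simp
  then have m1: "\<forall>u\<in>W. (T ^^ m1) u \<in> S ` W" unfolding m1_def by (rule LeastI)
  have "\<forall>w\<in>W. S w = \<zero>\<^sub>V \<longrightarrow> (T ^^ q) w = \<zero>\<^sub>V" using nilT by simp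
  then have m2: "\<forall>w\<in>W. S w = \<zero>\<^sub>V \<longrightarrow> (T ^^ m2) w = \<zero>\<^sub>V" unfolding m2_def by (rule LeastI)
  have "m1 \<noteq> 0"
  proof
   assume "m1 = 0"
   then have "v' 0 \<in> S ` W" using m1 rel_basisD(1)[OF b l] by simp
   then show False using rel_basis_notin[OF Wd(1) b l] by simp
  qed
  then obtain k1 where k1: "m1 = Suc k1" by (cases m1) simp_all
  have "m2 \<noteq> 0" using m2 zW[OF l] z0n by (metis funpow_0)
  then obtain k2 where k2: "m2 = Suc k2" by (cases m2) simp_all
  have "\<not> (\<forall>u\<in>W. (T ^^ k1) u \<in> S ` W)" using not_less_Least[of k1 "\<lambda>m. \<forall>u\<in>W. (T ^^ m) u \<in> S ` W"] k1 by (simp add: m1_def[symmetric])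
  then obtain u0 where u0: "u0 \<in> W" "(T ^^ k1) u0 \<notin> S ` W" by blast
  have "\<not> (\<forall>w\<in>W. S w = \<zero>\<^sub>V \<longrightarrow> (T ^^ k2) w = \<zero>\<^sub>V)"
   using not_less_Least[of k2 "\<lambda>m. \<forall>w\<in>W. S w = \<zero>\<^sub>V \<longrightarrow> (T ^^ m) w = \<zero>\<^sub>V"] k2 by (simp add: m2_def[symmetric])
  then obtain w0 where w0: "w0 \<in> W" "S w0 = \<zero>\<^sub>V" "(T ^^ k2) w0 \<noteq> \<zero>\<^sub>V" by blast
  show ?thesis
  proof (cases "m1 \<le> m2")
   case True
   have mW: "(T ^^ Suc k2) u \<in> S ` W" if "u \<in> W" for u
   proof -
    have "(T ^^ Suc k2) u = (T ^^ (m2 - m1)) ((T ^^ m1) u)"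
     using funpow_add[of "m2 - m1" m1 T] True k2 by (simp only: o_apply le_add_diff_inverse2)
    then show ?thesis using T_pow_in[OF SW(1) bspec[OF m1 that]] by (simp only:)
   qed
   have w0': "(T ^^ Suc k2) w0 = \<zero>\<^sub>V" using m2 w0 k2 by blast
   have "\<exists>f. linear_on K V scalars W f \<and> (\<forall>w\<in>W. (\<forall>a\<in>alg. f (a w) = \<zero>\<^sub>K) \<longrightarrow> w = \<zero>\<^sub>V)"
    by (rule cocyclic_or_extra[OF W b l b0 _ _ w0 w0']) (fact nilS nilT mW noH)+
   then show ?thesis using alg_indep_of_cocyclic[OF W b0] by blast
  next
   case False
   have zz: "z i \<in> W \<and> S (z i) = \<zero>\<^sub>V \<and> (T ^^ Suc k1) (z i) = \<zero>\<^sub>V" if i: "i < l" for i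
   proof -
    have "(T ^^ m2) (z i) = \<zero>\<^sub>V" using m2 zW[OF i] by simp
    moreover have "m2 \<le> Suc k1" using False k1 by simp
    ultimately have "(T ^^ Suc k1) (z i) = \<zero>\<^sub>V" by (rule T_pow_vanish[OF W])
    then show ?thesis using zW[OF i] by simp
   qed
   obtain a where a: "a \<in> alg" "a (z 0) \<in> W" "a (z 0) \<noteq> \<zero>\<^sub>V" "S (a (z 0)) = \<zero>\<^sub>V" "T (a (z 0)) = \<zero>\<^sub>V"
    by (rule nonzero_in_socle[OF W nilS[OF zW(1)[OF l]] nilT zW(1)[OF l] z0n])
   have mW: "(T ^^ Suc k1) u \<in> S ` W" if "u \<in> W" for u using m1 that k1 by blast
   have "\<forall>w\<in>W. \<exists>a\<in>alg. w = a u0"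
    by (rule cyclic_or_extra[OF W b _ _ _ rel_basisD(2)[OF zb] a(2-5) u0]) (fact nilS nilT zz mW noH)+
   then show ?thesis by (rule alg_indep_of_cyclic[OF W b0 u0(1)])
  qed
 qed
qed

end

section \<open>One-dimensional local domains\<close>

lemma (in noetherian_ring) ideal_maximal_exists:
 assumes "FF \<noteq> {}" "\<And>\<aa>. \<aa> \<in> FF ==> ideal \<aa> R"
 shows "\<exists>M\<in>FF. \<forall>\<aa>\<in>FF. M \<subseteq> \<aa> \<longrightarrow> \<aa> = M"
proof (rule subset_Zorn_nonempty[OF assms(1)])
 fix C assume C: "C \<noteq> {}" "subset.chain FF C"
 have "subset.chain {\<aa>. ideal \<aa> R} C" using C(2) assms(2) unfolding pred_on.chain_def by blast
 from ideal_chain_is_trivial[OF C(1) this] show "\<Union>C \<in> FF" using C(2) unfolding pred_on.chain_def by blast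
qed

lemma (in noetherian_ring) maximal_ideal_above:
 assumes "ideal \<aa> R" "\<one> \<notin> \<aa>"
 shows "\<exists>M. maximalideal M R \<and> \<aa> \<subseteq> M"
proof -
 let ?S = "{J. ideal J R \<and> \<aa> \<subseteq> J \<and> \<one> \<notin> J}"
 obtain M where M: "M \<in> ?S" "\<forall>J\<in>?S. M \<subseteq> J \<longrightarrow> J = M"
  using ideal_maximal_exists[of ?S] assms by blast
 have "maximalideal M R"
 proof (rule maximalidealI)
  show "ideal M R" using M(1) by simp
  show "carrier R \<noteq> M" using M(1) by auto
  fix J assume J: "ideal J R" "M \<subseteq> J" "J \<subseteq> carrier R"
  show "J = M \<or> J = carrier R"
  proof (cases "\<one> \<in> J")
   case True
   then show ?thesis using ideal.one_imp_carrier[OF J(1)] by simp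
  next
   case False
   then have "J \<in> ?S" using J M(1) by blast
   then show ?thesis using M(2) J(2) by blast
  qed
 qed
 then show ?thesis using M(1) by blast
qed

text \<open>A noetherian local domain of Krull dimension at most one: a nonzero prime ideal is the maximal ideal \<open>\<mm>\<close>.\<close>

locale one_dim_domain = noetherian_domain R for R (structure) +
 fixes \<mm>
 assumes maximal_unique: "{J. maximalideal J R} = {\<mm>}"
  and prime_maximal: "primeideal P R ==> P \<noteq> {\<zero>} ==> P = \<mm>"
begin

definition adjoin :: "'a set \<Rightarrow> 'a \<Rightarrow> 'a set" where
 "adjoin \<aa> b = {a \<oplus> r \<otimes> b | a r. a \<in> \<aa> \<and> r \<in> carrier R}"

primrec mpow :: "nat \<Rightarrow> 'a set" where
 "mpow 0 = carrier R"
| "mpow (Suc n) = ideal_prod R \<mm> (mpow n)"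

lemma ideal_facts:
 assumes "ideal \<aa> R"
 shows "\<aa> \<subseteq> carrier R" "x \<in> \<aa> ==> x \<in> carrier R" "\<zero> \<in> \<aa>" "x \<in> \<aa> ==> y \<in> \<aa> ==> x \<oplus> y \<in> \<aa>"
  "x \<in> \<aa> ==> r \<in> carrier R ==> r \<otimes> x \<in> \<aa>" "x \<in> \<aa> ==> r \<in> carrier R ==> x \<otimes> r \<in> \<aa>" "x \<in> \<aa> ==> \<ominus> x \<in> \<aa>"
  "x \<in> \<aa> ==> y \<in> \<aa> ==> x \<ominus> y \<in> \<aa>"
proof -
 interpret idl: ideal \<aa> R by (rule assms)
 show "\<aa> \<subseteq> carrier R" by (rule idl.a_subset)
 show "x \<in> \<aa> ==> x \<in> carrier R" by (rule idl.a_Hcarr)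
 show "\<zero> \<in> \<aa>" by (rule idl.zero_closed)
 show "x \<in> \<aa> ==> y \<in> \<aa> ==> x \<oplus> y \<in> \<aa>" by (rule idl.a_closed)
 show "x \<in> \<aa> ==> r \<in> carrier R ==> r \<otimes> x \<in> \<aa>" by (rule idl.I_l_closed)
 show "x \<in> \<aa> ==> r \<in> carrier R ==> x \<otimes> r \<in> \<aa>" by (rule idl.I_r_closed)
 show m: "x \<in> \<aa> ==> \<ominus> x \<in> \<aa>" for x by (rule idl.a_inv_closed)
 show "x \<in> \<aa> ==> y \<in> \<aa> ==> x \<ominus> y \<in> \<aa>" unfolding a_minus_def using m idl.a_closed by blast
qed

lemma mm_maximal: "maximalideal \<mm> R"
 using maximal_unique by blast

lemma mm_ideal: "ideal \<mm> R"
 using mm_maximal by (rule maximalideal.axioms(1))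

lemma mm_proper: "\<one> \<notin> \<mm>"
proof
 assume "\<one> \<in> \<mm>"
 then have "carrier R = \<mm>" using ideal.one_imp_carrier[OF mm_ideal] by simp
 then show False using maximalideal.I_notcarr[OF mm_maximal] by simp
qed

lemma proper_ideal_in_mm: "ideal \<aa> R ==> \<one> \<notin> \<aa> ==> \<aa> \<subseteq> \<mm>"
 using maximal_ideal_above maximal_unique by blast

lemma nonunit_in_mm:
 assumes x: "x \<in> carrier R" "x \<notin> \<mm>"
 shows "x \<in> Units R"
proof (rule ccontr)
 assume nu: "x \<notin> Units R"
 have aa: "ideal (PIdl x) R" by (rule cgenideal_ideal[OF x(1)])
 have "\<one> \<notin> PIdl x"
 proof
  assume "\<one> \<in> PIdl x"
  then obtain y where "y \<in> carrier R" "\<one> = y \<otimes> x" unfolding cgenideal_def by blast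
  then have "x \<in> Units R" using x(1) m_comm by (auto simp: Units_def)
  then show False using nu by simp
 qed
 from proper_ideal_in_mm[OF aa this] cgenideal_self[OF x(1)] show False using x(2) by blast
qed

lemma PIdl_iff: "x \<in> PIdl a \<longleftrightarrow> (\<exists>r\<in>carrier R. x = r \<otimes> a)"
 unfolding cgenideal_def by blast

lemma adjoin_eq: "adjoin \<aa> b = \<aa> <+> PIdl b"
 unfolding adjoin_def set_add_def' cgenideal_def by blast

lemma adjoin_ideal: "ideal \<aa> R ==> b \<in> carrier R ==> ideal (adjoin \<aa> b) R"
 unfolding adjoin_eq by (rule add_ideals[OF _ cgenideal_ideal])

lemma adjoin_contains:
 assumes "ideal \<aa> R" "b \<in> carrier R"
 shows "\<aa> \<subseteq> adjoin \<aa> b" "b \<in> adjoin \<aa> b"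
proof -
 show "\<aa> \<subseteq> adjoin \<aa> b"
 proof
  fix x assume "x \<in> \<aa>"
  then show "x \<in> adjoin \<aa> b"
   unfolding adjoin_def using ideal_facts(2)[OF assms(1)] assms(2) by (intro CollectI exI[of _ x] exI[of _ \<zero>]) simp
 qed
 show "b \<in> adjoin \<aa> b"
  unfolding adjoin_def using ideal_facts(3)[OF assms(1)] assms(2) by (intro CollectI exI[of _ \<zero>] exI[of _ \<one>]) simp
qed

text \<open>Among the annihilators of nonzero elements of \<open>R/\<aa>\<close> a maximal one is prime. It contains \<open>\<aa>\<close>, so it is not zero and must be \<open>\<mm>\<close>.\<close>

lemma socle_element_exists:
 assumes aa: "ideal \<aa> R" "\<aa> \<noteq> {\<zero>}" "\<one> \<notin> \<aa>"
 obtains b where "b \<in> carrier R" "b \<notin> \<aa>" "\<And>x. x \<in> \<mm> ==> x \<otimes> b \<in> \<aa>"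
proof -
 note If = ideal_facts[OF aa(1)]
 let ?c = "\<lambda>b. {x \<in> carrier R. x \<otimes> b \<in> \<aa>}"
 have ci: "ideal (?c b) R" if b: "b \<in> carrier R" for b
 proof (rule idealI)
  show "ring R" by (rule ring_axioms)
  show "subgroup (?c b) (add_monoid R)"
  proof (rule add.subgroupI)
   show "?c b \<subseteq> carrier R" by blast
   show "?c b \<noteq> {}" using b If(3) zero_closed by (metis (mono_tags, lifting) empty_iff l_null mem_Collect_eq)
   show "\<ominus> a \<in> ?c b" if "a \<in> ?c b" for a using that b If(7) by (simp add: l_minus)
   show "a \<oplus> a' \<in> ?c b" if "a \<in> ?c b" "a' \<in> ?c b" for a a' using that b If(4) by (simp add: l_distr)
  qed
  show "x \<otimes> a \<in> ?c b" if "a \<in> ?c b" "x \<in> carrier R" for a x using that b If(5) by (simp add: m_assoc)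
  show "a \<otimes> x \<in> ?c b" if "a \<in> ?c b" "x \<in> carrier R" for a x
   using that b If(5)[of "a \<otimes> b" x] by (simp add: m_assoc m_lcomm)
 qed
 let ?S = "?c ` (carrier R - \<aa>)"
 have ne: "?S \<noteq> {}" using aa(3) by blast
 have "\<And>J. J \<in> ?S ==> ideal J R" using ci by blast
 from ideal_maximal_exists[OF ne this] obtain M where M: "M \<in> ?S" "\<forall>J\<in>?S. M \<subseteq> J \<longrightarrow> J = M" by (rule bexE)
 from M(1) obtain b where b0: "M = ?c b" "b \<in> carrier R - \<aa>" by (rule imageE)
 have b: "b \<in> carrier R" "b \<notin> \<aa>" using b0(2) by simp_all
 have max: "?c b' = ?c b" if "b' \<in> carrier R" "b' \<notin> \<aa>" "?c b \<subseteq> ?c b'" for b'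
  using M(2)[rule_format, of "?c b'"] that imageI[of b' "carrier R - \<aa>" ?c] unfolding b0(1) by simp
 have "primeideal (?c b) R"
 proof (rule primeidealI[OF ci[OF b(1)] is_cring])
  show "carrier R \<noteq> ?c b"
  proof
   assume "carrier R = ?c b"
   then have "\<one> \<in> ?c b" using one_closed by blast
   then show False using b by simp
  qed
  fix x y assume x: "x \<in> carrier R" and y: "y \<in> carrier R" and xy: "x \<otimes> y \<in> ?c b"
  show "x \<in> ?c b \<or> y \<in> ?c b"
  proof (rule ccontr)
   assume n: "\<not> ?thesis"
   then have yb: "y \<otimes> b \<notin> \<aa>" using y by simp
   have sub: "?c b \<subseteq> ?c (y \<otimes> b)"
   proof
    fix t assume t: "t \<in> ?c b"
    then have "y \<otimes> (t \<otimes> b) \<in> \<aa>" using If(5) y by simp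
    then show "t \<in> ?c (y \<otimes> b)" using t y b by (simp add: m_lcomm)
   qed
   have "x \<in> ?c (y \<otimes> b)" using xy x y b by (simp add: m_assoc)
   then have "x \<in> ?c b" using max[OF _ yb sub] y b(1) by simp
   then show False using n by simp
  qed
 qed
 moreover have "?c b \<noteq> {\<zero>}"
 proof -
  obtain a where a: "a \<in> \<aa>" "a \<noteq> \<zero>" using aa(2) If(3) by blast
  then have "a \<in> ?c b" using If(2,6) b(1) by simp
  then show ?thesis using a(2) by blast
 qed
 ultimately have e: "?c b = \<mm>" by (rule prime_maximal)
 show ?thesis
 proof (rule that[OF b])
  fix x assume "x \<in> \<mm>"
  then have "x \<in> ?c b" unfolding e .
  then show "x \<otimes> b \<in> \<aa>" by simp
 qed
qed

lemma mpow_ideal: "ideal (mpow n) R"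
proof (induction n)
 case 0
 show ?case by (simp add: oneideal)
next
 case (Suc n)
 then show ?case by (simp add: ideal_prod_is_ideal[OF mm_ideal])
qed

lemma ideal_prod_least:
 assumes aa: "ideal \<aa> R" and h: "\<And>x y. x \<in> A ==> y \<in> B ==> x \<otimes> y \<in> \<aa>"
 shows "ideal_prod R A B \<subseteq> \<aa>"
proof
 fix s assume "s \<in> ideal_prod R A B"
 then show "s \<in> \<aa>" by (induction rule: ideal_prod.induct) (auto intro: h ideal_facts(4)[OF aa])
qed

text \<open>A largest nonzero ideal that contains no power of \<open>\<mm>\<close> would acquire one after adjoining a socle element \<open>b\<close>; one more factor \<open>\<mm>\<close> then removes \<open>b\<close>.\<close>

lemma mpow_in_ideal:
 assumes "ideal \<aa> R" "\<aa> \<noteq> {\<zero>}"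
 shows "\<exists>n. mpow n \<subseteq> \<aa>"
proof (rule ccontr)
 assume n: "\<not> ?thesis"
 let ?S = "{J. ideal J R \<and> J \<noteq> {\<zero>} \<and> (\<forall>n. \<not> mpow n \<subseteq> J)}"
 have ne: "?S \<noteq> {}" using n assms by blast
 have "ideal J R" if "J \<in> ?S" for J using that by simp
 from ideal_maximal_exists[OF ne this] obtain J where J0: "J \<in> ?S" "\<forall>J'\<in>?S. J \<subseteq> J' \<longrightarrow> J' = J" by (rule bexE)
 have J: "ideal J R" "J \<noteq> {\<zero>}" "\<And>n. \<not> mpow n \<subseteq> J" using J0(1) by simp_all
 have max: "J' = J" if "J' \<in> ?S" "J \<subseteq> J'" for J' using J0(2) that by simp
 note Jf = ideal_facts[OF J(1)]
 have "\<one> \<notin> J"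
 proof
  assume "\<one> \<in> J"
  then have "mpow 0 \<subseteq> J" using ideal.one_imp_carrier[OF J(1)] by simp
  then show False using J(3) by blast
 qed
 from socle_element_exists[OF J(1,2) this] obtain b where b: "b \<in> carrier R" "b \<notin> J" "\<And>x. x \<in> \<mm> ==> x \<otimes> b \<in> J" by blast
 note adj = adjoin_ideal[OF J(1) b(1)] and adjc = adjoin_contains[OF J(1) b(1)]
 have "adjoin J b \<noteq> J" using adjc(2) b(2) by blast
 then have "adjoin J b \<notin> ?S" using max adjc(1) by blast
 moreover have "adjoin J b \<noteq> {\<zero>}"
 proof
  assume h: "adjoin J b = {\<zero>}"
  then have "J \<subseteq> {\<zero>}" using adjc(1) by simp
  then show False using J(2) Jf(3) by blast
 qed
 ultimately obtain n where n: "mpow n \<subseteq> adjoin J b" using adj by blast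
 have "mpow (Suc n) \<subseteq> J" unfolding mpow.simps
 proof (rule ideal_prod_least[OF J(1)])
  fix x y assume x: "x \<in> \<mm>" and y: "y \<in> mpow n"
  then obtain a r where a: "y = a \<oplus> r \<otimes> b" "a \<in> J" "r \<in> carrier R" using n unfolding adjoin_def by blast
  have xc: "x \<in> carrier R" by (rule ideal_facts(2)[OF mm_ideal x])
  have "x \<otimes> y = x \<otimes> a \<oplus> r \<otimes> (x \<otimes> b)" using a b(1) xc Jf(2) by (simp add: r_distr m_lcomm)
  then show "x \<otimes> y \<in> J" using Jf(4,5) a b(3)[OF x] xc by simp
 qed
 then show False using J(3) by blast
qed

lemma cancel_left: "u \<in> carrier R ==> u \<noteq> \<zero> ==> a \<in> carrier R ==> b \<in> carrier R ==> u \<otimes> a = u \<otimes> b ==> a = b"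
 using m_lcancel by blast

abbreviation Rmod :: "('a, 'a) module" where "Rmod \<equiv> ideal_module R (carrier R)"

lemma ideal_module_simps [simp]:
 "carrier (ideal_module R \<aa>) = \<aa>" "\<zero>\<^bsub>ideal_module R \<aa>\<^esub> = \<zero>" "x \<oplus>\<^bsub>ideal_module R \<aa>\<^esub> y = x \<oplus> y"
 "x \<odot>\<^bsub>ideal_module R \<aa>\<^esub> y = x \<otimes> y"
 by (simp_all add: ideal_module_def)

lemma linear_on_zero':
 assumes N: "module R N" and aa: "ideal \<aa> R" and g: "linear_on R Rmod N \<aa> g"
 shows "g \<zero> = \<zero>\<^bsub>N\<^esub>"
proof -
 interpret N: module R N by (rule N)
 have "g (\<zero> \<otimes> \<zero>) = \<zero> \<odot>\<^bsub>N\<^esub> g \<zero>" using linear_onD(3)[OF g, of \<zero> \<zero>] ideal_facts(3)[OF aa] by simp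
 then show ?thesis using linear_onD(1)[OF g ideal_facts(3)[OF aa]] by simp
qed

lemma linear_on_minus':
 assumes N: "module R N" and aa: "ideal \<aa> R" and g: "linear_on R Rmod N \<aa> g" and x: "x \<in> \<aa>" "y \<in> \<aa>"
 shows "g (x \<ominus> y) = g x \<ominus>\<^bsub>N\<^esub> g y"
proof -
 interpret N: module R N by (rule N)
 note If = ideal_facts[OF aa]
 have yc: "y \<in> carrier R" by (rule If(2)[OF x(2)])
 have "g ((\<ominus> \<one>) \<otimes> y) = (\<ominus> \<one>) \<odot>\<^bsub>N\<^esub> g y" using linear_onD(3)[OF g _ x(2), of "\<ominus> \<one>"] by simp
 moreover have "(\<ominus> \<one>) \<otimes> y = \<ominus> y" using yc by (simp add: l_minus)
 moreover have "(\<ominus> \<one>) \<odot>\<^bsub>N\<^esub> g y = \<ominus>\<^bsub>N\<^esub> g y" using linear_onD(1)[OF g x(2)] by (simp add: N.smult_l_minus)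
 ultimately have "g (\<ominus> y) = \<ominus>\<^bsub>N\<^esub> g y" by simp
 moreover have "g (x \<oplus> \<ominus> y) = g x \<oplus>\<^bsub>N\<^esub> g (\<ominus> y)" using linear_onD(2)[OF g x(1) If(7)[OF x(2)]] by simp
 ultimately show ?thesis by (simp add: a_minus_def)
qed

text \<open>A homomorphism on \<open>\<aa>\<close> extends to \<open>\<aa> + Rb\<close> with value \<open>z\<close> at \<open>b\<close> once the two prescriptions agree on \<open>\<aa> \<inter> Rb\<close>. The set \<open>Z\<close> is a submodule that is to contain all values.\<close>

lemma extend_hom:
 assumes N: "module R N" and aa: "ideal \<aa> R" and b: "b \<in> carrier R" and g: "linear_on R Rmod N \<aa> g"
  and z: "z \<in> carrier N" and compat: "\<And>r. r \<in> carrier R ==> r \<otimes> b \<in> \<aa> ==> g (r \<otimes> b) = r \<odot>\<^bsub>N\<^esub> z"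
  and Z: "Z \<subseteq> carrier N" "\<And>x. x \<in> \<aa> ==> g x \<in> Z" "z \<in> Z" "\<And>x y. x \<in> Z ==> y \<in> Z ==> x \<oplus>\<^bsub>N\<^esub> y \<in> Z"
   "\<And>r x. r \<in> carrier R ==> x \<in> Z ==> r \<odot>\<^bsub>N\<^esub> x \<in> Z"
 shows "\<exists>g'. linear_on R Rmod N (adjoin \<aa> b) g' \<and> (\<forall>x\<in>\<aa>. g' x = g x) \<and> g' b = z \<and> (\<forall>x\<in>adjoin \<aa> b. g' x \<in> Z)"
proof -
 interpret N: module R N by (rule N)
 note If = ideal_facts[OF aa]
 define P where "P x p \<longleftrightarrow> fst p \<in> \<aa> \<and> snd p \<in> carrier R \<and> x = fst p \<oplus> snd p \<otimes> b" for x p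
 define val where "val p = g (fst p) \<oplus>\<^bsub>N\<^esub> snd p \<odot>\<^bsub>N\<^esub> z" for p
 have gN: "g x \<in> carrier N" if "x \<in> \<aa>" for x using linear_onD(1)[OF g that] .
 have uniq: "val p = val q" if p: "P x p" and q: "P x q" for x p q
 proof -
  obtain a r a' r' where pq: "p = (a, r)" "q = (a', r')" by (cases p, cases q)
  have h: "a \<in> \<aa>" "r \<in> carrier R" "a' \<in> \<aa>" "r' \<in> carrier R" "a \<oplus> r \<otimes> b = a' \<oplus> r' \<otimes> b"
   using p q unfolding P_def pq by simp_all
  have c: "a \<in> carrier R" "a' \<in> carrier R" using h If(2) by blast+
  have rb: "r \<otimes> b = \<ominus> a \<oplus> (a \<oplus> r \<otimes> b)" using c(1) m_closed[OF h(2) b] by (simp add: r_neg1)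
  have "(r \<ominus> r') \<otimes> b = r \<otimes> b \<ominus> r' \<otimes> b" using h(2,4) b by (simp add: a_minus_def l_distr l_minus)
  also have "\<dots> = (\<ominus> a \<oplus> (a \<oplus> r \<otimes> b)) \<ominus> r' \<otimes> b" by (simp only: rb[symmetric])
  also have "\<dots> = (\<ominus> a \<oplus> (a' \<oplus> r' \<otimes> b)) \<ominus> r' \<otimes> b" using h(5) by simp
  also have "\<dots> = a' \<ominus> a" using h c b by (simp add: a_minus_def a_ac r_neg r_neg1 r_neg2)
  finally have e: "(r \<ominus> r') \<otimes> b = a' \<ominus> a" .
  have inI: "(r \<ominus> r') \<otimes> b \<in> \<aa>" unfolding e using If(8) h by blast
  have "g a' \<ominus>\<^bsub>N\<^esub> g a = (r \<ominus> r') \<odot>\<^bsub>N\<^esub> z"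
   using compat[OF _ inI] h linear_on_minus'[OF N aa g h(3,1)] by (simp add: e)
  also have "\<dots> = r \<odot>\<^bsub>N\<^esub> z \<ominus>\<^bsub>N\<^esub> r' \<odot>\<^bsub>N\<^esub> z" using h z by (simp add: a_minus_def N.smult_l_distr N.smult_l_minus)
  finally have d: "g a' \<ominus>\<^bsub>N\<^esub> g a = r \<odot>\<^bsub>N\<^esub> z \<ominus>\<^bsub>N\<^esub> r' \<odot>\<^bsub>N\<^esub> z" .
  have k: "g a \<in> carrier N" "g a' \<in> carrier N" "r \<odot>\<^bsub>N\<^esub> z \<in> carrier N" "r' \<odot>\<^bsub>N\<^esub> z \<in> carrier N"
   using gN h z by simp_all
  have "g a' \<oplus>\<^bsub>N\<^esub> r' \<odot>\<^bsub>N\<^esub> z = ((g a' \<ominus>\<^bsub>N\<^esub> g a) \<oplus>\<^bsub>N\<^esub> g a) \<oplus>\<^bsub>N\<^esub> r' \<odot>\<^bsub>N\<^esub> z"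
   using k by (simp add: a_minus_def N.M.a_assoc N.M.l_neg)
  also have "\<dots> = ((r \<odot>\<^bsub>N\<^esub> z \<ominus>\<^bsub>N\<^esub> r' \<odot>\<^bsub>N\<^esub> z) \<oplus>\<^bsub>N\<^esub> g a) \<oplus>\<^bsub>N\<^esub> r' \<odot>\<^bsub>N\<^esub> z" by (simp only: d)
  also have "\<dots> = g a \<oplus>\<^bsub>N\<^esub> r \<odot>\<^bsub>N\<^esub> z" using k
   by (simp add: a_minus_def N.M.a_ac) (metis N.M.a_lcomm N.M.r_neg N.M.r_zero N.M.a_inv_closed)
  finally show ?thesis by (simp add: val_def pq)
 qed
 define g' where "g' x = val (SOME p. P x p)" for x
 have ex: "\<exists>p. P x p" if x: "x \<in> adjoin \<aa> b" for x
 proof -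
  obtain a r where "x = a \<oplus> r \<otimes> b" "a \<in> \<aa>" "r \<in> carrier R" using x unfolding adjoin_def by blast
  then have "P x (a, r)" by (simp add: P_def)
  then show ?thesis by (rule exI)
 qed
 have g'eq: "g' x = val p" if "P x p" for x p
  unfolding g'_def using uniq[OF someI[of "P x", OF that] that] .
 have valN: "val p \<in> carrier N" "val p \<in> Z" if "P x p" for x p
  using that gN z Z(2-5) by (auto simp: P_def val_def)
 have "linear_on R Rmod N (adjoin \<aa> b) g'"
 proof (rule linear_onI)
  fix x assume "x \<in> adjoin \<aa> b"
  then obtain p where "P x p" using ex by blast
  then show "g' x \<in> carrier N" using g'eq valN(1) by simp
 next
  fix x y assume "x \<in> adjoin \<aa> b" "y \<in> adjoin \<aa> b"
  then obtain p q where pq: "P x p" "P y q" using ex by metis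
  obtain a r a' r' where ar: "p = (a, r)" "q = (a', r')" by (cases p, cases q)
  have h: "a \<in> \<aa>" "r \<in> carrier R" "x = a \<oplus> r \<otimes> b" "a' \<in> \<aa>" "r' \<in> carrier R" "y = a' \<oplus> r' \<otimes> b"
   using pq unfolding P_def ar by simp_all
  have c: "a \<in> carrier R" "a' \<in> carrier R" using h If(2) by blast+
  have "x \<oplus> y = (a \<oplus> a') \<oplus> (r \<oplus> r') \<otimes> b" using h c b by (simp add: l_distr a_ac)
  then have "P (x \<oplus> y) (a \<oplus> a', r \<oplus> r')" using h If(4) by (simp add: P_def)
  then have "g' (x \<oplus> y) = g (a \<oplus> a') \<oplus>\<^bsub>N\<^esub> (r \<oplus> r') \<odot>\<^bsub>N\<^esub> z" using g'eq by (simp add: val_def)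
  also have "\<dots> = (g a \<oplus>\<^bsub>N\<^esub> g a') \<oplus>\<^bsub>N\<^esub> (r \<odot>\<^bsub>N\<^esub> z \<oplus>\<^bsub>N\<^esub> r' \<odot>\<^bsub>N\<^esub> z)"
   using linear_onD(2)[OF g h(1,4)] h z by (simp add: N.smult_l_distr)
  also have "\<dots> = (g a \<oplus>\<^bsub>N\<^esub> r \<odot>\<^bsub>N\<^esub> z) \<oplus>\<^bsub>N\<^esub> (g a' \<oplus>\<^bsub>N\<^esub> r' \<odot>\<^bsub>N\<^esub> z)"
   using gN h z by (simp add: N.M.a_ac)
  finally show "g' (x \<oplus>\<^bsub>Rmod\<^esub> y) = g' x \<oplus>\<^bsub>N\<^esub> g' y"
   using g'eq[OF pq(1)] g'eq[OF pq(2)] by (simp add: val_def ar)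
 next
  fix c x assume cK: "c \<in> carrier R" and "x \<in> adjoin \<aa> b"
  then obtain p where p: "P x p" using ex by blast
  obtain a r where ar: "p = (a, r)" by (cases p)
  have h: "a \<in> \<aa>" "r \<in> carrier R" "x = a \<oplus> r \<otimes> b" using p unfolding P_def ar by simp_all
  have c: "a \<in> carrier R" using h If(2) by blast
  have "c \<otimes> x = c \<otimes> a \<oplus> (c \<otimes> r) \<otimes> b" using h c b cK by (simp add: r_distr m_assoc)
  then have "P (c \<otimes> x) (c \<otimes> a, c \<otimes> r)" using h If(5) cK by (simp add: P_def)
  then have "g' (c \<otimes> x) = g (c \<otimes> a) \<oplus>\<^bsub>N\<^esub> (c \<otimes> r) \<odot>\<^bsub>N\<^esub> z" using g'eq by (simp add: val_def)
  also have "\<dots> = c \<odot>\<^bsub>N\<^esub> (g a \<oplus>\<^bsub>N\<^esub> r \<odot>\<^bsub>N\<^esub> z)"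
   using linear_onD(3)[OF g cK h(1)] h z gN cK by (simp add: N.smult_r_distr N.smult_assoc1)
  finally show "g' (c \<odot>\<^bsub>Rmod\<^esub> x) = c \<odot>\<^bsub>N\<^esub> g' x"
   using g'eq[OF p] by (simp add: val_def ar)
 qed
 moreover have "g' x = g x" if x: "x \<in> \<aa>" for x
 proof -
  have "P x (x, \<zero>)" using x If(2)[OF x] b by (simp add: P_def)
  then show ?thesis using g'eq gN[OF x] z by (simp add: val_def)
 qed
 moreover have "g' b = z"
 proof -
  have "P b (\<zero>, \<one>)" using If(3) b by (simp add: P_def)
  then show ?thesis using g'eq linear_on_zero'[OF N aa g] z by (simp add: val_def)
 qed
 moreover have "g' x \<in> Z" if x: "x \<in> adjoin \<aa> b" for x
 proof -
  obtain p where "P x p" using ex[OF x] by blast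
  then show ?thesis using g'eq valN(2) by simp
 qed
 ultimately show ?thesis by (intro exI[of _ g'] conjI ballI)
qed

end

section \<open>Injective modules and extension of homomorphisms\<close>

context one_dim_domain
begin

text \<open>Injectivity is tested on modules whose elements are sequences; ideals are copied there as constant sequences.\<close>

definition const_module :: "'a set \<Rightarrow> ('a, nat \<Rightarrow> 'a) module" where
 "const_module \<aa> =
  \<lparr>carrier = (\<lambda>a _. a) ` \<aa>, monoid.mult = undefined, monoid.one = undefined,
   ring.zero = (\<lambda>_. \<zero>), ring.add = (\<lambda>f g n. f n \<oplus> g n), smult = (\<lambda>c f n. c \<otimes> f n)\<rparr>"

lemma const_module_simps:
 "carrier (const_module \<aa>) = (\<lambda>a _. a) ` \<aa>" "\<zero>\<^bsub>const_module \<aa>\<^esub> = (\<lambda>_. \<zero>)"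
 "f \<oplus>\<^bsub>const_module \<aa>\<^esub> g = (\<lambda>n. f n \<oplus> g n)" "c \<odot>\<^bsub>const_module \<aa>\<^esub> f = (\<lambda>n. c \<otimes> f n)"
 by (simp_all add: const_module_def)

lemma const_module_module:
 assumes aa: "ideal \<aa> R"
 shows "module R (const_module \<aa>)"
proof (rule module_criteria)
 note If = ideal_facts[OF aa]
 show "cring R" by (rule is_cring)
 show "\<zero>\<^bsub>const_module \<aa>\<^esub> \<in> carrier (const_module \<aa>)" using If(3) by (simp add: const_module_simps)
 show "\<forall>v w. v \<in> carrier (const_module \<aa>) \<and> w \<in> carrier (const_module \<aa>) \<longrightarrow> v \<oplus>\<^bsub>const_module \<aa>\<^esub> w \<in> carrier (const_module \<aa>)"
  using If(4) by (auto simp: const_module_simps)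
 show "\<forall>c v. c \<in> carrier R \<and> v \<in> carrier (const_module \<aa>) \<longrightarrow> c \<odot>\<^bsub>const_module \<aa>\<^esub> v \<in> carrier (const_module \<aa>)"
  using If(5) by (auto simp: const_module_simps)
 show "\<forall>v\<in>carrier (const_module \<aa>). \<exists>neg_v\<in>carrier (const_module \<aa>). v \<oplus>\<^bsub>const_module \<aa>\<^esub> neg_v = \<zero>\<^bsub>const_module \<aa>\<^esub>"
 proof
  fix v assume "v \<in> carrier (const_module \<aa>)"
  then obtain a where a: "a \<in> \<aa>" "v = (\<lambda>_. a)" by (auto simp: const_module_simps)
  then show "\<exists>neg_v\<in>carrier (const_module \<aa>). v \<oplus>\<^bsub>const_module \<aa>\<^esub> neg_v = \<zero>\<^bsub>const_module \<aa>\<^esub>"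
   using If(2,7) by (intro bexI[of _ "\<lambda>_. \<ominus> a"]) (simp_all add: const_module_simps r_neg)
 qed
qed (use ideal_facts(2)[OF aa] in \<open>auto simp: const_module_simps a_ac l_distr r_distr m_assoc\<close>)

lemma baer_of_injective:
 assumes inj: "injective_module R E" and aa: "ideal \<aa> R" and f: "linear_on R Rmod E \<aa> f"
 shows "\<exists>z\<in>carrier E. \<forall>a\<in>\<aa>. f a = a \<odot>\<^bsub>E\<^esub> z"
proof -
 note If = ideal_facts[OF aa]
 have id: "(\<lambda>x. x) \<in> module_hom R (const_module \<aa>) (const_module (carrier R))"
  using If(2) by (auto simp: module_hom_def const_module_simps)
 have g: "(\<lambda>h. f (h 0)) \<in> module_hom R (const_module \<aa>) E"
  using linear_onD[OF f] by (auto simp: module_hom_def const_module_simps)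
 have lift: "\<And>(A :: ('a, nat \<Rightarrow> 'a) module) (B :: ('a, nat \<Rightarrow> 'a) module) i g.
    Module.module R A ==> Module.module R B ==>
    i \<in> module_hom R A B ==> inj_on i (carrier A) ==> g \<in> module_hom R A E ==>
    (\<exists>h \<in> module_hom R B E. \<forall>x \<in> carrier A. h (i x) = g x)"
  using inj unfolding injective_module_def by blast
 obtain h where h: "h \<in> module_hom R (const_module (carrier R)) E" "\<forall>x\<in>carrier (const_module \<aa>). h x = f (x 0)"
  using lift[OF const_module_module[OF aa] const_module_module[OF oneideal] id _ g] by (auto simp: inj_on_def)
 have one: "(\<lambda>_. \<one>) \<in> carrier (const_module (carrier R))" by (simp add: const_module_simps)
 have "f a = a \<odot>\<^bsub>E\<^esub> h (\<lambda>_. \<one>)" if a: "a \<in> \<aa>" for a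
 proof -
  have "(\<lambda>_. a) \<in> carrier (const_module \<aa>)" using a by (simp add: const_module_simps)
  then have 1: "h (\<lambda>_. a) = f a" by (rule bspec[OF h(2)])
  have "(\<lambda>_::nat. a) = a \<odot>\<^bsub>const_module (carrier R)\<^esub> (\<lambda>_. \<one>)" using If(2)[OF a] by (simp add: const_module_simps)
  then have "h (\<lambda>_. a) = h (a \<odot>\<^bsub>const_module (carrier R)\<^esub> (\<lambda>_. \<one>))" by (rule arg_cong)
  then show ?thesis using module_hom_smult[OF h(1) If(2)[OF a] one] 1 by simp
 qed
 moreover have "h (\<lambda>_. \<one>) \<in> carrier E" using module_hom_closed[OF h(1)] one by blast
 ultimately show ?thesis by blast
qed

text \<open>Baer's criterion for the submodule \<open>Z\<close> of \<open>E\<close>, restricted to nonzero ideals. The zeroth syzygy of an injective resolution of \<open>R\<close> violates it, but all later ones satisfy it.\<close>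

definition baer where
 "baer E Z \<longleftrightarrow> (\<forall>\<aa> f. ideal \<aa> R \<longrightarrow> \<aa> \<noteq> {\<zero>} \<longrightarrow> linear_on R Rmod E \<aa> f \<longrightarrow> (\<forall>a\<in>\<aa>. f a \<in> Z) \<longrightarrow>
   (\<exists>z\<in>Z. \<forall>a\<in>\<aa>. f a = a \<odot>\<^bsub>E\<^esub> z))"

lemma injective_divisible:
 assumes E: "module R E" and inj: "injective_module R E" and u: "u \<in> carrier R" "u \<noteq> \<zero>" and e: "e \<in> carrier E"
 shows "\<exists>e'\<in>carrier E. u \<odot>\<^bsub>E\<^esub> e' = e"
proof -
 interpret E: module R E by (rule E)
 have g: "linear_on R Rmod E {\<zero>} (\<lambda>_. \<zero>\<^bsub>E\<^esub>)" by (rule linear_onI) simp_all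
 have c: "\<zero>\<^bsub>E\<^esub> = r \<odot>\<^bsub>E\<^esub> e" if "r \<in> carrier R" "r \<otimes> u \<in> {\<zero>}" for r
  using that u e integral_iff[of r u] by simp
 have "\<exists>g'. linear_on R Rmod E (adjoin {\<zero>} u) g' \<and> (\<forall>x\<in>{\<zero>}. g' x = \<zero>\<^bsub>E\<^esub>) \<and> g' u = e \<and> (\<forall>x\<in>adjoin {\<zero>} u. g' x \<in> carrier E)"
  by (rule extend_hom[OF E zeroideal u(1) g e]) (use e in \<open>auto intro: c\<close>)
 then obtain g' where g': "linear_on R Rmod E (adjoin {\<zero>} u) g'" "g' u = e" by (elim exE conjE)
 obtain z where z: "z \<in> carrier E" "\<forall>a\<in>adjoin {\<zero>} u. g' a = a \<odot>\<^bsub>E\<^esub> z"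
  using baer_of_injective[OF inj adjoin_ideal[OF zeroideal u(1)] g'(1)] by blast
 have "u \<in> adjoin {\<zero>} u" using adjoin_contains(2)[OF zeroideal u(1)] .
 then show ?thesis using z g'(2) by (intro bexI[of _ z]) simp_all
qed

lemma module_hom_zero_eq:
 assumes "module R A" "module R B" "d \<in> module_hom R A B"
 shows "d \<zero>\<^bsub>A\<^esub> = \<zero>\<^bsub>B\<^esub>"
proof -
 interpret mod_hom R A B d using assms by (simp add: mod_hom_def mod_hom_axioms_def)
 show ?thesis by simp
qed

lemma module_hom_minus_eq:
 assumes "module R A" "module R B" "d \<in> module_hom R A B" "x \<in> carrier A" "y \<in> carrier A"
 shows "d (x \<ominus>\<^bsub>A\<^esub> y) = d x \<ominus>\<^bsub>B\<^esub> d y"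
proof -
 interpret mod_hom R A B d using assms by (simp add: mod_hom_def mod_hom_axioms_def)
 show ?thesis using assms(4,5) by simp
qed

lemma ker_closed:
 assumes A: "module R A" and B: "module R B" and d: "d \<in> module_hom R A B"
 shows "x \<in> module_ker A B d ==> x \<in> carrier A" "x \<in> module_ker A B d ==> y \<in> module_ker A B d ==> x \<oplus>\<^bsub>A\<^esub> y \<in> module_ker A B d"
  "r \<in> carrier R ==> x \<in> module_ker A B d ==> r \<odot>\<^bsub>A\<^esub> x \<in> module_ker A B d"
  "x \<in> module_ker A B d ==> y \<in> module_ker A B d ==> x \<ominus>\<^bsub>A\<^esub> y \<in> module_ker A B d"
proof -
 interpret A: module R A by (rule A)
 interpret B: module R B by (rule B)
 show "x \<in> module_ker A B d ==> x \<in> carrier A" by (simp add: module_ker_def)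
 show "x \<in> module_ker A B d ==> y \<in> module_ker A B d ==> x \<oplus>\<^bsub>A\<^esub> y \<in> module_ker A B d"
  using module_hom_add[OF d] by (simp add: module_ker_def)
 show "r \<in> carrier R ==> x \<in> module_ker A B d ==> r \<odot>\<^bsub>A\<^esub> x \<in> module_ker A B d"
  using module_hom_smult[OF d] by (simp add: module_ker_def)
 show "x \<in> module_ker A B d ==> y \<in> module_ker A B d ==> x \<ominus>\<^bsub>A\<^esub> y \<in> module_ker A B d"
  using module_hom_minus_eq[OF A B d] by (simp add: module_ker_def a_minus_def B.r_neg)
qed

text \<open>Extend from \<open>Ru + Rs\<close> to \<open>R\<close> the homomorphism \<open>u \<mapsto> 0\<close>, \<open>s \<mapsto> e\<close>. It is well defined because \<open>r s \<in> Ru\<close> forces \<open>r \<in> \<mm>\<close>, and \<open>\<mm> e = 0\<close>.\<close>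

lemma hom_on_line:
 assumes N: "module R N" and u: "u \<in> \<mm>" "u \<noteq> \<zero>" and s: "s \<in> carrier R" "s \<notin> PIdl u"
  and e: "e \<in> carrier N" "\<And>r. r \<in> \<mm> ==> r \<odot>\<^bsub>N\<^esub> e = \<zero>\<^bsub>N\<^esub>"
  and Z: "Z \<subseteq> carrier N" "\<zero>\<^bsub>N\<^esub> \<in> Z" "e \<in> Z" "\<And>x y. x \<in> Z ==> y \<in> Z ==> x \<oplus>\<^bsub>N\<^esub> y \<in> Z"
   "\<And>r x. r \<in> carrier R ==> x \<in> Z ==> r \<odot>\<^bsub>N\<^esub> x \<in> Z" and baer: "baer N Z"
 shows "\<exists>w. w \<in> Z \<and> s \<odot>\<^bsub>N\<^esub> w = e \<and> u \<odot>\<^bsub>N\<^esub> w = \<zero>\<^bsub>N\<^esub>"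
proof -
 interpret N: module R N by (rule N)
 have uR: "u \<in> carrier R" by (rule ideal_facts(2)[OF mm_ideal u(1)])
 have P: "ideal (PIdl u) R" by (rule cgenideal_ideal[OF uR])
 have g: "linear_on R Rmod N (PIdl u) (\<lambda>_. \<zero>\<^bsub>N\<^esub>)" by (rule linear_onI) simp_all
 have c: "\<zero>\<^bsub>N\<^esub> = r \<odot>\<^bsub>N\<^esub> e" if r: "r \<in> carrier R" "r \<otimes> s \<in> PIdl u" for r
 proof -
  have "r \<in> \<mm>"
  proof (rule ccontr)
   assume "r \<notin> \<mm>"
   then have ru: "r \<in> Units R" using nonunit_in_mm r(1) by blast
   have "s = inv r \<otimes> (r \<otimes> s)" using ru s(1) r(1) by (simp add: m_assoc[symmetric])
   also have "\<dots> \<in> PIdl u" using ideal_facts(5)[OF P r(2)] ru by simp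
   finally show False using s(2) by simp
  qed
  then show ?thesis using e(2) by simp
 qed
 have "\<exists>g'. linear_on R Rmod N (adjoin (PIdl u) s) g' \<and> (\<forall>x\<in>PIdl u. g' x = \<zero>\<^bsub>N\<^esub>) \<and> g' s = e \<and> (\<forall>x\<in>adjoin (PIdl u) s. g' x \<in> Z)"
  by (rule extend_hom[OF N P s(1) g e(1) _ Z(1)]) (fact c Z | rule Z(2))+
 then obtain g' where g': "linear_on R Rmod N (adjoin (PIdl u) s) g'" "\<forall>x\<in>PIdl u. g' x = \<zero>\<^bsub>N\<^esub>" "g' s = e"
  "\<forall>x\<in>adjoin (PIdl u) s. g' x \<in> Z" by (elim exE conjE)
 note adj = adjoin_ideal[OF P s(1)] adjoin_contains[OF P s(1)]
 have uu: "u \<in> adjoin (PIdl u) s" using cgenideal_self[OF uR] adj(2) by blast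
 then have "adjoin (PIdl u) s \<noteq> {\<zero>}" using u(2) by blast
 then have "\<exists>w\<in>Z. \<forall>a\<in>adjoin (PIdl u) s. g' a = a \<odot>\<^bsub>N\<^esub> w" using baer adj(1) g'(1,4) unfolding baer_def by simp
 then obtain w where w: "w \<in> Z" "\<forall>a\<in>adjoin (PIdl u) s. g' a = a \<odot>\<^bsub>N\<^esub> w" by (elim bexE)
 show ?thesis
  using w(1) bspec[OF w(2) adj(3)] bspec[OF w(2) uu] bspec[OF g'(2) cgenideal_self[OF uR]] g'(3)
  by (intro exI[of _ w]) simp
qed

text \<open>Descent from the image of \<open>d\<close> to its kernel \<open>Z\<close>. A homomorphism \<open>f : \<mm> \<rightarrow> Z\<close> is multiplication by some \<open>e \<in> E\<close>, and \<open>\<mm>\<close> kills \<open>d e\<close>. Choose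
a socle element \<open>s\<close> modulo \<open>u\<close>; by \<open>hom_on_line\<close>, \<open>d e = s w\<close> with \<open>u w = 0\<close>. As \<open>Z\<close> is divisible by \<open>u\<close>, a preimage \<open>w1\<close> of \<open>w\<close>
can be chosen with \<open>u w1 = 0\<close>. Then \<open>\<mm>\<close> kills \<open>s w1\<close>, and \<open>e - s w1\<close> lies in \<open>Z\<close> and induces \<open>f\<close>. An arbitrary
nonzero ideal is enlarged by socle elements until it is all of \<open>R\<close>; each enlargement is an instance of the case of \<open>\<mm>\<close>.\<close>

lemma baer_step:
 assumes E: "module R E" and E': "module R E'" and d: "d \<in> module_hom R E E'"
  and inj: "injective_module R E" and u: "u \<in> \<mm>" "u \<noteq> \<zero>"
  and div: "\<And>z. z \<in> module_ker E E' d ==> \<exists>z'\<in>module_ker E E' d. u \<odot>\<^bsub>E\<^esub> z' = z"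
  and baer': "baer E' (d ` carrier E)"
 shows "baer E (module_ker E E' d)"
proof -
 interpret E: module R E by (rule E)
 interpret E': module R E' by (rule E')
 define Z where "Z = module_ker E E' d"
 note Zc = ker_closed[OF E E' d, folded Z_def]
 note dc = module_hom_closed[OF d] and da = module_hom_add[OF d] and ds = module_hom_smult[OF d]
  and dz = module_hom_zero_eq[OF E E' d] and dm = module_hom_minus_eq[OF E E' d]
 have uR: "u \<in> carrier R" by (rule ideal_facts(2)[OF mm_ideal u(1)])
 have P: "ideal (PIdl u) R" by (rule cgenideal_ideal[OF uR])
 have Pn0: "PIdl u \<noteq> {\<zero>}" using cgenideal_self[OF uR] u(2) by blast
 have P1: "\<one> \<notin> PIdl u" using cgenideal_minimal[OF mm_ideal u(1)] mm_proper by blast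
 have mR: "r \<in> carrier R" if "r \<in> \<mm>" for r by (rule ideal_facts(2)[OF mm_ideal that])
 have socle_case: "\<exists>z\<in>Z. \<forall>r\<in>\<mm>. f r = r \<odot>\<^bsub>E\<^esub> z" if f: "linear_on R Rmod E \<mm> f" "\<And>r. r \<in> \<mm> ==> f r \<in> Z" for f
 proof -
  obtain e where e: "e \<in> carrier E" "\<forall>r\<in>\<mm>. f r = r \<odot>\<^bsub>E\<^esub> e" using baer_of_injective[OF inj mm_ideal f(1)] by blast
  have de: "d e \<in> carrier E'" using dc e(1) by blast
  have rde: "r \<odot>\<^bsub>E'\<^esub> d e = \<zero>\<^bsub>E'\<^esub>" if r: "r \<in> \<mm>" for r
  proof -
   have "r \<odot>\<^bsub>E'\<^esub> d e = d (f r)" using ds[OF mR[OF r] e(1)] e(2) r by simp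
   then show ?thesis using f(2)[OF r] by (simp add: Z_def module_ker_def)
  qed
  obtain s where s: "s \<in> carrier R" "s \<notin> PIdl u" "\<And>x. x \<in> \<mm> ==> x \<otimes> s \<in> PIdl u"
   using socle_element_exists[OF P Pn0 P1] by blast
  have im: "d ` carrier E \<subseteq> carrier E'" "\<zero>\<^bsub>E'\<^esub> \<in> d ` carrier E" "d e \<in> d ` carrier E"
   "\<And>x y. x \<in> d ` carrier E ==> y \<in> d ` carrier E ==> x \<oplus>\<^bsub>E'\<^esub> y \<in> d ` carrier E"
   "\<And>r x. r \<in> carrier R ==> x \<in> d ` carrier E ==> r \<odot>\<^bsub>E'\<^esub> x \<in> d ` carrier E"
  proof -
   show "d ` carrier E \<subseteq> carrier E'" using dc by blast
   show "\<zero>\<^bsub>E'\<^esub> \<in> d ` carrier E" using dz by (metis E.zero_closed imageI)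
   show "d e \<in> d ` carrier E" using e(1) by blast
   show "x \<oplus>\<^bsub>E'\<^esub> y \<in> d ` carrier E" if "x \<in> d ` carrier E" "y \<in> d ` carrier E" for x y
    using that da[symmetric] by (auto intro!: imageI)
   show "r \<odot>\<^bsub>E'\<^esub> x \<in> d ` carrier E" if "r \<in> carrier R" "x \<in> d ` carrier E" for r x
    using that ds[symmetric] by (auto intro!: imageI)
  qed
  have "\<exists>w. w \<in> d ` carrier E \<and> s \<odot>\<^bsub>E'\<^esub> w = d e \<and> u \<odot>\<^bsub>E'\<^esub> w = \<zero>\<^bsub>E'\<^esub>"
   by (rule hom_on_line[OF E' u s(1,2) de]) (fact rde im baer')+
  then obtain w where w: "w \<in> d ` carrier E" "s \<odot>\<^bsub>E'\<^esub> w = d e" "u \<odot>\<^bsub>E'\<^esub> w = \<zero>\<^bsub>E'\<^esub>" by (elim exE conjE)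
  obtain w0 where w0: "w0 \<in> carrier E" "w = d w0" using w(1) by blast
  have "u \<odot>\<^bsub>E\<^esub> w0 \<in> Z" using w(3) w0 uR ds[OF uR w0(1)] by (simp add: Z_def module_ker_def)
  then obtain z where z: "z \<in> Z" "u \<odot>\<^bsub>E\<^esub> z = u \<odot>\<^bsub>E\<^esub> w0" using div unfolding Z_def by blast
  have zE: "z \<in> carrier E" by (rule Zc(1)[OF z(1)])
  define w1 where "w1 = w0 \<ominus>\<^bsub>E\<^esub> z"
  have w1: "w1 \<in> carrier E" using w0(1) zE by (simp add: w1_def)
  have dw1: "d w1 = w"
   using dm[OF w0(1) zE] z(1) w0(2) dc w0(1) by (simp add: w1_def Z_def module_ker_def a_minus_def Pi_iff)
  have uw1: "u \<odot>\<^bsub>E\<^esub> w1 = \<zero>\<^bsub>E\<^esub>"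
   using w0(1) zE uR z(2) by (simp add: w1_def a_minus_def E.smult_r_distr E.smult_r_minus E.M.r_neg)
  define e0 where "e0 = s \<odot>\<^bsub>E\<^esub> w1"
  have e0: "e0 \<in> carrier E" "d e0 = d e" using w1 s(1) ds[OF s(1) w1] dw1 w(2) by (simp_all add: e0_def)
  have re0: "r \<odot>\<^bsub>E\<^esub> e0 = \<zero>\<^bsub>E\<^esub>" if r: "r \<in> \<mm>" for r
  proof -
   obtain c where c: "c \<in> carrier R" "r \<otimes> s = c \<otimes> u" using s(3)[OF r] unfolding PIdl_iff by blast
   have "r \<odot>\<^bsub>E\<^esub> e0 = (r \<otimes> s) \<odot>\<^bsub>E\<^esub> w1" using mR[OF r] s(1) w1 by (simp add: e0_def E.smult_assoc1)
   also have "\<dots> = c \<odot>\<^bsub>E\<^esub> (u \<odot>\<^bsub>E\<^esub> w1)" using c uR w1 by (simp add: E.smult_assoc1)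
   finally show ?thesis using uw1 c(1) by simp
  qed
  have "e \<ominus>\<^bsub>E\<^esub> e0 \<in> Z"
   using e(1) e0 dm[OF e(1) e0(1)] de by (simp add: Z_def module_ker_def a_minus_def E'.M.r_neg)
  moreover have "f r = r \<odot>\<^bsub>E\<^esub> (e \<ominus>\<^bsub>E\<^esub> e0)" if r: "r \<in> \<mm>" for r
   using e r re0[OF r] e0(1) mR[OF r] by (simp add: a_minus_def E.smult_r_distr E.smult_r_minus)
  ultimately show ?thesis by blast
 qed
 have "\<exists>z\<in>Z. \<forall>a\<in>\<aa>. f a = a \<odot>\<^bsub>E\<^esub> z" if aa: "ideal \<aa> R" "\<aa> \<noteq> {\<zero>}" and f: "linear_on R Rmod E \<aa> f" "\<forall>a\<in>\<aa>. f a \<in> Z" for \<aa> f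
 proof -
  let ?S = "{\<bb>. ideal \<bb> R \<and> \<aa> \<subseteq> \<bb> \<and> (\<exists>g. linear_on R Rmod E \<bb> g \<and> (\<forall>x\<in>\<bb>. g x \<in> Z) \<and> (\<forall>x\<in>\<aa>. g x = f x))}"
  have "\<aa> \<in> ?S" using aa f by blast
  then have ne: "?S \<noteq> {}" by blast
  have "ideal J R" if "J \<in> ?S" for J using that by simp
  from ideal_maximal_exists[OF ne this] obtain \<bb> where b0: "\<bb> \<in> ?S" "\<forall>J\<in>?S. \<bb> \<subseteq> J \<longrightarrow> J = \<bb>" by (rule bexE)
  then obtain g where b: "ideal \<bb> R" "\<aa> \<subseteq> \<bb>" and g: "linear_on R Rmod E \<bb> g" "\<forall>x\<in>\<bb>. g x \<in> Z" "\<forall>x\<in>\<aa>. g x = f x" by blast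
  note bf = ideal_facts[OF b(1)]
  show ?thesis
  proof (cases "\<one> \<in> \<bb>")
   case True
   have "f a = a \<odot>\<^bsub>E\<^esub> g \<one>" if a: "a \<in> \<aa>" for a
    using linear_onD(3)[OF g(1) _ True, of a] g(3) a b(2) bf(2) by auto
   then show ?thesis using g(2) True by blast
  next
   case False
   have "\<bb> \<noteq> {\<zero>}" using aa(2) b(2) ideal_facts(3)[OF aa(1)] by blast
   from socle_element_exists[OF b(1) this False] obtain c where c: "c \<in> carrier R" "c \<notin> \<bb>" "\<And>x. x \<in> \<mm> ==> x \<otimes> c \<in> \<bb>" by blast
   have "linear_on R Rmod E \<mm> (\<lambda>r. g (r \<otimes> c))"
   proof (rule linear_onI)
    show "g (r \<otimes> c) \<in> carrier E" if "r \<in> \<mm>" for r using linear_onD(1)[OF g(1) c(3)[OF that]] .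
    show "g ((r \<oplus>\<^bsub>Rmod\<^esub> r') \<otimes> c) = g (r \<otimes> c) \<oplus>\<^bsub>E\<^esub> g (r' \<otimes> c)" if "r \<in> \<mm>" "r' \<in> \<mm>" for r r'
     using linear_onD(2)[OF g(1) c(3)[OF that(1)] c(3)[OF that(2)]] mR that c(1) by (simp add: l_distr)
    show "g ((k \<odot>\<^bsub>Rmod\<^esub> r) \<otimes> c) = k \<odot>\<^bsub>E\<^esub> g (r \<otimes> c)" if "k \<in> carrier R" "r \<in> \<mm>" for k r
     using linear_onD(3)[OF g(1) that(1) c(3)[OF that(2)]] mR that c(1) by (simp add: m_assoc)
   qed
   from socle_case[OF this] obtain z where z: "z \<in> Z" "\<forall>r\<in>\<mm>. g (r \<otimes> c) = r \<odot>\<^bsub>E\<^esub> z" using g(2) c(3) by blast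
   have compat: "g (r \<otimes> c) = r \<odot>\<^bsub>E\<^esub> z" if r: "r \<in> carrier R" "r \<otimes> c \<in> \<bb>" for r
   proof -
    have "r \<in> \<mm>"
    proof (rule ccontr)
     assume "r \<notin> \<mm>"
     then have ru: "r \<in> Units R" using nonunit_in_mm r(1) by blast
     have "c = inv r \<otimes> (r \<otimes> c)" using ru c(1) r(1) by (simp add: m_assoc[symmetric])
     also have "\<dots> \<in> \<bb>" using bf(5)[OF r(2)] ru by simp
     finally show False using c(2) by simp
    qed
    then show ?thesis using z(2) by blast
   qed
   have ZE: "Z \<subseteq> carrier E" using Zc(1) by blast
   have gZ: "g x \<in> Z" if "x \<in> \<bb>" for x using g(2) that by blast
   have "\<exists>g'. linear_on R Rmod E (adjoin \<bb> c) g' \<and> (\<forall>x\<in>\<bb>. g' x = g x) \<and> g' c = z \<and> (\<forall>x\<in>adjoin \<bb> c. g' x \<in> Z)"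
    by (rule extend_hom[OF E b(1) c(1) g(1) Zc(1)[OF z(1)] _ ZE]) (fact compat gZ z(1) Zc(2) Zc(3))+
   then obtain g' where g': "linear_on R Rmod E (adjoin \<bb> c) g'" "\<forall>x\<in>\<bb>. g' x = g x" "g' c = z" "\<forall>x\<in>adjoin \<bb> c. g' x \<in> Z"
    by (elim exE conjE)
   have "adjoin \<bb> c \<in> ?S"
   proof (intro CollectI conjI exI[of _ g'] ballI)
    show "ideal (adjoin \<bb> c) R" by (rule adjoin_ideal[OF b(1) c(1)])
    show "\<aa> \<subseteq> adjoin \<bb> c" using b(2) adjoin_contains(1)[OF b(1) c(1)] by blast
    show "linear_on R Rmod E (adjoin \<bb> c) g'" by (rule g'(1))
    show "g' x \<in> Z" if "x \<in> adjoin \<bb> c" for x by (rule bspec[OF g'(4) that])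
    show "g' x = f x" if "x \<in> \<aa>" for x using g'(2) g(3) b(2) that by auto
   qed
   then have "adjoin \<bb> c = \<bb>" using b0(2) adjoin_contains(1)[OF b(1) c(1)] by simp
   then show ?thesis using adjoin_contains(2)[OF b(1) c(1)] c(2) by simp
  qed
 qed
 then show ?thesis unfolding baer_def Z_def by blast
qed

end

section \<open>The socle modulo a parameter, and maps out of free modules\<close>

context one_dim_domain
begin

text \<open>Every nonzero ideal is reached from \<open>R\<close> by finitely many steps that remove one composition factor \<open>R/\<mm>\<close>.\<close>

lemma descent [consumes 2, case_names top step]:
 assumes J: "ideal J R" "J \<noteq> {\<zero>}" and top: "Q (carrier R)"
  and step: "\<And>J b. ideal J R ==> J \<noteq> {\<zero>} ==> \<one> \<notin> J ==> b \<in> carrier R ==> b \<notin> J ==> (\<And>x. x \<in> \<mm> ==> x \<otimes> b \<in> J)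
   ==> Q (adjoin J b) ==> Q J"
 shows "Q J"
proof (rule ccontr)
 assume "\<not> Q J"
 let ?S = "{J. ideal J R \<and> J \<noteq> {\<zero>} \<and> \<not> Q J}"
 have ne: "?S \<noteq> {}" using J \<open>\<not> Q J\<close> by blast
 have "ideal J R" if "J \<in> ?S" for J using that by simp
 from ideal_maximal_exists[OF ne this] obtain M where M0: "M \<in> ?S" "\<forall>J\<in>?S. M \<subseteq> J \<longrightarrow> J = M" by (rule bexE)
 have M: "ideal M R" "M \<noteq> {\<zero>}" "\<not> Q M" using M0(1) by simp_all
 have one: "\<one> \<notin> M" using ideal.one_imp_carrier[OF M(1)] top M(3) by auto
 obtain b where b: "b \<in> carrier R" "b \<notin> M" "\<And>x. x \<in> \<mm> ==> x \<otimes> b \<in> M"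
  using socle_element_exists[OF M(1,2) one] by blast
 note adj = adjoin_ideal[OF M(1) b(1)] adjoin_contains[OF M(1) b(1)]
 have "adjoin M b \<notin> ?S" using M0(2) adj(2,3) b(2) by blast
 moreover have "adjoin M b \<noteq> {\<zero>}" using adj(2) M(2) ideal_facts(3)[OF M(1)] by blast
 ultimately have "Q (adjoin M b)" using adj(1) by simp
 then show False using step[OF M(1,2) one b(1,2)] b(3) M(3) by blast
qed

text \<open>Downward induction from the end of a finite injective resolution, where the modules vanish.\<close>

lemma baer_kernels:
 assumes res: "injective_resolution R M E \<delta> \<iota>" and fin: "\<forall>i>n. carrier (E i) = {\<zero>\<^bsub>E i\<^esub>}"
  and u: "u \<in> \<mm>" "u \<noteq> \<zero>"
 shows "baer (E (Suc i)) (module_ker (E (Suc i)) (E (Suc (Suc i))) (\<delta> (Suc i)))"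
proof -
 have inj: "injective_module R (E i)" and d: "\<delta> i \<in> module_hom R (E i) (E (Suc i))"
  and ex: "\<delta> i ` carrier (E i) = module_ker (E (Suc i)) (E (Suc (Suc i))) (\<delta> (Suc i))" for i
  using res unfolding injective_resolution_def by blast+
 have E: "module R (E i)" for i using inj unfolding injective_module_def by blast
 have uR: "u \<in> carrier R" by (rule ideal_facts(2)[OF mm_ideal u(1)])
 have "\<forall>i. n - i \<le> k \<longrightarrow> baer (E (Suc i)) (module_ker (E (Suc i)) (E (Suc (Suc i))) (\<delta> (Suc i)))" for k
 proof (induction k)
  case 0
  show ?case
  proof (intro allI impI)
   fix i assume "n - i \<le> 0"
   then have c: "carrier (E (Suc i)) = {\<zero>\<^bsub>E (Suc i)\<^esub>}" using fin by simp
   interpret E: module R "E (Suc i)" by (rule E)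
   have k: "module_ker (E (Suc i)) (E (Suc (Suc i))) (\<delta> (Suc i)) = {\<zero>\<^bsub>E (Suc i)\<^esub>}"
    using c module_hom_zero_eq[OF E E d] unfolding module_ker_def by auto
   show "baer (E (Suc i)) (module_ker (E (Suc i)) (E (Suc (Suc i))) (\<delta> (Suc i)))"
    unfolding baer_def k using ideal_facts(2) by simp
  qed
 next
  case (Suc k)
  show ?case
  proof (intro allI impI)
   fix i assume "n - i \<le> Suc k"
   then have "n - Suc i \<le> k" by simp
   then have b: "baer (E (Suc (Suc i))) (\<delta> (Suc i) ` carrier (E (Suc i)))" using Suc ex by simp
   have div: "\<exists>z'\<in>module_ker (E (Suc i)) (E (Suc (Suc i))) (\<delta> (Suc i)). u \<odot>\<^bsub>E (Suc i)\<^esub> z' = z"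
    if z: "z \<in> module_ker (E (Suc i)) (E (Suc (Suc i))) (\<delta> (Suc i))" for z
   proof -
    obtain e where e: "e \<in> carrier (E i)" "z = \<delta> i e" using z unfolding ex[symmetric] by blast
    obtain e' where e': "e' \<in> carrier (E i)" "u \<odot>\<^bsub>E i\<^esub> e' = e"
     using injective_divisible[OF E inj uR u(2) e(1)] by blast
    show ?thesis unfolding ex[symmetric]
     using e'(1) module_hom_smult[OF d uR e'(1)] e'(2) e(2) by (intro bexI[of _ "\<delta> i e'"]) auto
   qed
   show "baer (E (Suc i)) (module_ker (E (Suc i)) (E (Suc (Suc i))) (\<delta> (Suc i)))"
    by (rule baer_step[OF E E d inj u div b])
  qed
 qed
 then show ?thesis by blast
qed

text \<open>Let \<open>f : \<mm> \<rightarrow> R\<close> be \<open>r \<mapsto> r s2/u\<close>. In the injective module \<open>E 0\<close> it becomes multiplication by an element \<open>e\<close>, whose image in the first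
syzygy is killed by \<open>\<mm>\<close>. That syzygy satisfies Baer's criterion, so the image of \<open>e\<close> is \<open>s1\<close> times some \<open>w\<close> killed by \<open>u\<close>.
Lifting \<open>w\<close> back to \<open>E 0\<close> and comparing in \<open>R\<close> gives \<open>s1 q - s2 = u p\<close>.\<close>

lemma simple_socle:
 assumes gor: "finite_injdim R Rmod" and u: "u \<in> \<mm>" "u \<noteq> \<zero>"
  and s1: "s1 \<in> carrier R" "s1 \<notin> PIdl u"
  and s2: "s2 \<in> carrier R" "\<And>x. x \<in> \<mm> ==> x \<otimes> s2 \<in> PIdl u"
 shows "\<exists>t\<in>carrier R. s2 \<ominus> t \<otimes> s1 \<in> PIdl u"
proof -
 from gor obtain E :: "nat \<Rightarrow> ('a, nat \<Rightarrow> 'a) module" and \<delta> \<iota> n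
  where res: "injective_resolution R Rmod E \<delta> \<iota>" and fin: "\<forall>i>n. carrier (E i) = {\<zero>\<^bsub>E i\<^esub>}"
  unfolding finite_injdim_def by blast
 have inj: "injective_module R (E i)" and d: "\<delta> i \<in> module_hom R (E i) (E (Suc i))"
  and ex: "\<delta> i ` carrier (E i) = module_ker (E (Suc i)) (E (Suc (Suc i))) (\<delta> (Suc i))" for i
  using res unfolding injective_resolution_def by blast+
 have io: "\<iota> \<in> module_hom R Rmod (E 0)" "inj_on \<iota> (carrier R)" "\<iota> ` carrier R = module_ker (E 0) (E (Suc 0)) (\<delta> 0)"
  and Rm: "module R Rmod"
  using res unfolding injective_resolution_def by auto
 have E: "module R (E i)" for i using inj unfolding injective_module_def by blast
 have uR: "u \<in> carrier R" by (rule ideal_facts(2)[OF mm_ideal u(1)])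
 note mR = ideal_facts(2)[OF mm_ideal]
 interpret E0: module R "E 0" by (rule E)
 interpret E1: module R "E (Suc 0)" by (rule E)
 note ioc = module_hom_closed[OF io(1)] and ioa = module_hom_add[OF io(1)] and ios = module_hom_smult[OF io(1)]
 note dc = module_hom_closed[OF d[of 0]] and dm = module_hom_minus_eq[OF E E d[of 0]] and ds = module_hom_smult[OF d[of 0]]
 define f where "f r = (SOME c. c \<in> carrier R \<and> r \<otimes> s2 = u \<otimes> c)" for r
 have f: "f r \<in> carrier R" "r \<otimes> s2 = u \<otimes> f r" if r: "r \<in> \<mm>" for r
 proof -
  obtain c where "c \<in> carrier R" "r \<otimes> s2 = c \<otimes> u" using s2(2)[OF r] unfolding PIdl_iff by blast
  then have "\<exists>c. c \<in> carrier R \<and> r \<otimes> s2 = u \<otimes> c" using uR m_comm by auto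
  from someI_ex[OF this] show "f r \<in> carrier R" "r \<otimes> s2 = u \<otimes> f r" unfolding f_def by simp_all
 qed
 have feq: "f r = c" if "r \<in> \<mm>" "c \<in> carrier R" "r \<otimes> s2 = u \<otimes> c" for r c
  using cancel_left[OF uR u(2) f(1)[OF that(1)] that(2)] f(2)[OF that(1)] that(3) by simp
 have "linear_on R Rmod (E 0) \<mm> (\<lambda>r. \<iota> (f r))"
 proof (rule linear_onI)
  show "\<iota> (f r) \<in> carrier (E 0)" if "r \<in> \<mm>" for r using ioc f(1)[OF that] by auto
  show "\<iota> (f (r \<oplus>\<^bsub>Rmod\<^esub> r')) = \<iota> (f r) \<oplus>\<^bsub>E 0\<^esub> \<iota> (f r')" if r: "r \<in> \<mm>" "r' \<in> \<mm>" for r r'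
  proof -
   have "f (r \<oplus> r') = f r \<oplus> f r'"
    using feq[OF ideal_facts(4)[OF mm_ideal r]] f[OF r(1)] f[OF r(2)] mR[OF r(1)] mR[OF r(2)] s2(1) uR by (simp add: l_distr r_distr)
   then show ?thesis using ioa f(1) r by simp
  qed
  show "\<iota> (f (c \<odot>\<^bsub>Rmod\<^esub> r)) = c \<odot>\<^bsub>E 0\<^esub> \<iota> (f r)" if c: "c \<in> carrier R" and r: "r \<in> \<mm>" for c r
  proof -
   have "f (c \<otimes> r) = c \<otimes> f r"
    using feq[OF ideal_facts(5)[OF mm_ideal r c]] f[OF r] mR[OF r] s2(1) uR c by (simp add: m_assoc) (simp add: m_lcomm)
   then show ?thesis using ios f(1) r c by simp
  qed
 qed
 from baer_of_injective[OF inj mm_ideal this] obtain e where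
  e: "e \<in> carrier (E 0)" "\<forall>r\<in>\<mm>. \<iota> (f r) = r \<odot>\<^bsub>E 0\<^esub> e" by blast
 have dio: "\<delta> 0 (\<iota> r) = \<zero>\<^bsub>E (Suc 0)\<^esub>" if "r \<in> carrier R" for r
  using that io(3) by (auto simp: module_ker_def)
 have de: "\<delta> 0 e \<in> carrier (E (Suc 0))" using dc e(1) by blast
 have rde: "r \<odot>\<^bsub>E (Suc 0)\<^esub> \<delta> 0 e = \<zero>\<^bsub>E (Suc 0)\<^esub>" if r: "r \<in> \<mm>" for r
  using ds[OF mR[OF r] e(1)] e(2) r dio[OF f(1)[OF r]] by simp
 define Z where "Z = \<delta> 0 ` carrier (E 0)"
 have Zk: "Z = module_ker (E (Suc 0)) (E (Suc (Suc 0))) (\<delta> (Suc 0))" unfolding Z_def by (rule ex)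
 note Zc = ker_closed[OF E E d[of "Suc 0"], folded Zk]
 have Z: "Z \<subseteq> carrier (E (Suc 0))" "\<zero>\<^bsub>E (Suc 0)\<^esub> \<in> Z" "\<delta> 0 e \<in> Z" "baer (E (Suc 0)) Z"
 proof -
  show "Z \<subseteq> carrier (E (Suc 0))" using Zc(1) by blast
  show "\<zero>\<^bsub>E (Suc 0)\<^esub> \<in> Z" unfolding Zk using module_hom_zero_eq[OF E E d] by (simp add: module_ker_def)
  show "\<delta> 0 e \<in> Z" unfolding Z_def using e(1) by simp
  show "baer (E (Suc 0)) Z" unfolding Zk by (rule baer_kernels[OF res fin u])
 qed
 have "\<exists>w. w \<in> Z \<and> s1 \<odot>\<^bsub>E (Suc 0)\<^esub> w = \<delta> 0 e \<and> u \<odot>\<^bsub>E (Suc 0)\<^esub> w = \<zero>\<^bsub>E (Suc 0)\<^esub>"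
  by (rule hom_on_line[OF E u s1 de]) (fact rde Z Zc(2) Zc(3))+
 then obtain w where w: "w \<in> carrier (E 0)" "s1 \<odot>\<^bsub>E (Suc 0)\<^esub> \<delta> 0 w = \<delta> 0 e" "u \<odot>\<^bsub>E (Suc 0)\<^esub> \<delta> 0 w = \<zero>\<^bsub>E (Suc 0)\<^esub>"
  unfolding Z_def by blast
 have "u \<odot>\<^bsub>E 0\<^esub> w \<in> \<iota> ` carrier R" unfolding io(3) module_ker_def using w ds[OF uR w(1)] uR by simp
 then obtain q where q: "q \<in> carrier R" "u \<odot>\<^bsub>E 0\<^esub> w = \<iota> q" by blast
 have "s1 \<odot>\<^bsub>E 0\<^esub> w \<ominus>\<^bsub>E 0\<^esub> e \<in> \<iota> ` carrier R" unfolding io(3) module_ker_def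
  using w e(1) s1(1) ds[OF s1(1) w(1)] dm[of "s1 \<odot>\<^bsub>E 0\<^esub> w" e] de by (simp add: a_minus_def E1.M.r_neg)
 then obtain p where p: "p \<in> carrier R" "s1 \<odot>\<^bsub>E 0\<^esub> w \<ominus>\<^bsub>E 0\<^esub> e = \<iota> p" by blast
 have ip: "\<iota> p \<in> carrier (E 0)" using ioc p(1) by auto
 have sw: "s1 \<odot>\<^bsub>E 0\<^esub> w = \<iota> p \<oplus>\<^bsub>E 0\<^esub> e"
  using e(1) w(1) s1(1) unfolding p(2)[symmetric] by (simp add: a_minus_def E0.M.a_assoc E0.M.l_neg)
 have fu: "f u = s2" using feq[OF u(1) s2(1)] by simp
 have "\<iota> (s1 \<otimes> q) = s1 \<odot>\<^bsub>E 0\<^esub> (u \<odot>\<^bsub>E 0\<^esub> w)" using ios[OF s1(1), of q] q by simp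
 also have "\<dots> = u \<odot>\<^bsub>E 0\<^esub> (s1 \<odot>\<^bsub>E 0\<^esub> w)" using s1(1) uR w(1) by (simp add: E0.smult_assoc1[symmetric] m_comm)
 also have "\<dots> = u \<odot>\<^bsub>E 0\<^esub> \<iota> p \<oplus>\<^bsub>E 0\<^esub> u \<odot>\<^bsub>E 0\<^esub> e" using sw uR ip e(1) by (simp add: E0.smult_r_distr)
 also have "\<dots> = \<iota> (u \<otimes> p) \<oplus>\<^bsub>E 0\<^esub> \<iota> s2" using ios[OF uR, of p] p(1) e(2) u(1) fu by auto
 also have "\<dots> = \<iota> (u \<otimes> p \<oplus> s2)" using ioa[of "u \<otimes> p" s2] p(1) uR s2(1) by simp
 finally have eq: "s1 \<otimes> q = u \<otimes> p \<oplus> s2" using inj_onD[OF io(2)] s1(1) q(1) p(1) uR s2(1) by auto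
 have "s2 \<ominus> q \<otimes> s1 = \<ominus> p \<otimes> u"
 proof -
  have "s2 \<ominus> q \<otimes> s1 = s2 \<ominus> (u \<otimes> p \<oplus> s2)" using eq s1(1) q(1) m_comm by simp
  also have "\<dots> = \<ominus> p \<otimes> u" using p(1) uR s2(1) by algebra
  finally show ?thesis .
 qed
 then have "s2 \<ominus> q \<otimes> s1 \<in> PIdl u" unfolding PIdl_iff using p(1) by (intro bexI[of _ "\<ominus> p"]) auto
 then show ?thesis using q(1) by blast
qed

end

lemma (in abelian_monoid) finsum_support:
 assumes "finite D" "C \<subseteq> D" "f \<in> D \<rightarrow> carrier G" "\<And>v. v \<in> D - C ==> f v = \<zero>"
 shows "finsum G f D = finsum G f C"
proof -
 have D: "D = C \<union> (D - C)" using assms(2) by blast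
 have "finsum G f D = finsum G f C \<oplus> finsum G f (D - C)"
  using assms(1-3) finite_subset[OF assms(2,1)] by (subst D, intro finsum_Un_disjoint) auto
 moreover have "finsum G f (D - C) = \<zero>" using assms(4) by (intro finsum_all0) auto
 moreover have "finsum G f C \<in> carrier G" using assms(2,3) by (intro finsum_closed) blast
 ultimately show ?thesis by simp
qed

text \<open>The universal property of a basis. Coefficients are functions with finite support that vanish off a finite set \<open>C\<close>; \<open>C\<close> may be enlarged freely, so two representations can be compared on a common set.\<close>

lemma (in module) free_extension:
 assumes B: "B \<subseteq> carrier M" "lin_indpt B" "span B = carrier M" and h: "h \<in> B \<rightarrow> carrier R"
 shows "\<exists>G. G \<in> module_hom R M (ideal_module R (carrier R)) \<and> (\<forall>b\<in>B. G b = h b)"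
proof -
 define Q where "Q x a C \<longleftrightarrow> finite C \<and> C \<subseteq> B \<and> a \<in> UNIV \<rightarrow> carrier R \<and> (\<forall>v. v \<notin> C \<longrightarrow> a v = \<zero>) \<and> lincomb a C = x" for x a C
 define val where "val a C = finsum R (\<lambda>v. a v \<otimes> h v) C" for a C
 have Qx: "x \<in> carrier M" if "Q x a C" for x a C
  using that B(1) lincomb_closed[of C a] unfolding Q_def by blast
 have ex: "\<exists>a C. Q x a C" if "x \<in> carrier M" for x
 proof -
  have "x \<in> span B" using that B(3) by simp
  then have "\<exists>a C. x = lincomb a C \<and> finite C \<and> C \<subseteq> B \<and> a \<in> C \<rightarrow> carrier R" unfolding span_def by (rule CollectD)
  then obtain a C where aC: "finite C" "C \<subseteq> B" "a \<in> C \<rightarrow> carrier R" "x = lincomb a C" by (elim exE conjE)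
  let ?a = "\<lambda>v. if v \<in> C then a v else \<zero>"
  have "lincomb ?a C = lincomb a C" using aC B(1) by (intro lincomb_cong) auto
  then have "Q x ?a C" unfolding Q_def using aC by auto
  then show ?thesis by blast
 qed
 have mono: "Q x a D" "val a D = val a C" if Q: "Q x a C" and D: "finite D" "C \<subseteq> D" "D \<subseteq> B" for x a C D
 proof -
  have a: "a v \<in> carrier R" for v using Q unfolding Q_def by blast
  have "lincomb a D = lincomb a C" unfolding lincomb_def
  proof (rule M.finsum_support[OF D(1,2)])
   show "(\<lambda>v. a v \<odot>\<^bsub>M\<^esub> v) \<in> D \<rightarrow> carrier M" using a B(1) D(3) by blast
   show "a v \<odot>\<^bsub>M\<^esub> v = \<zero>\<^bsub>M\<^esub>" if "v \<in> D - C" for v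
   proof -
    have "a v = \<zero>" using Q that unfolding Q_def by blast
    moreover have "v \<in> carrier M" using that B(1) D(3) by blast
    ultimately show ?thesis by simp
   qed
  qed
  then show "Q x a D" using Q D unfolding Q_def by blast
  show "val a D = val a C" unfolding val_def
  proof (rule R.finsum_support[OF D(1,2)])
   show "(\<lambda>v. a v \<otimes> h v) \<in> D \<rightarrow> carrier R" using a h D(3) by (auto simp: Pi_iff)
   show "a v \<otimes> h v = \<zero>" if "v \<in> D - C" for v
   proof -
    have "a v = \<zero>" using Q that unfolding Q_def by blast
    moreover have "h v \<in> carrier R" using that h D(3) by blast
    ultimately show ?thesis by simp
   qed
  qed
 qed
 have uniq: "val a C = val b D" if p: "Q x a C" and q: "Q x b D" for x a b C D
 proof -
  let ?E = "C \<union> D"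
  have E: "finite ?E" "C \<subseteq> ?E" "D \<subseteq> ?E" "?E \<subseteq> B" using p q unfolding Q_def by auto
  note pE = mono[OF p E(1,2,4)] and qE = mono[OF q E(1,3,4)]
  have ab: "a \<in> ?E \<rightarrow> carrier R" "b \<in> ?E \<rightarrow> carrier R" using p q unfolding Q_def by auto
  have Ec: "?E \<subseteq> carrier M" using E(4) B(1) by blast
  have "lincomb (\<lambda>v. a v \<ominus> b v) ?E = x \<ominus>\<^bsub>M\<^esub> x"
   using lincomb_diff[OF E(1) Ec ab] pE(1) qE(1) unfolding Q_def by simp
  then have z: "lincomb (\<lambda>v. a v \<ominus> b v) ?E = \<zero>\<^bsub>M\<^esub>" using Qx[OF p] by (simp add: a_minus_def M.r_neg)
  have "a v = b v" if v: "v \<in> ?E" for v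
  proof (rule ccontr)
   assume n: "a v \<noteq> b v"
   have c: "a v \<in> carrier R" "b v \<in> carrier R" using v ab by blast+
   then have "a v \<ominus> b v \<noteq> \<zero>" using n by (metis R.r_right_minus_eq)
   moreover have "(\<lambda>v. a v \<ominus> b v) \<in> ?E \<rightarrow> carrier R" using ab by (auto simp: Pi_iff)
   ultimately have "lin_dep B" using lin_dep_crit[OF E(1,4) _ v _ z] by blast
   then show False using B(2) by simp
  qed
  then have "val a ?E = val b ?E" unfolding val_def using ab h E(4)
   by (intro R.finsum_cong') (auto simp: Pi_iff)
  then show ?thesis using pE(2) qE(2) by simp
 qed
 define G where "G x = (SOME y. \<exists>a C. Q x a C \<and> y = val a C)" for x
 have Geq: "G x = val a C" if Q: "Q x a C" for x a C
 proof -
  have "\<exists>y. \<exists>a C. Q x a C \<and> y = val a C" using Q by blast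
  from someI_ex[OF this] obtain a' C' where "Q x a' C'" "G x = val a' C'" unfolding G_def by blast
  then show ?thesis using uniq[OF Q] by simp
 qed
 have valc: "val a C \<in> carrier R" if "Q x a C" for x a C
  unfolding val_def using that h by (intro R.finsum_closed) (auto simp: Q_def Pi_iff)
 have "G \<in> module_hom R M (ideal_module R (carrier R))"
 proof -
  have 1: "G x \<in> carrier R" if "x \<in> carrier M" for x using ex[OF that] Geq valc by metis
  have 2: "G (x \<oplus>\<^bsub>M\<^esub> y) = G x \<oplus> G y" if x: "x \<in> carrier M" and y: "y \<in> carrier M" for x y
  proof -
   obtain a C where p: "Q x a C" using ex[OF x] by blast
   obtain b D where q: "Q y b D" using ex[OF y] by blast
   let ?E = "C \<union> D"
   have E: "finite ?E" "C \<subseteq> ?E" "D \<subseteq> ?E" "?E \<subseteq> B" using p q unfolding Q_def by auto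
   note pE = mono[OF p E(1,2,4)] and qE = mono[OF q E(1,3,4)]
   have ab: "a \<in> ?E \<rightarrow> carrier R" "b \<in> ?E \<rightarrow> carrier R" using p q unfolding Q_def by auto
   have Ec: "?E \<subseteq> carrier M" using E(4) B(1) by blast
   have "Q (x \<oplus>\<^bsub>M\<^esub> y) (\<lambda>v. a v \<oplus> b v) ?E"
    using lincomb_sum[OF E(1) Ec ab] pE(1) qE(1) unfolding Q_def by (auto simp: Pi_iff)
   then have "G (x \<oplus>\<^bsub>M\<^esub> y) = val (\<lambda>v. a v \<oplus> b v) ?E" by (rule Geq)
   also have "\<dots> = finsum R (\<lambda>v. a v \<otimes> h v \<oplus> b v \<otimes> h v) ?E"
    unfolding val_def using ab h E(4) by (intro R.finsum_cong') (auto simp: Pi_iff subset_iff R.l_distr)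
   also have "\<dots> = val a ?E \<oplus> val b ?E"
    unfolding val_def using ab h E(4) by (intro R.finsum_addf) (auto simp: Pi_iff subset_iff)
   finally show ?thesis using Geq[OF pE(1)] Geq[OF qE(1)] by simp
  qed
  have 3: "G (c \<odot>\<^bsub>M\<^esub> x) = c \<otimes> G x" if c: "c \<in> carrier R" and x: "x \<in> carrier M" for c x
  proof -
   obtain a C where p: "Q x a C" using ex[OF x] by blast
   have C: "finite C" "C \<subseteq> B" "a \<in> C \<rightarrow> carrier R" "C \<subseteq> carrier M" using p B(1) unfolding Q_def by auto
   have "Q (c \<odot>\<^bsub>M\<^esub> x) (\<lambda>v. c \<otimes> a v) C"
    using lincomb_smult[OF C(4,3) c] p c unfolding Q_def by (auto simp: Pi_iff)
   then have "G (c \<odot>\<^bsub>M\<^esub> x) = val (\<lambda>v. c \<otimes> a v) C" by (rule Geq)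
   also have "\<dots> = finsum R (\<lambda>v. c \<otimes> (a v \<otimes> h v)) C"
    unfolding val_def using C h c by (intro R.finsum_cong') (auto simp: Pi_iff subset_iff R.m_assoc)
   also have "\<dots> = c \<otimes> val a C"
    unfolding val_def using C h c by (intro R.finsum_rdistr[symmetric]) (auto simp: Pi_iff subset_iff)
   finally show ?thesis using Geq[OF p] by simp
  qed
  show ?thesis using 1 2 3 by (auto simp: module_hom_def ideal_module_def)
 qed
 moreover have "G b = h b" if b: "b \<in> B" for b
 proof -
  have bc: "b \<in> carrier M" "h b \<in> carrier R" using b B(1) h by blast+
  let ?a = "\<lambda>v. if v = b then \<one> else \<zero>"
  have "lincomb ?a {b} = b" unfolding lincomb_def using bc(1) by simp
  then have "Q b ?a {b}" unfolding Q_def using b by auto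
  then have "G b = val ?a {b}" by (rule Geq)
  then show ?thesis unfolding val_def using bc(2) by simp
 qed
 ultimately show ?thesis by blast
qed

section \<open>Vanishing of Ext and lifting of homomorphisms\<close>

context one_dim_domain
begin

definition scaled where "scaled u \<aa> = (\<lambda>x. u \<otimes> x) ` \<aa>"

lemma scaled_ideal:
 assumes aa: "ideal \<aa> R" and u: "u \<in> carrier R"
 shows "ideal (scaled u \<aa>) R"
proof (rule idealI)
 note If = ideal_facts[OF aa]
 show "ring R" by (rule ring_axioms)
 show "subgroup (scaled u \<aa>) (add_monoid R)"
 proof (rule add.subgroupI)
  show "scaled u \<aa> \<subseteq> carrier R" using If(2) u unfolding scaled_def by auto
  show "scaled u \<aa> \<noteq> {}" using If(3) unfolding scaled_def by blast
  show "\<ominus> a \<in> scaled u \<aa>" if a: "a \<in> scaled u \<aa>" for a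
  proof -
   obtain x where x: "x \<in> \<aa>" "a = u \<otimes> x" using a unfolding scaled_def by blast
   have "\<ominus> a = u \<otimes> \<ominus> x" using x u If(2) by (simp add: r_minus)
   then show ?thesis unfolding scaled_def using If(7)[OF x(1)] by blast
  qed
  show "a \<oplus> b \<in> scaled u \<aa>" if ab: "a \<in> scaled u \<aa>" "b \<in> scaled u \<aa>" for a b
  proof -
   obtain x y where x: "x \<in> \<aa>" "a = u \<otimes> x" and y: "y \<in> \<aa>" "b = u \<otimes> y" using ab unfolding scaled_def by blast
   have "a \<oplus> b = u \<otimes> (x \<oplus> y)" using x y u If(2) by (simp add: r_distr)
   then show ?thesis unfolding scaled_def using If(4)[OF x(1) y(1)] by blast
  qed
 qed
 show "r \<otimes> a \<in> scaled u \<aa>" if a: "a \<in> scaled u \<aa>" and r: "r \<in> carrier R" for a r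
 proof -
  obtain x where x: "x \<in> \<aa>" "a = u \<otimes> x" using a unfolding scaled_def by blast
  have "r \<otimes> a = u \<otimes> (r \<otimes> x)" using x u r If(2) by (simp add: m_lcomm)
  then show ?thesis unfolding scaled_def using If(5)[OF x(1) r] by blast
 qed
 show "a \<otimes> r \<in> scaled u \<aa>" if a: "a \<in> scaled u \<aa>" and r: "r \<in> carrier R" for a r
 proof -
  obtain x where x: "x \<in> \<aa>" "a = u \<otimes> x" using a unfolding scaled_def by blast
  have "a \<otimes> r = u \<otimes> (x \<otimes> r)" using x u r If(2) by (simp add: m_assoc)
  then show ?thesis unfolding scaled_def using If(6)[OF x(1) r] by blast
 qed
qed

lemma scaledI: "x \<in> \<aa> ==> u \<otimes> x \<in> scaled u \<aa>"
 unfolding scaled_def by blast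

lemma scaledE: "y \<in> scaled u \<aa> ==> \<exists>x\<in>\<aa>. y = u \<otimes> x"
 unfolding scaled_def by blast

text \<open>Every cocycle is a coboundary. The group elements are maps that are undefined off the carrier, so a cocycle is restricted first.\<close>

lemma trivial_Ext1:
 assumes M: "module R M" and N: "module R N" and res: "free_resolution R M F d \<epsilon>"
  and tr: "trivial_group (Ext_group R F d N 1)"
  and c: "c \<in> module_hom R (F 1) N" "\<And>x. x \<in> carrier (F (Suc 1)) ==> c (d 1 x) = \<zero>\<^bsub>N\<^esub>"
 shows "\<exists>h\<in>module_hom R (F 0) N. \<forall>x\<in>carrier (F 1). c x = h (d 0 x)"
proof -
 interpret N: module R N by (rule N)
 have dm: "d i \<in> module_hom R (F (Suc i)) (F i)" and Fm: "module R (F i)" for i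
  using res unfolding free_resolution_def free_module_def by blast+
 define c' where "c' = restrict c (carrier (F 1))"
 interpret F1: module R "F (Suc 0)" by (rule Fm)
 interpret F0: module R "F 0" by (rule Fm)
 have d1: "d 1 x \<in> carrier (F 1)" if "x \<in> carrier (F (Suc 1))" for x
  using module_hom_closed[OF dm[of 1]] that by blast
 have d0: "d 0 x \<in> carrier (F 0)" if "x \<in> carrier (F 1)" for x
  using module_hom_closed[OF dm[of 0]] that by auto
 have cN: "c x \<in> carrier N" if "x \<in> carrier (F 1)" for x using module_hom_closed[OF c(1)] that by blast
 have c'h: "c' \<in> carrier (Hom_group R (F 1) N)"
  using module_hom_add[OF c(1)] module_hom_smult[OF c(1)] cN
  by (auto simp: Hom_group_def module_hom_def c'_def)
 have "codiff F d 1 c' = \<one>\<^bsub>Hom_group R (F (Suc 1)) N\<^esub>"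
  unfolding codiff_def Hom_group_def using c(2) d1 by (auto simp: c'_def restrict_def)
 then have cc: "c' \<in> cocycles R F d N 1" unfolding cocycles_def kernel_def using c'h by simp
 let ?G = "(Hom_group R (F 1) N)\<lparr>carrier := cocycles R F d N 1\<rparr>"
 let ?H = "coboundaries R F d N 1"
 have H: "?H = codiff F d 0 ` carrier (Hom_group R (F 0) N)" by simp
 have z: "(\<lambda>x\<in>carrier (F 0). \<zero>\<^bsub>N\<^esub>) \<in> carrier (Hom_group R (F 0) N)"
  by (simp add: Hom_group_def module_hom_def Pi_iff)
 have z': "codiff F d 0 (\<lambda>x\<in>carrier (F 0). \<zero>\<^bsub>N\<^esub>) = (\<lambda>x\<in>carrier (F 1). \<zero>\<^bsub>N\<^esub>)"
  unfolding codiff_def using d0 by (auto simp: restrict_def)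
 have zH: "(\<lambda>x\<in>carrier (F 1). \<zero>\<^bsub>N\<^esub>) \<in> ?H" unfolding H z'[symmetric] using z by (rule imageI)
 have "?H #>\<^bsub>?G\<^esub> c' \<in> carrier (Ext_group R F d N 1)"
  unfolding Ext_group_def FactGroup_def RCOSETS_def using cc by auto
 moreover have "carrier (Ext_group R F d N 1) = {?H}"
  using tr unfolding trivial_group_def Ext_group_def FactGroup_def by simp
 ultimately have e: "?H #>\<^bsub>?G\<^esub> c' = ?H" by simp
 have "(\<lambda>x\<in>carrier (F 1). \<zero>\<^bsub>N\<^esub>) \<otimes>\<^bsub>?G\<^esub> c' \<in> ?H #>\<^bsub>?G\<^esub> c'" unfolding r_coset_def using zH by blast
 moreover have "(\<lambda>x\<in>carrier (F 1). \<zero>\<^bsub>N\<^esub>) \<otimes>\<^bsub>?G\<^esub> c' = c'"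
  using cN by (auto simp: Hom_group_def c'_def restrict_def)
 ultimately have "c' \<in> ?H" using e by simp
 then obtain h where h: "h \<in> carrier (Hom_group R (F 0) N)" "c' = codiff F d 0 h" unfolding H by (rule imageE)
 have "c x = h (d 0 x)" if x: "x \<in> carrier (F 1)" for x
 proof -
  have "c' x = codiff F d 0 h x" by (simp only: h(2))
  then show ?thesis using x by (simp add: c'_def codiff_def)
 qed
 moreover have "h \<in> module_hom R (F 0) N" using h(1) by (simp add: Hom_group_def)
 ultimately show ?thesis by blast
qed

text \<open>Part of the long exact sequence for \<open>0 \<rightarrow> \<aa> \<rightarrow> \<aa> \<rightarrow> \<aa>/u\<aa> \<rightarrow> 0\<close>; the map to \<open>\<aa>/u\<aa>\<close> is given by representatives \<open>g\<close>. Lift \<open>g\<close> over the free module \<open>F 0\<close> to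
\<open>G\<close>. On \<open>F 1\<close> the composite of \<open>G\<close> with the differential is divisible by \<open>u\<close>, and the quotient is a cocycle, hence the restriction of some \<open>h\<close> on \<open>F 0\<close>.
Then \<open>G - u h\<close> vanishes on the relations and descends to \<open>\<aa>\<close>.\<close>

lemma rigid_lifts:
 assumes rig: "Ext_vanishes R 1 (ideal_module R \<aa>) (ideal_module R \<aa>)" and aa: "ideal \<aa> R"
  and u: "u \<in> carrier R" "u \<noteq> \<zero>"
  and g: "\<And>x. x \<in> \<aa> ==> g x \<in> \<aa>"
   "\<And>x y. x \<in> \<aa> ==> y \<in> \<aa> ==> g (x \<oplus> y) \<ominus> (g x \<oplus> g y) \<in> scaled u \<aa>"
   "\<And>r x. r \<in> carrier R ==> x \<in> \<aa> ==> g (r \<otimes> x) \<ominus> r \<otimes> g x \<in> scaled u \<aa>"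
 shows "\<exists>e. linear_on R Rmod Rmod \<aa> e \<and> (\<forall>x\<in>\<aa>. e x \<in> \<aa> \<and> e x \<ominus> g x \<in> scaled u \<aa>)"
proof -
 let ?I = "ideal_module R \<aa>" and ?N = "scaled u \<aa>"
 from rig obtain F :: "nat \<Rightarrow> ('a, nat \<Rightarrow> 'a) module" and d \<epsilon> where res: "free_resolution R ?I F d \<epsilon>"
  and tr: "trivial_group (Ext_group R F d ?I 1)" unfolding Ext_vanishes_def by blast
 have mI: "module R ?I" and free: "free_module R (F i)" and dm: "d i \<in> module_hom R (F (Suc i)) (F i)"
  and em: "\<epsilon> \<in> module_hom R (F 0) ?I" and es: "\<epsilon> ` carrier (F 0) = \<aa>"
  and ker0: "d 0 ` carrier (F (Suc 0)) = module_ker (F 0) ?I \<epsilon>"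
  and ker1: "d (Suc 0) ` carrier (F (Suc (Suc 0))) = module_ker (F (Suc 0)) (F 0) (d 0)" for i
  using res unfolding free_resolution_def by auto
 have Fm: "module R (F i)" for i using free unfolding free_module_def by blast
 interpret F0: module R "F 0" by (rule Fm)
 interpret F1: module R "F (Suc 0)" by (rule Fm)
 note If = ideal_facts[OF aa] and Nf = ideal_facts[OF scaled_ideal[OF aa u(1)]]
 have NI: "x \<in> \<aa>" if "x \<in> ?N" for x using scaledE[OF that] If(5)[OF _ u(1)] by blast
 have ec: "\<epsilon> z \<in> \<aa>" if "z \<in> carrier (F 0)" for z using es that by blast
 have ea: "\<epsilon> (z \<oplus>\<^bsub>F 0\<^esub> z') = \<epsilon> z \<oplus> \<epsilon> z'" if "z \<in> carrier (F 0)" "z' \<in> carrier (F 0)" for z z'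
  using module_hom_add[OF em] that by simp
 have esm: "\<epsilon> (r \<odot>\<^bsub>F 0\<^esub> z) = r \<otimes> \<epsilon> z" if "r \<in> carrier R" "z \<in> carrier (F 0)" for r z
  using module_hom_smult[OF em] that by simp
 have e0: "\<epsilon> \<zero>\<^bsub>F 0\<^esub> = \<zero>" using module_hom_zero_eq[OF Fm mI em] by simp
 have g0: "g \<zero> \<in> ?N" using g(3)[OF zero_closed If(3)] If(2)[OF g(1)[OF If(3)]] by (simp add: a_minus_def)
 obtain B where B: "B \<subseteq> carrier (F 0)" "F0.lin_indpt B" "F0.span B = carrier (F 0)"
  using free[of 0] unfolding free_module_def by blast
 have hB: "(\<lambda>b. g (\<epsilon> b)) \<in> B \<rightarrow> carrier R" using B(1) ec g(1) If(2) by blast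
 obtain G where G: "G \<in> module_hom R (F 0) Rmod" "\<forall>b\<in>B. G b = g (\<epsilon> b)"
  using F0.free_extension[OF B hB] by blast
 have Rm: "module R Rmod"
  by (rule module_criteria) (auto simp: is_cring a_ac l_distr r_distr m_assoc intro: r_neg)
 have Gc: "G z \<in> carrier R" if "z \<in> carrier (F 0)" for z using module_hom_closed[OF G(1)] that by auto
 have Ga: "G (z \<oplus>\<^bsub>F 0\<^esub> z') = G z \<oplus> G z'" if "z \<in> carrier (F 0)" "z' \<in> carrier (F 0)" for z z'
  using module_hom_add[OF G(1)] that by simp
 have Gs: "G (r \<odot>\<^bsub>F 0\<^esub> z) = r \<otimes> G z" if "r \<in> carrier R" "z \<in> carrier (F 0)" for r z
  using module_hom_smult[OF G(1)] that by simp
 have G0: "G \<zero>\<^bsub>F 0\<^esub> = \<zero>" using module_hom_zero_eq[OF Fm Rm G(1)] by simp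
 define L where "L = {z \<in> carrier (F 0). G z \<ominus> g (\<epsilon> z) \<in> ?N}"
 have "submodule R L (F 0)"
 proof (unfold_locales)
  show "L \<subseteq> carrier (F 0)" unfolding L_def by blast
  show "\<zero>\<^bsub>F 0\<^esub> \<in> L" unfolding L_def using G0 e0 Nf(7)[OF g0] Nf(2)[OF g0] by (simp add: a_minus_def)
  show "z \<oplus>\<^bsub>F 0\<^esub> z' \<in> L" if z: "z \<in> L" "z' \<in> L" for z z'
  proof -
   have c: "z \<in> carrier (F 0)" "z' \<in> carrier (F 0)" using z by (simp_all add: L_def)
   note e = ec[OF c(1)] ec[OF c(2)]
   have k: "g (\<epsilon> z) \<in> carrier R" "g (\<epsilon> z') \<in> carrier R" "g (\<epsilon> z \<oplus> \<epsilon> z') \<in> carrier R"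
    using If(2)[OF g(1)] e If(4) by blast+
   have "G z \<oplus> G z' \<ominus> g (\<epsilon> z \<oplus> \<epsilon> z')
     = ((G z \<ominus> g (\<epsilon> z)) \<oplus> (G z' \<ominus> g (\<epsilon> z'))) \<ominus> (g (\<epsilon> z \<oplus> \<epsilon> z') \<ominus> (g (\<epsilon> z) \<oplus> g (\<epsilon> z')))"
    using Gc[OF c(1)] Gc[OF c(2)] k by algebra
   also have "\<dots> \<in> ?N" by (rule Nf(8)[OF Nf(4) g(2)[OF e]]) (use z in \<open>simp_all add: L_def\<close>)
   finally show ?thesis using c by (simp add: L_def Ga ea)
  qed
  show "r \<odot>\<^bsub>F 0\<^esub> z \<in> L" if r: "r \<in> carrier R" and z: "z \<in> L" for r z
  proof -
   have c: "z \<in> carrier (F 0)" using z by (simp add: L_def)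
   have k: "g (\<epsilon> z) \<in> carrier R" "g (r \<otimes> \<epsilon> z) \<in> carrier R" using If(2)[OF g(1)] ec[OF c] If(5)[OF _ r] by blast+
   have "r \<otimes> G z \<ominus> g (r \<otimes> \<epsilon> z) = r \<otimes> (G z \<ominus> g (\<epsilon> z)) \<ominus> (g (r \<otimes> \<epsilon> z) \<ominus> r \<otimes> g (\<epsilon> z))"
    using Gc[OF c] k r by algebra
   also have "\<dots> \<in> ?N" by (rule Nf(8)[OF Nf(5)[OF _ r] g(3)[OF r ec[OF c]]]) (use z in \<open>simp_all add: L_def\<close>)
   finally show ?thesis using c r by (simp add: L_def Gs esm)
  qed
 qed
 moreover have "B \<subseteq> L"
 proof
  fix b assume b: "b \<in> B"
  then have "b \<in> carrier (F 0)" using B(1) by blast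
  then show "b \<in> L" unfolding L_def using G(2) b If(2)[OF g(1)[OF ec]] Nf(3) by (simp add: a_minus_def r_neg)
 qed
 ultimately have L: "G z \<ominus> g (\<epsilon> z) \<in> ?N" if "z \<in> carrier (F 0)" for z
  using F0.span_is_subset[of B L] that B(3) unfolding L_def by blast
 have Gi: "G z \<in> \<aa>" if z: "z \<in> carrier (F 0)" for z
 proof -
  have "G z = (G z \<ominus> g (\<epsilon> z)) \<oplus> g (\<epsilon> z)"
   using Gc[OF z] If(2)[OF g(1)[OF ec[OF z]]] by algebra
  then show ?thesis using If(4)[OF NI[OF L[OF z]] g(1)[OF ec[OF z]]] by simp
 qed
 have d0: "d 0 w \<in> carrier (F 0)" "\<epsilon> (d 0 w) = \<zero>" if "w \<in> carrier (F (Suc 0))" for w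
  using that ker0 by (auto simp: module_ker_def)
 define c where "c w = (SOME y. y \<in> \<aa> \<and> G (d 0 w) = u \<otimes> y)" for w
 have c: "c w \<in> \<aa>" "G (d 0 w) = u \<otimes> c w" if w: "w \<in> carrier (F (Suc 0))" for w
 proof -
  have "G (d 0 w) = (G (d 0 w) \<ominus> g \<zero>) \<oplus> g \<zero>"
   using Gc[OF d0(1)[OF w]] Nf(2)[OF g0] by algebra
  then have "G (d 0 w) \<in> ?N" using Nf(4)[OF L[OF d0(1)[OF w]] g0] d0(2)[OF w] by simp
  then have "\<exists>y. y \<in> \<aa> \<and> G (d 0 w) = u \<otimes> y" using scaledE by blast
  from someI_ex[OF this] show "c w \<in> \<aa>" "G (d 0 w) = u \<otimes> c w" unfolding c_def by simp_all
 qed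
 have ceq: "c w = y" if "w \<in> carrier (F (Suc 0))" "y \<in> carrier R" "G (d 0 w) = u \<otimes> y" for w y
  using cancel_left[OF u If(2)[OF c(1)[OF that(1)]] that(2)] c(2)[OF that(1)] that(3) by simp
 have da: "d 0 (w \<oplus>\<^bsub>F (Suc 0)\<^esub> w') = d 0 w \<oplus>\<^bsub>F 0\<^esub> d 0 w'" if "w \<in> carrier (F (Suc 0))" "w' \<in> carrier (F (Suc 0))" for w w'
  using module_hom_add[OF dm[of 0] that] .
 have ds: "d 0 (r \<odot>\<^bsub>F (Suc 0)\<^esub> w) = r \<odot>\<^bsub>F 0\<^esub> d 0 w" if "r \<in> carrier R" "w \<in> carrier (F (Suc 0))" for r w
  using module_hom_smult[OF dm[of 0] that] .
 have cadd: "c (w \<oplus>\<^bsub>F (Suc 0)\<^esub> w') = c w \<oplus> c w'" if w: "w \<in> carrier (F (Suc 0))" "w' \<in> carrier (F (Suc 0))" for w w'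
 proof (rule ceq)
  show "G (d 0 (w \<oplus>\<^bsub>F (Suc 0)\<^esub> w')) = u \<otimes> (c w \<oplus> c w')"
   using If(2)[OF c(1)[OF w(1)]] If(2)[OF c(1)[OF w(2)]] c(2)[OF w(1)] c(2)[OF w(2)] u(1) w
   by (simp add: da Ga d0(1) r_distr)
 qed (use w If(2)[OF c(1)] in simp_all)
 have csm: "c (r \<odot>\<^bsub>F (Suc 0)\<^esub> w) = r \<otimes> c w" if r: "r \<in> carrier R" and w: "w \<in> carrier (F (Suc 0))" for r w
 proof (rule ceq)
  show "G (d 0 (r \<odot>\<^bsub>F (Suc 0)\<^esub> w)) = u \<otimes> (r \<otimes> c w)"
   using If(2)[OF c(1)[OF w]] c(2)[OF w] u(1) w r by (simp add: ds Gs d0(1) m_lcomm)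
 qed (use w r If(2)[OF c(1)] in simp_all)
 have chom: "c \<in> module_hom R (F 1) ?I"
  using cadd csm c(1) by (simp add: module_hom_def)
 have cd: "c (d 1 x) = \<zero>\<^bsub>?I\<^esub>" if x: "x \<in> carrier (F (Suc 1))" for x
 proof -
  have "d (Suc 0) x \<in> module_ker (F (Suc 0)) (F 0) (d 0)" unfolding ker1[symmetric] using x by simp
  then have "d (Suc 0) x \<in> carrier (F (Suc 0))" "d 0 (d (Suc 0) x) = \<zero>\<^bsub>F 0\<^esub>" by (simp_all add: module_ker_def)
  then show ?thesis using ceq[of "d (Suc 0) x" \<zero>] G0 u(1) by simp
 qed
 have "\<exists>h\<in>module_hom R (F 0) ?I. \<forall>x\<in>carrier (F 1). c x = h (d 0 x)"
  by (rule trivial_Ext1[OF mI mI res tr chom]) (fact cd)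
 then obtain h where h: "h \<in> module_hom R (F 0) ?I" "\<forall>x\<in>carrier (F 1). c x = h (d 0 x)" by blast
 have hc: "h z \<in> \<aa>" if "z \<in> carrier (F 0)" for z using module_hom_closed[OF h(1)] that by auto
 have ha: "h (z \<oplus>\<^bsub>F 0\<^esub> z') = h z \<oplus> h z'" if "z \<in> carrier (F 0)" "z' \<in> carrier (F 0)" for z z'
  using module_hom_add[OF h(1) that] by simp
 have hs: "h (r \<odot>\<^bsub>F 0\<^esub> z) = r \<otimes> h z" if "r \<in> carrier R" "z \<in> carrier (F 0)" for r z
  using module_hom_smult[OF h(1) that] by simp
 define E where "E z = G z \<ominus> u \<otimes> h z" for z
 have Ehom: "E \<in> module_hom R (F 0) Rmod"
 proof -
  have 1: "E z \<in> carrier R" if "z \<in> carrier (F 0)" for z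
   unfolding E_def using Gc[OF that] If(2)[OF hc[OF that]] u(1) by simp
  have 2: "E (z \<oplus>\<^bsub>F 0\<^esub> z') = E z \<oplus> E z'" if z: "z \<in> carrier (F 0)" "z' \<in> carrier (F 0)" for z z'
   unfolding E_def Ga[OF z] ha[OF z] using Gc[OF z(1)] Gc[OF z(2)] If(2)[OF hc[OF z(1)]] If(2)[OF hc[OF z(2)]] u(1)
   by algebra
  have 3: "E (r \<odot>\<^bsub>F 0\<^esub> z) = r \<otimes> E z" if r: "r \<in> carrier R" and z: "z \<in> carrier (F 0)" for r z
   unfolding E_def Gs[OF r z] hs[OF r z] using Gc[OF z] If(2)[OF hc[OF z]] u(1) r by algebra
  show ?thesis using 1 2 3 by (simp add: module_hom_def)
 qed
 have Ea: "E (z \<oplus>\<^bsub>F 0\<^esub> z') = E z \<oplus> E z'" if "z \<in> carrier (F 0)" "z' \<in> carrier (F 0)" for z z'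
  using module_hom_add[OF Ehom that] by simp
 have Esm: "E (r \<odot>\<^bsub>F 0\<^esub> z) = r \<otimes> E z" if "r \<in> carrier R" "z \<in> carrier (F 0)" for r z
  using module_hom_smult[OF Ehom that] by simp
 have Ec: "E z \<in> carrier R" if "z \<in> carrier (F 0)" for z using module_hom_closed[OF Ehom] that by auto
 have Ei: "E z \<in> \<aa>" if "z \<in> carrier (F 0)" for z
  unfolding E_def using Gi[OF that] If(5)[OF hc[OF that] u(1)] by (rule If(8))
 have Eker: "E z = E z'" if z: "z \<in> carrier (F 0)" "z' \<in> carrier (F 0)" "\<epsilon> z = \<epsilon> z'" for z z'
 proof -
  have "\<epsilon> (z \<ominus>\<^bsub>F 0\<^esub> z') = \<epsilon> z \<ominus> \<epsilon> z'"
   using module_hom_minus_eq[OF Fm mI em z(1,2)] ea[OF z(1), of "\<ominus>\<^bsub>F 0\<^esub> z'"] esm[of "\<ominus> \<one>" z'] z If(2)[OF ec[OF z(2)]]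
   by (simp add: a_minus_def F0.smult_l_minus l_minus)
  also have "\<dots> = \<zero>" using z(3) If(2)[OF ec[OF z(2)]] by (simp add: a_minus_def r_neg)
  finally have "z \<ominus>\<^bsub>F 0\<^esub> z' \<in> module_ker (F 0) ?I \<epsilon>" using z by (simp add: module_ker_def)
  then obtain w where w: "w \<in> carrier (F (Suc 0))" "z \<ominus>\<^bsub>F 0\<^esub> z' = d 0 w" unfolding ker0[symmetric] by blast
  have "E (d 0 w) = \<zero>" unfolding E_def using c(2)[OF w(1)] h(2) w(1) If(2)[OF c(1)[OF w(1)]] u(1)
   by (simp add: a_minus_def r_neg)
  then have "E (z \<ominus>\<^bsub>F 0\<^esub> z') = \<zero>" using w(2) by simp
  moreover have "z = (z \<ominus>\<^bsub>F 0\<^esub> z') \<oplus>\<^bsub>F 0\<^esub> z'" using z by (simp add: a_minus_def F0.M.a_assoc F0.M.l_neg)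
  ultimately show ?thesis using Ea[of "z \<ominus>\<^bsub>F 0\<^esub> z'" z'] z Ec[OF z(2)] by simp
 qed
 define e where "e x = E (SOME z. z \<in> carrier (F 0) \<and> \<epsilon> z = x)" for x
 have eE: "e (\<epsilon> z) = E z" if z: "z \<in> carrier (F 0)" for z
 proof -
  have "\<exists>z'. z' \<in> carrier (F 0) \<and> \<epsilon> z' = \<epsilon> z" using z by blast
  from someI_ex[OF this] show ?thesis unfolding e_def by (intro Eker) (simp_all add: z)
 qed
 have pre: "\<exists>z. z \<in> carrier (F 0) \<and> x = \<epsilon> z" if "x \<in> \<aa>" for x using es that by blast
 have "linear_on R Rmod Rmod \<aa> e"
 proof (rule linear_onI)
  show "e x \<in> carrier Rmod" if x: "x \<in> \<aa>" for x using pre[OF x] eE Ec by auto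
  show "e (x \<oplus>\<^bsub>Rmod\<^esub> y) = e x \<oplus>\<^bsub>Rmod\<^esub> e y" if x: "x \<in> \<aa>" and y: "y \<in> \<aa>" for x y
  proof -
   obtain z z' where z: "z \<in> carrier (F 0)" "x = \<epsilon> z" "z' \<in> carrier (F 0)" "y = \<epsilon> z'" using pre[OF x] pre[OF y] by blast
   then show ?thesis using eE[of "z \<oplus>\<^bsub>F 0\<^esub> z'"] by (simp add: ea Ea eE)
  qed
  show "e (r \<odot>\<^bsub>Rmod\<^esub> x) = r \<odot>\<^bsub>Rmod\<^esub> e x" if r: "r \<in> carrier R" and x: "x \<in> \<aa>" for r x
  proof -
   obtain z where z: "z \<in> carrier (F 0)" "x = \<epsilon> z" using pre[OF x] by blast
   then show ?thesis using eE[of "r \<odot>\<^bsub>F 0\<^esub> z"] r by (simp add: esm Esm eE)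
  qed
 qed
 moreover have "e x \<in> \<aa> \<and> e x \<ominus> g x \<in> ?N" if x: "x \<in> \<aa>" for x
 proof -
  obtain z where z: "z \<in> carrier (F 0)" "x = \<epsilon> z" using pre[OF x] by blast
  have "E z \<ominus> g (\<epsilon> z) = (G z \<ominus> g (\<epsilon> z)) \<ominus> u \<otimes> h z"
   unfolding E_def using Gc[OF z(1)] If(2)[OF hc[OF z(1)]] u(1) If(2)[OF g(1)[OF ec[OF z(1)]]] by algebra
  also have "\<dots> \<in> ?N" by (rule Nf(8)[OF L[OF z(1)] scaledI[OF hc[OF z(1)]]])
  finally show ?thesis using z eE Ei by simp
 qed
 ultimately show ?thesis by blast
qed

end

section \<open>Quotients of ideals and the coefficient field\<close>

context one_dim_domain
begin

text \<open>The module \<open>P/N\<close> over a quotient ring \<open>R/J\<close> with \<open>J P \<subseteq> N\<close>; the cotangent space is the case \<open>P = J = \<mm>\<close>, \<open>N = \<mm>\<^sup>2\<close>.\<close>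

definition quot :: "'a set \<Rightarrow> 'a set \<Rightarrow> ('a set, 'a set) module" where
 "quot P N =
  \<lparr>carrier = {N +> x | x. x \<in> P}, monoid.mult = undefined, monoid.one = undefined,
   ring.zero = N, ring.add = set_add R, smult = rcoset_mult R N\<rparr>"

lemma quot_simps:
 "carrier (quot P N) = (\<lambda>x. N +> x) ` P" "\<zero>\<^bsub>quot P N\<^esub> = N" "A \<oplus>\<^bsub>quot P N\<^esub> B = A <+> B"
 "A \<odot>\<^bsub>quot P N\<^esub> B = rcoset_mult R N A B"
 by (auto simp: quot_def)

lemma coset_eq:
 assumes "ideal N R" "x \<in> carrier R" "y \<in> carrier R"
 shows "N +> x = N +> y \<longleftrightarrow> x \<ominus> y \<in> N"
 using quotient_eq_iff_same_a_r_cos[OF assms] by simp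

lemma coset_zero_eq:
 assumes N: "ideal N R" and x: "x \<in> carrier R"
 shows "N +> x = N \<longleftrightarrow> x \<in> N"
proof -
 interpret idl: ideal N R by (rule N)
 have "N +> \<zero> = N" by (rule a_coset_add_zero[OF ideal_facts(1)[OF N]])
 then show ?thesis using coset_eq[OF N x zero_closed] x by (simp add: a_minus_def)
qed

lemma coset_add:
 assumes N: "ideal N R" and "x \<in> carrier R" "y \<in> carrier R"
 shows "(N +> x) <+> (N +> y) = N +> (x \<oplus> y)"
proof -
 interpret idl: ideal N R by (rule N)
 show ?thesis by (rule idl.a_rcos_sum[OF assms(2,3)])
qed

lemma coset_smult:
 assumes J: "ideal J R" and N: "ideal N R" and prod: "\<And>j p. j \<in> J ==> p \<in> P ==> j \<otimes> p \<in> N"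
  and P: "P \<subseteq> carrier R" and r: "r \<in> carrier R" and x: "x \<in> P"
 shows "rcoset_mult R N (J +> r) (N +> x) = N +> (r \<otimes> x)"
proof -
 have xc: "x \<in> carrier R" using P x by blast
 have "N +> (a \<otimes> b) = N +> (r \<otimes> x)" if a: "a \<in> J +> r" and b: "b \<in> N +> x" for a b
 proof -
  obtain j where j: "j \<in> J" "a = j \<oplus> r" using a unfolding a_r_coset_def' by blast
  obtain y where y: "y \<in> N" "b = y \<oplus> x" using b unfolding a_r_coset_def' by blast
  have c: "j \<in> carrier R" "y \<in> carrier R" using ideal_facts(2)[OF J j(1)] ideal_facts(2)[OF N y(1)] .
  have "a \<otimes> b \<ominus> r \<otimes> x = (j \<oplus> r) \<otimes> y \<oplus> j \<otimes> x" unfolding j(2) y(2) using c r xc by algebra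
  also have "\<dots> \<in> N"
   using ideal_facts(4)[OF N ideal_facts(5)[OF N y(1)] prod[OF j(1) x]] c r by blast
  finally show ?thesis using coset_eq[OF N] c r xc j y by simp
 qed
 moreover have "r \<in> J +> r" using r ideal_facts(3)[OF J] unfolding a_r_coset_def' by force
 moreover have "x \<in> N +> x" using xc ideal_facts(3)[OF N] unfolding a_r_coset_def' by force
 ultimately show ?thesis unfolding rcoset_mult_def by blast
qed

lemma quot_vectorspace:
 assumes J: "ideal J R" and N: "ideal N R" and P: "ideal P R" and prod: "\<And>j p. j \<in> J ==> p \<in> P ==> j \<otimes> p \<in> N"
  and k: "field k" "carrier k \<subseteq> (\<lambda>r. J +> r) ` carrier R"
   "\<And>A B. A \<otimes>\<^bsub>k\<^esub> B = rcoset_mult R J A B" "\<And>A B. A \<oplus>\<^bsub>k\<^esub> B = A <+> B" "\<one>\<^bsub>k\<^esub> = J +> \<one>"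
 shows "vectorspace k (quot P N)"
proof -
 let ?V = "quot P N"
 note Pf = ideal_facts[OF P]
 interpret idl: ideal J R by (rule J)
 have kE: "\<exists>r\<in>carrier R. c = J +> r" if "c \<in> carrier k" for c using k(2) that by blast
 have vE: "\<exists>x\<in>P. v = N +> x" if "v \<in> carrier (?V)" for v using that by (auto simp: quot_simps)
 have vI: "N +> x \<in> carrier (?V)" if "x \<in> P" for x using that by (simp add: quot_simps)
 have z: "N = N +> \<zero>" using coset_zero_eq[OF N zero_closed] ideal_facts(3)[OF N] by simp
 note sm = coset_smult[OF J N prod Pf(1)]
 note ops = quot_simps(2-4) k(3-5) sm coset_add[OF N] coset_add[OF J] idl.rcoset_mult_add
 show ?thesis
 proof (rule vs_criteria)
  show "field k" by (rule k(1))
  show "\<zero>\<^bsub>?V\<^esub> \<in> carrier (?V)" using vI[OF Pf(3)] z by (simp add: quot_simps(2))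
  show "\<forall>v w. v \<in> carrier (?V) \<and> w \<in> carrier (?V) \<longrightarrow> v \<oplus>\<^bsub>?V\<^esub> w \<in> carrier (?V)"
  proof (intro allI impI)
   fix v w assume "v \<in> carrier (?V) \<and> w \<in> carrier (?V)"
   then obtain x y where "x \<in> P" "v = N +> x" "y \<in> P" "w = N +> y" using vE by blast
   then show "v \<oplus>\<^bsub>?V\<^esub> w \<in> carrier (?V)" using vI[of "x \<oplus> y"] Pf(2,4) by (simp add: ops)
  qed
  show "\<forall>v\<in>carrier (?V). \<exists>w\<in>carrier (?V). v \<oplus>\<^bsub>?V\<^esub> w = \<zero>\<^bsub>?V\<^esub>"
  proof
   fix v assume "v \<in> carrier (?V)"
   then obtain x where x: "x \<in> P" "v = N +> x" using vE by blast
   have "v \<oplus>\<^bsub>?V\<^esub> (N +> \<ominus> x) = \<zero>\<^bsub>?V\<^esub>" using x Pf(2) z by (simp add: ops r_neg)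
   then show "\<exists>w\<in>carrier (?V). v \<oplus>\<^bsub>?V\<^esub> w = \<zero>\<^bsub>?V\<^esub>" using vI[OF Pf(7)[OF x(1)]] by blast
  qed
  show "\<forall>c v. c \<in> carrier k \<and> v \<in> carrier (?V) \<longrightarrow> c \<odot>\<^bsub>?V\<^esub> v \<in> carrier (?V)"
  proof (intro allI impI)
   fix c v assume "c \<in> carrier k \<and> v \<in> carrier (?V)"
   then obtain r x where "r \<in> carrier R" "c = J +> r" "x \<in> P" "v = N +> x" using vE kE by blast
   then show "c \<odot>\<^bsub>?V\<^esub> v \<in> carrier (?V)" using vI[of "r \<otimes> x"] Pf(5) by (simp add: ops)
  qed
  show "\<forall>v w. v \<in> carrier (?V) \<and> w \<in> carrier (?V) \<longrightarrow> v \<oplus>\<^bsub>?V\<^esub> w = w \<oplus>\<^bsub>?V\<^esub> v"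
  proof (intro allI impI)
   fix v w assume "v \<in> carrier (?V) \<and> w \<in> carrier (?V)"
   then obtain x y where "x \<in> P" "v = N +> x" "y \<in> P" "w = N +> y" using vE by blast
   then show "v \<oplus>\<^bsub>?V\<^esub> w = w \<oplus>\<^bsub>?V\<^esub> v" using Pf(2) by (simp add: ops a_comm)
  qed
  show "\<forall>v w t. v \<in> carrier (?V) \<and> w \<in> carrier (?V) \<and> t \<in> carrier (?V)
   \<longrightarrow> v \<oplus>\<^bsub>?V\<^esub> w \<oplus>\<^bsub>?V\<^esub> t = v \<oplus>\<^bsub>?V\<^esub> (w \<oplus>\<^bsub>?V\<^esub> t)"
  proof (intro allI impI)
   fix v w t assume h: "v \<in> carrier (?V) \<and> w \<in> carrier (?V) \<and> t \<in> carrier (?V)"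
   obtain x where "x \<in> P" "v = N +> x" using vE[of v] h by blast
   moreover obtain y where "y \<in> P" "w = N +> y" using vE[of w] h by blast
   moreover obtain y' where "y' \<in> P" "t = N +> y'" using vE[of t] h by blast
   ultimately show "v \<oplus>\<^bsub>?V\<^esub> w \<oplus>\<^bsub>?V\<^esub> t = v \<oplus>\<^bsub>?V\<^esub> (w \<oplus>\<^bsub>?V\<^esub> t)" using Pf(2) by (simp add: ops a_assoc)
  qed
  show "\<forall>v\<in>carrier (?V). v \<oplus>\<^bsub>?V\<^esub> \<zero>\<^bsub>?V\<^esub> = v"
  proof
   fix v assume "v \<in> carrier (?V)"
   then obtain x where x: "x \<in> P" "v = N +> x" using vE by blast
   have "v \<oplus>\<^bsub>?V\<^esub> \<zero>\<^bsub>?V\<^esub> = (N +> x) <+> (N +> \<zero>)" using x(2) z by (simp add: ops)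
   then show "v \<oplus>\<^bsub>?V\<^esub> \<zero>\<^bsub>?V\<^esub> = v" using x Pf(2) by (simp add: ops)
  qed
  show "\<forall>a b v. a \<in> carrier k \<and> b \<in> carrier k \<and> v \<in> carrier (?V) \<longrightarrow> (a \<otimes>\<^bsub>k\<^esub> b) \<odot>\<^bsub>?V\<^esub> v = a \<odot>\<^bsub>?V\<^esub> (b \<odot>\<^bsub>?V\<^esub> v)"
  proof (intro allI impI)
   fix a b v assume h: "a \<in> carrier k \<and> b \<in> carrier k \<and> v \<in> carrier (?V)"
   obtain r where "r \<in> carrier R" "a = J +> r" using kE[of a] h by blast
   moreover obtain s where "s \<in> carrier R" "b = J +> s" using kE[of b] h by blast
   moreover obtain x where "x \<in> P" "v = N +> x" using vE[of v] h by blast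
   ultimately show "(a \<otimes>\<^bsub>k\<^esub> b) \<odot>\<^bsub>?V\<^esub> v = a \<odot>\<^bsub>?V\<^esub> (b \<odot>\<^bsub>?V\<^esub> v)" using Pf(2,5) by (simp add: ops m_assoc)
  qed
  show "\<forall>v\<in>carrier (?V). \<one>\<^bsub>k\<^esub> \<odot>\<^bsub>?V\<^esub> v = v"
  proof
   fix v assume "v \<in> carrier (?V)"
   then obtain x where x: "x \<in> P" "v = N +> x" using vE by blast
   then show "\<one>\<^bsub>k\<^esub> \<odot>\<^bsub>?V\<^esub> v = v" using Pf(2) by (simp add: ops)
  qed
  show "\<forall>a b v. a \<in> carrier k \<and> b \<in> carrier k \<and> v \<in> carrier (?V) \<longrightarrow> (a \<oplus>\<^bsub>k\<^esub> b) \<odot>\<^bsub>?V\<^esub> v = (a \<odot>\<^bsub>?V\<^esub> v) \<oplus>\<^bsub>?V\<^esub> (b \<odot>\<^bsub>?V\<^esub> v)"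
  proof (intro allI impI)
   fix a b v assume h: "a \<in> carrier k \<and> b \<in> carrier k \<and> v \<in> carrier (?V)"
   obtain r where "r \<in> carrier R" "a = J +> r" using kE[of a] h by blast
   moreover obtain s where "s \<in> carrier R" "b = J +> s" using kE[of b] h by blast
   moreover obtain x where "x \<in> P" "v = N +> x" using vE[of v] h by blast
   ultimately show "(a \<oplus>\<^bsub>k\<^esub> b) \<odot>\<^bsub>?V\<^esub> v = (a \<odot>\<^bsub>?V\<^esub> v) \<oplus>\<^bsub>?V\<^esub> (b \<odot>\<^bsub>?V\<^esub> v)" using Pf(2,5) by (simp add: ops l_distr)
  qed
  show "\<forall>a v w. a \<in> carrier k \<and> v \<in> carrier (?V) \<and> w \<in> carrier (?V) \<longrightarrow> a \<odot>\<^bsub>?V\<^esub> (v \<oplus>\<^bsub>?V\<^esub> w) = (a \<odot>\<^bsub>?V\<^esub> v) \<oplus>\<^bsub>?V\<^esub> (a \<odot>\<^bsub>?V\<^esub> w)"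
  proof (intro allI impI)
   fix a v w assume h: "a \<in> carrier k \<and> v \<in> carrier (?V) \<and> w \<in> carrier (?V)"
   obtain r where "r \<in> carrier R" "a = J +> r" using kE[of a] h by blast
   moreover obtain x where "x \<in> P" "v = N +> x" using vE[of v] h by blast
   moreover obtain y where "y \<in> P" "w = N +> y" using vE[of w] h by blast
   ultimately show "a \<odot>\<^bsub>?V\<^esub> (v \<oplus>\<^bsub>?V\<^esub> w) = (a \<odot>\<^bsub>?V\<^esub> v) \<oplus>\<^bsub>?V\<^esub> (a \<odot>\<^bsub>?V\<^esub> w)" using Pf(2,4,5) by (simp add: ops r_distr)
  qed
 qed
qed

lemma lc_ideal:
 assumes P: "ideal P R" and "\<forall>i<n. t i \<in> carrier R" "\<forall>i<n. v i \<in> P"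
 shows "lc Rmod n t v \<in> P"
 using assms(2,3) by (induction n) (auto intro: ideal_facts(3,4,5)[OF P])

lemma lc_quot:
 assumes J: "ideal J R" and N: "ideal N R" and P: "ideal P R" and prod: "\<And>j p. j \<in> J ==> p \<in> P ==> j \<otimes> p \<in> N"
  and "\<forall>i<n. t i \<in> carrier R" "\<forall>i<n. v i \<in> P"
 shows "lc (quot P N) n (\<lambda>i. J +> t i) (\<lambda>i. N +> v i) = N +> lc Rmod n t v"
 using assms(5,6)
proof (induction n)
 case 0
 show ?case using coset_zero_eq[OF N zero_closed] ideal_facts(3)[OF N] by (simp add: quot_simps)
next
 case (Suc n)
 have "rcoset_mult R N (J +> t n) (N +> v n) = N +> (t n \<otimes> v n)"
  by (rule coset_smult[OF J N prod ideal_facts(1)[OF P]]) (use Suc.prems in auto)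
 moreover have "lc Rmod n t v \<in> carrier R" "t n \<otimes> v n \<in> carrier R"
  using lc_ideal[OF P, of n t v] Suc.prems ideal_facts(2,5)[OF P] by auto
 ultimately show ?case using Suc coset_add[OF N] by (simp add: quot_simps)
qed

end

locale coefficient_setting = one_dim_domain +
 fixes u K
 assumes u_mm: "u \<in> \<mm>" and u_nonzero: "u \<noteq> \<zero>" and coeff: "coefficient_field R \<mm> (PIdl u) K"
begin

abbreviation U where "U \<equiv> PIdl u"
abbreviation k where "k \<equiv> (R Quot U)\<lparr>carrier := K\<rparr>"
text \<open>The preimage in \<open>R\<close> of the coefficient field. It is a subring with \<open>C + \<mm> = R\<close> and \<open>C \<inter> \<mm> = uR\<close>, so coefficients in \<open>K\<close> can be replaced by elements of \<open>C\<close>.\<close>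

definition C where "C = {t \<in> carrier R. U +> t \<in> K}"

lemma u_carrier: "u \<in> carrier R" by (rule ideal_facts(2)[OF mm_ideal u_mm])

lemma U_ideal: "ideal U R" by (rule cgenideal_ideal[OF u_carrier])

lemma U_scaled: "U = scaled u (carrier R)"
 unfolding scaled_def cgenideal_def using u_carrier m_comm by auto

lemma U_mm: "U \<subseteq> \<mm>" using cgenideal_minimal[OF mm_ideal u_mm] .

lemma k_field: "field k"
proof -
 interpret idl: ideal U R by (rule U_ideal)
 have "ring (R Quot U)" by (rule idl.quotient_is_ring)
 then show ?thesis using coeff ring.subfield_iff(2) unfolding coefficient_field_def by blast
qed

lemma K_coset: "A \<in> K ==> \<exists>t\<in>C. A = U +> t"
proof -
 assume A: "A \<in> K"
 have "K \<subseteq> carrier (R Quot U)" using coeff unfolding coefficient_field_def by (blast dest: subfieldE(3))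
 then obtain t where "t \<in> carrier R" "A = U +> t" using A unfolding FactRing_def A_RCOSETS_def' by auto
 then show ?thesis using A unfolding C_def by blast
qed

lemma C_carrier: "t \<in> C ==> t \<in> carrier R" unfolding C_def by simp

lemma k_ops:
 "A \<otimes>\<^bsub>k\<^esub> B = rcoset_mult R U A B" "A \<oplus>\<^bsub>k\<^esub> B = A <+> B" "\<one>\<^bsub>k\<^esub> = U +> \<one>" "\<zero>\<^bsub>k\<^esub> = U" "carrier k = K"
 by (simp_all add: FactRing_def)

lemma K_sub: "K \<subseteq> (\<lambda>r. U +> r) ` carrier R"
 using K_coset C_carrier by blast

lemma C_add: "s \<in> C ==> t \<in> C ==> s \<oplus> t \<in> C"
proof -
 interpret k: field k by (rule k_field)
 assume st: "s \<in> C" "t \<in> C"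
 then have "(U +> s) <+> (U +> t) \<in> K" using k.a_closed[of "U +> s" "U +> t"] unfolding k_ops C_def by simp
 then show ?thesis using st coset_add[OF U_ideal] by (simp add: C_def)
qed

lemma C_mult: "s \<in> C ==> t \<in> C ==> s \<otimes> t \<in> C"
proof -
 interpret k: field k by (rule k_field)
 interpret idl: ideal U R by (rule U_ideal)
 assume st: "s \<in> C" "t \<in> C"
 then have "rcoset_mult R U (U +> s) (U +> t) \<in> K" using k.m_closed[of "U +> s" "U +> t"] unfolding k_ops C_def by simp
 then show ?thesis using st idl.rcoset_mult_add by (simp add: C_def)
qed

lemma U_C: "t \<in> U ==> t \<in> C"
proof -
 interpret k: field k by (rule k_field)
 assume t: "t \<in> U"
 have tc: "t \<in> carrier R" by (rule ideal_facts(2)[OF U_ideal t])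
 have "U \<in> K" using k.zero_closed unfolding k_ops .
 then show ?thesis unfolding C_def using coset_zero_eq[OF U_ideal tc] t tc by simp
qed

lemma C_one: "\<one> \<in> C"
proof -
 interpret k: field k by (rule k_field)
 show ?thesis using k.one_closed unfolding k_ops C_def by simp
qed

lemma C_representative:
 assumes r: "r \<in> carrier R"
 shows "\<exists>t\<in>C. r \<ominus> t \<in> \<mm>"
proof -
 have "set_add R \<mm> \<in> ring_iso k (R Quot \<mm>)" using coeff unfolding coefficient_field_def by simp
 then have b: "bij_betw (set_add R \<mm>) K (carrier (R Quot \<mm>))" unfolding ring_iso_def by simp
 have "\<mm> +> r \<in> carrier (R Quot \<mm>)" using r unfolding FactRing_def A_RCOSETS_def' by auto
 then obtain A where A: "A \<in> K" "\<mm> +> r = \<mm> <+> A" using b unfolding bij_betw_def by blast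
 obtain t where t: "t \<in> C" "A = U +> t" using K_coset[OF A(1)] by blast
 have tc: "t \<in> carrier R" by (rule C_carrier[OF t(1)])
 have "t \<in> A" unfolding t(2) a_r_coset_def' using ideal_facts(3)[OF U_ideal] tc by force
 then have "t \<in> \<mm> <+> A" unfolding set_add_def' using ideal_facts(3)[OF mm_ideal] tc by force
 then obtain m where m: "m \<in> \<mm>" "t = m \<oplus> r" unfolding A(2)[symmetric] a_r_coset_def' by blast
 have mc: "m \<in> carrier R" by (rule ideal_facts(2)[OF mm_ideal m(1)])
 have "r \<ominus> t = \<ominus> m" unfolding m(2) using r mc by algebra
 then have "r \<ominus> t \<in> \<mm>" using ideal_facts(7)[OF mm_ideal m(1)] by (simp only:)
 then show ?thesis using t(1) by blast
qed

lemma C_inter_mm: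
 assumes t: "t \<in> C" "t \<in> \<mm>"
 shows "t \<in> U"
proof -
 interpret k: field k by (rule k_field)
 have tc: "t \<in> carrier R" by (rule C_carrier[OF t(1)])
 note mf = ideal_facts[OF mm_ideal]
 have abs: "\<mm> <+> A = \<mm>" if A: "A \<subseteq> \<mm>" "A \<noteq> {}" for A
 proof
  show "\<mm> <+> A \<subseteq> \<mm>" unfolding set_add_def' using mf(4) A(1) by blast
  show "\<mm> \<subseteq> \<mm> <+> A"
  proof
   fix m assume m: "m \<in> \<mm>"
   obtain a where a: "a \<in> A" using A(2) by blast
   have "m = (m \<ominus> a) \<oplus> a" using mf(2)[OF m] mf(2)[of a] a A(1) by (auto simp: a_minus_def a_assoc l_neg)
   then show "m \<in> \<mm> <+> A" unfolding set_add_def' using mf(8)[OF m] a A(1) by blast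
  qed
 qed
 have "set_add R \<mm> \<in> ring_iso k (R Quot \<mm>)" using coeff unfolding coefficient_field_def by simp
 then have b: "inj_on (set_add R \<mm>) K" unfolding ring_iso_def bij_betw_def by simp
 have 1: "U +> t \<subseteq> \<mm>" unfolding a_r_coset_def' using mf(4) t(2) U_mm by blast
 have 2: "U +> t \<noteq> {}" "U \<noteq> {}" unfolding a_r_coset_def' using ideal_facts(3)[OF U_ideal] by blast+
 have "set_add R \<mm> (U +> t) = set_add R \<mm> U" using abs[OF 1 2(1)] abs[OF U_mm 2(2)] by simp
 moreover have "U +> t \<in> K" "U \<in> K" using t(1) k.zero_closed unfolding k_ops C_def by simp_all
 ultimately have "U +> t = U" by (rule inj_onD[OF b])
 then show ?thesis using coset_zero_eq[OF U_ideal tc] by simp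
qed

text \<open>The closed fibre \<open>J/uJ\<close>.\<close>

definition fiber where "fiber J = quot J (scaled u J)"

lemma fiber_prod:
 assumes "ideal J R" "j \<in> U" "p \<in> J"
 shows "j \<otimes> p \<in> scaled u J"
proof -
 obtain r where r: "r \<in> carrier R" "j = r \<otimes> u" using assms(2) unfolding PIdl_iff by blast
 have "j \<otimes> p = u \<otimes> (r \<otimes> p)" using r u_carrier ideal_facts(2)[OF assms(1,3)] by (simp add: m_assoc m_lcomm)
 then show ?thesis using scaledI[OF ideal_facts(5)[OF assms(1,3) r(1)]] by simp
qed

lemma fiber_vectorspace:
 assumes J: "ideal J R"
 shows "vectorspace k (fiber J)"
 unfolding fiber_def
 by (rule quot_vectorspace[OF U_ideal scaled_ideal[OF J u_carrier] J fiber_prod[OF J] k_field])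
  (use K_sub in \<open>simp_all add: FactRing_def\<close>)

lemma fiber_carrier: "carrier (fiber J) = (\<lambda>x. scaled u J +> x) ` J"
 unfolding fiber_def quot_simps ..

lemma fiber_smult:
 assumes J: "ideal J R" "t \<in> carrier R" "v \<in> J"
 shows "(U +> t) \<odot>\<^bsub>fiber J\<^esub> (scaled u J +> v) = scaled u J +> (t \<otimes> v)"
 unfolding fiber_def quot_simps
 by (rule coset_smult[OF U_ideal scaled_ideal[OF J(1) u_carrier] _ ideal_facts(1)[OF J(1)] J(2,3)]) (rule fiber_prod[OF J(1)])

lemma fiber_add:
 assumes J: "ideal J R" "v \<in> J" "w \<in> J"
 shows "(scaled u J +> v) \<oplus>\<^bsub>fiber J\<^esub> (scaled u J +> w) = scaled u J +> (v \<oplus> w)"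
 unfolding fiber_def quot_simps
 by (rule coset_add[OF scaled_ideal[OF J(1) u_carrier] ideal_facts(2)[OF J(1,2)] ideal_facts(2)[OF J(1,3)]])

lemma fiber_zero: "\<zero>\<^bsub>fiber J\<^esub> = scaled u J"
 unfolding fiber_def quot_simps ..

lemma lc_fiber:
 assumes J: "ideal J R" and "\<forall>i<n. t i \<in> carrier R" "\<forall>i<n. v i \<in> J"
 shows "lc (fiber J) n (\<lambda>i. U +> t i) (\<lambda>i. scaled u J +> v i) = scaled u J +> lc Rmod n t v"
 unfolding fiber_def
 by (rule lc_quot[OF U_ideal scaled_ideal[OF J u_carrier] J _ assms(2,3)]) (rule fiber_prod[OF J])

end

section \<open>All nonzero ideals have fibres of the same dimension\<close>

text \<open>Any nonzero vector is the last member of some basis of the same length.\<close>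

lemma (in vectorspace) basis_through:
 assumes v: "rel_basis K V (carrier V) {\<zero>\<^bsub>V\<^esub>} n v" and w: "w \<in> carrier V" "w \<noteq> \<zero>\<^bsub>V\<^esub>"
 shows "\<exists>l v'. n = Suc l \<and> rel_basis K V (carrier V) {\<zero>\<^bsub>V\<^esub>} n v' \<and> v' l = w"
proof -
 define L where "L = (\<lambda>c. c \<odot>\<^bsub>V\<^esub> w) ` carrier K"
 have L: "submodule K L V"
 proof (unfold_locales)
  show "L \<subseteq> carrier V" using w(1) unfolding L_def by auto
  show "\<zero>\<^bsub>V\<^esub> \<in> L" unfolding L_def using w(1) by (intro image_eqI[of _ _ "\<zero>\<^bsub>K\<^esub>"]) auto
  show "a \<oplus>\<^bsub>V\<^esub> b \<in> L" if h: "a \<in> L" "b \<in> L" for a b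
  proof -
   obtain c d where c: "c \<in> carrier K" "a = c \<odot>\<^bsub>V\<^esub> w" "d \<in> carrier K" "b = d \<odot>\<^bsub>V\<^esub> w" using h unfolding L_def by blast
   then have "a \<oplus>\<^bsub>V\<^esub> b = (c \<oplus>\<^bsub>K\<^esub> d) \<odot>\<^bsub>V\<^esub> w" using w(1) by (simp add: smult_l_distr)
   then show ?thesis unfolding L_def using c by blast
  qed
  show "d \<odot>\<^bsub>V\<^esub> a \<in> L" if h: "d \<in> carrier K" "a \<in> L" for a d
  proof -
   obtain c where c: "c \<in> carrier K" "a = c \<odot>\<^bsub>V\<^esub> w" using h unfolding L_def by blast
   then have "d \<odot>\<^bsub>V\<^esub> a = (d \<otimes>\<^bsub>K\<^esub> c) \<odot>\<^bsub>V\<^esub> w" using w(1) h by (simp add: smult_assoc1)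
   then show ?thesis unfolding L_def using c h by blast
  qed
 qed
 have wL: "w \<in> L" unfolding L_def using w(1) by (intro image_eqI[of _ _ "\<one>\<^bsub>K\<^esub>"]) auto
 have Lc: "L \<subseteq> carrier V" using sub_carrier[OF L] by blast
 have zL: "{\<zero>\<^bsub>V\<^esub>} \<subseteq> L" using submodule_zero sub_minus[OF L wL wL] w(1) by (simp add: a_minus_def M.r_neg)
 have one: "rel_basis K V L {\<zero>\<^bsub>V\<^esub>} 1 (\<lambda>_. w)"
  unfolding rel_basis_def
 proof (intro conjI ballI allI impI)
  show "w \<in> L" by (rule wL)
  show "rel_indep K V {\<zero>\<^bsub>V\<^esub>} 1 (\<lambda>_. w)"
  proof (rule rel_indepI)
   fix a i assume a: "\<And>i. i < (1::nat) ==> a i \<in> carrier K" and z: "lc V 1 a (\<lambda>_. w) \<in> {\<zero>\<^bsub>V\<^esub>}" and i: "i < (1::nat)"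
   have "a 0 \<in> carrier K" using a by simp
   moreover have "a 0 \<odot>\<^bsub>V\<^esub> w = \<zero>\<^bsub>V\<^esub>" using z w(1) calculation by simp
   ultimately have "a 0 = \<zero>\<^bsub>K\<^esub>" using smult_eq_zero w by blast
   then show "a i = \<zero>\<^bsub>K\<^esub>" using i by simp
  qed
  show "\<exists>a. (\<forall>i<1. a i \<in> carrier K) \<and> x \<ominus>\<^bsub>V\<^esub> lc V 1 a (\<lambda>_. w) \<in> {\<zero>\<^bsub>V\<^esub>}" if x: "x \<in> L" for x
  proof -
   obtain c where c: "c \<in> carrier K" "x = c \<odot>\<^bsub>V\<^esub> w" using x unfolding L_def by blast
   then show ?thesis using w(1) by (intro exI[of _ "\<lambda>_. c"]) (simp add: a_minus_def M.r_neg)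
  qed
 qed
 obtain l v1 m w1 where v1: "rel_basis K V (carrier V) L l v1"
  using subspace_basis[OF submodule_zero L submodule_carrier zL Lc v] by blast
 from rel_basis_append[OF submodule_zero L submodule_carrier zL Lc v1 one]
 have b: "rel_basis K V (carrier V) {\<zero>\<^bsub>V\<^esub>} (l + 1) (\<lambda>i. if i < l then v1 i else w)" by simp
 have "n = l + 1" by (rule rel_basis_unique[OF submodule_zero submodule_carrier v b])
 then show ?thesis using b by (intro exI[of _ l] exI[of _ "\<lambda>i. if i < l then v1 i else w"]) simp
qed

context coefficient_setting
begin

text \<open>A basis of \<open>J/uJ\<close> over \<open>K\<close>, expressed by representatives in \<open>J\<close> and \<open>C\<close>; this allows comparison of bases for different \<open>J\<close>.\<close>

definition fiber_basis where
 "fiber_basis J n v \<longleftrightarrow> (\<forall>i<n. v i \<in> J)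
   \<and> (\<forall>p\<in>J. \<exists>t. (\<forall>i<n. t i \<in> C) \<and> p \<ominus> lc Rmod n t v \<in> scaled u J)
   \<and> (\<forall>t. (\<forall>i<n. t i \<in> C) \<longrightarrow> lc Rmod n t v \<in> scaled u J \<longrightarrow> (\<forall>i<n. t i \<in> U))"

lemma fiber_basisD:
 assumes "fiber_basis J n v"
 shows "i < n ==> v i \<in> J" "p \<in> J ==> \<exists>t. (\<forall>i<n. t i \<in> C) \<and> p \<ominus> lc Rmod n t v \<in> scaled u J"
  "(\<forall>i<n. t i \<in> C) ==> lc Rmod n t v \<in> scaled u J ==> i < n ==> t i \<in> U"
 using assms unfolding fiber_basis_def by blast+

lemma K_choice:
 assumes "\<forall>i<n. a i \<in> K"
 shows "\<exists>t. \<forall>i<n. t i \<in> C \<and> a i = U +> t i"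
proof -
 have "\<forall>i. \<exists>t. i < n \<longrightarrow> t \<in> C \<and> a i = U +> t" using assms K_coset by blast
 from choice[OF this] show ?thesis .
qed

lemma C_K: "t \<in> C ==> U +> t \<in> K" unfolding C_def by simp

lemma coset_U: "t \<in> carrier R ==> U +> t = U \<longleftrightarrow> t \<in> U"
 by (rule coset_zero_eq[OF U_ideal])

lemma fiber_coset_zero:
 assumes "ideal J R" "p \<in> J"
 shows "scaled u J +> p = \<zero>\<^bsub>fiber J\<^esub> \<longleftrightarrow> p \<in> scaled u J"
 unfolding fiber_zero by (rule coset_zero_eq[OF scaled_ideal[OF assms(1) u_carrier] ideal_facts(2)[OF assms]])

lemma fiber_minus:
 assumes J: "ideal J R" "p \<in> J" "q \<in> J"
 shows "(scaled u J +> p) \<ominus>\<^bsub>fiber J\<^esub> (scaled u J +> q) = scaled u J +> (p \<ominus> q)"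
proof -
 interpret V: vectorspace k "fiber J" by (rule fiber_vectorspace[OF J(1)])
 note Jf = ideal_facts[OF J(1)]
 have c: "scaled u J +> (p \<ominus> q) \<in> carrier (fiber J)" "scaled u J +> q \<in> carrier (fiber J)"
  unfolding fiber_carrier using Jf(8)[OF J(2,3)] J(3) by blast+
 have "p = (p \<ominus> q) \<oplus> q" using Jf(2)[OF J(2)] Jf(2)[OF J(3)] by algebra
 then have "scaled u J +> p = (scaled u J +> (p \<ominus> q)) \<oplus>\<^bsub>fiber J\<^esub> (scaled u J +> q)"
  using fiber_add[OF J(1) Jf(8)[OF J(2,3)] J(3)] by simp
 then show ?thesis using c by (simp add: a_minus_def V.M.a_assoc V.M.r_neg)
qed

lemma lc_C:
 assumes "\<forall>i<n. t i \<in> C" "\<forall>i<n. s i \<in> C"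
 shows "lc Rmod n t s \<in> C"
 using assms U_C[OF ideal_facts(3)[OF U_ideal]] by (induction n) (auto intro: C_add C_mult)

lemma rel_indep_fiber:
 assumes J: "ideal J R" and v: "\<forall>i<n. v i \<in> J"
 shows "rel_indep k (fiber J) {\<zero>\<^bsub>fiber J\<^esub>} n (\<lambda>i. scaled u J +> v i)
  \<longleftrightarrow> (\<forall>t. (\<forall>i<n. t i \<in> C) \<longrightarrow> lc Rmod n t v \<in> scaled u J \<longrightarrow> (\<forall>i<n. t i \<in> U))" (is "?A \<longleftrightarrow> ?B")
proof
 assume A: ?A
 show ?B
 proof (intro allI impI)
  fix t i assume t: "\<forall>i<n. t i \<in> C" and z: "lc Rmod n t v \<in> scaled u J" and i: "i < n"
  have tc: "\<forall>i<n. t i \<in> carrier R" using t C_carrier by blast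
  have "lc (fiber J) n (\<lambda>i. U +> t i) (\<lambda>i. scaled u J +> v i) \<in> {\<zero>\<^bsub>fiber J\<^esub>}"
   unfolding lc_fiber[OF J tc v] using fiber_coset_zero[OF J lc_ideal[OF J tc v]] z by simp
  moreover have "U +> t i \<in> carrier k" if "i < n" for i using t that C_K k_ops(5) by blast
  ultimately have "U +> t i = \<zero>\<^bsub>k\<^esub>" using rel_indepD[OF A, of "\<lambda>i. U +> t i" i] i by blast
  then show "t i \<in> U" using coset_U tc i unfolding k_ops by simp
 qed
next
 assume B: ?B
 show ?A
 proof (rule rel_indepI)
  fix a i assume a: "\<And>i. i < n ==> a i \<in> carrier k"
   and z: "lc (fiber J) n a (\<lambda>i. scaled u J +> v i) \<in> {\<zero>\<^bsub>fiber J\<^esub>}" and i: "i < n"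
  have "\<forall>i<n. a i \<in> K" using a k_ops(5) by blast
  from K_choice[OF this] obtain t where t: "\<forall>i<n. t i \<in> C \<and> a i = U +> t i" by blast
  have tc: "\<forall>i<n. t i \<in> carrier R" using t C_carrier by blast
  have "lc (fiber J) n a (\<lambda>i. scaled u J +> v i) = lc (fiber J) n (\<lambda>i. U +> t i) (\<lambda>i. scaled u J +> v i)"
   by (rule lc_cong) (use t in auto)
  then have "lc Rmod n t v \<in> scaled u J"
   using z fiber_coset_zero[OF J lc_ideal[OF J tc v]] unfolding lc_fiber[OF J tc v] by simp
  then have "t i \<in> U" using B t i by blast
  then show "a i = \<zero>\<^bsub>k\<^esub>" using t tc i coset_U unfolding k_ops by simp
 qed
qed

lemma rel_span_fiber:
 assumes J: "ideal J R" and v: "\<forall>i<n. v i \<in> J" and p: "p \<in> J"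
 shows "(\<exists>a. (\<forall>i<n. a i \<in> carrier k) \<and> (scaled u J +> p) \<ominus>\<^bsub>fiber J\<^esub> lc (fiber J) n a (\<lambda>i. scaled u J +> v i) \<in> {\<zero>\<^bsub>fiber J\<^esub>})
  \<longleftrightarrow> (\<exists>t. (\<forall>i<n. t i \<in> C) \<and> p \<ominus> lc Rmod n t v \<in> scaled u J)"
proof -
 have key: "(scaled u J +> p) \<ominus>\<^bsub>fiber J\<^esub> lc (fiber J) n (\<lambda>i. U +> t i) (\<lambda>i. scaled u J +> v i) = \<zero>\<^bsub>fiber J\<^esub>
   \<longleftrightarrow> p \<ominus> lc Rmod n t v \<in> scaled u J" if t: "\<forall>i<n. t i \<in> C" for t
 proof -
  have tc: "\<forall>i<n. t i \<in> carrier R" using t C_carrier by blast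
  note l = lc_ideal[OF J tc v]
  show ?thesis unfolding lc_fiber[OF J tc v] fiber_minus[OF J p l]
   by (rule fiber_coset_zero[OF J ideal_facts(8)[OF J p l]])
 qed
 show ?thesis
 proof
  assume "\<exists>a. (\<forall>i<n. a i \<in> carrier k) \<and> (scaled u J +> p) \<ominus>\<^bsub>fiber J\<^esub> lc (fiber J) n a (\<lambda>i. scaled u J +> v i) \<in> {\<zero>\<^bsub>fiber J\<^esub>}"
  then obtain a where a: "\<forall>i<n. a i \<in> K" "(scaled u J +> p) \<ominus>\<^bsub>fiber J\<^esub> lc (fiber J) n a (\<lambda>i. scaled u J +> v i) = \<zero>\<^bsub>fiber J\<^esub>"
   unfolding k_ops by blast
  obtain t where t: "\<forall>i<n. t i \<in> C \<and> a i = U +> t i" using K_choice[OF a(1)] by blast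
  have "lc (fiber J) n a (\<lambda>i. scaled u J +> v i) = lc (fiber J) n (\<lambda>i. U +> t i) (\<lambda>i. scaled u J +> v i)"
   by (rule lc_cong) (use t in auto)
  then show "\<exists>t. (\<forall>i<n. t i \<in> C) \<and> p \<ominus> lc Rmod n t v \<in> scaled u J" using key[of t] t a(2) by auto
 next
  assume "\<exists>t. (\<forall>i<n. t i \<in> C) \<and> p \<ominus> lc Rmod n t v \<in> scaled u J"
  then obtain t where t: "\<forall>i<n. t i \<in> C" "p \<ominus> lc Rmod n t v \<in> scaled u J" by blast
  then show "\<exists>a. (\<forall>i<n. a i \<in> carrier k) \<and> (scaled u J +> p) \<ominus>\<^bsub>fiber J\<^esub> lc (fiber J) n a (\<lambda>i. scaled u J +> v i) \<in> {\<zero>\<^bsub>fiber J\<^esub>}"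
   using key[OF t(1)] C_K unfolding k_ops by (intro exI[of _ "\<lambda>i. U +> t i"]) auto
 qed
qed

lemma fiber_basis_iff:
 assumes J: "ideal J R" and v: "\<forall>i<n. v i \<in> J"
 shows "rel_basis k (fiber J) (carrier (fiber J)) {\<zero>\<^bsub>fiber J\<^esub>} n (\<lambda>i. scaled u J +> v i) \<longleftrightarrow> fiber_basis J n v"
 unfolding rel_basis_def fiber_basis_def rel_indep_fiber[OF J v]
 using v rel_span_fiber[OF J v] unfolding fiber_carrier by blast

lemma fiber_basis_of_rel:
 assumes J: "ideal J R" and w: "rel_basis k (fiber J) (carrier (fiber J)) {\<zero>\<^bsub>fiber J\<^esub>} n w"
 shows "\<exists>v. fiber_basis J n v \<and> (\<forall>i<n. w i = scaled u J +> v i)"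
proof -
 have "\<forall>i. \<exists>v. i < n \<longrightarrow> v \<in> J \<and> w i = scaled u J +> v" using w unfolding rel_basis_def fiber_carrier by blast
 from choice[OF this] obtain v where v: "\<forall>i. i < n \<longrightarrow> v i \<in> J \<and> w i = scaled u J +> v i" by blast
 interpret V: vectorspace k "fiber J" by (rule fiber_vectorspace[OF J])
 have e: "lc (fiber J) n a w = lc (fiber J) n a (\<lambda>i. scaled u J +> v i)" for a
  by (rule lc_cong) (use v in auto)
 have "rel_basis k (fiber J) (carrier (fiber J)) {\<zero>\<^bsub>fiber J\<^esub>} n (\<lambda>i. scaled u J +> v i)"
  using w v unfolding rel_basis_def rel_indep_def e by simp
 then show ?thesis using fiber_basis_iff[OF J, of n v] v by blast
qed

lemma fiber_basis_dependent:
 assumes J: "ideal J R" and v: "fiber_basis J n v" and w: "\<forall>i<Suc n. w i \<in> J"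
 shows "\<exists>t. (\<forall>i<Suc n. t i \<in> C) \<and> (\<exists>i<Suc n. t i \<notin> U) \<and> lc Rmod (Suc n) t w \<in> scaled u J"
proof (rule ccontr)
 assume n: "\<not> ?thesis"
 interpret V: vectorspace k "fiber J" by (rule fiber_vectorspace[OF J])
 have i: "rel_indep k (fiber J) {\<zero>\<^bsub>fiber J\<^esub>} (Suc n) (\<lambda>i. scaled u J +> w i)"
  unfolding rel_indep_fiber[OF J w] using n by blast
 have b: "rel_basis k (fiber J) (carrier (fiber J)) {\<zero>\<^bsub>fiber J\<^esub>} n (\<lambda>i. scaled u J +> v i)"
  using fiber_basis_iff[OF J] fiber_basisD(1)[OF v] v by blast
 have "Suc n \<le> n"
  by (rule V.rel_basis_bound[OF V.submodule_zero V.submodule_carrier b _ i]) (use w in \<open>auto simp: fiber_carrier\<close>)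
 then show False by simp
qed

lemma lc_shift:
 assumes "\<forall>i<n. t i \<in> carrier R" "\<forall>i<n. v i \<in> carrier R" "\<forall>i<n. s i \<in> carrier R" and b: "b \<in> carrier R"
 shows "lc Rmod n t (\<lambda>i. v i \<ominus> s i \<otimes> b) = lc Rmod n t v \<ominus> lc Rmod n t s \<otimes> b"
 using assms(1-3)
proof (induction n)
 case 0
 show ?case using b by (simp add: a_minus_def)
next
 case (Suc n)
 have c: "lc Rmod n t v \<in> carrier R" "lc Rmod n t s \<in> carrier R" "t n \<in> carrier R" "v n \<in> carrier R" "s n \<in> carrier R"
  using lc_ideal[OF oneideal] Suc.prems by auto
 have e: "lc Rmod n t (\<lambda>i. v i \<ominus> s i \<otimes> b) = lc Rmod n t v \<ominus> lc Rmod n t s \<otimes> b" using Suc by simp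
 show ?case unfolding lc.simps e ideal_module_simps using c b by algebra
qed

text \<open>Let \<open>J1 = J + Rb\<close> with \<open>\<mm> b \<subseteq> J\<close>. Choose a basis of \<open>J1/uJ1\<close> that ends in \<open>b\<close>, correct its other members by multiples of \<open>b\<close> so that they
lie in \<open>J\<close>, and replace \<open>b\<close> by \<open>u b\<close>. The length is unchanged: \<open>J1/J\<close> is lost and \<open>uJ1/uJ\<close>, isomorphic to it, is gained.\<close>

lemma fiber_basis_descend:
 assumes J: "ideal J R" and b: "b \<in> carrier R" "b \<notin> J" "\<And>m. m \<in> \<mm> ==> m \<otimes> b \<in> J"
  and v: "fiber_basis (adjoin J b) n v0"
 shows "\<exists>v. fiber_basis J n v"
proof -
 define J1 where "J1 = adjoin J b"
 have J1: "ideal J1 R" "J \<subseteq> J1" "b \<in> J1" unfolding J1_def using adjoin_ideal[OF J b(1)] adjoin_contains[OF J b(1)] .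
 note Jf = ideal_facts[OF J] and J1f = ideal_facts[OF J1(1)]
 note uJ = ideal_facts[OF scaled_ideal[OF J u_carrier]] and uJ1 = ideal_facts[OF scaled_ideal[OF J1(1) u_carrier]]
 have dec: "\<exists>j r. j \<in> J \<and> r \<in> carrier R \<and> p = j \<oplus> r \<otimes> b" if "p \<in> J1" for p
  using that unfolding J1_def adjoin_def by blast
 have ub: "u \<otimes> b \<in> J" by (rule b(3)[OF u_mm])
 have sub: "scaled u J1 \<subseteq> J"
 proof
  fix z assume "z \<in> scaled u J1"
  then obtain p where p: "p \<in> J1" "z = u \<otimes> p" using scaledE by blast
  obtain j r where j: "j \<in> J" "r \<in> carrier R" "p = j \<oplus> r \<otimes> b" using dec[OF p(1)] by blast
  have "z = u \<otimes> j \<oplus> r \<otimes> (u \<otimes> b)" unfolding p(2) j(3) using j Jf(2)[OF j(1)] b(1) u_carrier by algebra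
  then show "z \<in> J" using Jf(4)[OF Jf(5)[OF j(1) u_carrier] Jf(5)[OF ub j(2)]] by simp
 qed
 have sub': "scaled u J \<subseteq> scaled u J1" unfolding scaled_def using J1(2) by blast
 have unit: "c \<in> \<mm>" if c: "c \<in> carrier R" "c \<otimes> b \<in> J" for c
 proof (rule ccontr)
  assume "c \<notin> \<mm>"
  then have cu: "c \<in> Units R" using nonunit_in_mm c(1) by blast
  have "inv c \<otimes> (c \<otimes> b) \<in> J" by (rule Jf(5)[OF c(2)]) (use cu in simp)
  then show False using cu b(1,2) c(1) by (simp add: m_assoc[symmetric])
 qed
 interpret V: vectorspace k "fiber J1" by (rule fiber_vectorspace[OF J1(1)])
 have "rel_basis k (fiber J1) (carrier (fiber J1)) {\<zero>\<^bsub>fiber J1\<^esub>} n (\<lambda>i. scaled u J1 +> v0 i)"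
  using fiber_basis_iff[OF J1(1)] fiber_basisD(1)[OF v] v unfolding J1_def by blast
 moreover have "scaled u J1 +> b \<in> carrier (fiber J1)" unfolding fiber_carrier using J1(3) by blast
 moreover have "scaled u J1 +> b \<noteq> \<zero>\<^bsub>fiber J1\<^esub>"
  using fiber_coset_zero[OF J1(1,3)] sub b(2) by blast
 ultimately obtain l w where l: "n = Suc l" and w: "rel_basis k (fiber J1) (carrier (fiber J1)) {\<zero>\<^bsub>fiber J1\<^esub>} n w"
  "w l = scaled u J1 +> b" using V.basis_through by blast
 obtain v1 where v1: "fiber_basis J1 n v1" "\<forall>i<n. w i = scaled u J1 +> v1 i"
  using fiber_basis_of_rel[OF J1(1) w(1)] by blast
 define v where "v = v1(l := b)"
 have "rel_basis k (fiber J1) (carrier (fiber J1)) {\<zero>\<^bsub>fiber J1\<^esub>} n (\<lambda>i. scaled u J1 +> v i)"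
 proof -
  have wv: "w i = scaled u J1 +> v i" if i: "i < n" for i
  proof (cases "i = l")
   case True
   then show ?thesis using w(2) by (simp add: v_def)
  next
   case False
   then show ?thesis using v1(2) i by (simp add: v_def)
  qed
  then have "lc (fiber J1) n a w = lc (fiber J1) n a (\<lambda>i. scaled u J1 +> v i)" for a by (intro lc_cong) auto
  then show ?thesis using w(1) wv unfolding rel_basis_def rel_indep_def by simp
 qed
 moreover have vJ1: "\<forall>i<n. v i \<in> J1" using fiber_basisD(1)[OF v1(1)] J1(3) by (simp add: v_def)
 ultimately have v: "fiber_basis J1 n v" using fiber_basis_iff[OF J1(1)] by blast
 have vl: "v l = b" by (simp add: v_def)
 have vc: "\<forall>i<n. v i \<in> carrier R" using vJ1 J1f(2) by blast
 have "\<forall>i. \<exists>s. i < l \<longrightarrow> s \<in> C \<and> v i \<ominus> s \<otimes> b \<in> J"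
 proof (intro allI)
  fix i
  show "\<exists>s. i < l \<longrightarrow> s \<in> C \<and> v i \<ominus> s \<otimes> b \<in> J"
  proof (cases "i < l")
   case True
   then obtain j r where j: "j \<in> J" "r \<in> carrier R" "v i = j \<oplus> r \<otimes> b" using dec vJ1 l by (metis less_SucI)
   obtain s where s: "s \<in> C" "r \<ominus> s \<in> \<mm>" using C_representative[OF j(2)] by blast
   have "v i \<ominus> s \<otimes> b = j \<oplus> (r \<ominus> s) \<otimes> b" unfolding j(3) using j(2) Jf(2)[OF j(1)] C_carrier[OF s(1)] b(1) by algebra
   then show ?thesis using Jf(4)[OF j(1) b(3)[OF s(2)]] s(1) by auto
  qed simp
 qed
 from choice[OF this] obtain s where s: "\<forall>i<l. s i \<in> C \<and> v i \<ominus> s i \<otimes> b \<in> J" by blast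
 have sc: "\<forall>i<l. s i \<in> C" "\<forall>i<l. s i \<in> carrier R" using s C_carrier by blast+
 have vcl: "\<forall>i<l. v i \<in> carrier R" using vc l by simp
 define v' where "v' i = (if i < l then v i \<ominus> s i \<otimes> b else u \<otimes> b)" for i
 have v'J: "\<forall>i<n. v' i \<in> J" using s ub by (simp add: v'_def)
 have lcv': "lc Rmod n t v' = (lc Rmod l t v \<ominus> lc Rmod l t s \<otimes> b) \<oplus> t l \<otimes> (u \<otimes> b)" if "\<forall>i<n. t i \<in> C" for t
 proof -
  have tc: "\<forall>i<l. t i \<in> carrier R" using that C_carrier l by simp
  have "lc Rmod l t v' = lc Rmod l t (\<lambda>i. v i \<ominus> s i \<otimes> b)" by (rule lc_cong) (simp_all add: v'_def)
  then show ?thesis using lc_shift[OF tc vcl sc(2) b(1)] unfolding l by (simp add: v'_def)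
 qed
 have lcc: "lc Rmod l t v \<in> carrier R" "lc Rmod l t s \<in> C" "lc Rmod l t s \<in> carrier R" "t l \<in> carrier R" "t l \<in> C"
  if t: "\<forall>i<n. t i \<in> C" for t
 proof -
  have tl: "\<forall>i<l. t i \<in> C" "\<forall>i<l. t i \<in> carrier R" "t l \<in> C" using t l C_carrier by auto
  show "lc Rmod l t v \<in> carrier R" by (rule lc_ideal[OF oneideal tl(2) vcl])
  show "lc Rmod l t s \<in> C" by (rule lc_C[OF tl(1) sc(1)])
  then show "lc Rmod l t s \<in> carrier R" by (rule C_carrier)
  show "t l \<in> carrier R" "t l \<in> C" using tl(3) C_carrier by blast+
 qed
 have "fiber_basis J n v'"
  unfolding fiber_basis_def
 proof (intro conjI)
  show "\<forall>i<n. v' i \<in> J" by (rule v'J)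
  show "\<forall>p\<in>J. \<exists>t. (\<forall>i<n. t i \<in> C) \<and> p \<ominus> lc Rmod n t v' \<in> scaled u J"
  proof
   fix p assume p: "p \<in> J"
   have "p \<in> J1" using p J1(2) by blast
   from fiber_basisD(2)[OF v this] obtain t where t: "\<forall>i<n. t i \<in> C" "p \<ominus> lc Rmod n t v \<in> scaled u J1" by blast
   note c = lcc[OF t(1)]
   obtain q where q: "q \<in> J1" "p \<ominus> lc Rmod n t v = u \<otimes> q" using scaledE[OF t(2)] by blast
   have tl: "\<forall>i<l. t i \<in> carrier R" using t(1) C_carrier l by simp
   have lcn: "lc Rmod n t v = lc Rmod l t v \<oplus> t l \<otimes> b" unfolding l by (simp add: vl)
   have pc: "p \<in> carrier R" by (rule Jf(2)[OF p])
   have qc: "q \<in> carrier R" by (rule J1f(2)[OF q(1)])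
   \<comment> \<open>The coefficient of \<open>b\<close> after the correction; it lies in \<open>C \<inter> \<mm>\<close> because \<open>d b \<in> J\<close>.\<close>
   define d where "d = lc Rmod l t s \<oplus> t l"
   have dC: "d \<in> C" "d \<in> carrier R" unfolding d_def using C_add[OF c(2,5)] C_carrier by blast+
   have lJ: "lc Rmod l t v \<ominus> lc Rmod l t s \<otimes> b \<in> J"
   proof -
    have "lc Rmod l t (\<lambda>i. v i \<ominus> s i \<otimes> b) \<in> J" by (rule lc_ideal[OF J tl]) (use s in blast)
    then show ?thesis unfolding lc_shift[OF tl vcl sc(2) b(1)] .
   qed
   have pe: "p = (lc Rmod l t v \<oplus> t l \<otimes> b) \<oplus> u \<otimes> q"
    unfolding q(2)[symmetric] lcn using pc c b(1) by algebra
   have "d \<otimes> b = (p \<ominus> (lc Rmod l t v \<ominus> lc Rmod l t s \<otimes> b)) \<ominus> u \<otimes> q"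
    unfolding d_def pe using c b(1) qc u_carrier by algebra
   also have "\<dots> \<in> J" using Jf(8)[OF Jf(8)[OF p lJ]] sub scaledI[OF q(1)] by blast
   finally have "d \<in> \<mm>" using unit dC(2) by blast
   then obtain d' where d': "d' \<in> carrier R" "d = d' \<otimes> u" using C_inter_mm[OF dC(1)] unfolding PIdl_iff by blast
   obtain j r where j: "j \<in> J" "r \<in> carrier R" "q = j \<oplus> r \<otimes> b" using dec[OF q(1)] by blast
   obtain t' where t': "t' \<in> C" "(d' \<oplus> r) \<ominus> t' \<in> \<mm>" using C_representative d'(1) j(2) by blast
   define t2 where "t2 = t(l := t')"
   have t2: "\<forall>i<n. t2 i \<in> C" using t(1) t'(1) by (simp add: t2_def)
   have e: "lc Rmod l t2 v = lc Rmod l t v" "lc Rmod l t2 s = lc Rmod l t s" "t2 l = t'"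
    by (auto simp: t2_def intro!: lc_cong)
   have t'c: "t' \<in> carrier R" by (rule C_carrier[OF t'(1)])
   have jc: "j \<in> carrier R" by (rule Jf(2)[OF j(1)])
   have tle: "t l = d' \<otimes> u \<ominus> lc Rmod l t s" unfolding d'(2)[symmetric] d_def using c by algebra
   have "p \<ominus> lc Rmod n t2 v' = u \<otimes> (j \<oplus> ((d' \<oplus> r) \<ominus> t') \<otimes> b)"
    unfolding lcv'[OF t2] e pe tle j(3) using c b(1) jc j(2) u_carrier d'(1) t'c by algebra
   then have "p \<ominus> lc Rmod n t2 v' \<in> scaled u J" using scaledI[OF Jf(4)[OF j(1) b(3)[OF t'(2)]]] by simp
   then show "\<exists>t. (\<forall>i<n. t i \<in> C) \<and> p \<ominus> lc Rmod n t v' \<in> scaled u J" using t2 by blast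
  qed
  show "\<forall>t. (\<forall>i<n. t i \<in> C) \<longrightarrow> lc Rmod n t v' \<in> scaled u J \<longrightarrow> (\<forall>i<n. t i \<in> U)"
  proof (intro allI impI)
   fix t i assume t: "\<forall>i<n. t i \<in> C" and z: "lc Rmod n t v' \<in> scaled u J" and i: "i < n"
   note c = lcc[OF t]
   define t2 where "t2 = t(l := \<ominus> lc Rmod l t s)"
   have neg: "\<ominus> lc Rmod l t s \<in> C"
   proof -
    interpret kf: field k by (rule k_field)
    obtain m where m: "m \<in> C" "\<ominus> \<one> \<ominus> m \<in> \<mm>" using C_representative[of "\<ominus> \<one>"] by auto
    have mc: "m \<in> carrier R" by (rule C_carrier[OF m(1)])
    have "\<ominus> (\<ominus> \<one> \<ominus> m) \<in> \<mm>" by (rule ideal_facts(7)[OF mm_ideal m(2)])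
    moreover have "\<ominus> (\<ominus> \<one> \<ominus> m) = \<one> \<oplus> m" using mc by algebra
    ultimately have "\<one> \<oplus> m \<in> U" using C_inter_mm[OF C_add[OF C_one m(1)]] by simp
    then have "\<ominus> (\<one> \<oplus> m) \<oplus> m \<in> C" using C_add[OF U_C[OF ideal_facts(7)[OF U_ideal]] m(1)] by blast
    moreover have "\<ominus> (\<one> \<oplus> m) \<oplus> m = \<ominus> \<one>" using mc by algebra
    ultimately have "\<ominus> \<one> \<in> C" by simp
    then have "(\<ominus> \<one>) \<otimes> lc Rmod l t s \<in> C" using C_mult c(2) by blast
    then show ?thesis using c(3) by (simp add: l_minus)
   qed
   have t2: "\<forall>i<n. t2 i \<in> C" using t neg by (simp add: t2_def)
   have e: "lc Rmod l t2 v = lc Rmod l t v" by (auto simp: t2_def intro!: lc_cong)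
   have "lc Rmod n t2 v = lc Rmod l t v \<ominus> lc Rmod l t s \<otimes> b"
    unfolding l using e c b(1) by (simp add: vl t2_def l_minus a_minus_def)
   also have "\<dots> = lc Rmod n t v' \<ominus> u \<otimes> (t l \<otimes> b)"
    unfolding lcv'[OF t] using c b(1) u_carrier by algebra
   also have "\<dots> \<in> scaled u J1"
    using uJ1(8) z sub' scaledI[OF J1f(5)[OF J1(3) c(4)]] by blast
   finally have t2U: "\<forall>i<n. t2 i \<in> U" using fiber_basisD(3)[OF v t2] by blast
   have tU: "\<forall>i<l. t i \<in> U"
   proof (intro allI impI)
    fix i assume i: "i < l"
    then have "t2 i \<in> U" using t2U l by simp
    then show "t i \<in> U" using i by (simp add: t2_def)
   qed
   have lJ: "lc Rmod l t v' \<in> scaled u J"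
   proof -
    have "lc Rmod m t v' \<in> scaled u J" if "m \<le> l" for m
     using that
    proof (induction m)
     case 0
     show ?case using uJ(3) by simp
    next
     case (Suc m)
     then have "t m \<otimes> v' m \<in> scaled u J" using fiber_prod[OF J] tU v'J l by simp
     then show ?case using Suc uJ(4) by simp
    qed
    then show ?thesis by simp
   qed
   have ln: "lc Rmod n t v' = lc Rmod l t v' \<oplus> t l \<otimes> (u \<otimes> b)" unfolding l by (simp add: v'_def)
   have lR: "lc Rmod l t v' \<in> carrier R" by (rule uJ(2)[OF lJ])
   have "t l \<otimes> (u \<otimes> b) = lc Rmod n t v' \<ominus> lc Rmod l t v'"
    unfolding ln using lR c(4) b(1) u_carrier by algebra
   then have "t l \<otimes> (u \<otimes> b) \<in> scaled u J" using uJ(8)[OF z lJ] by simp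
   then obtain j where j: "j \<in> J" "t l \<otimes> (u \<otimes> b) = u \<otimes> j" using scaledE by blast
   have "u \<otimes> (t l \<otimes> b) = u \<otimes> j" using j(2) c b(1) u_carrier by (simp add: m_lcomm)
   then have "t l \<otimes> b = j" using cancel_left[OF u_carrier u_nonzero] c(4) b(1) Jf(2)[OF j(1)] by simp
   then have "t l \<in> U" using C_inter_mm[OF c(5)] unit[OF c(4)] j(1) by blast
   then show "t i \<in> U" using tU i l by (cases "i = l") auto
  qed
 qed
 then show ?thesis by blast
qed

text \<open>\<open>R/J\<close> has finite length, and each composition factor contributes one generator over \<open>C\<close>.\<close>

lemma C_span:
 assumes "ideal J R" "J \<noteq> {\<zero>}"
 shows "\<exists>n w. (\<forall>i<n. w i \<in> carrier R) \<and> (\<forall>p\<in>carrier R. \<exists>t. (\<forall>i<n. t i \<in> C) \<and> p \<ominus> lc Rmod n t w \<in> J)"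
 using assms
proof (induction J rule: descent)
 case top
 show ?case by (intro exI[of _ 0] exI[of _ "\<lambda>_. \<zero>"]) (simp add: a_minus_def)
next
 case (step J b)
 note Jf = ideal_facts[OF step(1)]
 obtain n w where w: "\<forall>i<n. w i \<in> carrier R"
  "\<And>p. p \<in> carrier R ==> \<exists>t. (\<forall>i<n. t i \<in> C) \<and> p \<ominus> lc Rmod n t w \<in> adjoin J b" using step(7) by blast
 show ?case
 proof (rule exI[of _ "Suc n"], rule exI[of _ "w(n := b)"], intro conjI ballI)
  show "\<forall>i<Suc n. (w(n := b)) i \<in> carrier R" using w(1) step(4) by (simp add: less_Suc_eq)
  fix p assume p: "p \<in> carrier R"
  obtain t where t: "\<forall>i<n. t i \<in> C" "p \<ominus> lc Rmod n t w \<in> adjoin J b" using w(2)[OF p] by blast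
  obtain j r where j: "j \<in> J" "r \<in> carrier R" "p \<ominus> lc Rmod n t w = j \<oplus> r \<otimes> b" using t(2) unfolding adjoin_def by blast
  obtain s where s: "s \<in> C" "r \<ominus> s \<in> \<mm>" using C_representative[OF j(2)] by blast
  have lw: "lc Rmod n t w \<in> carrier R" using lc_ideal[OF oneideal _ w(1)] t(1) C_carrier by blast
  have e: "lc Rmod n (t(n := s)) (w(n := b)) = lc Rmod n t w" by (rule lc_cong) auto
  have c: "s \<in> carrier R" "j \<in> carrier R" using C_carrier[OF s(1)] Jf(2)[OF j(1)] .
  have "p \<ominus> lc Rmod (Suc n) (t(n := s)) (w(n := b)) = (p \<ominus> lc Rmod n t w) \<ominus> s \<otimes> b"
   unfolding lc.simps e using p lw c step(4) by (simp add: a_minus_def minus_add a_ac)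
  also have "\<dots> = j \<oplus> (r \<ominus> s) \<otimes> b" unfolding j(3) using c j(2) step(4) by algebra
  also have "\<dots> \<in> J" using Jf(4)[OF j(1) step(6)[OF s(2)]] .
  finally show "\<exists>t. (\<forall>i<Suc n. t i \<in> C) \<and> p \<ominus> lc Rmod (Suc n) t (w(n := b)) \<in> J"
   using t(1) s(1) by (intro exI[of _ "t(n := s)"]) (simp add: less_Suc_eq)
 qed
qed

lemma U_nonzero: "U \<noteq> {\<zero>}"
 using cgenideal_self[OF u_carrier] u_nonzero by blast

lemma fiber_dimension:
 shows "\<exists>n. \<forall>J. ideal J R \<longrightarrow> J \<noteq> {\<zero>} \<longrightarrow> (\<exists>v. fiber_basis J n v)"
proof -
 note R = oneideal
 interpret V: vectorspace k "fiber (carrier R)" by (rule fiber_vectorspace[OF R])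
 obtain N w where w: "\<forall>i<N. w i \<in> carrier R" "\<forall>p\<in>carrier R. \<exists>t. (\<forall>i<N. t i \<in> C) \<and> p \<ominus> lc Rmod N t w \<in> U"
  using C_span[OF U_ideal U_nonzero] by blast
 have sp: "\<exists>a. (\<forall>i<N. a i \<in> carrier k) \<and> z \<ominus>\<^bsub>fiber (carrier R)\<^esub> lc (fiber (carrier R)) N a (\<lambda>i. scaled u (carrier R) +> w i) \<in> {\<zero>\<^bsub>fiber (carrier R)\<^esub>}"
  if z: "z \<in> carrier (fiber (carrier R))" for z
 proof -
  obtain p where p: "p \<in> carrier R" "z = scaled u (carrier R) +> p" using z unfolding fiber_carrier by blast
  show ?thesis unfolding p(2) rel_span_fiber[OF R w(1) p(1)] using w(2) p(1) unfolding U_scaled by blast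
 qed
 have wV: "\<forall>i<N. scaled u (carrier R) +> w i \<in> carrier (fiber (carrier R))" unfolding fiber_carrier using w(1) by blast
 have "\<exists>n v. rel_basis k (fiber (carrier R)) (carrier (fiber (carrier R))) {\<zero>\<^bsub>fiber (carrier R)\<^esub>} n v"
 proof (rule V.rel_basis_exists[OF V.submodule_zero V.submodule_carrier])
  fix m z assume z: "\<forall>i<m. z i \<in> carrier (fiber (carrier R))" "rel_indep k (fiber (carrier R)) {\<zero>\<^bsub>fiber (carrier R)\<^esub>} m z"
  show "m \<le> N" by (rule V.indep_le_spanning[OF V.submodule_zero wV _ z]) (use sp z(1) in blast)
 qed
 then obtain n v where v: "rel_basis k (fiber (carrier R)) (carrier (fiber (carrier R))) {\<zero>\<^bsub>fiber (carrier R)\<^esub>} n v" by blast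
 have ring: "\<exists>v. fiber_basis (carrier R) n v" using fiber_basis_of_rel[OF R v] by blast
 have "\<exists>v. fiber_basis J n v" if "ideal J R" "J \<noteq> {\<zero>}" for J
  using that
 proof (induction J rule: descent)
  case top
  show ?case by (rule ring)
 next
  case (step J b)
  then show ?case using fiber_basis_descend[OF step(1,4,5,6)] by blast
 qed
 then show ?thesis by blast
qed

end

section \<open>Ring elements as operators on a fibre\<close>

text \<open>The elements \<open>x\<close> and \<open>y\<close> may be zero, so this covers embedding dimension less than three.\<close>

locale three_generated = coefficient_setting +
 fixes x y
 assumes x_mm: "x \<in> \<mm>" and y_mm: "y \<in> \<mm>"
  and generators: "m \<in> \<mm> ==> \<exists>a b c. a \<in> carrier R \<and> b \<in> carrier R \<and> c \<in> carrier R \<and> m = u \<otimes> a \<oplus> x \<otimes> b \<oplus> y \<otimes> c"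
begin

abbreviation act where "act J r \<equiv> (\<lambda>A. (U +> r) \<odot>\<^bsub>fiber J\<^esub> A)"

lemma x_carrier: "x \<in> carrier R" and y_carrier: "y \<in> carrier R"
 using ideal_facts(2)[OF mm_ideal] x_mm y_mm by blast+

lemma act_closed:
 assumes J: "ideal J R" and r: "r \<in> carrier R" and A: "A \<in> carrier (fiber J)"
 shows "act J r A \<in> carrier (fiber J)"
 using A fiber_smult[OF J r] ideal_facts(5)[OF J _ r] unfolding fiber_carrier by auto

lemma act_mult:
 assumes J: "ideal J R" and r: "r \<in> carrier R" "s \<in> carrier R" and A: "A \<in> carrier (fiber J)"
 shows "act J r (act J s A) = act J (r \<otimes> s) A"
proof -
 obtain v where v: "v \<in> J" "A = scaled u J +> v" using A unfolding fiber_carrier by blast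
 show ?thesis unfolding v(2) using fiber_smult[OF J] r v(1) ideal_facts(2,5)[OF J] by (simp add: m_assoc)
qed

lemma act_add:
 assumes J: "ideal J R" and r: "r \<in> carrier R" "s \<in> carrier R" and A: "A \<in> carrier (fiber J)"
 shows "act J r A \<oplus>\<^bsub>fiber J\<^esub> act J s A = act J (r \<oplus> s) A"
proof -
 obtain v where v: "v \<in> J" "A = scaled u J +> v" using A unfolding fiber_carrier by blast
 show ?thesis unfolding v(2) using fiber_smult[OF J] fiber_add[OF J] r v(1) ideal_facts(2,5)[OF J] by (simp add: l_distr)
qed

lemma act_linear:
 assumes J: "ideal J R" and r: "r \<in> carrier R"
 shows "linear_on k (fiber J) (fiber J) (carrier (fiber J)) (act J r)"
proof (rule linear_onI)
 show "act J r A \<in> carrier (fiber J)" if "A \<in> carrier (fiber J)" for A by (rule act_closed[OF J r that])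
 show "act J r (A \<oplus>\<^bsub>fiber J\<^esub> B) = act J r A \<oplus>\<^bsub>fiber J\<^esub> act J r B" if AB: "A \<in> carrier (fiber J)" "B \<in> carrier (fiber J)" for A B
 proof -
  obtain v where v: "v \<in> J" "A = scaled u J +> v" using AB unfolding fiber_carrier by blast
  obtain w where w: "w \<in> J" "B = scaled u J +> w" using AB unfolding fiber_carrier by blast
  show ?thesis unfolding v(2) w(2)
   using fiber_smult[OF J r] fiber_add[OF J] v(1) w(1) r ideal_facts(2,4,5)[OF J] by (simp add: r_distr)
 qed
 show "act J r (c \<odot>\<^bsub>fiber J\<^esub> A) = c \<odot>\<^bsub>fiber J\<^esub> act J r A" if c: "c \<in> carrier k" and A: "A \<in> carrier (fiber J)" for c A
 proof -
  have "c \<in> K" using c unfolding k_ops .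
  then obtain t where t: "t \<in> C" "c = U +> t" using K_coset by blast
  have tc: "t \<in> carrier R" by (rule C_carrier[OF t(1)])
  show ?thesis unfolding t(2) act_mult[OF J r tc A] act_mult[OF J tc r A] using r tc by (simp add: m_comm)
 qed
qed

lemma act_commuting_pair:
 assumes J: "ideal J R"
 shows "commuting_pair k (fiber J) (act J x) (act J y)"
proof -
 interpret V: vectorspace k "fiber J" by (rule fiber_vectorspace[OF J])
 show ?thesis
 proof (unfold_locales)
  show "linear_on k (fiber J) (fiber J) (carrier (fiber J)) (act J x)" by (rule act_linear[OF J x_carrier])
  show "linear_on k (fiber J) (fiber J) (carrier (fiber J)) (act J y)" by (rule act_linear[OF J y_carrier])
  show "act J x (act J y A) = act J y (act J x A)" if "A \<in> carrier (fiber J)" for A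
   using act_mult[OF J x_carrier y_carrier that] act_mult[OF J y_carrier x_carrier that] x_carrier y_carrier by (simp add: m_comm)
 qed
qed

lemma alg_is_act:
 assumes J: "ideal J R" and \<rho>: "\<rho> \<in> commuting_pair.alg k (fiber J) (act J x) (act J y)"
 shows "\<exists>r\<in>carrier R. \<forall>A\<in>carrier (fiber J). \<rho> A = act J r A"
proof -
 interpret cp: commuting_pair k "fiber J" "act J x" "act J y" by (rule act_commuting_pair[OF J])
 show ?thesis using \<rho>
 proof (induction rule: cp.alg.induct)
  case alg_id
  have "act J \<one> A = A" if A: "A \<in> carrier (fiber J)" for A
  proof -
   obtain v where v: "v \<in> J" "A = scaled u J +> v" using A unfolding fiber_carrier by blast
   show ?thesis unfolding v(2) using fiber_smult[OF J one_closed v(1)] ideal_facts(2)[OF J v(1)] by simp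
  qed
  then show ?case by (intro bexI[of _ \<one>]) auto
 next
  case (alg_S a)
  then obtain r where r: "r \<in> carrier R" "\<forall>A\<in>carrier (fiber J). a A = act J r A" by blast
  show ?case using r act_mult[OF J x_carrier r(1)] x_carrier by (intro bexI[of _ "x \<otimes> r"]) simp_all
 next
  case (alg_T a)
  then obtain r where r: "r \<in> carrier R" "\<forall>A\<in>carrier (fiber J). a A = act J r A" by blast
  show ?case using r act_mult[OF J y_carrier r(1)] y_carrier by (intro bexI[of _ "y \<otimes> r"]) simp_all
 next
  case (alg_comb a b c)
  obtain r where r: "r \<in> carrier R" "\<forall>A\<in>carrier (fiber J). a A = act J r A" using alg_comb.IH(1) by blast
  obtain s where s: "s \<in> carrier R" "\<forall>A\<in>carrier (fiber J). b A = act J s A" using alg_comb.IH(2) by blast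
  have "c \<in> K" using alg_comb.hyps unfolding k_ops by blast
  then obtain t where t: "t \<in> C" "c = U +> t" using K_coset by blast
  have tc: "t \<in> carrier R" by (rule C_carrier[OF t(1)])
  show ?case
  proof (intro bexI[of _ "t \<otimes> r \<oplus> s"] ballI)
   fix A assume A: "A \<in> carrier (fiber J)"
   show "c \<odot>\<^bsub>fiber J\<^esub> a A \<oplus>\<^bsub>fiber J\<^esub> b A = act J (t \<otimes> r \<oplus> s) A"
    using r s tc act_mult[OF J tc r(1) A] act_add[OF J _ s(1) A, of "t \<otimes> r"] A by (simp add: t(2))
  qed (use r s tc in simp)
 qed
qed

text \<open>Since \<open>R = C + uR + xR + yR\<close>, every element is congruent modulo any power of \<open>\<mm>\<close> to a polynomial in \<open>x\<close> and \<open>y\<close> over \<open>C\<close>, and a high power of \<open>\<mm>\<close> lies in \<open>uR\<close>.\<close>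

lemma act_is_alg:
 assumes J: "ideal J R" and r: "r \<in> carrier R"
 shows "\<exists>\<rho> \<in> commuting_pair.alg k (fiber J) (act J x) (act J y). \<forall>A\<in>carrier (fiber J). act J r A = \<rho> A"
proof -
 interpret cp: commuting_pair k "fiber J" "act J x" "act J y" by (rule act_commuting_pair[OF J])
 define P where "P = {r \<in> carrier R. \<exists>\<rho>\<in>cp.alg. \<forall>A\<in>carrier (fiber J). act J r A = \<rho> A}"
 have comb: "t \<otimes> p \<oplus> q \<in> P" if t: "t \<in> C" and p: "p \<in> P" and q: "q \<in> P" for t p q
 proof -
  obtain \<rho> where \<rho>: "\<rho> \<in> cp.alg" "\<forall>A\<in>carrier (fiber J). act J p A = \<rho> A" using p unfolding P_def by blast
  obtain \<sigma> where \<sigma>: "\<sigma> \<in> cp.alg" "\<forall>A\<in>carrier (fiber J). act J q A = \<sigma> A" using q unfolding P_def by blast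
  have c: "t \<in> carrier R" "p \<in> carrier R" "q \<in> carrier R" using p q C_carrier[OF t] unfolding P_def by auto
  have tk: "U +> t \<in> carrier k" using C_K[OF t] unfolding k_ops .
  have "act J (t \<otimes> p \<oplus> q) A = (U +> t) \<odot>\<^bsub>fiber J\<^esub> \<rho> A \<oplus>\<^bsub>fiber J\<^esub> \<sigma> A" if A: "A \<in> carrier (fiber J)" for A
   using act_mult[OF J c(1,2) A] act_add[OF J _ c(3) A, of "t \<otimes> p"] \<rho>(2) \<sigma>(2) A c by simp
  then show ?thesis unfolding P_def using c
   by (intro CollectI conjI bexI[OF _ cp.alg_comb[OF \<rho>(1) \<sigma>(1) tk]]) simp_all
 qed
 have one: "\<one> \<in> P"
 proof -
  have "act J \<one> A = A" if A: "A \<in> carrier (fiber J)" for A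
  proof -
   obtain v where v: "v \<in> J" "A = scaled u J +> v" using A unfolding fiber_carrier by blast
   show ?thesis unfolding v(2) using fiber_smult[OF J one_closed v(1)] ideal_facts(2)[OF J v(1)] by simp
  qed
  then show ?thesis unfolding P_def using cp.alg_id by (intro CollectI conjI bexI[of _ "\<lambda>w. w"]) auto
 qed
 have xP: "x \<otimes> p \<in> P" if p: "p \<in> P" for p
 proof -
  obtain \<rho> where \<rho>: "\<rho> \<in> cp.alg" "\<forall>A\<in>carrier (fiber J). act J p A = \<rho> A" and c: "p \<in> carrier R" using p unfolding P_def by blast
  have "act J (x \<otimes> p) A = act J x (\<rho> A)" if A: "A \<in> carrier (fiber J)" for A
   using act_mult[OF J x_carrier c A] \<rho>(2) A by simp
  then show ?thesis unfolding P_def using c x_carrier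
   by (intro CollectI conjI bexI[OF _ cp.alg_S[OF \<rho>(1)]]) simp_all
 qed
 have yP: "y \<otimes> p \<in> P" if p: "p \<in> P" for p
 proof -
  obtain \<rho> where \<rho>: "\<rho> \<in> cp.alg" "\<forall>A\<in>carrier (fiber J). act J p A = \<rho> A" and c: "p \<in> carrier R" using p unfolding P_def by blast
  have "act J (y \<otimes> p) A = act J y (\<rho> A)" if A: "A \<in> carrier (fiber J)" for A
   using act_mult[OF J y_carrier c A] \<rho>(2) A by simp
  then show ?thesis unfolding P_def using c y_carrier
   by (intro CollectI conjI bexI[OF _ cp.alg_T[OF \<rho>(1)]]) simp_all
 qed
 have zero: "\<zero> \<in> P"
 proof -
  have z: "(\<ominus> \<one>) \<in> carrier R" by simp
  obtain m where m: "m \<in> C" "\<ominus> \<one> \<ominus> m \<in> \<mm>" using C_representative[OF z] by blast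
  have mc: "m \<in> carrier R" by (rule C_carrier[OF m(1)])
  have "\<ominus> (\<ominus> \<one> \<ominus> m) \<in> \<mm>" by (rule ideal_facts(7)[OF mm_ideal m(2)])
  moreover have "\<ominus> (\<ominus> \<one> \<ominus> m) = m \<otimes> \<one> \<oplus> \<one>" using mc by algebra
  ultimately have e: "m \<otimes> \<one> \<oplus> \<one> \<in> U" using C_inter_mm[OF C_add[OF m(1) C_one]] mc by simp
  have e': "m \<otimes> \<one> \<oplus> \<one> \<in> P" by (rule comb[OF m(1) one one])
  have ne: "\<ominus> (m \<otimes> \<one> \<oplus> \<one>) \<in> C" by (rule U_C[OF ideal_facts(7)[OF U_ideal e]])
  have "\<ominus> (m \<otimes> \<one> \<oplus> \<one>) \<otimes> \<one> \<oplus> (m \<otimes> \<one> \<oplus> \<one>) \<in> P" by (rule comb[OF ne one e'])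
  moreover have "\<ominus> (m \<otimes> \<one> \<oplus> \<one>) \<otimes> \<one> \<oplus> (m \<otimes> \<one> \<oplus> \<one>) = \<zero>" using mc by algebra
  ultimately show ?thesis by simp
 qed
 have CP: "t \<in> P" if t: "t \<in> C" for t using comb[OF t one zero] C_carrier[OF t] by simp
 have add: "p \<oplus> q \<in> P" if "p \<in> P" "q \<in> P" for p q
  using comb[OF C_one that] that(1) unfolding P_def by simp
 have PR: "p \<in> carrier R" if "p \<in> P" for p using that unfolding P_def by blast
 have approx: "\<forall>r\<in>carrier R. \<exists>p\<in>P. r \<ominus> p \<in> mpow N" for N
 proof (induction N)
  case 0
  show ?case using zero by (auto intro!: bexI[of _ \<zero>])
 next
  case (Suc N)
  show ?case
  proof
   fix r assume r: "r \<in> carrier R"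
   obtain t where t: "t \<in> C" "r \<ominus> t \<in> \<mm>" using C_representative[OF r] by blast
   obtain a b c where abc: "a \<in> carrier R" "b \<in> carrier R" "c \<in> carrier R" "r \<ominus> t = u \<otimes> a \<oplus> x \<otimes> b \<oplus> y \<otimes> c"
    using generators[OF t(2)] by blast
   obtain p where p: "p \<in> P" "b \<ominus> p \<in> mpow N" using Suc abc(2) by blast
   obtain q where q: "q \<in> P" "c \<ominus> q \<in> mpow N" using Suc abc(3) by blast
   have "u \<otimes> a \<in> U" unfolding U_scaled using abc(1) by (rule scaledI)
   then have "u \<otimes> a \<in> P" using CP U_C by blast
   then have s: "(t \<oplus> u \<otimes> a) \<oplus> (x \<otimes> p \<oplus> y \<otimes> q) \<in> P"
    using add[OF add[OF CP[OF t(1)]] add[OF xP[OF p(1)] yP[OF q(1)]]] by blast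
   have tc: "t \<in> carrier R" by (rule C_carrier[OF t(1)])
   have re: "r = t \<oplus> (u \<otimes> a \<oplus> x \<otimes> b \<oplus> y \<otimes> c)" unfolding abc(4)[symmetric] using r tc by algebra
   note pq = PR[OF p(1)] PR[OF q(1)]
   have lin: "(t \<oplus> (A \<oplus> B \<oplus> D)) \<ominus> ((t \<oplus> A) \<oplus> (E \<oplus> G)) = (B \<ominus> E) \<oplus> (D \<ominus> G)"
    if h: "A \<in> carrier R" "B \<in> carrier R" "D \<in> carrier R" "E \<in> carrier R" "G \<in> carrier R" for A B D E G
   proof -
    have cancel: "(Z \<oplus> W) \<ominus> (Z \<oplus> V) = W \<ominus> V" if "Z \<in> carrier R" "W \<in> carrier R" "V \<in> carrier R" for Z W V
    proof -
     have "(Z \<oplus> W) \<ominus> (Z \<oplus> V) = (W \<oplus> Z) \<oplus> (\<ominus> Z \<oplus> \<ominus> V)" using that by (simp add: a_minus_def minus_add a_comm)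
     also have "\<dots> = W \<ominus> V" using that by (simp add: a_minus_def a_assoc r_neg2)
     finally show ?thesis .
    qed
    have "(t \<oplus> (A \<oplus> B \<oplus> D)) \<ominus> ((t \<oplus> A) \<oplus> (E \<oplus> G)) = ((t \<oplus> A) \<oplus> (B \<oplus> D)) \<ominus> ((t \<oplus> A) \<oplus> (E \<oplus> G))"
     using h tc by (simp add: a_assoc)
    also have "\<dots> = (B \<oplus> D) \<ominus> (E \<oplus> G)" using cancel[of "t \<oplus> A" "B \<oplus> D" "E \<oplus> G"] h tc by simp
    also have "\<dots> = (B \<ominus> E) \<oplus> (D \<ominus> G)" using h by (simp add: a_minus_def minus_add a_ac)
    finally show ?thesis .
   qed
   have "x \<otimes> b \<ominus> x \<otimes> p = x \<otimes> (b \<ominus> p)" "y \<otimes> c \<ominus> y \<otimes> q = y \<otimes> (c \<ominus> q)"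
    using abc(2,3) pq x_carrier y_carrier by (simp_all add: a_minus_def r_distr r_minus)
   then have "r \<ominus> ((t \<oplus> u \<otimes> a) \<oplus> (x \<otimes> p \<oplus> y \<otimes> q)) = x \<otimes> (b \<ominus> p) \<oplus> y \<otimes> (c \<ominus> q)"
    unfolding re using lin[of "u \<otimes> a" "x \<otimes> b" "y \<otimes> c" "x \<otimes> p" "y \<otimes> q"] abc(1-3) pq u_carrier x_carrier y_carrier by simp
   moreover have "x \<otimes> (b \<ominus> p) \<in> mpow (Suc N)" unfolding mpow.simps by (rule ideal_prod.prod[OF x_mm p(2)])
   moreover have "y \<otimes> (c \<ominus> q) \<in> mpow (Suc N)" unfolding mpow.simps by (rule ideal_prod.prod[OF y_mm q(2)])
   ultimately have "r \<ominus> ((t \<oplus> u \<otimes> a) \<oplus> (x \<otimes> p \<oplus> y \<otimes> q)) \<in> mpow (Suc N)"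
    using ideal_facts(4)[OF mpow_ideal] by (simp only:)
   then show "\<exists>p\<in>P. r \<ominus> p \<in> mpow (Suc N)" using s by (rule bexI)
  qed
 qed
 obtain N where N: "mpow N \<subseteq> U" using mpow_in_ideal[OF U_ideal U_nonzero] by blast
 obtain p where p: "p \<in> P" "r \<ominus> p \<in> mpow N" using approx r by blast
 have "r \<ominus> p \<in> P" using p(2) N CP U_C by blast
 then have "p \<oplus> (r \<ominus> p) \<in> P" using add p(1) by blast
 moreover have "p \<oplus> (r \<ominus> p) = r" using r PR[OF p(1)] by algebra
 ultimately have "r \<in> P" by simp
 then show ?thesis unfolding P_def by blast
qed

lemma comm_end_act:
 assumes J: "ideal J R" and \<phi>: "comm_end k (fiber J) (act J x) (act J y) (carrier (fiber J)) \<phi>"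
  and r: "r \<in> carrier R" and A: "A \<in> carrier (fiber J)"
 shows "\<phi> (act J r A) = act J r (\<phi> A)"
proof -
 interpret cp: commuting_pair k "fiber J" "act J x" "act J y" by (rule act_commuting_pair[OF J])
 have \<phi>l: "linear_on k (fiber J) (fiber J) (carrier (fiber J)) \<phi>" and
  \<phi>c: "\<And>w. w \<in> carrier (fiber J) ==> \<phi> w \<in> carrier (fiber J) \<and> \<phi> (act J x w) = act J x (\<phi> w) \<and> \<phi> (act J y w) = act J y (\<phi> w)"
  using \<phi> unfolding comm_end_def by blast+
 obtain \<rho> where \<rho>: "\<rho> \<in> cp.alg" "\<forall>A\<in>carrier (fiber J). act J r A = \<rho> A" using act_is_alg[OF J r] by blast
 have "\<forall>B\<in>carrier (fiber J). \<rho> B \<in> carrier (fiber J) \<and> \<phi> (\<rho> B) = \<rho> (\<phi> B)"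
  using \<rho>(1)
 proof (induction rule: cp.alg.induct)
  case alg_id
  show ?case by simp
 next
  case (alg_S a)
  show ?case using alg_S.IH \<phi>c act_closed[OF J x_carrier] by simp
 next
  case (alg_T a)
  show ?case using alg_T.IH \<phi>c act_closed[OF J y_carrier] by simp
 next
  case (alg_comb a b c)
  show ?case using alg_comb.IH \<phi>c alg_comb.hyps(3) linear_onD(2,3)[OF \<phi>l] by simp
 qed
 then show ?thesis using \<rho>(2) A \<phi>c by simp
qed

end

section \<open>Rigid ideals are principal\<close>

context three_generated
begin

lemma evaluation_ideal:
 assumes \<aa>: "ideal \<aa> R" and a: "a \<in> \<aa>"
 shows "ideal {e a | e. linear_on R Rmod Rmod \<aa> e \<and> (\<forall>z\<in>\<aa>. e z \<in> \<aa>)} R" (is "ideal ?J R")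
proof (rule idealI)
 note If = ideal_facts[OF \<aa>]
 show "ring R" by (rule ring_axioms)
 have ev: "e a \<in> ?J" if "linear_on R Rmod Rmod \<aa> e" "\<forall>z\<in>\<aa>. e z \<in> \<aa>" for e
  using that by (intro CollectI exI[of _ e]) simp
 have mul: "r \<otimes> j \<in> ?J" if j: "j \<in> ?J" and r: "r \<in> carrier R" for j r
 proof -
  obtain e where e: "j = e a" "linear_on R Rmod Rmod \<aa> e" "\<forall>z\<in>\<aa>. e z \<in> \<aa>" using j by blast
  note el = linear_onD[OF e(2), simplified]
  have "linear_on R Rmod Rmod \<aa> (\<lambda>z. r \<otimes> e z)"
   using el r by (intro linear_onI) (simp_all add: r_distr m_lcomm)
  moreover have "\<forall>z\<in>\<aa>. r \<otimes> e z \<in> \<aa>" using e(3) If(5) r by blast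
  ultimately show ?thesis unfolding e(1) by (rule ev[of "\<lambda>z. r \<otimes> e z"])
 qed
 show "r \<otimes> j \<in> ?J" if "j \<in> ?J" "r \<in> carrier R" for j r by (rule mul[OF that])
 have Jc: "?J \<subseteq> carrier R" using a If(2) by blast
 show "j \<otimes> r \<in> ?J" if h: "j \<in> ?J" "r \<in> carrier R" for j r
 proof -
  have "j \<in> carrier R" using Jc h(1) by blast
  then show ?thesis using mul[OF h] m_comm[OF _ h(2)] by simp
 qed
 show "subgroup ?J (add_monoid R)"
 proof (rule add.subgroupI)
  show "?J \<subseteq> carrier R" by (rule Jc)
  have "linear_on R Rmod Rmod \<aa> (\<lambda>z. z)" using If(2) by (intro linear_onI) simp_all
  then have "a \<in> ?J" using ev[of "\<lambda>z. z"] by simp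
  then show "?J \<noteq> {}" by auto
  show "\<ominus> j \<in> ?J" if j: "j \<in> ?J" for j
  proof -
   have "j \<in> carrier R" using Jc j by blast
   then show ?thesis using mul[OF j, of "\<ominus> \<one>"] by (simp add: l_minus)
  qed
  show "i \<oplus> j \<in> ?J" if ij: "i \<in> ?J" "j \<in> ?J" for i j
  proof -
   obtain e where e: "i = e a" "linear_on R Rmod Rmod \<aa> e" "\<forall>z\<in>\<aa>. e z \<in> \<aa>" using ij(1) by blast
   obtain f where f: "j = f a" "linear_on R Rmod Rmod \<aa> f" "\<forall>z\<in>\<aa>. f z \<in> \<aa>" using ij(2) by blast
   note el = linear_onD[OF e(2), simplified] and fl = linear_onD[OF f(2), simplified]
   have "linear_on R Rmod Rmod \<aa> (\<lambda>z. e z \<oplus> f z)"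
    using el fl by (intro linear_onI) (simp_all add: r_distr a_ac)
   moreover have "\<forall>z\<in>\<aa>. e z \<oplus> f z \<in> \<aa>" using e(3) f(3) If(4) by blast
   ultimately show ?thesis unfolding e(1) f(1) by (rule ev[of "\<lambda>z. e z \<oplus> f z"])
  qed
 qed
qed

lemma lc_linear_on:
 assumes \<aa>: "ideal \<aa> R" and t: "\<forall>i<n. t i \<in> carrier R" and e: "\<forall>i<n. linear_on R Rmod Rmod \<aa> (e i)"
 shows "linear_on R Rmod Rmod \<aa> (\<lambda>z. lc Rmod n t (\<lambda>i. e i z))"
 using t e
proof (induction n)
 case 0
 show ?case by (rule linear_onI) simp_all
next
 case (Suc n)
 then have "linear_on R Rmod Rmod \<aa> (\<lambda>z. lc Rmod n t (\<lambda>i. e i z))" and "linear_on R Rmod Rmod \<aa> (e n)" "t n \<in> carrier R"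
  by simp_all
 note h = linear_onD[OF this(1), simplified] linear_onD[OF this(2), simplified] this(3)
 show ?case using h by (intro linear_onI) (simp_all add: r_distr a_ac m_lcomm)
qed

lemma linear_on_exchange:
 assumes \<aa>: "ideal \<aa> R" and f: "linear_on R Rmod Rmod \<aa> f" and a: "a \<in> \<aa>" "z \<in> \<aa>"
 shows "a \<otimes> f z = z \<otimes> f a"
 using linear_onD(3)[OF f ideal_facts(2)[OF \<aa> a(1)] a(2)] linear_onD(3)[OF f ideal_facts(2)[OF \<aa> a(2)] a(1)]
  m_comm[OF ideal_facts(2)[OF \<aa> a(1)] ideal_facts(2)[OF \<aa> a(2)]] by simp

lemma comm_end_lifts:
 assumes \<aa>: "ideal \<aa> R" and rig: "Ext_vanishes R 1 (ideal_module R \<aa>) (ideal_module R \<aa>)"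
  and \<phi>: "comm_end k (fiber \<aa>) (act \<aa> x) (act \<aa> y) (carrier (fiber \<aa>)) \<phi>"
 shows "\<exists>e. linear_on R Rmod Rmod \<aa> e \<and> (\<forall>z\<in>\<aa>. e z \<in> \<aa> \<and> \<phi> (scaled u \<aa> +> z) = scaled u \<aa> +> e z)"
proof -
 let ?N = "scaled u \<aa>"
 note N = scaled_ideal[OF \<aa> u_carrier]
 note If = ideal_facts[OF \<aa>]
 have \<phi>l: "linear_on k (fiber \<aa>) (fiber \<aa>) (carrier (fiber \<aa>)) \<phi>" using \<phi> unfolding comm_end_def by blast
 have cF: "?N +> z \<in> carrier (fiber \<aa>)" if "z \<in> \<aa>" for z unfolding fiber_carrier using that by blast
 have "\<forall>z. \<exists>g. z \<in> \<aa> \<longrightarrow> g \<in> \<aa> \<and> \<phi> (?N +> z) = ?N +> g"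
  using linear_onD(1)[OF \<phi>l] cF unfolding fiber_carrier by blast
 from choice[OF this] obtain g where g: "\<And>z. z \<in> \<aa> ==> g z \<in> \<aa>" "\<And>z. z \<in> \<aa> ==> \<phi> (?N +> z) = ?N +> g z" by blast
 have ga: "g (z \<oplus> w) \<ominus> (g z \<oplus> g w) \<in> ?N" if h: "z \<in> \<aa>" "w \<in> \<aa>" for z w
 proof -
  have "?N +> g (z \<oplus> w) = \<phi> ((?N +> z) \<oplus>\<^bsub>fiber \<aa>\<^esub> (?N +> w))" using g(2)[OF If(4)[OF h]] fiber_add[OF \<aa> h] by simp
  also have "\<dots> = (?N +> g z) \<oplus>\<^bsub>fiber \<aa>\<^esub> (?N +> g w)" using linear_onD(2)[OF \<phi>l cF[OF h(1)] cF[OF h(2)]] g(2) h by simp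
  also have "\<dots> = ?N +> (g z \<oplus> g w)" using fiber_add[OF \<aa>] g(1) h by simp
  finally show ?thesis using coset_eq[OF N] If(2)[OF g(1)] If(4) h by simp
 qed
 have gs: "g (r \<otimes> z) \<ominus> r \<otimes> g z \<in> ?N" if r: "r \<in> carrier R" and h: "z \<in> \<aa>" for r z
 proof -
  have "?N +> g (r \<otimes> z) = \<phi> (act \<aa> r (?N +> z))" using g(2)[OF If(5)[OF h r]] fiber_smult[OF \<aa> r h] by simp
  also have "\<dots> = act \<aa> r (?N +> g z)" using comm_end_act[OF \<aa> \<phi> r cF[OF h]] g(2)[OF h] by simp
  also have "\<dots> = ?N +> (r \<otimes> g z)" using fiber_smult[OF \<aa> r g(1)[OF h]] .
  finally show ?thesis using coset_eq[OF N] If(2)[OF g(1)[OF h]] If(2)[OF g(1)[OF If(5)[OF h r]]] r by simp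
 qed
 have "\<exists>e. linear_on R Rmod Rmod \<aa> e \<and> (\<forall>z\<in>\<aa>. e z \<in> \<aa> \<and> e z \<ominus> g z \<in> ?N)"
  by (rule rigid_lifts[OF rig \<aa> u_carrier u_nonzero]) (fact g(1) ga gs)+
 then obtain e where e: "linear_on R Rmod Rmod \<aa> e" "\<forall>z\<in>\<aa>. e z \<in> \<aa> \<and> e z \<ominus> g z \<in> ?N" by blast
 have "\<phi> (?N +> z) = ?N +> e z" if z: "z \<in> \<aa>" for z
 proof -
  have "?N +> e z = ?N +> g z" using coset_eq[OF N] e(2) If(2) g(1)[OF z] z by blast
  then show ?thesis using g(2)[OF z] by simp
 qed
 then show ?thesis using e by blast
qed

text \<open>Lift \<open>n + 1\<close> centralizer elements to endomorphisms \<open>e\<^sub>i\<close> of \<open>\<aa>\<close> and evaluate at \<open>a\<close>. The values lie in the ideal \<open>J\<close> of all \<open>e a\<close>, whose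
fibre has dimension \<open>n\<close>, so a nontrivial combination of the \<open>e\<^sub>i\<close> agrees with \<open>u e\<close> at \<open>a\<close>. Over a domain endomorphisms of \<open>\<aa>\<close>
that agree at \<open>a\<close> are equal, so the combination is zero on \<open>\<aa>/u\<aa>\<close>.\<close>

lemma comm_end_dependent:
 assumes \<aa>: "ideal \<aa> R" "\<aa> \<noteq> {\<zero>}" and rig: "Ext_vanishes R 1 (ideal_module R \<aa>) (ideal_module R \<aa>)"
  and n: "\<And>J. ideal J R ==> J \<noteq> {\<zero>} ==> \<exists>v. fiber_basis J n v"
  and \<phi>: "\<forall>i<Suc n. comm_end k (fiber \<aa>) (act \<aa> x) (act \<aa> y) (carrier (fiber \<aa>)) (\<phi> i)"
  and ind: "mindep k (fiber \<aa>) (carrier (fiber \<aa>)) (Suc n) \<phi>"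
 shows False
proof -
 let ?N = "scaled u \<aa>"
 note If = ideal_facts[OF \<aa>(1)]
 have "\<forall>i. \<exists>e. i < Suc n \<longrightarrow> linear_on R Rmod Rmod \<aa> e \<and> (\<forall>z\<in>\<aa>. e z \<in> \<aa> \<and> \<phi> i (?N +> z) = ?N +> e z)"
  using comm_end_lifts[OF \<aa>(1) rig] \<phi> by blast
 from choice[OF this] obtain e where e: "\<forall>i<Suc n. linear_on R Rmod Rmod \<aa> (e i)"
  "\<forall>i<Suc n. \<forall>z\<in>\<aa>. e i z \<in> \<aa> \<and> \<phi> i (?N +> z) = ?N +> e i z" by blast
 obtain a where a: "a \<in> \<aa>" "a \<noteq> \<zero>" using \<aa>(2) If(3) by blast
 define J where "J = {e a | e. linear_on R Rmod Rmod \<aa> e \<and> (\<forall>z\<in>\<aa>. e z \<in> \<aa>)}"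
 have J: "ideal J R" unfolding J_def by (rule evaluation_ideal[OF \<aa>(1) a(1)])
 have "linear_on R Rmod Rmod \<aa> (\<lambda>z. z)" using If(2) by (intro linear_onI) simp_all
 then have "a \<in> J" unfolding J_def by (intro CollectI exI[of _ "\<lambda>z. z"]) simp
 then have "J \<noteq> {\<zero>}" using a(2) by blast
 then obtain v where v: "fiber_basis J n v" using n[OF J] by blast
 have w: "\<forall>i<Suc n. e i a \<in> J"
 proof (intro allI impI)
  fix i assume "i < Suc n"
  then show "e i a \<in> J" unfolding J_def using e by (intro CollectI exI[of _ "e i"]) simp
 qed
 obtain t where t: "\<forall>i<Suc n. t i \<in> C" "\<exists>i<Suc n. t i \<notin> U" "lc Rmod (Suc n) t (\<lambda>i. e i a) \<in> scaled u J"
  using fiber_basis_dependent[OF J v w] by blast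
 have tc: "\<forall>i<Suc n. t i \<in> carrier R" using t(1) C_carrier by blast
 define f where "f z = lc Rmod (Suc n) t (\<lambda>i. e i z)" for z
 have f: "linear_on R Rmod Rmod \<aa> f" unfolding f_def by (rule lc_linear_on[OF \<aa>(1) tc e(1)])
 obtain j where j: "j \<in> J" "f a = u \<otimes> j" using scaledE[OF t(3)] unfolding f_def by blast
 obtain h where h: "j = h a" "linear_on R Rmod Rmod \<aa> h" "\<forall>z\<in>\<aa>. h z \<in> \<aa>" using j(1) unfolding J_def by blast
 have fN: "f z \<in> ?N" if z: "z \<in> \<aa>" for z
 proof -
  have c: "a \<in> carrier R" "z \<in> carrier R" "h a \<in> carrier R" "h z \<in> carrier R" "f z \<in> carrier R"
   using If(2) h(3) a(1) z linear_onD(1)[OF f z] by auto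
  have "a \<otimes> f z = z \<otimes> (u \<otimes> h a)" using linear_on_exchange[OF \<aa>(1) f a(1) z] j(2) h(1) by simp
  also have "\<dots> = u \<otimes> (z \<otimes> h a)" using c u_carrier by (simp add: m_lcomm)
  also have "\<dots> = u \<otimes> (a \<otimes> h z)" using linear_on_exchange[OF \<aa>(1) h(2) a(1) z] by simp
  also have "\<dots> = a \<otimes> (u \<otimes> h z)" using c u_carrier by (simp add: m_lcomm)
  finally have "f z = u \<otimes> h z" using cancel_left[OF c(1) a(2) c(5)] c(4) u_carrier by simp
  then show ?thesis using scaledI h(3) z by simp
 qed
 have "t i \<in> U" if i: "i < Suc n" for i
 proof -
  have "U +> t i = \<zero>\<^bsub>k\<^esub>"
  proof (rule mindepD[OF ind _ _ i])
   show "U +> t i \<in> carrier k" if "i < Suc n" for i using t(1) that C_K k_ops(5) by blast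
   fix A assume "A \<in> carrier (fiber \<aa>)"
   then obtain z where z: "z \<in> \<aa>" "A = ?N +> z" unfolding fiber_carrier by blast
   have ez: "\<forall>i<Suc n. e i z \<in> \<aa>" using e(2) z(1) by blast
   have "lc (fiber \<aa>) (Suc n) (\<lambda>i. U +> t i) (\<lambda>i. \<phi> i A) = lc (fiber \<aa>) (Suc n) (\<lambda>i. U +> t i) (\<lambda>i. ?N +> e i z)"
    by (rule lc_cong) (use e(2) z in auto)
   also have "\<dots> = ?N +> f z" unfolding f_def by (rule lc_fiber[OF \<aa>(1) tc ez])
   also have "\<dots> = \<zero>\<^bsub>fiber \<aa>\<^esub>"
    using fiber_coset_zero[OF \<aa>(1) lc_ideal[OF \<aa>(1) tc ez]] fN[OF z(1)] unfolding f_def by simp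
   finally show "lc (fiber \<aa>) (Suc n) (\<lambda>i. U +> t i) (\<lambda>i. \<phi> i A) = \<zero>\<^bsub>fiber \<aa>\<^esub>" .
  qed
  then show ?thesis using coset_U tc i unfolding k_ops by simp
 qed
 then show False using t(2) by blast
qed

lemma mult_pow: "r \<in> \<mm> ==> r [^] n \<in> mpow n" for n :: nat
proof (induction n)
 case (Suc n)
 have "r \<otimes> r [^] n \<in> mpow (Suc n)" unfolding mpow.simps by (rule ideal_prod.prod[OF Suc.prems Suc.IH[OF Suc.prems]])
 then show ?case using ideal_facts(2)[OF mm_ideal Suc.prems] by (simp add: m_comm)
qed simp

lemma unit_of_C: "t \<in> C ==> t \<notin> U ==> t \<in> Units R"
 using nonunit_in_mm C_carrier C_inter_mm by blast

lemma act_pow_vanish: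
 assumes \<aa>: "ideal \<aa> R" and r: "r \<in> \<mm>"
 shows "\<exists>p. \<forall>A\<in>carrier (fiber \<aa>). (act \<aa> r ^^ p) A = \<zero>\<^bsub>fiber \<aa>\<^esub>"
proof -
 have rc: "r \<in> carrier R" by (rule ideal_facts(2)[OF mm_ideal r])
 obtain N where N: "mpow N \<subseteq> U" using mpow_in_ideal[OF U_ideal U_nonzero] by blast
 have pow: "(act \<aa> r ^^ p) (scaled u \<aa> +> z) = scaled u \<aa> +> (r [^] p \<otimes> z)" if z: "z \<in> \<aa>" for p z
 proof (induction p)
  case 0
  show ?case using ideal_facts(2)[OF \<aa> z] by simp
 next
  case (Suc p)
  have "r \<otimes> (r [^] p \<otimes> z) = r [^] Suc p \<otimes> z" using rc ideal_facts(2)[OF \<aa> z] by (simp add: m_ac)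
  then show ?case using Suc fiber_smult[OF \<aa> rc ideal_facts(5)[OF \<aa> z, of "r [^] p"]] rc by simp
 qed
 have "(act \<aa> r ^^ N) A = \<zero>\<^bsub>fiber \<aa>\<^esub>" if A: "A \<in> carrier (fiber \<aa>)" for A
 proof -
  obtain z where z: "z \<in> \<aa>" "A = scaled u \<aa> +> z" using A unfolding fiber_carrier by blast
  have rU: "r [^] N \<in> U" using mult_pow[OF r] N by blast
  show ?thesis unfolding z(2) pow[OF z(1)]
   using fiber_coset_zero[OF \<aa> ideal_facts(5)[OF \<aa> z(1), of "r [^] N"]] fiber_prod[OF \<aa> rU z(1)] rc by simp
 qed
 then show ?thesis by blast
qed

text \<open>The algebra generated by \<open>x\<close> and \<open>y\<close> contains \<open>n\<close> independent operators, all given by elements of \<open>R/uR\<close>. An annihilator \<open>r\<close> outside \<open>uR\<close> would be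
independent of these and give \<open>n + 1\<close> independent elements of \<open>R/uR\<close>.\<close>

lemma fiber_faithful:
 assumes \<aa>: "ideal \<aa> R" "\<aa> \<noteq> {\<zero>}" and rig: "Ext_vanishes R 1 (ideal_module R \<aa>) (ideal_module R \<aa>)"
  and n: "\<And>J. ideal J R ==> J \<noteq> {\<zero>} ==> \<exists>v. fiber_basis J n v"
  and r: "r \<in> carrier R" "\<And>z. z \<in> \<aa> ==> r \<otimes> z \<in> scaled u \<aa>"
 shows "r \<in> U"
proof -
 let ?N = "scaled u \<aa>"
 note If = ideal_facts[OF \<aa>(1)] and Nf = ideal_facts[OF scaled_ideal[OF \<aa>(1) u_carrier]]
 interpret cp: commuting_pair k "fiber \<aa>" "act \<aa> x" "act \<aa> y" by (rule act_commuting_pair[OF \<aa>(1)])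
 have st: "cp.stable (carrier (fiber \<aa>))"
  unfolding cp.stable_def using cp.submodule_carrier act_closed[OF \<aa>(1)] x_carrier y_carrier by blast
 obtain v where v: "fiber_basis \<aa> n v" using n[OF \<aa>] by blast
 have vb: "rel_basis k (fiber \<aa>) (carrier (fiber \<aa>)) {\<zero>\<^bsub>fiber \<aa>\<^esub>} n (\<lambda>i. ?N +> v i)"
  using fiber_basis_iff[OF \<aa>(1)] fiber_basisD(1)[OF v] v by blast
 obtain p where p: "\<forall>A\<in>carrier (fiber \<aa>). (act \<aa> x ^^ p) A = \<zero>\<^bsub>fiber \<aa>\<^esub>" using act_pow_vanish[OF \<aa>(1) x_mm] by blast
 obtain q where q: "\<forall>A\<in>carrier (fiber \<aa>). (act \<aa> y ^^ q) A = \<zero>\<^bsub>fiber \<aa>\<^esub>" using act_pow_vanish[OF \<aa>(1) y_mm] by blast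
 have "\<exists>\<rho>. (\<forall>i<n. \<rho> i \<in> cp.alg) \<and> mindep k (fiber \<aa>) (carrier (fiber \<aa>)) n \<rho>"
 proof (rule cp.alg_indep[OF st vb])
  show "(act \<aa> x ^^ p) A = \<zero>\<^bsub>fiber \<aa>\<^esub>" if "A \<in> carrier (fiber \<aa>)" for A using p that by blast
  show "(act \<aa> y ^^ q) A = \<zero>\<^bsub>fiber \<aa>\<^esub>" if "A \<in> carrier (fiber \<aa>)" for A using q that by blast
  show False if "\<forall>i<Suc n. comm_end k (fiber \<aa>) (act \<aa> x) (act \<aa> y) (carrier (fiber \<aa>)) (\<phi> i)"
   "mindep k (fiber \<aa>) (carrier (fiber \<aa>)) (Suc n) \<phi>" for \<phi>
   by (rule comm_end_dependent[OF \<aa> rig _ that]) (rule n)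
 qed
 then obtain \<rho> where \<rho>: "\<forall>i<n. \<rho> i \<in> cp.alg" "mindep k (fiber \<aa>) (carrier (fiber \<aa>)) n \<rho>" by blast
 have "\<forall>i. \<exists>s. i < n \<longrightarrow> s \<in> carrier R \<and> (\<forall>A\<in>carrier (fiber \<aa>). \<rho> i A = act \<aa> s A)"
  using alg_is_act[OF \<aa>(1)] \<rho>(1) by blast
 from choice[OF this] obtain s where s: "\<forall>i<n. s i \<in> carrier R" "\<forall>i<n. \<forall>A\<in>carrier (fiber \<aa>). \<rho> i A = act \<aa> (s i) A" by blast
 obtain w where w: "fiber_basis (carrier R) n w" using n[OF oneideal] one_not_zero one_closed by blast
 have "\<forall>i<Suc n. (s(n := r)) i \<in> carrier R" using s(1) r(1) by (simp add: less_Suc_eq)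
 from fiber_basis_dependent[OF oneideal w this] obtain t where t: "\<forall>i<Suc n. t i \<in> C" "\<exists>i<Suc n. t i \<notin> U"
  "lc Rmod (Suc n) t (s(n := r)) \<in> U" unfolding U_scaled by blast
 have tc: "\<forall>i<n. t i \<in> carrier R" "t n \<in> carrier R" using t(1) C_carrier by auto
 have "lc Rmod n t (s(n := r)) = lc Rmod n t s" by (rule lc_cong) auto
 then have rel: "lc Rmod n t s \<oplus> t n \<otimes> r \<in> U" using t(3) by simp
 have sR: "lc Rmod n t s \<in> carrier R" by (rule lc_ideal[OF oneideal tc(1) s(1)])
 have lcz: "lc Rmod m t (\<lambda>i. s i \<otimes> z) = lc Rmod m t s \<otimes> z" if z: "z \<in> \<aa>" and m: "m \<le> n" for z m
  using m
 proof (induction m)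
  case 0
  show ?case using If(2)[OF z] by simp
 next
  case (Suc m)
  have "lc Rmod m t s \<in> carrier R" by (rule lc_ideal[OF oneideal]) (use tc s Suc.prems in auto)
  then show ?case using Suc If(2)[OF z] tc(1) s(1) by (simp add: l_distr m_assoc)
 qed
 have tU: "t i \<in> U" if i: "i < n" for i
 proof -
  have "U +> t i = \<zero>\<^bsub>k\<^esub>"
  proof (rule mindepD[OF \<rho>(2) _ _ i])
   show "U +> t i \<in> carrier k" if "i < n" for i using t(1) that C_K k_ops(5) by (metis less_SucI)
   fix A assume A: "A \<in> carrier (fiber \<aa>)"
   then obtain z where z: "z \<in> \<aa>" "A = ?N +> z" unfolding fiber_carrier by blast
   have zc: "z \<in> carrier R" by (rule If(2)[OF z(1)])
   have sz: "\<forall>i<n. s i \<otimes> z \<in> \<aa>" using s(1) If(5)[OF z(1)] by blast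
   have "lc (fiber \<aa>) n (\<lambda>i. U +> t i) (\<lambda>i. \<rho> i A) = lc (fiber \<aa>) n (\<lambda>i. U +> t i) (\<lambda>i. ?N +> (s i \<otimes> z))"
    by (rule lc_cong) (use s A z fiber_smult[OF \<aa>(1) _ z(1)] in auto)
   also have "\<dots> = ?N +> (lc Rmod n t s \<otimes> z)"
    using lc_fiber[OF \<aa>(1) tc(1) sz] lcz[OF z(1)] by simp
   also have "\<dots> = \<zero>\<^bsub>fiber \<aa>\<^esub>"
   proof -
    have "lc Rmod n t s \<otimes> z = (lc Rmod n t s \<oplus> t n \<otimes> r) \<otimes> z \<ominus> t n \<otimes> (r \<otimes> z)"
     using sR tc(2) r(1) zc by algebra
    also have "\<dots> \<in> ?N" by (rule Nf(8)[OF fiber_prod[OF \<aa>(1) rel z(1)] Nf(5)[OF r(2)[OF z(1)] tc(2)]])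
    finally show ?thesis using fiber_coset_zero[OF \<aa>(1) If(5)[OF z(1) sR]] by simp
   qed
   finally show "lc (fiber \<aa>) n (\<lambda>i. U +> t i) (\<lambda>i. \<rho> i A) = \<zero>\<^bsub>fiber \<aa>\<^esub>" .
  qed
  then show ?thesis using coset_U tc i unfolding k_ops by simp
 qed
 then have "t n \<notin> U" using t(2) by (auto simp: less_Suc_eq)
 then have tn: "t n \<in> Units R" using unit_of_C t(1) by blast
 have "lc Rmod n t s \<in> U"
 proof -
  have "lc Rmod m t s \<in> U" if "m \<le> n" for m
   using that
  proof (induction m)
   case 0
   show ?case using ideal_facts(3)[OF U_ideal] by simp
  next
   case (Suc m)
   then show ?case using tU s(1) ideal_facts(4,6)[OF U_ideal] by simp
  qed
  then show ?thesis by simp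
 qed
 then have "(lc Rmod n t s \<oplus> t n \<otimes> r) \<ominus> lc Rmod n t s \<in> U" using ideal_facts(8)[OF U_ideal rel] by blast
 moreover have "(lc Rmod n t s \<oplus> t n \<otimes> r) \<ominus> lc Rmod n t s = t n \<otimes> r" using sR tc(2) r(1) by algebra
 ultimately have tr: "t n \<otimes> r \<in> U" by simp
 have "inv (t n) \<otimes> (t n \<otimes> r) \<in> U" by (rule ideal_facts(5)[OF U_ideal tr]) (use tn in simp)
 then show ?thesis using tn r(1) tc(2) by (simp add: m_assoc[symmetric])
qed

text \<open>Nakayama's lemma: \<open>\<aa> = Ra + u\<^sup>m\<aa>\<close> for all \<open>m\<close>, and \<open>u\<^sup>m\<close> eventually lies in \<open>Ra\<close>.\<close>

lemma mod_u_generates: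
 assumes \<aa>: "ideal \<aa> R" and a: "a \<in> \<aa>" "a \<noteq> \<zero>" and gen: "\<And>p. p \<in> \<aa> ==> \<exists>r\<in>carrier R. p \<ominus> r \<otimes> a \<in> scaled u \<aa>"
 shows "\<aa> = PIdl a"
proof
 note If = ideal_facts[OF \<aa>]
 show "PIdl a \<subseteq> \<aa>" by (rule cgenideal_minimal[OF \<aa> a(1)])
 have ac: "a \<in> carrier R" by (rule If(2)[OF a(1)])
 have P: "ideal (PIdl a) R" by (rule cgenideal_ideal[OF ac])
 have "PIdl a \<noteq> {\<zero>}" using cgenideal_self[OF ac] a(2) by blast
 then obtain N where N: "mpow N \<subseteq> PIdl a" using mpow_in_ideal[OF P] by blast
 have "\<exists>q\<in>\<aa>. p \<ominus> u [^] m \<otimes> q \<in> PIdl a" if p: "p \<in> \<aa>" for p and m :: nat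
 proof (induction m)
  case 0
  show ?case using p If(2)[OF p] ideal_facts(3)[OF P] by (intro bexI[of _ p]) (simp_all add: a_minus_def r_neg)
 next
  case (Suc m)
  then obtain q where q: "q \<in> \<aa>" "p \<ominus> u [^] m \<otimes> q \<in> PIdl a" by blast
  obtain r where r: "r \<in> carrier R" "q \<ominus> r \<otimes> a \<in> scaled u \<aa>" using gen[OF q(1)] by blast
  obtain q' where q': "q' \<in> \<aa>" "q \<ominus> r \<otimes> a = u \<otimes> q'" using scaledE[OF r(2)] by blast
  have c: "p \<in> carrier R" "q \<in> carrier R" "q' \<in> carrier R" "u [^] m \<in> carrier R"
   using If(2) p q(1) q'(1) u_carrier by auto
  have qe: "q = r \<otimes> a \<oplus> u \<otimes> q'" unfolding q'(2)[symmetric] using c r(1) ac by algebra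
  have "p \<ominus> u [^] Suc m \<otimes> q' = (p \<ominus> u [^] m \<otimes> q) \<oplus> (u [^] m \<otimes> r) \<otimes> a"
   unfolding nat_pow_Suc qe using c r(1) ac u_carrier by algebra
  also have "\<dots> \<in> PIdl a"
   using ideal_facts(4)[OF P q(2) ideal_facts(5)[OF P cgenideal_self[OF ac]]] c(4) r(1) by simp
  finally show ?case using q'(1) by blast
 qed
 then have "\<exists>q\<in>\<aa>. p \<ominus> u [^] N \<otimes> q \<in> PIdl a" if "p \<in> \<aa>" for p using that by blast
 then show "\<aa> \<subseteq> PIdl a"
 proof (intro subsetI)
  fix p assume p: "p \<in> \<aa>" and "\<And>p. p \<in> \<aa> ==> \<exists>q\<in>\<aa>. p \<ominus> u [^] N \<otimes> q \<in> PIdl a"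
  then obtain q where q: "q \<in> \<aa>" "p \<ominus> u [^] N \<otimes> q \<in> PIdl a" by blast
  have c: "p \<in> carrier R" "q \<in> carrier R" "u [^] N \<in> carrier R" using If(2) p q(1) u_carrier by auto
  have "u [^] N \<in> PIdl a" using mult_pow[OF u_mm] N by blast
  then have "u [^] N \<otimes> q \<in> PIdl a" using ideal_facts(6)[OF P] c(2) by blast
  then have "(p \<ominus> u [^] N \<otimes> q) \<oplus> u [^] N \<otimes> q \<in> PIdl a" using ideal_facts(4)[OF P q(2)] by blast
  moreover have "(p \<ominus> u [^] N \<otimes> q) \<oplus> u [^] N \<otimes> q = p" using c by algebra
  ultimately show "p \<in> PIdl a" by simp
 qed
qed

text \<open>A socle generator \<open>s\<close> does not kill the fibre of \<open>\<aa>\<close>; take \<open>a\<close> with \<open>s a \<notin> u\<aa>\<close>. If \<open>r \<notin> uR\<close>, some multiple \<open>c r\<close> lies in the socle modulo \<open>u\<close> and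
is proportional to \<open>s\<close>, so \<open>r a \<notin> u\<aa>\<close>. Hence \<open>R/uR\<close> embeds in the fibre, which has the same dimension.\<close>

lemma rigid_principal:
 assumes gor: "finite_injdim R Rmod" and \<aa>: "ideal \<aa> R" "\<aa> \<noteq> {\<zero>}"
  and rig: "Ext_vanishes R 1 (ideal_module R \<aa>) (ideal_module R \<aa>)"
 shows "\<exists>a\<in>\<aa>. \<aa> = PIdl a"
proof -
 let ?N = "scaled u \<aa>"
 note If = ideal_facts[OF \<aa>(1)] and N = scaled_ideal[OF \<aa>(1) u_carrier]
 note Nf = ideal_facts[OF N] and Uf = ideal_facts[OF U_ideal]
 obtain n where n: "\<And>J. ideal J R ==> J \<noteq> {\<zero>} ==> \<exists>v. fiber_basis J n v" using fiber_dimension by blast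
 have U1: "\<one> \<notin> U" using U_mm mm_proper by blast
 obtain s where s: "s \<in> carrier R" "s \<notin> U" "\<And>m. m \<in> \<mm> ==> m \<otimes> s \<in> U"
  using socle_element_exists[OF U_ideal U_nonzero U1] by blast
 have "\<exists>a\<in>\<aa>. s \<otimes> a \<notin> ?N"
 proof (rule ccontr)
  assume "\<not> ?thesis"
  then have "s \<in> U" using fiber_faithful[OF \<aa> rig n s(1)] by blast
  then show False using s(2) by simp
 qed
 then obtain a where a: "a \<in> \<aa>" "s \<otimes> a \<notin> ?N" by blast
 have ac: "a \<in> carrier R" by (rule If(2)[OF a(1)])
 have a0: "a \<noteq> \<zero>" using a(2) s(1) Nf(3) by auto
 obtain M where M: "mpow M \<subseteq> U" using mpow_in_ideal[OF U_ideal U_nonzero] by blast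
 have inj: "r \<in> U" if r: "r \<in> carrier R" "r \<otimes> a \<in> ?N" for r
 proof (rule ccontr)
  assume rU: "r \<notin> U"
  \<comment> \<open>The last power of \<open>\<mm>\<close> that does not carry \<open>r\<close> into \<open>uR\<close> supplies a multiple of \<open>r\<close> in the socle.\<close>
  define i where "i = (LEAST i. \<forall>c\<in>mpow i. c \<otimes> r \<in> U)"
  have ex: "\<forall>c\<in>mpow M. c \<otimes> r \<in> U" using M Uf(6) r(1) by blast
  have i: "\<forall>c\<in>mpow i. c \<otimes> r \<in> U" unfolding i_def by (rule LeastI[where P="\<lambda>i. \<forall>c\<in>mpow i. c \<otimes> r \<in> U", OF ex])
  have "i \<noteq> 0"
  proof
   assume "i = 0"
   then have "\<one> \<otimes> r \<in> U" using i by auto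
   then show False using rU r(1) by simp
  qed
  then obtain i' where i': "i = Suc i'" by (cases i) auto
  have "\<not> (\<forall>c\<in>mpow i'. c \<otimes> r \<in> U)"
   by (rule not_less_Least[where P="\<lambda>i. \<forall>c\<in>mpow i. c \<otimes> r \<in> U"]) (use i' i_def in simp)
  then obtain c where c: "c \<in> mpow i'" "c \<otimes> r \<notin> U" by blast
  have cc: "c \<in> carrier R" by (rule ideal_facts(2)[OF mpow_ideal c(1)])
  have ms: "m \<otimes> (c \<otimes> r) \<in> U" if m: "m \<in> \<mm>" for m
  proof -
   have "m \<otimes> c \<in> mpow i" unfolding i' mpow.simps using m c(1) by (rule ideal_prod.prod)
   then have "(m \<otimes> c) \<otimes> r \<in> U" using i by blast
   then show ?thesis using ideal_facts(2)[OF mm_ideal m] cc r(1) by (simp add: m_assoc)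
  qed
  have crR: "c \<otimes> r \<in> carrier R" using cc r(1) by simp
  have "\<exists>t\<in>carrier R. s \<ominus> t \<otimes> (c \<otimes> r) \<in> U"
   by (rule simple_socle[OF gor u_mm u_nonzero crR c(2) s(1)]) (fact s(3))
  then obtain t where t: "t \<in> carrier R" "s \<ominus> t \<otimes> (c \<otimes> r) \<in> U" by blast
  have "s \<otimes> a = (s \<ominus> t \<otimes> (c \<otimes> r)) \<otimes> a \<oplus> (t \<otimes> c) \<otimes> (r \<otimes> a)" using s(1) t(1) cc r(1) ac by algebra
  also have "\<dots> \<in> ?N" using Nf(4)[OF fiber_prod[OF \<aa>(1) t(2) a(1)] Nf(5)[OF r(2)]] t(1) cc by simp
  finally show False using a(2) by simp
 qed
 obtain v where v: "fiber_basis (carrier R) n v" using n[OF oneideal] one_not_zero one_closed by blast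
 obtain w where w: "fiber_basis \<aa> n w" using n[OF \<aa>] by blast
 have vc: "\<forall>i<n. v i \<in> carrier R" using fiber_basisD(1)[OF v] by blast
 have "\<exists>r\<in>carrier R. p \<ominus> r \<otimes> a \<in> ?N" if p: "p \<in> \<aa>" for p
 proof -
  define z where "z i = (if i < n then v i \<otimes> a else p)" for i
  have "\<forall>i<Suc n. z i \<in> \<aa>" unfolding z_def using vc If(5)[OF a(1)] p by simp
  from fiber_basis_dependent[OF \<aa>(1) w this] obtain t where t: "\<forall>i<Suc n. t i \<in> C" "\<exists>i<Suc n. t i \<notin> U"
   "lc Rmod (Suc n) t z \<in> ?N" by blast
  have tc: "\<forall>i<n. t i \<in> carrier R" "t n \<in> carrier R" using t(1) C_carrier by auto
  have lv: "lc Rmod n t v \<in> carrier R" by (rule lc_ideal[OF oneideal tc(1) vc])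
  have pc: "p \<in> carrier R" by (rule If(2)[OF p])
  have "lc Rmod m t z = lc Rmod m t v \<otimes> a" if "m \<le> n" for m
   using that
  proof (induction m)
   case 0
   show ?case using ac by simp
  next
   case (Suc m)
   have "lc Rmod m t v \<in> carrier R" by (rule lc_ideal[OF oneideal]) (use tc vc Suc.prems in auto)
   then show ?case using Suc ac tc(1) vc by (simp add: z_def l_distr m_assoc)
  qed
  then have rel: "lc Rmod n t v \<otimes> a \<oplus> t n \<otimes> p \<in> ?N" using t(3) by (simp add: z_def)
  have "t n \<notin> U"
  proof
   assume tn: "t n \<in> U"
   have "(lc Rmod n t v \<otimes> a \<oplus> t n \<otimes> p) \<ominus> t n \<otimes> p \<in> ?N" by (rule Nf(8)[OF rel fiber_prod[OF \<aa>(1) tn p]])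
   moreover have "(lc Rmod n t v \<otimes> a \<oplus> t n \<otimes> p) \<ominus> t n \<otimes> p = lc Rmod n t v \<otimes> a" using lv ac tc(2) pc by algebra
   ultimately have "lc Rmod n t v \<in> scaled u (carrier R)" using inj[OF lv] U_scaled by simp
   then have "\<forall>i<n. t i \<in> U" using fiber_basisD(3)[OF v] t(1) by simp
   then show False using t(2) tn by (auto simp: less_Suc_eq)
  qed
  then have tn: "t n \<in> Units R" using unit_of_C t(1) by blast
  define r where "r = \<ominus> (inv (t n) \<otimes> lc Rmod n t v)"
  have ic: "inv (t n) \<in> carrier R" "inv (t n) \<otimes> t n = \<one>" using tn by simp_all
  have rc: "r \<in> carrier R" unfolding r_def using ic lv by simp
  have "inv (t n) \<otimes> (lc Rmod n t v \<otimes> a \<oplus> t n \<otimes> p) = (inv (t n) \<otimes> t n) \<otimes> p \<ominus> r \<otimes> a"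
   unfolding r_def using ic(1) lv ac tc(2) pc by algebra
  also have "\<dots> = p \<ominus> r \<otimes> a" unfolding ic(2) using pc by simp
  finally show ?thesis using Nf(5)[OF rel ic(1)] rc by auto
 qed
 then have "\<aa> = PIdl a" using mod_u_generates[OF \<aa>(1) a(1) a0] by blast
 then show ?thesis using a(1) by blast
qed

end

section \<open>Three generators of the maximal ideal, and the conclusion\<close>

context vectorspace
begin

text \<open>Links dimension as the least size of a spanning set to bases given as families.\<close>

lemma small_basis:
 assumes A: "finite A" "A \<subseteq> carrier V" "gen_set A"
 shows "\<exists>n v. n \<le> card A \<and> rel_basis K V (carrier V) {\<zero>\<^bsub>V\<^esub>} n v"
proof -
 define m where "m = card A"
 obtain f where "bij_betw f {0..<card A} A" using ex_bij_betw_nat_finite[OF A(1)] by blast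
 then have f: "f ` {..<m} = A" unfolding m_def bij_betw_def by (simp add: atLeast0LessThan)
 have fc: "\<forall>i<m. f i \<in> carrier V" using f A(2) by blast
 define L where "L = {lc V m a f | a. \<forall>i<m. a i \<in> carrier K}"
 have LI: "lc V m a f \<in> L" if "\<forall>i<m. a i \<in> carrier K" for a unfolding L_def using that by blast
 have "submodule K L V"
 proof (unfold_locales)
  show "L \<subseteq> carrier V" unfolding L_def using lc_closed fc by blast
  show "\<zero>\<^bsub>V\<^esub> \<in> L" using LI[of "\<lambda>_. \<zero>\<^bsub>K\<^esub>"] lc_coeff_zero[of m "\<lambda>_. \<zero>\<^bsub>K\<^esub>" f] fc by simp
  show "v \<oplus>\<^bsub>V\<^esub> w \<in> L" if h: "v \<in> L" "w \<in> L" for v w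
  proof -
   obtain a where a: "\<forall>i<m. a i \<in> carrier K" "v = lc V m a f" using h(1) unfolding L_def by blast
   obtain b where b: "\<forall>i<m. b i \<in> carrier K" "w = lc V m b f" using h(2) unfolding L_def by blast
   show ?thesis using LI[of "\<lambda>i. a i \<oplus>\<^bsub>K\<^esub> b i"] lc_coeff_add[OF a(1) b(1) fc] a b by simp
  qed
  show "c \<odot>\<^bsub>V\<^esub> v \<in> L" if h: "c \<in> carrier K" "v \<in> L" for c v
  proof -
   obtain a where a: "\<forall>i<m. a i \<in> carrier K" "v = lc V m a f" using h(2) unfolding L_def by blast
   show ?thesis using LI[of "\<lambda>i. c \<otimes>\<^bsub>K\<^esub> a i"] lc_coeff_smult[OF a(1) h(1) fc] a h by simp
  qed
 qed
 moreover have "A \<subseteq> L"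
 proof
  fix v assume "v \<in> A"
  then obtain j where j: "j < m" "v = f j" using f by blast
  have "lc V m (\<lambda>i. if i = j then \<one>\<^bsub>K\<^esub> else \<zero>\<^bsub>K\<^esub>) f = v"
   using lc_delta[OF j(1) R.one_closed fc] fc j by simp
  then show "v \<in> L" using LI[of "\<lambda>i. if i = j then \<one>\<^bsub>K\<^esub> else \<zero>\<^bsub>K\<^esub>"] by simp
 qed
 ultimately have "carrier V \<subseteq> L" using span_is_subset[of A L] A(3) by simp
 then have sp: "\<exists>a. (\<forall>i<m. a i \<in> carrier K) \<and> w \<ominus>\<^bsub>V\<^esub> lc V m a f \<in> {\<zero>\<^bsub>V\<^esub>}" if w: "w \<in> carrier V" for w
 proof -
  obtain a where a: "\<forall>i<m. a i \<in> carrier K" "w = lc V m a f" using \<open>carrier V \<subseteq> L\<close> w unfolding L_def by blast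
  then show ?thesis using w by (intro exI[of _ a]) (simp add: a_minus_def M.r_neg)
 qed
 have bound: "l \<le> m" if w: "\<forall>i<l. w i \<in> carrier V" "rel_indep K V {\<zero>\<^bsub>V\<^esub>} l w" for l w
  by (rule indep_le_spanning[OF submodule_zero fc _ w]) (use sp w(1) in blast)
 obtain n v where v: "rel_basis K V (carrier V) {\<zero>\<^bsub>V\<^esub>} n v"
 proof -
  have "\<exists>n v. rel_basis K V (carrier V) {\<zero>\<^bsub>V\<^esub>} n v"
   by (rule rel_basis_exists[OF submodule_zero submodule_carrier]) (rule bound)
  then show thesis using that by blast
 qed
 have nv: "\<forall>i<n. v i \<in> carrier V" using rel_basisD(1)[OF v] by blast
 have "n \<le> m" by (rule bound[OF nv rel_basisD(2)[OF v]])
 then show ?thesis using v unfolding m_def by blast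
qed

end

context one_dim_domain
begin

text \<open>Finiteness of the cotangent space: peel off composition factors of \<open>\<mm>/J\<close>.\<close>

lemma mm_finite_modulo:
 assumes "ideal J R" "J \<noteq> {\<zero>}"
 shows "J \<subseteq> \<mm> \<longrightarrow> (\<exists>n w. (\<forall>i<n. w i \<in> \<mm>) \<and> (\<forall>p\<in>\<mm>. \<exists>r. (\<forall>i<n. r i \<in> carrier R) \<and> p \<ominus> lc Rmod n r w \<in> J))"
 using assms
proof (induction J rule: descent)
 case top
 show ?case using mm_proper one_closed by blast
next
 case (step J b)
 note Jf = ideal_facts[OF step(1)] and mf = ideal_facts[OF mm_ideal]
 show ?case
 proof (intro impI)
  assume J: "J \<subseteq> \<mm>"
  show "\<exists>n w. (\<forall>i<n. w i \<in> \<mm>) \<and> (\<forall>p\<in>\<mm>. \<exists>r. (\<forall>i<n. r i \<in> carrier R) \<and> p \<ominus> lc Rmod n r w \<in> J)"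
  proof (cases "b \<in> \<mm>")
   case True
   have "adjoin J b \<subseteq> \<mm>" unfolding adjoin_def using J mf(4) mf(5)[OF True] by blast
   then obtain n w where w: "\<forall>i<n. w i \<in> \<mm>"
    "\<And>p. p \<in> \<mm> ==> \<exists>r. (\<forall>i<n. r i \<in> carrier R) \<and> p \<ominus> lc Rmod n r w \<in> adjoin J b" using step(7) by blast
   show ?thesis
   proof (rule exI[of _ "Suc n"], rule exI[of _ "w(n := b)"], intro conjI ballI)
    show "\<forall>i<Suc n. (w(n := b)) i \<in> \<mm>" using w(1) True by (simp add: less_Suc_eq)
    fix p assume p: "p \<in> \<mm>"
    obtain r where r: "\<forall>i<n. r i \<in> carrier R" "p \<ominus> lc Rmod n r w \<in> adjoin J b" using w(2)[OF p] by blast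
    obtain j s where j: "j \<in> J" "s \<in> carrier R" "p \<ominus> lc Rmod n r w = j \<oplus> s \<otimes> b" using r(2) unfolding adjoin_def by blast
    have lw: "lc Rmod n r w \<in> carrier R" by (rule mf(2)[OF lc_ideal[OF mm_ideal r(1) w(1)]])
    have e: "lc Rmod n (r(n := s)) (w(n := b)) = lc Rmod n r w" by (rule lc_cong) auto
    have "p \<ominus> lc Rmod (Suc n) (r(n := s)) (w(n := b)) = (p \<ominus> lc Rmod n r w) \<ominus> s \<otimes> b"
     unfolding lc.simps e using mf(2)[OF p] lw step(4) j(2) by (simp add: a_minus_def minus_add a_ac)
    also have "\<dots> = j" unfolding j(3) using Jf(2)[OF j(1)] j(2) step(4) by (simp add: a_minus_def a_assoc r_neg)
    finally have "p \<ominus> lc Rmod (Suc n) (r(n := s)) (w(n := b)) \<in> J" using j(1) by simp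
    then show "\<exists>r. (\<forall>i<Suc n. r i \<in> carrier R) \<and> p \<ominus> lc Rmod (Suc n) r (w(n := b)) \<in> J"
     using r(1) j(2) by (intro exI[of _ "r(n := s)"]) (simp add: less_Suc_eq)
   qed
  next
   case False
   then have bu: "b \<in> Units R" using nonunit_in_mm step(4) by blast
   have "p \<in> J" if p: "p \<in> \<mm>" for p
   proof -
    have pb: "p \<otimes> b \<in> J" by (rule step(6)[OF p])
    have "(p \<otimes> b) \<otimes> inv b \<in> J" by (rule Jf(6)[OF pb]) (use bu in simp)
    then show ?thesis using bu mf(2)[OF p] step(4) by (simp add: m_assoc)
   qed
   then have "\<forall>p\<in>\<mm>. \<exists>r. (\<forall>i<0. r i \<in> carrier R) \<and> p \<ominus> lc Rmod 0 r (\<lambda>_. \<zero>) \<in> J"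
    using mf(2) by (simp add: a_minus_def)
   then show ?thesis by (intro exI[of _ 0] exI[of _ "\<lambda>_. \<zero>"]) simp
  qed
 qed
qed

text \<open>Nakayama's lemma, in the form \<open>\<mm> \<subseteq> G + \<mm>\<^sup>n\<close> for all \<open>n\<close>.\<close>

lemma generates_of_mod_square:
 assumes G: "ideal G R" "G \<noteq> {\<zero>}" and gen: "\<And>p. p \<in> \<mm> ==> \<exists>g\<in>G. p \<ominus> g \<in> ideal_prod R \<mm> \<mm>"
 shows "\<mm> \<subseteq> G"
proof -
 note Gf = ideal_facts[OF G(1)] and mf = ideal_facts[OF mm_ideal]
 have add: "p \<in> set_add R G H \<longleftrightarrow> (\<exists>g\<in>G. \<exists>h\<in>H. p = g \<oplus> h)" for p H unfolding set_add_def' by blast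
 have step: "\<mm> \<subseteq> set_add R G (mpow n)" for n
 proof (induction n)
  case 0
  show ?case
  proof
   fix p assume "p \<in> \<mm>"
   then have "p \<in> carrier R" by (rule mf(2))
   then show "p \<in> set_add R G (mpow 0)" unfolding add using Gf(3) by (intro bexI[of _ \<zero>] bexI[of _ p]) simp_all
  qed
 next
  case (Suc n)
  let ?H = "set_add R G (mpow (Suc n))"
  have H: "ideal ?H R" by (rule add_ideals[OF G(1) mpow_ideal])
  have GH: "g \<in> ?H" if g: "g \<in> G" for g
   unfolding add
   by (rule bexI[of _ g], rule bexI[of _ \<zero>]) (use g Gf(2)[OF g] ideal_facts(3)[OF mpow_ideal, of "Suc n"] in simp_all)
  have "ideal_prod R \<mm> \<mm> \<subseteq> ?H"
  proof (rule ideal_prod_least[OF H])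
   fix a b assume a: "a \<in> \<mm>" and b: "b \<in> \<mm>"
   have ac: "a \<in> carrier R" by (rule mf(2)[OF a])
   have "b \<in> set_add R G (mpow n)" using Suc b by blast
   then obtain g h where g: "g \<in> G" and h: "h \<in> mpow n" and bgh: "b = g \<oplus> h" unfolding add by blast
   have "a \<otimes> h \<in> mpow (Suc n)" unfolding mpow.simps by (rule ideal_prod.prod[OF a h])
   moreover have "a \<otimes> b = a \<otimes> g \<oplus> a \<otimes> h" unfolding bgh using ac Gf(2)[OF g] ideal_facts(2)[OF mpow_ideal h] by (simp add: r_distr)
   ultimately show "a \<otimes> b \<in> ?H" unfolding add using Gf(5)[OF g ac] by blast
  qed
  show ?case
  proof
   fix p assume p: "p \<in> \<mm>"
   obtain g where g: "g \<in> G" "p \<ominus> g \<in> ideal_prod R \<mm> \<mm>" using gen[OF p] by blast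
   have "g \<oplus> (p \<ominus> g) \<in> ?H" using ideal_facts(4)[OF H GH[OF g(1)]] g(2) \<open>ideal_prod R \<mm> \<mm> \<subseteq> ?H\<close> by blast
   moreover have "g \<oplus> (p \<ominus> g) = p" using mf(2)[OF p] Gf(2)[OF g(1)] by algebra
   ultimately show "p \<in> ?H" by simp
  qed
 qed
 obtain n where n: "mpow n \<subseteq> G" using mpow_in_ideal[OF G] by blast
 show ?thesis
 proof
  fix p assume "p \<in> \<mm>"
  then have "p \<in> set_add R G (mpow n)" using step[of n] by blast
  then obtain g h where "g \<in> G" "h \<in> mpow n" "p = g \<oplus> h" unfolding add by blast
  then show "p \<in> G" using n Gf(4) by blast
 qed
qed

text \<open>The class of \<open>u\<close> in the cotangent space is not zero and so belongs to a basis, which has at most two more members.\<close>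

lemma three_generators:
 assumes ed: "embdim R \<mm> \<le> 3" and u: "u \<in> \<mm>" "u \<notin> ideal_prod R \<mm> \<mm>"
 shows "\<exists>x y. x \<in> \<mm> \<and> y \<in> \<mm> \<and>
  (\<forall>m\<in>\<mm>. \<exists>a b c. a \<in> carrier R \<and> b \<in> carrier R \<and> c \<in> carrier R \<and> m = u \<otimes> a \<oplus> x \<otimes> b \<oplus> y \<otimes> c)"
proof -
 let ?N = "ideal_prod R \<mm> \<mm>" and ?k = "R Quot \<mm>"
 let ?V = "quot \<mm> ?N"
 note mf = ideal_facts[OF mm_ideal]
 have N: "ideal ?N R" by (rule ideal_prod_is_ideal[OF mm_ideal mm_ideal])
 have Nm: "?N \<subseteq> \<mm>" by (rule ideal_prod_least[OF mm_ideal]) (use mf(2,5) in blast)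
 have uR: "u \<in> carrier R" by (rule mf(2)[OF u(1)])
 have u0: "u \<noteq> \<zero>" using u(2) ideal_facts(3)[OF N] by blast
 have prod: "j \<otimes> p \<in> ?N" if "j \<in> \<mm>" "p \<in> \<mm>" for j p using that by (rule ideal_prod.prod)
 have cot: "cotangent_space R \<mm> = ?V" unfolding cotangent_space_def quot_def ..
 have kc: "carrier ?k = (\<lambda>r. \<mm> +> r) ` carrier R" unfolding FactRing_def A_RCOSETS_def' by auto
 have "vectorspace ?k ?V"
 proof (rule quot_vectorspace[OF mm_ideal N mm_ideal prod])
  show "field ?k" by (rule maximalideal.quotient_is_field[OF mm_maximal is_cring])
  show "carrier ?k \<subseteq> (\<lambda>r. \<mm> +> r) ` carrier R" using kc by simp
 qed (simp_all add: FactRing_def)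
 then interpret V: vectorspace ?k ?V .
 have Vc: "carrier ?V = (\<lambda>p. ?N +> p) ` \<mm>" by (rule quot_simps)
 have "u \<otimes> u \<in> ?N" by (rule prod[OF u(1) u(1)])
 moreover have "u \<otimes> u \<noteq> \<zero>" using u0 uR integral_iff by simp
 ultimately have "?N \<noteq> {\<zero>}" by blast
 from mm_finite_modulo[OF N this] Nm obtain m w where w: "\<forall>i<m. w i \<in> \<mm>"
  "\<forall>p\<in>\<mm>. \<exists>r. (\<forall>i<m. r i \<in> carrier R) \<and> p \<ominus> lc Rmod m r w \<in> ?N" by blast
 have lcV: "lc ?V n (\<lambda>i. \<mm> +> r i) (\<lambda>i. ?N +> v i) = ?N +> lc Rmod n r v"
  if "\<forall>i<n. r i \<in> carrier R" "\<forall>i<n. v i \<in> \<mm>" for n r v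
  by (rule lc_quot[OF mm_ideal N mm_ideal prod that])
 define A where "A = (\<lambda>i. ?N +> w i) ` {..<m}"
 have AV: "A \<subseteq> carrier ?V" unfolding A_def Vc using w(1) by blast
 have sA: "submodule ?k (V.span A) ?V" by (rule V.span_is_submodule[OF AV])
 have "V.span A = carrier ?V"
 proof
  show "V.span A \<subseteq> carrier ?V" by (rule V.span_is_subset2[OF AV])
  show "carrier ?V \<subseteq> V.span A"
  proof
   fix v assume "v \<in> carrier ?V"
   then obtain p where p: "p \<in> \<mm>" "v = ?N +> p" unfolding Vc by blast
   obtain r where r: "\<forall>i<m. r i \<in> carrier R" "p \<ominus> lc Rmod m r w \<in> ?N" using w(2) p(1) by blast
   have "?N +> p = ?N +> lc Rmod m r w"
    using coset_eq[OF N] mf(2)[OF p(1)] mf(2)[OF lc_ideal[OF mm_ideal r(1) w(1)]] r(2) by blast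
   then have "v = lc ?V m (\<lambda>i. \<mm> +> r i) (\<lambda>i. ?N +> w i)" unfolding p(2) lcV[OF r(1) w(1)] .
   moreover have "lc ?V m (\<lambda>i. \<mm> +> r i) (\<lambda>i. ?N +> w i) \<in> V.span A"
   proof (rule V.lc_in[OF sA])
    show "\<forall>i<m. \<mm> +> r i \<in> carrier ?k" unfolding kc using r(1) by blast
    show "\<forall>i<m. ?N +> w i \<in> V.span A" using V.in_own_span[OF AV] unfolding A_def by blast
   qed
   ultimately show "v \<in> V.span A" by simp
  qed
 qed
 then have "\<exists>n. \<exists>B. finite B \<and> card B = n \<and> B \<subseteq> carrier ?V \<and> V.gen_set B"
  using AV unfolding A_def by (intro exI[of _ "card A"] exI[of _ A]) (auto simp: A_def)
 from LeastI_ex[OF this] obtain B where B: "finite B" "card B = V.dim" "B \<subseteq> carrier ?V" "V.gen_set B"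
  unfolding V.dim_def by blast
 have "card B \<le> 3" using ed B(2) unfolding embdim_def cot by simp
 then obtain d v0 where d: "d \<le> 3" and v0: "rel_basis ?k ?V (carrier ?V) {\<zero>\<^bsub>?V\<^esub>} d v0"
  using V.small_basis[OF B(1,3,4)] by (meson order_trans)
 have "?N +> u \<in> carrier ?V" unfolding Vc using u(1) by blast
 moreover have "?N +> u \<noteq> \<zero>\<^bsub>?V\<^esub>" using coset_zero_eq[OF N uR] u(2) by (simp add: quot_simps)
 ultimately obtain l v where l: "d = Suc l" and v: "rel_basis ?k ?V (carrier ?V) {\<zero>\<^bsub>?V\<^esub>} d v" "v l = ?N +> u"
  using V.basis_through[OF v0] by blast
 have "\<exists>z. i < l \<longrightarrow> z \<in> \<mm> \<and> v i = ?N +> z" for i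
 proof (cases "i < l")
  case True
  then have "v i \<in> carrier ?V" using V.rel_basisD(1)[OF v(1), of i] l by simp
  then show ?thesis unfolding Vc by blast
 qed simp
 then have "\<forall>i. \<exists>z. i < l \<longrightarrow> z \<in> \<mm> \<and> v i = ?N +> z" by (rule allI)
 from choice[OF this] obtain z where z: "\<forall>i<l. z i \<in> \<mm> \<and> v i = ?N +> z i" by blast
 define x where "x = (if 0 < l then z 0 else \<zero>)"
 define y where "y = (if 1 < l then z 1 else \<zero>)"
 have xy: "x \<in> \<mm>" "y \<in> \<mm>" using z mf(3) by (simp_all add: x_def y_def)
 have xyR: "x \<in> carrier R" "y \<in> carrier R" using mf(2) xy by blast+
 define G where "G = adjoin (adjoin (PIdl u) x) y"
 have P: "ideal (PIdl u) R" by (rule cgenideal_ideal[OF uR])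
 note G1 = adjoin_ideal[OF P xyR(1)] adjoin_contains[OF P xyR(1)]
 note G2 = adjoin_ideal[OF G1(1) xyR(2)] adjoin_contains[OF G1(1) xyR(2)]
 have G: "ideal G R" "u \<in> G" "x \<in> G" "y \<in> G"
  unfolding G_def using G2 G1 cgenideal_self[OF uR] by blast+
 note Gf = ideal_facts[OF G(1)]
 have "\<mm> \<subseteq> G"
 proof (rule generates_of_mod_square[OF G(1)])
  show "G \<noteq> {\<zero>}" using G(2) u0 by blast
  fix p assume p: "p \<in> \<mm>"
  then have "?N +> p \<in> carrier ?V" unfolding Vc by blast
  from V.rel_basisD(3)[OF v(1) this] obtain a where a: "\<forall>i<d. a i \<in> carrier ?k"
   "(?N +> p) \<ominus>\<^bsub>?V\<^esub> lc ?V d a v = \<zero>\<^bsub>?V\<^esub>" by blast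
  have "\<forall>i. \<exists>r. i < d \<longrightarrow> r \<in> carrier R \<and> a i = \<mm> +> r" using a(1) unfolding kc by blast
  from choice[OF this] obtain r where r: "\<forall>i<d. r i \<in> carrier R \<and> a i = \<mm> +> r i" by blast
  define z' where "z' = z(l := u)"
  have z'm: "\<forall>i<d. z' i \<in> \<mm>" using z u(1) l by (simp add: z'_def less_Suc_eq)
  have vz: "v i = ?N +> z' i" if i: "i < d" for i
  proof (cases "i = l")
   case True
   then show ?thesis using v(2) by (simp add: z'_def)
  next
   case False
   then show ?thesis using z i l by (simp add: z'_def)
  qed
  have rc: "\<forall>i<d. r i \<in> carrier R" using r by blast
  have "lc ?V d a v = lc ?V d (\<lambda>i. \<mm> +> r i) (\<lambda>i. ?N +> z' i)" by (rule lc_cong) (use r vz in auto)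
  then have e: "lc ?V d a v = ?N +> lc Rmod d r z'" using lcV[OF rc z'm] by simp
  have lm: "lc Rmod d r z' \<in> \<mm>" by (rule lc_ideal[OF mm_ideal rc z'm])
  have c: "?N +> p \<in> carrier ?V" "?N +> lc Rmod d r z' \<in> carrier ?V" unfolding Vc using p lm by blast+
  have "?N +> p = ((?N +> p) \<ominus>\<^bsub>?V\<^esub> (?N +> lc Rmod d r z')) \<oplus>\<^bsub>?V\<^esub> (?N +> lc Rmod d r z')"
   using c by (simp add: a_minus_def V.M.a_assoc V.M.l_neg)
  also have "\<dots> = ?N +> lc Rmod d r z'" using a(2) c unfolding e by simp
  finally have "?N +> p = ?N +> lc Rmod d r z'" .
  then have "p \<ominus> lc Rmod d r z' \<in> ?N" using coset_eq[OF N] mf(2)[OF p] mf(2)[OF lm] by blast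
  moreover have "lc Rmod d r z' \<in> G"
  proof (rule lc_ideal[OF G(1) rc])
   have "i = 0 \<or> i = 1" if "i < l" for i using that l d by auto
   then have "z i \<in> G" if "i < l" for i using that G(3,4) unfolding x_def y_def by fastforce
   then show "\<forall>i<d. z' i \<in> G" using G(2) l by (simp add: z'_def less_Suc_eq)
  qed
  ultimately show "\<exists>g\<in>G. p \<ominus> g \<in> ?N" by blast
 qed
 have "\<exists>a b c. a \<in> carrier R \<and> b \<in> carrier R \<and> c \<in> carrier R \<and> p = u \<otimes> a \<oplus> x \<otimes> b \<oplus> y \<otimes> c" if p: "p \<in> \<mm>" for p
 proof -
  have "p \<in> G" using \<open>\<mm> \<subseteq> G\<close> p by blast
  then obtain q c where q: "q \<in> adjoin (PIdl u) x" "c \<in> carrier R" "p = q \<oplus> c \<otimes> y" unfolding G_def adjoin_def by blast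
  obtain q' b where q': "q' \<in> PIdl u" "b \<in> carrier R" "q = q' \<oplus> b \<otimes> x" using q(1) unfolding adjoin_def by blast
  obtain a where a: "a \<in> carrier R" "q' = a \<otimes> u" using q'(1) unfolding PIdl_iff by blast
  have "p = u \<otimes> a \<oplus> x \<otimes> b \<oplus> y \<otimes> c" unfolding q(3) q'(3) a(2) using a(1) q(2) q'(2) uR xyR by (simp add: m_comm)
  then show ?thesis using a(1) q(2) q'(2) by blast
 qed
 then show ?thesis using xy by blast
qed

lemma ideal_module_module:
 assumes \<aa>: "ideal \<aa> R"
 shows "module R (ideal_module R \<aa>)"
proof (rule module_criteria)
 note If = ideal_facts[OF \<aa>]
 show "cring R" by (rule is_cring)
 show "\<forall>v\<in>carrier (ideal_module R \<aa>). \<exists>neg_v\<in>carrier (ideal_module R \<aa>). v \<oplus>\<^bsub>ideal_module R \<aa>\<^esub> neg_v = \<zero>\<^bsub>ideal_module R \<aa>\<^esub>"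
  using If(2,7) r_neg by (auto intro!: bexI[of _ "\<ominus> _"])
qed (use ideal_facts[OF \<aa>] in \<open>auto simp: a_ac l_distr r_distr m_assoc\<close>)

lemma PIdl_zero: "PIdl \<zero> = {\<zero>}"
 unfolding cgenideal_def by (auto intro!: exI[of _ \<zero>])

lemma principal_free:
 assumes a: "a \<in> carrier R"
 shows "free_module R (ideal_module R (PIdl a))"
proof -
 have P: "ideal (PIdl a) R" by (rule cgenideal_ideal[OF a])
 interpret M: module R "ideal_module R (PIdl a)" by (rule ideal_module_module[OF P])
 show ?thesis
 proof (cases "a = \<zero>")
  case True
  have "PIdl a = {\<zero>}" unfolding True by (rule PIdl_zero)
  moreover have "M.lincomb c {} = \<zero>" for c unfolding M.lincomb_def by simp
  ultimately have "M.span {} = carrier (ideal_module R (PIdl a))" using M.finite_span[of "{}"] by simp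
  moreover have "M.lin_indpt {}" unfolding M.lin_dep_def by simp
  ultimately show ?thesis unfolding free_module_def using M.module_axioms by blast
 next
  case False
  have aP: "a \<in> PIdl a" by (rule cgenideal_self[OF a])
  have l: "M.lincomb c {a} = c a \<otimes> a" if "c a \<in> carrier R" for c
   unfolding M.lincomb_def using that a ideal_facts(5)[OF P aP] by simp
  have "M.lin_indpt {a}"
  proof (rule M.finite_lin_indpt2)
   show "finite {a}" "{a} \<subseteq> carrier (ideal_module R (PIdl a))" using aP by simp_all
   fix c assume c: "c \<in> {a} \<rightarrow> carrier R" "M.lincomb c {a} = \<zero>\<^bsub>ideal_module R (PIdl a)\<^esub>"
   then show "\<forall>v\<in>{a}. c v = \<zero>" using l[of c] False a integral_iff by simp
  qed
  moreover have "M.span {a} = carrier (ideal_module R (PIdl a))"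
  proof -
   have "{a} \<subseteq> carrier (ideal_module R (PIdl a))" using aP by simp
   then have s: "M.span {a} = {M.lincomb c {a} | c. c \<in> {a} \<rightarrow> carrier R}" by (intro M.finite_span) simp_all
   show ?thesis
   proof
    show "M.span {a} \<subseteq> carrier (ideal_module R (PIdl a))" by (rule M.span_is_subset2) (use aP in simp)
    show "carrier (ideal_module R (PIdl a)) \<subseteq> M.span {a}"
    proof
     fix p assume "p \<in> carrier (ideal_module R (PIdl a))"
     then obtain r where r: "r \<in> carrier R" "p = r \<otimes> a" by (auto simp: PIdl_iff)
     then have "p = M.lincomb (\<lambda>_. r) {a}" using l[of "\<lambda>_. r"] by simp
     then show "p \<in> M.span {a}" unfolding s using r(1) by blast
    qed
   qed
  qed
  ultimately show ?thesis unfolding free_module_def using M.module_axioms aP by (intro conjI exI[of _ "{a}"]) simp_all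
 qed
qed

end

text \<open>A nonzero prime other than \<open>\<mm>\<close> would give a chain of length two.\<close>

lemma one_dim_domain_of_krull_dim:
 fixes R :: "('a, 'm) ring_scheme"
 assumes noeth: "noetherian_ring R" and dom: "domain R" and max: "{J. maximalideal J R} = {\<mm>}" and dim: "krull_dim R = 1"
 shows "one_dim_domain R \<mm>"
proof -
 interpret noetherian_ring R by (rule noeth)
 interpret domain R by (rule dom)
 have mx: "maximalideal \<mm> R" using max by blast
 have pm: "primeideal \<mm> R" by (rule maximalideal_prime[OF mx])
 have "P = \<mm>" if P: "primeideal P R" "P \<noteq> {\<zero>\<^bsub>R\<^esub>}" for P
 proof (rule ccontr)
  assume ne: "P \<noteq> \<mm>"
  have Pi: "ideal P R" using P(1) by (rule primeideal.axioms(1))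
  have "\<one>\<^bsub>R\<^esub> \<notin> P" using ideal.one_imp_carrier[OF Pi] primeideal.I_notcarr[OF P(1)] by auto
  then have sub: "P \<subset> \<mm>" using maximal_ideal_above[OF Pi] max ne by blast
  have zP: "{\<zero>\<^bsub>R\<^esub>} \<subset> P" using P(2) additive_subgroup.zero_closed[OF ideal.axioms(1)[OF Pi]] by blast
  define Q where "Q i = (if i = 0 then {\<zero>\<^bsub>R\<^esub>} else if i = 1 then P else \<mm>)" for i :: nat
  have "(\<forall>i\<le>2. primeideal (Q i) R) \<and> (\<forall>i<2. Q i \<subset> Q (Suc i))"
   using zeroprimeideal P(1) pm sub zP by (auto simp: Q_def less_2_cases_iff)
  then have "enat 2 \<in> {enat n | n. \<exists>P :: nat \<Rightarrow> 'a set. (\<forall>i\<le>n. primeideal (P i) R) \<and> (\<forall>i<n. P i \<subset> P (Suc i))}" by blast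
  then have "enat 2 \<le> krull_dim R" unfolding krull_dim_def by (rule Sup_upper)
  then show False unfolding dim by (simp add: one_enat_def)
 qed
 then show ?thesis
  using noeth dom max by (intro one_dim_domain.intro noetherian_domain.intro one_dim_domain_axioms.intro)
qed

theorem proposition5p2:
  fixes R :: "('a, 'm) ring_scheme" and \<mm> :: "'a set"
  assumes "gorenstein_local_ring R \<mm>"
    and "domain R"
    and "krull_dim R = 1"
    and "embdim R \<mm> \<le> 3"
    and "\<exists>u \<in> \<mm> - ideal_prod R \<mm> \<mm>. \<exists>K. coefficient_field R \<mm> (PIdl\<^bsub>R\<^esub> u) K"
  shows "(\<forall>I. rigid_ideal R I \<longrightarrow> principalideal I R) \<and>
         (\<forall>I. rigid_ideal R I \<longrightarrow> free_module R (ideal_module R I))"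
proof -
 have noeth: "noetherian_ring R" and max: "{J. maximalideal J R} = {\<mm>}"
  and gor: "finite_injdim R (ideal_module R (carrier R))"
  using assms(1) unfolding gorenstein_local_ring_def local_ring_def by blast+
 interpret one_dim_domain R \<mm> by (rule one_dim_domain_of_krull_dim[OF noeth assms(2) max assms(3)])
 obtain u K where u: "u \<in> \<mm>" "u \<notin> ideal_prod R \<mm> \<mm>" and K: "coefficient_field R \<mm> (PIdl\<^bsub>R\<^esub> u) K"
  using assms(5) by blast
 have u0: "u \<noteq> \<zero>\<^bsub>R\<^esub>" using u(2) ideal_facts(3)[OF ideal_prod_is_ideal[OF mm_ideal mm_ideal]] by blast
 obtain x y where xy: "x \<in> \<mm>" "y \<in> \<mm>"
  "\<forall>m\<in>\<mm>. \<exists>a b c. a \<in> carrier R \<and> b \<in> carrier R \<and> c \<in> carrier R \<and> m = u \<otimes>\<^bsub>R\<^esub> a \<oplus>\<^bsub>R\<^esub> x \<otimes>\<^bsub>R\<^esub> b \<oplus>\<^bsub>R\<^esub> y \<otimes>\<^bsub>R\<^esub> c"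
  using three_generators[OF assms(4) u] by blast
 interpret three_generated R \<mm> u K x y
  by unfold_locales (use u u0 K xy in auto)
 have *: "\<exists>a\<in>carrier R. I = PIdl\<^bsub>R\<^esub> a" if rigid: "rigid_ideal R I" for I
 proof (cases "I = {\<zero>\<^bsub>R\<^esub>}")
  case True
  show ?thesis using True PIdl_zero by (intro bexI[of _ "\<zero>\<^bsub>R\<^esub>"]) auto
 next
  case False
  have I: "ideal I R" "Ext_vanishes R 1 (ideal_module R I) (ideal_module R I)"
   using rigid unfolding rigid_ideal_def by blast+
  show ?thesis using rigid_principal[OF gor I(1) False I(2)] ideal_facts(2)[OF I(1)] by blast
 qed
 have "principalideal I R" if rigid: "rigid_ideal R I" for I
 proof (rule principalidealI)
  show "ideal I R" using rigid unfolding rigid_ideal_def by blast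
  show "\<exists>i\<in>carrier R. I = Idl\<^bsub>R\<^esub> {i}" using *[OF rigid] cgenideal_eq_genideal by blast
 qed
 moreover have "free_module R (ideal_module R I)" if rigid: "rigid_ideal R I" for I
  using *[OF rigid] principal_free by blast
 ultimately show ?thesis by blast
qed

end
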